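(* Let $\mathcal{E}_{\mathfrak b}(z,s)$ be the Eisenstein series with noncommutative twists $$\mathcal{E}_{\mathfrak b}(z,s):=\sum_{\gamma\in\Gamma_{\mathfrak b}\backslash\Gamma} I_{\gamma a}^{a}\cdot \mathrm{Im}(\sigma_{\mathfrak b}^{-1}\gamma z)^s ,\qquad z\in\mathbb{H},$$ attached to a cusp $\mathfrak b$ of $\Gamma$, a base point $a\in\mathbb{H}\cup\{\text{cusps}\}$ and a tuple $\mathbf f=(f_1,\dots,f_r)$ of weight $2$ holomorphic cusp forms for $\Gamma$. Then $\mathcal{E}_{\mathfrak b}(z,s)$ is well-defined (the summands depend only on the coset $\Gamma_{\mathfrak b}\gamma$) and absolutely convergent for $\mathrm{Re}(s)>1$. It is an eigenfunction of the Laplacian: $$\Delta\,\mathcal{E}_{\mathfrak b}(z,s)=s(s-1)\,\mathcal{E}_{\mathfrak b}(z,s),$$ and for all $\delta\in\Gamma$ it satisfies $$\mathcal{E}_{\mathfrak b}(\delta z,s)=I_{a}^{\delta a}\cdot\mathcal{E}_{\mathfrak b}(z,s).$$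
   Context: $\Gamma\subset \mathrm{SL}_2(\mathbb{R})$ is a Fuchsian group of the first kind (discrete, with $\Gamma\backslash\mathbb{H}$ of finite hyperbolic volume), with at least one cusp; $-I\in\Gamma$ is not assumed. It acts on the upper half plane $\mathbb{H}$ and on $\mathbb{P}^1(\mathbb{R})$ by linear fractional transformations. "Cusps" means cusps of $\Gamma$. For a cusp $\mathfrak b$, $\Gamma_{\mathfrak b}$ is its stabilizer in $\Gamma$, and $\sigma_{\mathfrak b}\in\mathrm{SL}_2(\mathbb{R})$ is a fixed scaling matrix: $\sigma_{\mathfrak b}\infty=\mathfrak b$ and, with bars denoting images in $\mathrm{SL}_2(\mathbb{R})/\pm I$, $\sigma_{\mathfrak b}^{-1}\overline{\Gamma}_{\mathfrak b}\sigma_{\mathfrak b}=\{\pm\begin{pmatrix}1&\ell\\0&1\end{pmatrix}:\ell\in\mathbb{Z}\}$. For $\gamma=\begin{pmatrix}a&b\\c&d\end{pmatrix}$, $(f|_2\gamma)(z)=(cz+d)^{-2}f(\gamma z)$. A weight $2$ holomorphic cusp form for $\Gamma$ is a holomorphic $f$ on $\mathbb{H}$ with $f|_2\gamma=f$ for all $\gamma\in\Gamma$ and, at each cusp $\mathfrak a$, $(f|_2\sigma_{\mathfrak a})(z)=\sum_{m\ge 1}c_{\mathfrak a}(m;f)e^{2\pi i m z}$. For $a,b\in\mathbb{H}\cup\{\text{cusps}\}$ the iterated integral is $$C_a^b(f_1,\dots,f_n):=\int_a^b f_n(z_n)\int_a^{z_n}f_{n-1}(z_{n-1})\cdots\int_a^{z_2}f_1(z_1)\,dz_1\cdots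 dz_n,\qquad C_a^b():=1,$$ where near end-points that are cusps the path of integration follows a geodesic (so that the integral converges absolutely). For $\mathbf f=(f_1,\dots,f_r)$ a tuple of not necessarily distinct weight $2$ holomorphic cusp forms for $\Gamma$ and non-commuting variables $X_1,\dots,X_r$, $$I_a^b=I_a^b(\mathbf f):=1+\sum_i C_a^b(f_i)X_i+\sum_{i,j}C_a^b(f_i,f_j)X_iX_j+\sum_{i,j,k}C_a^b(f_i,f_j,f_k)X_iX_jX_k+\cdots\in\mathbb{C}\langle\langle X_1,\dots,X_r\rangle\rangle .$$ If $r=0$, $I_a^b:=1$. $\Delta=y^2(\partial^2/\partial x^2+\partial^2/\partial y^2)$ for $z=x+iy$, applied coefficientwise. Absolute convergence of $\mathcal{E}_{\mathfrak b}(z,s)$ means that the coefficient of each monomial $X_{i_1}\cdots X_{i_n}$ is an absolutely convergent sum over $\gamma\in\Gamma_{\mathfrak b}\backslash\Gamma$. *)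

theory Defs
  imports "HOL-Complex_Analysis.Complex_Analysis" "HOL-Algebra.Coset"
begin

definition upper_half_plane :: "complex set" where
  "upper_half_plane = {z. Im z > 0}"

datatype proj_real = Fin real | Infty

datatype endpoint = Interior complex | Boundary proj_real

definition SL2R :: "(real^2^2) monoid" where
  "SL2R = \<lparr>carrier = {A. det A = 1}, mult = (**), one = mat 1\<rparr>"

definition act :: "real^2^2 \<Rightarrow> complex \<Rightarrow> complex" where
  "act A = moebius (of_real (A$1$1)) (of_real (A$1$2)) (of_real (A$2$1)) (of_real (A$2$2))"

fun act_proj :: "real^2^2 \<Rightarrow> proj_real \<Rightarrow> proj_real" where
  "act_proj A (Fin x) =
     (if A$2$1 * x + A$2$2 = 0 then Infty else Fin ((A$1$1 * x + A$1$2) / (A$2$1 * x + A$2$2)))"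
| "act_proj A Infty = (if A$2$1 = 0 then Infty else Fin (A$1$1 / A$2$1))"

fun act_endpoint :: "real^2^2 \<Rightarrow> endpoint \<Rightarrow> endpoint" where
  "act_endpoint A (Interior z) = Interior (act A z)"
| "act_endpoint A (Boundary c) = Boundary (act_proj A c)"


definition hyperbolic_area :: "complex set \<Rightarrow> ennreal" where
  "hyperbolic_area F = (\<integral>\<^sup>+ z \<in> F. ennreal (1 / (Im z)\<^sup>2) \<partial>lborel)"

definition fundamental_domain :: "(real^2^2) set \<Rightarrow> complex set \<Rightarrow> bool" where
  "fundamental_domain \<Gamma> F \<longleftrightarrow>
     F \<in> sets borel \<and> F \<subseteq> upper_half_plane \<and>
     (\<Union>\<gamma>\<in>\<Gamma>. act \<gamma> ` F) = upper_half_plane \<and>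
     (\<forall>\<gamma>\<in>\<Gamma>. \<gamma> \<noteq> mat 1 \<and> \<gamma> \<noteq> - mat 1 \<longrightarrow> hyperbolic_area (F \<inter> act \<gamma> ` F) = 0)"

definition fuchsian_first_kind :: "(real^2^2) set \<Rightarrow> bool" where
  "fuchsian_first_kind \<Gamma> \<longleftrightarrow>
     subgroup \<Gamma> SL2R \<and> discrete \<Gamma> \<and>
     (\<exists>F. fundamental_domain \<Gamma> F \<and> hyperbolic_area F < \<infinity>)"

definition parabolic :: "real^2^2 \<Rightarrow> bool" where
  "parabolic A \<longleftrightarrow> det A = 1 \<and> \<bar>trace A\<bar> = 2 \<and> A \<noteq> mat 1 \<and> A \<noteq> - mat 1"

definition is_cusp :: "(real^2^2) set \<Rightarrow> proj_real \<Rightarrow> bool" where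
  "is_cusp \<Gamma> c \<longleftrightarrow> (\<exists>\<gamma>\<in>\<Gamma>. parabolic \<gamma> \<and> act_proj \<gamma> c = c)"

fun is_endpoint :: "(real^2^2) set \<Rightarrow> endpoint \<Rightarrow> bool" where
  "is_endpoint \<Gamma> (Interior z) \<longleftrightarrow> z \<in> upper_half_plane"
| "is_endpoint \<Gamma> (Boundary c) \<longleftrightarrow> is_cusp \<Gamma> c"

definition cusp_stabilizer :: "(real^2^2) set \<Rightarrow> proj_real \<Rightarrow> (real^2^2) set" where
  "cusp_stabilizer \<Gamma> c = {\<gamma>\<in>\<Gamma>. act_proj \<gamma> c = c}"

text \<open>Two subsets of \<open>SL\<^sub>2(\<real>)\<close> have the same image modulo \<open>\<plusminus>I\<close> iff their saturations
  under \<open>\<plusminus>I\<close> agree.\<close>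

definition pm :: "(real^2^2) set \<Rightarrow> (real^2^2) set" where
  "pm S = S \<union> uminus ` S"

definition scaling_matrix :: "(real^2^2) set \<Rightarrow> proj_real \<Rightarrow> real^2^2 \<Rightarrow> bool" where
  "scaling_matrix \<Gamma> c S \<longleftrightarrow>
     det S = 1 \<and> act_proj S Infty = c \<and>
     pm ((\<lambda>\<gamma>. matrix_inv S ** \<gamma> ** S) ` cusp_stabilizer \<Gamma> c) =
     pm (range (\<lambda>l::int. vector [vector [1, of_int l], vector [0, 1]]))"


definition slash2 :: "(complex \<Rightarrow> complex) \<Rightarrow> real^2^2 \<Rightarrow> complex \<Rightarrow> complex" where
  "slash2 f A z = f (act A z) / (of_real (A$2$1) * z + of_real (A$2$2))\<^sup>2"

text \<open>A family \<open>\<sigma>\<close> assigns to each cusp its fixed scaling matrix; its values at points that are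
  not cusps are irrelevant.\<close>

definition cusp_form ::
    "(real^2^2) set \<Rightarrow> (proj_real \<Rightarrow> real^2^2) \<Rightarrow> (complex \<Rightarrow> complex) \<Rightarrow> bool" where
  "cusp_form \<Gamma> \<sigma> f \<longleftrightarrow>
     f holomorphic_on upper_half_plane \<and>
     (\<forall>\<gamma>\<in>\<Gamma>. \<forall>z\<in>upper_half_plane. slash2 f \<gamma> z = f z) \<and>
     (\<forall>c. is_cusp \<Gamma> c \<longrightarrow> (\<exists>q :: nat \<Rightarrow> complex. \<forall>z\<in>upper_half_plane.
        (\<lambda>m. q (Suc m) * exp (2 * of_real pi * \<i> * of_nat (Suc m) * z)) sums slash2 f (\<sigma> c) z))"


text \<open>The geodesic ray that starts at \<open>z\<close> (at time 0) and tends to the cusp \<open>c\<close>: the image under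
  \<open>\<sigma> c\<close> of a vertical half-line. As an oriented curve it does not depend on the choice of
  \<open>\<sigma> c\<close>.\<close>

definition cusp_ray :: "(proj_real \<Rightarrow> real^2^2) \<Rightarrow> proj_real \<Rightarrow> complex \<Rightarrow> real \<Rightarrow> complex" where
  "cusp_ray \<sigma> c z t = act (\<sigma> c) (act (matrix_inv (\<sigma> c)) z + \<i> * of_real t)"

fun end_integral ::
    "(proj_real \<Rightarrow> real^2^2) \<Rightarrow> complex \<Rightarrow> endpoint \<Rightarrow> (complex \<Rightarrow> complex) \<Rightarrow> complex" where
  "end_integral \<sigma> z (Interior w) g = 0"
| "end_integral \<sigma> z (Boundary c) g =
     (LBINT t:{0..}. g (cusp_ray \<sigma> c z t) * vector_derivative (cusp_ray \<sigma> c z) (at t))"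

fun attached :: "complex \<Rightarrow> endpoint \<Rightarrow> bool" where
  "attached z (Interior w) \<longleftrightarrow> z = w"
| "attached z (Boundary c) \<longleftrightarrow> True"

definition middle_path :: "endpoint \<Rightarrow> endpoint \<Rightarrow> (real \<Rightarrow> complex) \<Rightarrow> bool" where
  "middle_path a b p \<longleftrightarrow>
     valid_path p \<and> path_image p \<subseteq> upper_half_plane \<and>
     attached (pathstart p) a \<and> attached (pathfinish p) b"

text \<open>The integral of \<open>g\<close> from \<open>a\<close> to \<open>b\<close> is taken along an arbitrary path in the upper half plane
  that follows a geodesic near each end-point which is a cusp: the path consists of the middle part
  \<open>p\<close>, preceded (followed) by the geodesic ray from \<open>a\<close> to the start of \<open>p\<close> (from the end of \<open>p\<close>
  to \<open>b\<close>) in case \<open>a\<close> (\<open>b\<close>) is a cusp. For the integrands used below the value does not depend on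
  the path chosen.\<close>

definition endpoint_integral ::
    "(proj_real \<Rightarrow> real^2^2) \<Rightarrow> endpoint \<Rightarrow> endpoint \<Rightarrow> (complex \<Rightarrow> complex) \<Rightarrow> complex" where
  "endpoint_integral \<sigma> a b g =
     (let p = (SOME p. middle_path a b p) in
        - end_integral \<sigma> (pathstart p) a g + contour_integral p g + end_integral \<sigma> (pathfinish p) b g)"

text \<open>The list argument is in reverse order: its head is the outermost form \<open>f\<^sub>n\<close>.\<close>

primrec iterated_integral_rev ::
    "(proj_real \<Rightarrow> real^2^2) \<Rightarrow> endpoint \<Rightarrow> (complex \<Rightarrow> complex) list \<Rightarrow> endpoint \<Rightarrow> complex" where
  "iterated_integral_rev \<sigma> a [] b = 1"
| "iterated_integral_rev \<sigma> a (f # gs) b =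
     endpoint_integral \<sigma> a b (\<lambda>z. f z * iterated_integral_rev \<sigma> a gs (Interior z))"

definition iterated_integral ::
    "(proj_real \<Rightarrow> real^2^2) \<Rightarrow> endpoint \<Rightarrow> endpoint \<Rightarrow> (complex \<Rightarrow> complex) list \<Rightarrow> complex" where
  "iterated_integral \<sigma> a b fs = iterated_integral_rev \<sigma> a (rev fs) b"


text \<open>A formal power series in \<open>r\<close> non-commuting variables \<open>X\<^sub>0, \<dots>, X\<^sub>r\<^sub>-\<^sub>1\<close> is given by its
  coefficients: the value at \<open>[i\<^sub>1, \<dots>, i\<^sub>n]\<close> is the coefficient of the monomial
  \<open>X\<^bsub>i\<^sub>1\<^esub> \<cdots> X\<^bsub>i\<^sub>n\<^esub>\<close>, and words using indices \<open>\<ge> r\<close> have coefficient 0.\<close>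

type_synonym nc_series = "nat list \<Rightarrow> complex"

definition nc_mult :: "nc_series \<Rightarrow> nc_series \<Rightarrow> nc_series" where
  "nc_mult A B w = (\<Sum>k\<le>length w. A (take k w) * B (drop k w))"

definition gen_series ::
    "(proj_real \<Rightarrow> real^2^2) \<Rightarrow> (complex \<Rightarrow> complex) list \<Rightarrow> endpoint \<Rightarrow> endpoint \<Rightarrow> nc_series" where
  "gen_series \<sigma> fs a b w =
     (if set w \<subseteq> {..<length fs} then iterated_integral \<sigma> a b (map (\<lambda>i. fs ! i) w) else 0)"

definition eisenstein_term ::
    "(proj_real \<Rightarrow> real^2^2) \<Rightarrow> (complex \<Rightarrow> complex) list \<Rightarrow> endpoint \<Rightarrow> proj_real \<Rightarrow>
     complex \<Rightarrow> complex \<Rightarrow> real^2^2 \<Rightarrow> nc_series" where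
  "eisenstein_term \<sigma> fs a b z s \<gamma> w =
     gen_series \<sigma> fs (act_endpoint \<gamma> a) a w *
     of_real (Im (act (matrix_inv (\<sigma> b)) (act \<gamma> z))) powr s"

definition cusp_cosets :: "(real^2^2) set \<Rightarrow> proj_real \<Rightarrow> (real^2^2) set set" where
  "cusp_cosets \<Gamma> b = rcosets\<^bsub>SL2R\<lparr>carrier := \<Gamma>\<rparr>\<^esub> (cusp_stabilizer \<Gamma> b)"

definition eisenstein_coset_term ::
    "(proj_real \<Rightarrow> real^2^2) \<Rightarrow> (complex \<Rightarrow> complex) list \<Rightarrow> endpoint \<Rightarrow> proj_real \<Rightarrow>
     complex \<Rightarrow> complex \<Rightarrow> (real^2^2) set \<Rightarrow> nc_series" where
  "eisenstein_coset_term \<sigma> fs a b z s K = eisenstein_term \<sigma> fs a b z s (SOME \<gamma>. \<gamma> \<in> K)"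

definition nc_eisenstein ::
    "(real^2^2) set \<Rightarrow> (proj_real \<Rightarrow> real^2^2) \<Rightarrow> (complex \<Rightarrow> complex) list \<Rightarrow> endpoint \<Rightarrow>
     proj_real \<Rightarrow> complex \<Rightarrow> complex \<Rightarrow> nc_series" where
  "nc_eisenstein \<Gamma> \<sigma> fs a b z s w =
     (\<Sum>\<^sub>\<infinity>K\<in>cusp_cosets \<Gamma> b. eisenstein_coset_term \<sigma> fs a b z s K w)"


definition partial_x :: "(complex \<Rightarrow> complex) \<Rightarrow> complex \<Rightarrow> complex" where
  "partial_x u z = vector_derivative (\<lambda>t. u (z + of_real t)) (at 0)"

definition partial_y :: "(complex \<Rightarrow> complex) \<Rightarrow> complex \<Rightarrow> complex" where
  "partial_y u z = vector_derivative (\<lambda>t. u (z + \<i> * of_real t)) (at 0)"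

definition C1_on :: "complex set \<Rightarrow> (complex \<Rightarrow> complex) \<Rightarrow> bool" where
  "C1_on S u \<longleftrightarrow>
     (\<forall>z\<in>S. (\<lambda>t::real. u (z + of_real t)) differentiable (at 0) \<and>
            (\<lambda>t::real. u (z + \<i> * of_real t)) differentiable (at 0)) \<and>
     continuous_on S (partial_x u) \<and> continuous_on S (partial_y u)"

definition C2_on :: "complex set \<Rightarrow> (complex \<Rightarrow> complex) \<Rightarrow> bool" where
  "C2_on S u \<longleftrightarrow> C1_on S u \<and> C1_on S (partial_x u) \<and> C1_on S (partial_y u)"

text \<open>Since \<open>vector_derivative\<close> is total, this is meaningful only for functions satisfying
  \<open>C2_on\<close>.\<close>

definition hyp_laplacian :: "(complex \<Rightarrow> complex) \<Rightarrow> complex \<Rightarrow> complex" where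
  "hyp_laplacian u z =
     of_real ((Im z)\<^sup>2) * (partial_x (partial_x u) z + partial_y (partial_y u) z)"

end

theory Submission
  imports Defs
begin

text \<open>
  Cusp forms have primitives on the upper half plane that extend continuously to the cusps, and so
  do the iterated integrals.  Uniqueness of such primitives yields
  \<open>I\<^sub>a\<^sup>b I\<^sub>b\<^sup>c = I\<^sub>a\<^sup>c\<close> and
  \<open>I\<^bsub>\<gamma>a\<^esub>\<^bsup>\<gamma>b\<^esup> = I\<^sub>a\<^sup>b\<close>.  The transformation law
  follows, and so does well-definedness: if \<open>\<tau>\<close> fixes \<open>b\<close>, then
  \<open>I\<^bsub>\<tau>a\<^esub>\<^bsup>a\<^esup> = I\<^bsub>\<tau>a\<^esub>\<^bsup>\<tau>b\<^esup> I\<^sub>b\<^sup>a = I\<^sub>a\<^sup>b I\<^sub>b\<^sup>a = 1\<close>.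

  For convergence, finite area implies that the part of the upper half plane moved noticeably by every non-trivial
  element is compact modulo \<open>\<Gamma>\<close> (pack disjoint boxes), while elements with small displacement at
  a point commute, so the remaining part lies in finitely many cusp regions modulo \<open>\<Gamma>\<close>.  Hence
  \<open>y |f(z)|\<close> is bounded for cusp forms \<open>f\<close>, and the coefficients of
  \<open>I\<^bsub>\<gamma>a\<^esub>\<^bsup>a\<^esup>\<close> grow more slowly than any power of
  \<open>1 / Im (\<sigma>\<^sup>-\<^sup>1 \<gamma> z)\<close>.  A packing count of orbit points at dyadic heights bounds
  \<open>\<Sum> Im (\<sigma>\<^sup>-\<^sup>1 \<gamma> z) powr t\<close> for \<open>t > 1\<close>.  The same majorant, locally uniform in
  \<open>z\<close> up to second derivatives, lets the Laplacian act termwise.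
\<close>

section \<open>Fractional linear action\<close>

no_notation fps_nth (infixl "$" 75)

text \<open>The hypotheses supply only a measurable fundamental domain of finite area, neither a
  polygon nor a finite list of cusps. Yet the growth estimate needs a bound for cusp forms on all of
  the half plane, since the orbit of a single point approaches every boundary point. Control near
  all cusps is therefore extracted from the area by the Margulis-Zassenhaus mechanism, run on
  elementary quantities: displacement at a point is the Frobenius norm of a conjugated matrix minus
  the identity, and constants such as 1/100, 1/400, 6 and 34 are convenient values coming from that
  norm. The bound \<open>y |f| \<le> M\<close> alone is too weak: integrating \<open>1 / y\<close>
  up to a cusp diverges logarithmically. Joined with the exponential decay at the cusp it gives
  \<open>y powr (-1 - \<eta>)\<close>, for which every integration costs a factor
  \<open>y powr (- \<eta>)\<close>; since \<eta> is free, n integrations can be kept within the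
  margin \<open>Re s - 1\<close>. Base points may be cusps. Functions are therefore defined on
  end-points, their value at a cusp being a limit, so that one uniqueness statement serves interior
  and boundary base points alike.\<close>

definition auto_factor :: "real^2^2 \<Rightarrow> complex \<Rightarrow> complex" where
  "auto_factor A z = of_real (A$2$1) * z + of_real (A$2$2)"

text \<open>The adjugate: it is the inverse once \<open>det A = 1\<close>, and its entries are
  visible to the simplifier, unlike those of \<open>matrix_inv\<close>.\<close>

definition adj2 :: "real^2^2 \<Rightarrow> real^2^2" where
  "adj2 A = vector [vector [A$2$2, - (A$1$2)], vector [- (A$2$1), A$1$1]]"

lemma mat2_mult_nth: "((A::real^2^2) ** B) $ i $ k = A$i$1 * B$1$k + A$i$2 * B$2$k"
  by (simp add: matrix_matrix_mult_def sum_2)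

lemma mat2_eq_iff:
  "(A::real^2^2) = B \<longleftrightarrow> A$1$1 = B$1$1 \<and> A$1$2 = B$1$2 \<and> A$2$1 = B$2$1 \<and> A$2$2 = B$2$2"
  by (auto simp: vec_eq_iff forall_2)

lemma mat2_one_nth [simp]:
  "(mat 1 :: real^2^2)$1$1 = 1" "(mat 1 :: real^2^2)$1$2 = 0"
  "(mat 1 :: real^2^2)$2$1 = 0" "(mat 1 :: real^2^2)$2$2 = 1"
  by (simp_all add: mat_def)

lemma adj2_nth [simp]:
  "adj2 A $1$1 = A$2$2" "adj2 A $1$2 = - (A$1$2)" "adj2 A $2$1 = - (A$2$1)" "adj2 A $2$2 = A$1$1"
  by (simp_all add: adj2_def)

lemma det_adj2 [simp]: "det (adj2 A) = det A"
  by (simp add: det_2)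

lemma adj2_mult:
  assumes "det A = 1"
  shows "A ** adj2 A = mat 1" "adj2 A ** A = mat 1"
  using assms by (auto simp: mat2_eq_iff mat2_mult_nth det_2 algebra_simps)

lemma matrix_inv_eq_adj2:
  assumes "det A = 1"
  shows "matrix_inv A = adj2 A"
proof -
  have "A ** matrix_inv A = mat 1 \<and> matrix_inv A ** A = mat 1"
    unfolding matrix_inv_def by (rule someI[of _ "adj2 A"]) (simp add: adj2_mult[OF assms])
  hence "matrix_inv A ** (A ** adj2 A) = adj2 A" by (simp add: matrix_mul_assoc)
  thus ?thesis by (simp add: adj2_mult(1)[OF assms])
qed

lemma det_mult2: "det A = 1 \<Longrightarrow> det B = 1 \<Longrightarrow> det ((A::real^2^2) ** B) = 1"
  by (simp add: det_mul)

lemma det_neg2 [simp]: "det (- A :: real^2^2) = det A"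
  by (simp add: det_2)

lemma act_eq: "act A z = (of_real (A$1$1) * z + of_real (A$1$2)) / auto_factor A z"
  by (simp add: act_def moebius_def auto_factor_def)

lemma auto_factor_nonzero:
  assumes "det A = 1" "Im z > 0"
  shows "auto_factor A z \<noteq> 0"
proof
  assume "auto_factor A z = 0"
  hence r: "A$2$1 * Re z + A$2$2 = 0" and i: "A$2$1 * Im z = 0"
    by (auto simp: auto_factor_def complex_eq_iff)
  from i assms(2) have "A$2$1 = 0" by simp
  with r assms(1) show False by (simp add: det_2)
qed

lemma act_one [simp]: "act (mat 1) z = z"
  by (simp add: act_eq auto_factor_def)

lemma act_neg [simp]: "act (- A) z = act A z"
proof -
  have "act (- A) z = (- (of_real (A$1$1) * z + of_real (A$1$2))) / (- auto_factor A z)"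
    by (simp add: act_eq auto_factor_def)
  also have "\<dots> = act A z" unfolding act_eq by (rule minus_divide_divide)
  finally show ?thesis .
qed

lemma Im_act:
  assumes "det A = 1"
  shows "Im (act A z) = Im z / (cmod (auto_factor A z))\<^sup>2"
proof -
  have "Im (act A z) = Im ((of_real (A$1$1) * z + of_real (A$1$2)) * cnj (auto_factor A z)) / (cmod (auto_factor A z))\<^sup>2"
    unfolding act_eq by (subst complex_div_cnj) (simp only: Im_divide_of_real)
  also have "Im ((of_real (A$1$1) * z + of_real (A$1$2)) * cnj (auto_factor A z)) = det A * Im z"
    by (simp add: auto_factor_def det_2 algebra_simps)
  finally show ?thesis using assms by simp
qed

lemma Im_act_pos:
  assumes "det A = 1" "Im z > 0"
  shows "Im (act A z) > 0"
  using auto_factor_nonzero[OF assms] assms(2) by (simp add: Im_act[OF assms(1)])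

lemma act_upper: "det A = 1 \<Longrightarrow> z \<in> upper_half_plane \<Longrightarrow> act A z \<in> upper_half_plane"
  by (simp add: upper_half_plane_def Im_act_pos)

lemma auto_factor_mult:
  assumes "det B = 1" "Im z > 0"
  shows "auto_factor (A ** B) z = auto_factor A (act B z) * auto_factor B z"
  using auto_factor_nonzero[OF assms]
  by (simp add: act_eq auto_factor_def[of A] auto_factor_def[of "A ** B"] mat2_mult_nth field_simps)
     (simp add: auto_factor_def algebra_simps)

lemma act_mult:
  assumes "det A = 1" "det B = 1" "Im z > 0"
  shows "act (A ** B) z = act A (act B z)"
proof -
  have nz: "auto_factor A (act B z) \<noteq> 0" "auto_factor B z \<noteq> 0"
    using auto_factor_nonzero Im_act_pos assms by auto
  have "act A (act B z) = (of_real (A$1$1) * act B z + of_real (A$1$2)) / auto_factor A (act B z)"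
    by (rule act_eq)
  also have "\<dots> = ((of_real (A$1$1) * act B z + of_real (A$1$2)) * auto_factor B z) / auto_factor (A ** B) z"
    using nz by (simp add: auto_factor_mult[OF assms(2,3)])
  also have "(of_real (A$1$1) * act B z + of_real (A$1$2)) * auto_factor B z
     = of_real ((A ** B)$1$1) * z + of_real ((A ** B)$1$2)"
    using nz by (simp add: act_eq mat2_mult_nth field_simps) (simp add: auto_factor_def algebra_simps)
  finally show ?thesis by (simp add: act_eq)
qed

lemma act_adj2:
  assumes "det A = 1" "Im z > 0"
  shows "act (adj2 A) (act A z) = z" "act A (act (adj2 A) z) = z"
  using assms act_mult[of "adj2 A" A z] act_mult[of A "adj2 A" z] by (simp_all add: adj2_mult)

text \<open>The two-point version of the derivative \<open>1 / (cz + d)^2\<close>; together with the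
  formula for \<open>Im (act A z)\<close> it yields the invariance of \<open>udist\<close>.\<close>

lemma act_diff:
  assumes "det A = 1" "Im z > 0" "Im w > 0"
  shows "act A z - act A w = (z - w) / (auto_factor A z * auto_factor A w)"
proof -
  have nz: "auto_factor A z \<noteq> 0" "auto_factor A w \<noteq> 0"
    using auto_factor_nonzero assms by auto
  have d: "of_real (A$1$1) * of_real (A$2$2) - of_real (A$1$2) * of_real (A$2$1) = (1::complex)"
    using assms(1) unfolding det_2 by (metis of_real_1 of_real_diff of_real_mult)
  have "act A z - act A w = ((of_real (A$1$1) * z + of_real (A$1$2)) * auto_factor A w
         - (of_real (A$1$1) * w + of_real (A$1$2)) * auto_factor A z) / (auto_factor A z * auto_factor A w)"
    using nz by (simp add: act_eq field_simps)
  also have "(of_real (A$1$1) * z + of_real (A$1$2)) * auto_factor A w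
         - (of_real (A$1$1) * w + of_real (A$1$2)) * auto_factor A z
      = (of_real (A$1$1) * of_real (A$2$2) - of_real (A$1$2) * of_real (A$2$1)) * (z - w)"
    by (simp add: auto_factor_def algebra_simps)
  finally show ?thesis by (simp add: d)
qed

lemma has_field_derivative_act:
  assumes "det A = 1" "Im z > 0"
  shows "(act A has_field_derivative 1 / (auto_factor A z)\<^sup>2) (at z)"
proof -
  have nz: "of_real (A$2$1) * z + of_real (A$2$2) \<noteq> (0::complex)"
    using auto_factor_nonzero[OF assms] by (simp add: auto_factor_def)
  have d: "of_real (A$1$1) * of_real (A$2$2) - of_real (A$1$2) * of_real (A$2$1) = (1::complex)"
    using assms(1) unfolding det_2 by (metis of_real_1 of_real_diff of_real_mult)
  have e: "of_real (A$1$1) * (of_real (A$2$1) * z + of_real (A$2$2)) -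
       (of_real (A$1$1) * z + of_real (A$1$2)) * of_real (A$2$1) = (1::complex)"
    using d by (simp add: algebra_simps)
  have "((\<lambda>z. (of_real (A$1$1) * z + of_real (A$1$2)) / (of_real (A$2$1) * z + of_real (A$2$2)))
     has_field_derivative 1 / (of_real (A$2$1) * z + of_real (A$2$2))\<^sup>2) (at z)"
    by (rule derivative_eq_intros refl nz)+
       (use nz e in \<open>simp add: power2_eq_square\<close>)
  thus ?thesis unfolding act_eq[abs_def] auto_factor_def .
qed

lemma slash2_eq: "slash2 f A z = f (act A z) / (auto_factor A z)\<^sup>2"
  by (simp add: slash2_def auto_factor_def)

lemma act_proj_one [simp]: "act_proj (mat 1) c = c"
  by (cases c) auto

lemma act_proj_mult:
  assumes "det A = 1" "det B = 1"
  shows "act_proj (A ** B) c = act_proj A (act_proj B c)"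
proof (cases c)
  case (Fin x)
  show ?thesis
  proof (cases "B$2$1 * x + B$2$2 = 0")
    case True
    have nz: "B$1$1 * x + B$1$2 \<noteq> 0"
    proof
      assume 0: "B$1$1 * x + B$1$2 = 0"
      have "det B = B$1$1 * (B$2$1 * x + B$2$2) - B$2$1 * (B$1$1 * x + B$1$2)"
        by (simp add: det_2 algebra_simps)
      thus False using 0 True assms(2) by simp
    qed
    have "(A ** B)$2$1 * x + (A ** B)$2$2 = A$2$1 * (B$1$1 * x + B$1$2) + A$2$2 * (B$2$1 * x + B$2$2)"
      "(A ** B)$1$1 * x + (A ** B)$1$2 = A$1$1 * (B$1$1 * x + B$1$2) + A$1$2 * (B$2$1 * x + B$2$2)"
      by (simp_all add: mat2_mult_nth algebra_simps)
    hence 1: "(A ** B)$2$1 * x + (A ** B)$2$2 = A$2$1 * (B$1$1 * x + B$1$2)"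
      "(A ** B)$1$1 * x + (A ** B)$1$2 = A$1$1 * (B$1$1 * x + B$1$2)"
      by (simp_all add: True)
    show ?thesis using nz True unfolding Fin act_proj.simps 1 by simp
  next
    case False
    have 1: "(A ** B)$2$1 * x + (A ** B)$2$2 = (A$2$1 * ((B$1$1 * x + B$1$2) / (B$2$1 * x + B$2$2)) + A$2$2) * (B$2$1 * x + B$2$2)"
      "(A ** B)$1$1 * x + (A ** B)$1$2 = (A$1$1 * ((B$1$1 * x + B$1$2) / (B$2$1 * x + B$2$2)) + A$1$2) * (B$2$1 * x + B$2$2)"
      using False by (simp_all add: mat2_mult_nth field_simps)
    show ?thesis using False unfolding Fin act_proj.simps 1 by simp
  qed
next
  case Infty
  show ?thesis
  proof (cases "B$2$1 = 0")
    case True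
    hence "B$1$1 \<noteq> 0" using assms(2) by (auto simp: det_2)
    thus ?thesis using True Infty by (simp add: mat2_mult_nth)
  next
    case False
    have 1: "(A ** B)$2$1 = (A$2$1 * (B$1$1 / B$2$1) + A$2$2) * B$2$1"
      "(A ** B)$1$1 = (A$1$1 * (B$1$1 / B$2$1) + A$1$2) * B$2$1"
      using False by (simp_all add: mat2_mult_nth field_simps)
    show ?thesis using False unfolding Infty act_proj.simps 1 by simp
  qed
qed

lemma trace2: "trace (A::real^2^2) = A$1$1 + A$2$2"
  by (simp add: trace_def sum_2)

lemma trace_conj2:
  assumes "det S = 1"
  shows "trace (S ** A ** adj2 S) = trace A"
proof -
  have "trace (S ** A ** adj2 S) = trace (adj2 S ** (S ** A))" by (rule trace_mul_sym)
  also have "adj2 S ** (S ** A) = A" by (simp add: matrix_mul_assoc adj2_mult[OF assms])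
  finally show ?thesis .
qed

locale SL2R_subgroup =
  fixes \<Gamma> :: "(real^2^2) set"
  assumes sub: "subgroup \<Gamma> SL2R"
begin

lemma det_1: "\<gamma> \<in> \<Gamma> \<Longrightarrow> det \<gamma> = 1"
  using subgroup.subset[OF sub] by (auto simp: SL2R_def)

lemma mult_closed: "\<gamma> \<in> \<Gamma> \<Longrightarrow> \<delta> \<in> \<Gamma> \<Longrightarrow> \<gamma> ** \<delta> \<in> \<Gamma>"
  using subgroup.m_closed[OF sub] by (auto simp: SL2R_def)

lemma one_closed: "mat 1 \<in> \<Gamma>"
  using subgroup.one_closed[OF sub] by (auto simp: SL2R_def)

lemma adj2_closed:
  assumes "\<gamma> \<in> \<Gamma>"
  shows "adj2 \<gamma> \<in> \<Gamma>"
proof -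
  have d: "det \<gamma> = 1" using assms by (rule det_1)
  have "inv\<^bsub>SL2R\<^esub> \<gamma> = adj2 \<gamma>"
    unfolding m_inv_def SL2R_def
  proof (rule the_equality, simp_all add: d adj2_mult)
    fix y :: "real^2^2"
    assume y: "det y = 1 \<and> \<gamma> ** y = mat 1 \<and> y ** \<gamma> = mat 1"
    hence "y ** (\<gamma> ** adj2 \<gamma>) = adj2 \<gamma>" by (simp add: matrix_mul_assoc)
    thus "y = adj2 \<gamma>" by (simp add: adj2_mult d)
  qed
  thus ?thesis using subgroup.m_inv_closed[OF sub assms] by simp
qed

lemma conj_closed: "\<gamma> \<in> \<Gamma> \<Longrightarrow> \<delta> \<in> \<Gamma> \<Longrightarrow> \<delta> ** \<gamma> ** adj2 \<delta> \<in> \<Gamma>"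
  by (simp add: mult_closed adj2_closed)

lemma act_closed: "\<gamma> \<in> \<Gamma> \<Longrightarrow> z \<in> upper_half_plane \<Longrightarrow> act \<gamma> z \<in> upper_half_plane"
  by (simp add: act_upper det_1)

lemma parabolic_conj:
  assumes "det \<delta> = 1" "parabolic \<gamma>"
  shows "parabolic (\<delta> ** \<gamma> ** adj2 \<delta>)"
proof -
  have inv: "adj2 \<delta> ** (\<delta> ** \<gamma> ** adj2 \<delta>) ** \<delta> = \<gamma>"
  proof -
    have "adj2 \<delta> ** (\<delta> ** \<gamma> ** adj2 \<delta>) ** \<delta> = (adj2 \<delta> ** \<delta>) ** \<gamma> ** (adj2 \<delta> ** \<delta>)"
      by (simp add: matrix_mul_assoc)
    thus ?thesis by (simp add: adj2_mult[OF assms(1)])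
  qed
  have n: "adj2 \<delta> ** (- mat 1) ** \<delta> = - mat 1"
    using assms(1) by (simp add: mat2_eq_iff mat2_mult_nth det_2 algebra_simps)
  have "\<delta> ** \<gamma> ** adj2 \<delta> \<noteq> mat 1"
  proof
    assume "\<delta> ** \<gamma> ** adj2 \<delta> = mat 1"
    with inv have "\<gamma> = mat 1" by (simp add: adj2_mult[OF assms(1)])
    thus False using assms(2) by (simp add: parabolic_def)
  qed
  moreover have "\<delta> ** \<gamma> ** adj2 \<delta> \<noteq> - mat 1"
  proof
    assume "\<delta> ** \<gamma> ** adj2 \<delta> = - mat 1"
    with inv n have "\<gamma> = - mat 1" by simp
    thus False using assms(2) by (simp add: parabolic_def)
  qed
  ultimately show ?thesis using assms
    by (simp add: parabolic_def trace_conj2 det_mult2)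
qed

lemma is_cusp_act:
  assumes "is_cusp \<Gamma> c" "\<delta> \<in> \<Gamma>"
  shows "is_cusp \<Gamma> (act_proj \<delta> c)"
proof -
  from assms obtain \<gamma> where g: "\<gamma> \<in> \<Gamma>" "parabolic \<gamma>" "act_proj \<gamma> c = c" by (auto simp: is_cusp_def)
  have d: "det \<delta> = 1" "det \<gamma> = 1" using g assms det_1 by auto
  have "act_proj (\<delta> ** \<gamma> ** adj2 \<delta>) (act_proj \<delta> c) = act_proj (\<delta> ** \<gamma> ** adj2 \<delta> ** \<delta>) c"
    using d by (subst act_proj_mult) (auto simp: det_mult2)
  also have "\<delta> ** \<gamma> ** adj2 \<delta> ** \<delta> = \<delta> ** \<gamma>"
    by (simp add: matrix_mul_assoc[symmetric] adj2_mult d)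
  also have "act_proj (\<delta> ** \<gamma>) c = act_proj \<delta> c"
    using d g by (simp add: act_proj_mult)
  finally show ?thesis
    using conj_closed[OF g(1) assms(2)] parabolic_conj[OF d(1) g(2)] unfolding is_cusp_def by blast
qed

lemma is_endpoint_act:
  assumes "is_endpoint \<Gamma> a" "\<delta> \<in> \<Gamma>"
  shows "is_endpoint \<Gamma> (act_endpoint \<delta> a)"
  using assms by (cases a) (auto simp: is_cusp_act act_closed)

lemma act_endpoint_mult:
  assumes "is_endpoint \<Gamma> a" "det \<gamma> = 1" "det \<delta> = 1"
  shows "act_endpoint (\<gamma> ** \<delta>) a = act_endpoint \<gamma> (act_endpoint \<delta> a)"
  using assms by (cases a) (auto simp: act_proj_mult act_mult upper_half_plane_def)

lemma cusp_stabilizerD: "\<tau> \<in> cusp_stabilizer \<Gamma> b \<Longrightarrow> \<tau> \<in> \<Gamma> \<and> act_proj \<tau> b = b"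
  by (simp add: cusp_stabilizer_def)

lemma cusp_stabilizer_mult:
  "\<tau> \<in> cusp_stabilizer \<Gamma> b \<Longrightarrow> \<tau>' \<in> cusp_stabilizer \<Gamma> b \<Longrightarrow> \<tau> ** \<tau>' \<in> cusp_stabilizer \<Gamma> b"
  by (simp add: cusp_stabilizer_def mult_closed act_proj_mult det_1)

lemma cusp_stabilizer_adj2:
  assumes "\<tau> \<in> cusp_stabilizer \<Gamma> b"
  shows "adj2 \<tau> \<in> cusp_stabilizer \<Gamma> b"
proof -
  have d: "det \<tau> = 1" "act_proj \<tau> b = b" using assms by (auto simp: cusp_stabilizer_def det_1)
  have "act_proj (adj2 \<tau> ** \<tau>) b = act_proj (adj2 \<tau>) (act_proj \<tau> b)"
    using d by (intro act_proj_mult) auto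
  thus ?thesis using assms d by (simp add: cusp_stabilizer_def adj2_closed adj2_mult)
qed

lemma one_in_cusp_stabilizer: "mat 1 \<in> cusp_stabilizer \<Gamma> b"
  by (simp add: cusp_stabilizer_def one_closed)

lemma cusp_cosets_eq:
  "cusp_cosets \<Gamma> b = (\<lambda>\<gamma>. (\<lambda>\<tau>. \<tau> ** \<gamma>) ` cusp_stabilizer \<Gamma> b) ` \<Gamma>"
  by (auto simp: cusp_cosets_def RCOSETS_def r_coset_def SL2R_def image_def)

end

section \<open>Invariance of hyperbolic area under the action\<close>

lemma act_measurable [measurable]: "act A \<in> borel_measurable borel"
  unfolding act_eq[abs_def] auto_factor_def by measurable

lemma upper_half_plane_borel [measurable]: "upper_half_plane \<in> sets borel"
  unfolding upper_half_plane_def by measurable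

lemma act_image_eq_vimage:
  assumes "det A = 1" "S \<subseteq> upper_half_plane"
  shows "act A ` S = {w. Im w > 0 \<and> act (adj2 A) w \<in> S}"
proof (intro equalityI subsetI)
  fix w assume "w \<in> act A ` S"
  then obtain z where z: "z \<in> S" "w = act A z" by auto
  hence "Im z > 0" using assms by (auto simp: upper_half_plane_def)
  thus "w \<in> {w. Im w > 0 \<and> act (adj2 A) w \<in> S}"
    using z assms by (simp add: Im_act_pos act_adj2)
next
  fix w assume w: "w \<in> {w. Im w > 0 \<and> act (adj2 A) w \<in> S}"
  hence "w = act A (act (adj2 A) w)" by (simp add: act_adj2 assms)
  thus "w \<in> act A ` S" using w by blast
qed

lemma act_image_borel:
  assumes "det A = 1" "S \<subseteq> upper_half_plane" "S \<in> sets borel"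
  shows "act A ` S \<in> sets borel"
proof -
  have "{w. Im w > 0 \<and> act (adj2 A) w \<in> S} = upper_half_plane \<inter> act (adj2 A) -` S"
    by (auto simp: upper_half_plane_def)
  also have "\<dots> \<in> sets borel"
    using measurable_sets_borel[OF act_measurable assms(3)] upper_half_plane_borel by (rule sets.Int[rotated])
  finally show ?thesis using act_image_eq_vimage[OF assms(1,2)] by simp
qed

text \<open>The change of variables applied below is stated for \<open>real^n\<close>, so Lebesgue
  measure on the complex numbers is carried over from \<open>real^2\<close>; the two measures agree
  on open boxes.\<close>

lemma lborel_complex_eq_distr:
  "(lborel :: complex measure) = distr lborel borel (\<lambda>v::real^2. Complex (v$1) (v$2))"
proof (rule lborel_eqI)
  have cont: "continuous_on UNIV (\<lambda>v::real^2. Complex (v$1) (v$2))"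
    unfolding Complex_eq by (intro continuous_intros)
  hence meas [measurable]: "(\<lambda>v::real^2. Complex (v$1) (v$2)) \<in> borel_measurable borel"
    by (rule borel_measurable_continuous_onI)
  fix l u :: complex
  assume le: "\<And>b. b \<in> Basis \<Longrightarrow> l \<bullet> b \<le> u \<bullet> b"
  have "(\<lambda>v::real^2. Complex (v$1) (v$2)) -` box l u
      = box (vector [Re l, Im l]) (vector [Re u, Im u])"
  proof (rule Set.set_eqI)
    fix v :: "real^2"
    have "v \<in> box (vector [Re l, Im l]) (vector [Re u, Im u]) \<longleftrightarrow>
       Re l < v$1 \<and> v$1 < Re u \<and> Im l < v$2 \<and> v$2 < Im u"
      by (simp add: mem_box_cart forall_2)
    thus "v \<in> (\<lambda>v. Complex (v$1) (v$2)) -` box l u \<longleftrightarrow> v \<in> box (vector [Re l, Im l]) (vector [Re u, Im u])"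
      by (simp add: mem_box[of _ l] Basis_complex_def)
  qed
  hence "emeasure (distr lborel borel (\<lambda>v::real^2. Complex (v$1) (v$2))) (box l u)
     = emeasure lborel (box (vector [Re l, Im l] :: real^2) (vector [Re u, Im u]))"
    by (subst emeasure_distr) auto
  also have "\<dots> = (\<Prod>b\<in>Basis. (vector [Re u, Im u] - vector [Re l, Im l] :: real^2) \<bullet> b)"
    using le[of 1] le[of \<i>] by (intro emeasure_lborel_box) (auto simp: Basis_vec_def inner_axis Basis_complex_def forall_2 UNIV_2)
  also have "(\<Prod>b\<in>Basis. (vector [Re u, Im u] - vector [Re l, Im l] :: real^2) \<bullet> b)
      = (\<Prod>b\<in>Basis. (u - l) \<bullet> b)"
  proof -
    have B: "(Basis :: (real^2) set) = {axis 1 1, axis 2 1}" by (auto simp: Basis_vec_def UNIV_2)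
    have "axis 1 1 \<noteq> (axis 2 1 :: real^2)" by (simp add: axis_eq_axis)
    thus ?thesis unfolding B by (simp add: Basis_complex_def inner_axis)
  qed
  finally show "emeasure (distr lborel borel (\<lambda>v::real^2. Complex (v$1) (v$2))) (box l u) = (\<Prod>b\<in>Basis. (u - l) \<bullet> b)" .
qed simp

lemma nn_integral_lborel_complex:
  assumes [measurable]: "f \<in> borel_measurable (borel :: complex measure)"
  shows "(\<integral>\<^sup>+z. f z \<partial>lborel) = (\<integral>\<^sup>+v. f (Complex ((v::real^2)$1) (v$2)) \<partial>lborel)"
proof -
  have cont: "continuous_on UNIV (\<lambda>v::real^2. Complex (v$1) (v$2))"
    unfolding Complex_eq by (intro continuous_intros)
  hence [measurable]: "(\<lambda>v::real^2. Complex (v$1) (v$2)) \<in> borel_measurable borel"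
    by (rule borel_measurable_continuous_onI)
  show ?thesis by (subst lborel_complex_eq_distr, subst nn_integral_distr) auto
qed

text \<open>The Jacobian of \<open>act A\<close> is \<open>|cz + d|^-4\<close>, and
  \<open>Im (act A z)\<close> carries the factor \<open>|cz + d|^-2\<close>, so the density
  \<open>1 / y^2\<close> absorbs the Jacobian. The compact \<open>T\<close> keeps the image bounded
  and away from the real line, which makes the density integrable over it.\<close>

lemma hyperbolic_area_act:
  assumes A: "det A = 1" and S: "S \<in> sets borel" "S \<subseteq> upper_half_plane"
    and T: "act A ` S \<subseteq> T" "compact T" "T \<subseteq> upper_half_plane"
  shows "hyperbolic_area (act A ` S) = hyperbolic_area S"
proof -
  define \<phi> where "\<phi> = (\<lambda>v::real^2. Complex (v$1) (v$2))"
  define \<psi> where "\<psi> = (\<lambda>z. vector [Re z, Im z] :: real^2)"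
  have \<phi>\<psi> [simp]: "\<phi> (\<psi> z) = z" "\<psi> (\<phi> v) = v" for z v
    by (auto simp: \<phi>_def \<psi>_def vec_eq_iff forall_2)
  have Re\<phi>[simp]: "Re (\<phi> v) = v$1" "Im (\<phi> v) = v$2" for v by (simp_all add: \<phi>_def)
  have \<psi>i[simp]: "\<psi> z $1 = Re z" "\<psi> z $2 = Im z" for z by (simp_all add: \<psi>_def)
  have bl\<phi>: "bounded_linear \<phi>"
    by (intro linear_conv_bounded_linear[THEN iffD1] linearI) (simp_all add: complex_eq_iff)
  have bl\<psi>: "bounded_linear \<psi>"
    by (intro linear_conv_bounded_linear[THEN iffD1] linearI) (simp_all add: vec_eq_iff forall_2)
  have [measurable]: "\<phi> \<in> borel_measurable borel"
    using linear_continuous_on[OF bl\<phi>] by (rule borel_measurable_continuous_onI)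
  define g where "g = \<psi> \<circ> act A \<circ> \<phi>"
  define D where "D = (\<lambda>v. 1 / (auto_factor A (\<phi> v))\<^sup>2)"
  define g' where "g' = (\<lambda>v h. \<psi> (D v * \<phi> h))"
  define f where "f = (\<lambda>v::real^2. 1 / (v$2)\<^sup>2)"
  have pos: "v$2 > 0" if "v \<in> \<phi> -` S" for v using S that by (auto simp: upper_half_plane_def)
  have S2: "\<phi> -` S \<in> sets borel" using measurable_sets[OF _ S(1), of \<phi> borel] by simp
  have deriv: "(g has_derivative g' v) (at v within \<phi> -` S)" if "v \<in> \<phi> -` S" for v
  proof -
    have "(act A has_derivative (*) (D v)) (at (\<phi> v))"
      using has_field_derivative_act[OF A, of "\<phi> v"] pos[OF that] unfolding has_field_derivative_def D_def by simp
    hence "(act A has_derivative (*) (D v)) (at (\<phi> v) within range \<phi>)"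
      by (rule has_derivative_at_withinI)
    hence "((\<lambda>v. act A (\<phi> v)) has_derivative (\<lambda>h. D v * \<phi> h)) (at v)"
      using bounded_linear_imp_has_derivative[OF bl\<phi>, of "at v"]
      by (rule has_derivative_in_compose[rotated])
    hence "((\<lambda>v. \<psi> (act A (\<phi> v))) has_derivative (\<lambda>h. \<psi> (D v * \<phi> h))) (at v)"
      by (rule bounded_linear.has_derivative[OF bl\<psi>])
    thus ?thesis unfolding g_def g'_def comp_def by (rule has_derivative_at_withinI)
  qed
  have inj: "inj_on g (\<phi> -` S)"
  proof (rule inj_onI)
    fix v w assume vw: "v \<in> \<phi> -` S" "w \<in> \<phi> -` S" "g v = g w"
    from vw(3) have "\<phi> (g v) = \<phi> (g w)" by (rule arg_cong)
    hence "act A (\<phi> v) = act A (\<phi> w)" unfolding g_def by simp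
    hence "act (adj2 A) (act A (\<phi> v)) = act (adj2 A) (act A (\<phi> w))" by simp
    moreover have "Im (\<phi> v) > 0" "Im (\<phi> w) > 0" using pos[OF vw(1)] pos[OF vw(2)] by simp_all
    ultimately have "\<phi> v = \<phi> w" by (simp only: act_adj2(1)[OF A])
    hence "\<psi> (\<phi> v) = \<psi> (\<phi> w)" by (rule arg_cong)
    thus "v = w" by simp
  qed
  have im: "g ` (\<phi> -` S) = \<phi> -` (act A ` S)"
  proof (intro equalityI subsetI)
    fix v assume "v \<in> \<phi> -` (act A ` S)"
    then obtain z where "z \<in> S" "\<phi> v = act A z" by auto
    hence "g (\<psi> z) = \<psi> (\<phi> v)" "\<psi> z \<in> \<phi> -` S" unfolding g_def by simp_all
    hence "v = g (\<psi> z)" "\<psi> z \<in> \<phi> -` S" by simp_all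
    thus "v \<in> g ` (\<phi> -` S)" by blast
  qed (auto simp: g_def)
  have detg: "\<bar>det (matrix (g' v))\<bar> = (cmod (D v))\<^sup>2" for v
  proof -
    have "matrix (g' v) $ 1 $ 1 = Re (D v)" "matrix (g' v) $ 1 $ 2 = - Im (D v)"
      "matrix (g' v) $ 2 $ 1 = Im (D v)" "matrix (g' v) $ 2 $ 2 = Re (D v)"
      by (simp_all add: matrix_def g'_def \<phi>_def axis_def)
    hence "det (matrix (g' v)) = (cmod (D v))\<^sup>2" unfolding cmod_power2 by (simp add: det_2 power2_eq_square)
    thus ?thesis by simp
  qed
  have jac: "\<bar>det (matrix (g' v))\<bar> * f (g v) = f v" if "v \<in> \<phi> -` S" for v
  proof -
    have "auto_factor A (\<phi> v) \<noteq> 0" using auto_factor_nonzero[OF A] pos[OF that] by simp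
    thus ?thesis unfolding detg using A
      by (simp add: f_def g_def Im_act D_def norm_divide norm_mult divide_simps power2_eq_square)
  qed
  have "compact (\<psi> ` T)"
    using T(2) linear_continuous_on[OF bl\<psi>] by (intro compact_continuous_image) auto
  moreover have "g ` (\<phi> -` S) \<subseteq> \<psi> ` T" unfolding g_def using T(1) by (auto 0 4)
  ultimately have bdd: "bounded (g ` (\<phi> -` S))" using compact_imp_bounded bounded_subset by blast
  have T2: "g ` (\<phi> -` S) \<in> sets borel"
    unfolding im using measurable_sets[OF _ act_image_borel[OF A S(2,1)], of \<phi> borel] by simp
  hence T3: "g ` (\<phi> -` S) \<in> lmeasurable"
    using bdd by (intro bounded_set_imp_lmeasurable) auto
  obtain e where e: "e > 0" "\<And>w. w \<in> T \<Longrightarrow> Im w \<ge> e"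
  proof (cases "T = {}")
    case False
    have "continuous_on T Im" by (intro continuous_intros)
    then obtain w0 where "w0 \<in> T" "\<And>w. w \<in> T \<Longrightarrow> Im w0 \<le> Im w"
      using continuous_attains_inf[OF T(2) False] by blast
    thus ?thesis using that[of "Im w0"] T(3) by (auto simp: upper_half_plane_def)
  qed (use that[of 1] in auto)
  have fm: "f \<in> borel_measurable lborel" unfolding f_def by measurable
  have fai: "f absolutely_integrable_on g ` (\<phi> -` S)"
  proof (rule measurable_bounded_by_integrable_imp_absolutely_integrable)
    show "f \<in> borel_measurable (lebesgue_on (g ` (\<phi> -` S)))"
      using fm by (simp add: measurable_completion measurable_restrict_space1)
    show "g ` (\<phi> -` S) \<in> sets lebesgue" using T3 by (rule fmeasurableD)
    show "(\<lambda>x. 1 / e\<^sup>2) integrable_on g ` (\<phi> -` S)" using T3 by (rule integrable_on_const)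
    fix v assume "v \<in> g ` (\<phi> -` S)"
    hence "\<phi> v \<in> T" using T(1) unfolding im by auto
    hence "v$2 \<ge> e" using e(2)[of "\<phi> v"] by simp
    thus "norm (f v) \<le> 1 / e\<^sup>2" using e(1) by (auto simp: f_def intro!: divide_left_mono power_mono)
  qed
  \<comment> \<open>The change of variables theorem speaks of vector-valued functions; the real
    density is wrapped into \<open>real^1\<close> and unwrapped afterwards by taking the
    component.\<close>
  hence fai1: "(\<lambda>v. vec (f v) :: real^1) absolutely_integrable_on g ` (\<phi> -` S)"
    by (simp add: absolutely_integrable_on_1_iff)
  define I where "I = integral (g ` (\<phi> -` S)) (\<lambda>v. vec (f v) :: real^1)"
  have "(\<lambda>x. \<bar>det (matrix (g' x))\<bar> *\<^sub>R (vec (f (g x)) :: real^1)) absolutely_integrable_on \<phi> -` S \<and>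
           integral (\<phi> -` S) (\<lambda>x. \<bar>det (matrix (g' x))\<bar> *\<^sub>R vec (f (g x))) = I"
    using has_absolute_integral_change_of_variables[of "\<phi> -` S" g g' "\<lambda>v. vec (f v)" I] deriv inj S2 fai1
    by (auto simp: I_def)
  hence "((\<lambda>x. \<bar>det (matrix (g' x))\<bar> *\<^sub>R (vec (f (g x)) :: real^1)) has_integral I) (\<phi> -` S)"
    by (simp add: has_integral_iff absolutely_integrable_on_def)
  hence "((\<lambda>x. (\<bar>det (matrix (g' x))\<bar> *\<^sub>R (vec (f (g x)) :: real^1)) $ 1) has_integral I $ 1) (\<phi> -` S)"
    by (rule has_integral_linear[where h="\<lambda>x. x $ 1", unfolded comp_def, OF _ bounded_linear_vec_nth]) 
  hence "((\<lambda>x. f x) has_integral I $ 1) (\<phi> -` S)"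
    by (rule has_integral_eq[rotated]) (simp add: jac)
  hence 1: "integral\<^sup>N lborel (\<lambda>x. ennreal (f x) * indicator (\<phi> -` S) x) = ennreal (I $ 1)"
    by (intro nn_integral_has_integral_lebesgue') (auto simp: f_def)
  have "((\<lambda>v. vec (f v) :: real^1) has_integral I) (g ` (\<phi> -` S))"
    using fai1 by (simp add: has_integral_iff absolutely_integrable_on_def I_def)
  hence "((\<lambda>v. (vec (f v) :: real^1) $ 1) has_integral I $ 1) (g ` (\<phi> -` S))"
    by (rule has_integral_linear[where h="\<lambda>x. x $ 1", unfolded comp_def, OF _ bounded_linear_vec_nth])
  hence 2: "integral\<^sup>N lborel (\<lambda>x. ennreal (f x) * indicator (g ` (\<phi> -` S)) x) = ennreal (I $ 1)"
    by (intro nn_integral_has_integral_lebesgue') (auto simp: f_def)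
  have 3: "hyperbolic_area U = integral\<^sup>N lborel (\<lambda>x. ennreal (f x) * indicator (\<phi> -` U) x)"
    if [measurable]: "U \<in> sets borel" for U
    unfolding hyperbolic_area_def
    by (subst nn_integral_lborel_complex) (auto simp: f_def \<phi>_def indicator_def intro!: nn_integral_cong)
  show ?thesis using 1 2 3[OF S(1)] 3[OF act_image_borel[OF A S(2,1)]] by (simp add: im)
qed

section \<open>Displacement\<close>

lemma norm_mat2_sq: "(norm (A::real^2^2))\<^sup>2 = (A$1$1)\<^sup>2 + (A$1$2)\<^sup>2 + (A$2$1)\<^sup>2 + (A$2$2)\<^sup>2"
  by (simp add: norm_vec_def L2_set_def sum_2)

text \<open>The norm on \<open>real^2^2\<close> is the Frobenius norm; Cauchy-Schwarz is applied to
  each entry of the product.\<close>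

lemma norm_mat2_mult: "norm ((A::real^2^2) ** (B::real^2^2)) \<le> norm A * norm B"
proof (rule power2_le_imp_le)
  have *: "(p*x+q*y)\<^sup>2 \<le> (p\<^sup>2+q\<^sup>2)*(x\<^sup>2+y\<^sup>2)" for p q x y :: real
  proof -
    have "(p\<^sup>2+q\<^sup>2)*(x\<^sup>2+y\<^sup>2) - (p*x+q*y)\<^sup>2 = (p*y-q*x)\<^sup>2"
      by (simp add: power2_eq_square algebra_simps)
    thus ?thesis using zero_le_power2[of "p*y-q*x"] by linarith
  qed
  have "(norm (A ** B))\<^sup>2 \<le>
      ((A$1$1)\<^sup>2+(A$1$2)\<^sup>2)*((B$1$1)\<^sup>2+(B$2$1)\<^sup>2) + ((A$1$1)\<^sup>2+(A$1$2)\<^sup>2)*((B$1$2)\<^sup>2+(B$2$2)\<^sup>2)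
    + ((A$2$1)\<^sup>2+(A$2$2)\<^sup>2)*((B$1$1)\<^sup>2+(B$2$1)\<^sup>2) + ((A$2$1)\<^sup>2+(A$2$2)\<^sup>2)*((B$1$2)\<^sup>2+(B$2$2)\<^sup>2)"
    unfolding norm_mat2_sq mat2_mult_nth by (intro add_mono *)
  also have "\<dots> = (norm A * norm B)\<^sup>2"
    unfolding power_mult_distrib norm_mat2_sq by (simp add: algebra_simps)
  finally show "(norm (A ** B))\<^sup>2 \<le> (norm A * norm B)\<^sup>2" .
qed simp

lemma norm_adj2 [simp]: "norm (adj2 A) = norm A"
  by (rule power2_eq_imp_eq) (simp_all add: norm_mat2_sq)

lemma adj2_adj2 [simp]: "adj2 (adj2 A) = A"
  by (simp add: mat2_eq_iff)

lemma adj2_mult_distrib: "adj2 (A ** B) = adj2 B ** adj2 A"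
  by (simp add: mat2_eq_iff mat2_mult_nth)

lemma mat2_diff_rdistrib: "((A::real^2^2) - B) ** (C::real^2^2) = A ** C - B ** C"
  by (simp only: mat2_eq_iff mat2_mult_nth vector_minus_component left_diff_distrib) simp

lemma mat2_diff_ldistrib: "(C::real^2^2) ** ((A::real^2^2) - B) = C ** A - C ** B"
  by (simp only: mat2_eq_iff mat2_mult_nth vector_minus_component right_diff_distrib) simp

text \<open>The Frobenius norm of the identity is \<open>sqrt 2\<close>; 71/50 is a rational number
  slightly above it.\<close>

lemma norm_one_mat2_le: "norm (mat 1 :: real^2^2) \<le> (71/50)"
proof (rule power2_le_imp_le)
  show "(norm (mat 1 :: real^2^2))\<^sup>2 \<le> (71/50)\<^sup>2"
    unfolding norm_mat2_sq by (simp add: power2_eq_square)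
qed simp

text \<open>Equals \<open>2 cosh d - 2\<close> for the hyperbolic distance \<open>d\<close> of the
  two points; being rational in the coordinates, it replaces the distance throughout.\<close>

definition udist :: "complex \<Rightarrow> complex \<Rightarrow> real" where
  "udist z w = (cmod (z - w))\<^sup>2 / (Im z * Im w)"

text \<open>For \<open>det A = 1\<close> this is the squared norm of \<open>A - mat 1\<close> after conjugating \<open>z\<close> to \<open>\<i>\<close>.\<close>

definition disp :: "real^2^2 \<Rightarrow> complex \<Rightarrow> real" where
  "disp A z = udist z (act A z) + 4 - 2 * trace A"

text \<open>The quadratic form \<open>c z^2 + (d - a) z - b\<close>, whose zeros are the fixed
  points of \<open>A\<close>; for \<open>det A = 1\<close> its discriminant is
  \<open>(trace A)^2 - 4\<close>.\<close>

definition fixform :: "real^2^2 \<Rightarrow> complex \<Rightarrow> complex" where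
  "fixform A z = of_real (A$2$1) * z\<^sup>2 + of_real (A$2$2 - A$1$1) * z - of_real (A$1$2)"

text \<open>The upper triangular matrix of determinant 1 that acts as
  \<open>w \<mapsto> Im z * w + Re z\<close> and so carries \<open>\<i>\<close> to z.\<close>

definition gmat :: "complex \<Rightarrow> real^2^2" where
  "gmat z = vector [vector [sqrt (Im z), Re z / sqrt (Im z)], vector [0, 1 / sqrt (Im z)]]"

lemma gmat_nth [simp]: "gmat z $1$1 = sqrt (Im z)" "gmat z $1$2 = Re z / sqrt (Im z)"
  "gmat z $2$1 = 0" "gmat z $2$2 = 1 / sqrt (Im z)"
  by (simp_all add: gmat_def)

lemma det_gmat [simp]: "Im z > 0 \<Longrightarrow> det (gmat z) = 1"
  by (simp add: det_2)

lemma act_gmat: "Im z > 0 \<Longrightarrow> act (gmat z) w = of_real (Im z) * w + of_real (Re z)"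
proof -
  assume z: "Im z > 0"
  define t where "t = sqrt (Im z)"
  have t: "t > 0" "Im z = t * t" using z by (auto simp: t_def)
  show ?thesis
    unfolding act_eq auto_factor_def gmat_nth t_def[symmetric] using t
    by (simp add: t_def[symmetric] field_simps)
qed

lemma act_gmat_ii [simp]: "Im z > 0 \<Longrightarrow> act (gmat z) \<i> = z"
  by (simp add: act_gmat complex_eq_iff)

lemma udist_act:
  assumes "det A = 1" "Im z > 0" "Im w > 0"
  shows "udist (act A z) (act A w) = udist z w"
  using auto_factor_nonzero[of A] assms
  by (simp add: udist_def act_diff Im_act norm_divide norm_mult power_mult_distrib power_divide)

lemma udist_nonneg: "Im z > 0 \<Longrightarrow> Im w > 0 \<Longrightarrow> udist z w \<ge> 0"
  by (simp add: udist_def)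

lemma udist_act_fixform:
  assumes "det A = 1" "Im z > 0"
  shows "udist z (act A z) = (cmod (fixform A z))\<^sup>2 / (Im z)\<^sup>2"
proof -
  have nz: "auto_factor A z \<noteq> 0" using auto_factor_nonzero assms by blast
  have "z - act A z = fixform A z / auto_factor A z"
    using nz by (simp add: act_eq field_simps) (simp add: fixform_def auto_factor_def power2_eq_square algebra_simps)
  thus ?thesis using nz assms
    by (simp add: udist_def Im_act norm_divide power_divide power2_eq_square)
qed

lemma disp_conj:
  assumes "det A = 1" "det \<delta> = 1" "Im z > 0"
  shows "disp (\<delta> ** A ** adj2 \<delta>) (act \<delta> z) = disp A z"
proof -
  have "act (\<delta> ** A ** adj2 \<delta>) (act \<delta> z) = act \<delta> (act A z)"
    using assms by (simp add: act_mult det_mult2 Im_act_pos act_adj2)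
  thus ?thesis using assms by (simp add: disp_def udist_act Im_act_pos trace_conj2)
qed

text \<open>The classical identity \<open>a^2 + b^2 + c^2 + d^2 = 2 cosh d(\<i>, A \<i>)\<close>. It
  converts statements about points into statements about matrix norms and back.\<close>

lemma norm_sq_eq_udist:
  assumes "det A = 1"
  shows "(norm A)\<^sup>2 = udist \<i> (act A \<i>) + 2"
proof -
  have "udist \<i> (act A \<i>) = (A$2$1 + A$1$2)\<^sup>2 + (A$2$2 - A$1$1)\<^sup>2"
    using assms power2_minus[of "A$2$1 + A$1$2"]
    by (subst udist_act_fixform) (simp_all add: fixform_def cmod_power2)
  thus ?thesis unfolding norm_mat2_sq using assms by (simp add: det_2 power2_eq_square algebra_simps)
qed

lemma norm_diff_one_sq:
  assumes "det A = 1"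
  shows "(norm (A - mat 1))\<^sup>2 = disp A \<i>"
proof -
  have "(norm (A - mat 1))\<^sup>2 = (norm A)\<^sup>2 + 2 - 2 * (A$1$1 + A$2$2)"
    unfolding norm_mat2_sq by (simp add: power2_eq_square algebra_simps)
  thus ?thesis unfolding disp_def trace2 using norm_sq_eq_udist[OF assms] by simp
qed

text \<open>Views \<open>A\<close> in the frame at z: conjugation moves z to \<open>\<i>\<close>,
  where displacement becomes the Frobenius distance to the identity.\<close>

definition loc :: "complex \<Rightarrow> real^2^2 \<Rightarrow> real^2^2" where
  "loc z A = adj2 (gmat z) ** A ** gmat z"

lemma det_loc [simp]: "Im z > 0 \<Longrightarrow> det (loc z A) = det A"
  by (simp add: loc_def det_mul)

lemma loc_mult: "Im z > 0 \<Longrightarrow> loc z (A ** B) = loc z A ** loc z B"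
proof -
  assume z: "Im z > 0"
  have "loc z A ** loc z B = adj2 (gmat z) ** A ** (gmat z ** adj2 (gmat z)) ** B ** gmat z"
    by (simp add: loc_def matrix_mul_assoc)
  also have "\<dots> = loc z (A ** B)" using z by (simp add: adj2_mult loc_def matrix_mul_assoc)
  finally show ?thesis by simp
qed

lemma loc_adj2: "loc z (adj2 A) = adj2 (loc z A)"
  by (simp add: loc_def adj2_mult_distrib matrix_mul_assoc)

lemma unloc: "Im z > 0 \<Longrightarrow> gmat z ** loc z A ** adj2 (gmat z) = A"
proof -
  assume z: "Im z > 0"
  have "gmat z ** loc z A ** adj2 (gmat z) = (gmat z ** adj2 (gmat z)) ** A ** (gmat z ** adj2 (gmat z))"
    by (simp add: loc_def matrix_mul_assoc)
  thus ?thesis using z by (simp add: adj2_mult)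
qed

lemma disp_loc:
  assumes "det A = 1" "Im z > 0"
  shows "disp (loc z A) \<i> = disp A z"
proof -
  have "disp (gmat z ** loc z A ** adj2 (gmat z)) (act (gmat z) \<i>) = disp (loc z A) \<i>"
    using assms by (intro disp_conj) auto
  thus ?thesis using assms by (simp add: unloc)
qed

lemma norm_loc_diff_one:
  assumes "det A = 1" "Im z > 0"
  shows "(norm (loc z A - mat 1))\<^sup>2 = disp A z"
  using norm_diff_one_sq[of "loc z A"] assms by (simp add: disp_loc)

lemma norm_loc_sq:
  assumes "det A = 1" "Im z > 0"
  shows "(norm (loc z A))\<^sup>2 = udist z (act A z) + 2"
proof -
  have "act (gmat z) (act (loc z A) \<i>) = act (gmat z ** loc z A ** adj2 (gmat z)) z"
    using assms by (subst act_mult, auto simp: det_mult2 act_mult Im_act_pos) (metis act_adj2(1) act_gmat_ii det_gmat imaginary_unit.sel(2) zero_less_one)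
  hence "udist \<i> (act (loc z A) \<i>) = udist z (act A z)"
    using assms udist_act[of "gmat z" \<i> "act (loc z A) \<i>"] by (simp add: unloc Im_act_pos)
  thus ?thesis using norm_sq_eq_udist[of "loc z A"] assms by simp
qed

lemma disp_eq_0:
  assumes "det A = 1" "Im z > 0" "disp A z = 0"
  shows "A = mat 1"
proof -
  have "loc z A = mat 1" using norm_loc_diff_one[OF assms(1,2)] assms(3) by simp
  hence "gmat z ** loc z A ** adj2 (gmat z) = mat 1" using assms(2) by (simp add: adj2_mult)
  thus ?thesis using assms(2) by (simp add: unloc)
qed

text \<open>Since \<open>AB - BA = (A - 1)(B - 1) - (B - 1)(A - 1)\<close>, the commutator is
  quadratically small when both matrices are close to the identity. This drives the argument with an
  element of least displacement.\<close>

lemma norm_commutator_diff_one: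
  assumes "det A = 1" "det B = 1"
  shows "norm (A ** B ** adj2 A ** adj2 B - mat 1) \<le> 2 * norm (A - mat 1) * norm (B - mat 1) * norm A * norm B"
proof -
  define X where "X = (A - mat 1) ** (B - mat 1) - (B - mat 1) ** (A - mat 1)"
  have "A ** B ** adj2 A ** adj2 B - mat 1 = (A ** B - B ** A) ** (adj2 A ** adj2 B)"
  proof -
    have "B ** A ** (adj2 A ** adj2 B) = B ** (A ** adj2 A) ** adj2 B"
      by (simp only: matrix_mul_assoc)
    also have "\<dots> = mat 1" using assms by (simp add: adj2_mult)
    finally show ?thesis by (simp add: mat2_diff_rdistrib matrix_mul_assoc)
  qed
  also have "A ** B - B ** A = X"
    by (simp add: X_def mat2_eq_iff mat2_mult_nth algebra_simps)
  finally have "norm (A ** B ** adj2 A ** adj2 B - mat 1) \<le> norm X * (norm A * norm B)"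
    using norm_mat2_mult[of X "adj2 A ** adj2 B"] norm_mat2_mult[of "adj2 A" "adj2 B"]
    by (smt (verit) mult_left_mono norm_adj2 norm_ge_zero)
  also have "norm X \<le> 2 * norm (A - mat 1) * norm (B - mat 1)"
    unfolding X_def using norm_mat2_mult[of "A - mat 1" "B - mat 1"] norm_mat2_mult[of "B - mat 1" "A - mat 1"]
    by (intro order.trans[OF norm_triangle_ineq4]) (simp add: mult_ac)
  finally show ?thesis by (simp add: mult_right_mono mult.assoc)
qed

lemma commute_imp_commutator:
  assumes "det A = 1" "det B = 1" "A ** B ** adj2 A ** adj2 B = mat 1"
  shows "A ** B = B ** A"
proof -
  have "A ** B ** adj2 A ** adj2 B ** (B ** A) = A ** B ** (adj2 A ** (adj2 B ** B) ** A)"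
    by (simp only: matrix_mul_assoc)
  also have "\<dots> = A ** B" using assms by (simp add: adj2_mult)
  finally show ?thesis using assms(3) by simp
qed

text \<open>The entries of \<open>AB - BA\<close> are, up to sign, the components of the cross
  product of the traceless parts \<open>(b, c, d - a)\<close>.\<close>

lemma commute_iff_cross:
  "(A::real^2^2) ** (B::real^2^2) = B ** A \<longleftrightarrow>
     A$1$2 * B$2$1 = B$1$2 * A$2$1 \<and>
     A$1$2 * (B$2$2 - B$1$1) = B$1$2 * (A$2$2 - A$1$1) \<and>
     A$2$1 * (B$2$2 - B$1$1) = B$2$1 * (A$2$2 - A$1$1)"
  unfolding mat2_eq_iff mat2_mult_nth by (simp add: algebra_simps) linarith

text \<open>Proportionality of traceless parts, that is, of the forms \<open>fixform\<close>; for
  nonzero \<beta> both matrices have the same fixed points.\<close>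

definition proportional :: "real \<Rightarrow> real^2^2 \<Rightarrow> real^2^2 \<Rightarrow> bool" where
  "proportional \<beta> A B \<longleftrightarrow> B$2$1 = \<beta> * A$2$1 \<and> B$2$2 - B$1$1 = \<beta> * (A$2$2 - A$1$1) \<and> B$1$2 = \<beta> * A$1$2"

lemma scalar_cases:
  assumes "det (A::real^2^2) = 1" "A$2$1 = 0" "A$1$2 = 0" "A$1$1 = A$2$2"
  shows "A = mat 1 \<or> A = - mat 1"
  using assms by (auto simp: det_2 mat2_eq_iff square_eq_1_iff)

lemma commute_proportional:
  assumes "det (A::real^2^2) = 1" "A \<noteq> mat 1" "A \<noteq> - mat 1" "A ** (B::real^2^2) = B ** A"
  obtains \<beta> where "proportional \<beta> A B"
proof -
  from assms consider "A$2$1 \<noteq> 0" | "A$1$2 \<noteq> 0" | "A$2$2 - A$1$1 \<noteq> 0" using scalar_cases[of A] by fastforce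
  thus ?thesis
  proof cases
    case 1
    show ?thesis by (rule that[of "B$2$1 / A$2$1"])
      (use assms(4) 1 in \<open>auto simp: commute_iff_cross proportional_def field_simps\<close>)
  next
    case 2
    show ?thesis by (rule that[of "B$1$2 / A$1$2"])
      (use assms(4) 2 in \<open>auto simp: commute_iff_cross proportional_def field_simps\<close>)
  next
    case 3
    show ?thesis by (rule that[of "(B$2$2 - B$1$1) / (A$2$2 - A$1$1)"])
      (use assms(4) 3 in \<open>auto simp: commute_iff_cross proportional_def field_simps\<close>)
  qed
qed

lemma proportional_commute: "proportional \<beta> A B \<Longrightarrow> proportional \<beta>' A C \<Longrightarrow> B ** C = C ** B"
  unfolding commute_iff_cross proportional_def by (simp add: mult_ac)

text \<open>Commuting with a non-scalar matrix means having a traceless part proportional to its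
  own, and matrices with proportional traceless parts commute.\<close>

lemma commute_trans:
  assumes "det (A::real^2^2) = 1" "A \<noteq> mat 1" "A \<noteq> - mat 1" "A ** (B::real^2^2) = B ** A" "A ** (C::real^2^2) = C ** A"
  shows "B ** C = C ** B"
  using commute_proportional[OF assms(1-4)] commute_proportional[OF assms(1-3,5)] proportional_commute by metis

text \<open>\<open>A\<close> and \<open>- A\<close> act alike, but \<open>disp\<close> sees the
  trace and tells them apart: a small displacement forces a positive trace.\<close>

lemma disp_neg_trace: "Im z > 0 \<Longrightarrow> det A = 1 \<Longrightarrow> trace A \<le> 0 \<Longrightarrow> disp A z \<ge> 4"
  using udist_nonneg[of z "act A z"] by (simp add: disp_def Im_act_pos)

lemma disp_minus_one: "Im z > 0 \<Longrightarrow> disp (- mat 1) z = 8"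
  by (simp add: disp_def udist_def trace2)

text \<open>By total boundedness the ball is covered by finitely many balls of radius
  \<open>e / 2\<close>, and each of these contains at most one point of an e-separated set. The
  number \<open>M\<close> depends on \<open>R\<close> and \<open>e\<close> only.\<close>

lemma card_separated_bound:
  fixes R e :: real
  assumes "e > 0"
  obtains M where "\<And>S :: (real^2^2) set. S \<subseteq> cball 0 R \<Longrightarrow>
     (\<And>x y. x \<in> S \<Longrightarrow> y \<in> S \<Longrightarrow> x \<noteq> y \<Longrightarrow> dist x y \<ge> e) \<Longrightarrow> finite S \<and> card S \<le> M"
proof -
  have "compact (cball (0::real^2^2) R)" by simp
  then obtain k where k: "finite k" "cball (0::real^2^2) R \<subseteq> (\<Union>x\<in>k. ball x (e/2))"
    using assms by (metis compact_eq_totally_bounded half_gt_zero)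
  show ?thesis
  proof (rule that[of "card k"])
    fix S :: "(real^2^2) set"
    assume S: "S \<subseteq> cball 0 R" and sep: "\<And>x y. x \<in> S \<Longrightarrow> y \<in> S \<Longrightarrow> x \<noteq> y \<Longrightarrow> dist x y \<ge> e"
    have "\<forall>x\<in>S. \<exists>c\<in>k. x \<in> ball c (e/2)" using S k(2) by blast
    then obtain c where c: "\<And>x. x \<in> S \<Longrightarrow> c x \<in> k" "\<And>x. x \<in> S \<Longrightarrow> x \<in> ball (c x) (e/2)" by metis
    have inj: "inj_on c S"
    proof (rule inj_onI, rule ccontr)
      fix x y assume xy: "x \<in> S" "y \<in> S" "c x = c y" "x \<noteq> y"
      have "dist x y \<le> dist (c x) x + dist (c x) y" by (metis dist_commute dist_triangle)
      also have "\<dots> < e/2 + e/2" using c(2)[OF xy(1)] c(2)[OF xy(2)] xy(3) by (intro add_strict_mono) auto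
      finally show False using sep[OF xy(1,2,4)] by simp
    qed
    moreover have "c ` S \<subseteq> k" using c by auto
    ultimately show "finite S \<and> card S \<le> card k"
      using k(1) by (metis card_inj_on_le finite_subset inj_on_finite)
  qed
qed

section \<open>Boxes comparable to hyperbolic balls\<close>

lemma norm_gmat_sq: "Im z > 0 \<Longrightarrow> (norm (gmat z))\<^sup>2 = Im z + (Re z)\<^sup>2 / Im z + 1 / Im z"
  unfolding norm_mat2_sq by (simp add: power_divide)

lemma norm_unloc:
  assumes "Im z > 0"
  shows "norm A \<le> (norm (gmat z))\<^sup>2 * norm (loc z A)"
proof -
  have "norm A = norm (gmat z ** loc z A ** adj2 (gmat z))" using assms by (simp add: unloc)
  also have "\<dots> \<le> norm (gmat z ** loc z A) * norm (gmat z)" using norm_mat2_mult[of _ "adj2 (gmat z)"] by simp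
  also have "\<dots> \<le> norm (gmat z) * norm (loc z A) * norm (gmat z)"
    by (intro mult_right_mono norm_mat2_mult) simp
  finally show ?thesis by (simp add: power2_eq_square mult_ac)
qed

lemma norm_loc_le:
  assumes "det A = 1" "Im z > 0" "disp A z \<le> R\<^sup>2" "R \<ge> 0"
  shows "norm (loc z A) \<le> R + (71/50)"
proof -
  have "norm (loc z A - mat 1) \<le> R"
    using assms norm_loc_diff_one[of A z] by (metis power2_le_imp_le)
  thus ?thesis using norm_triangle_sub[of "loc z A" "mat 1"] norm_one_mat2_le by linarith
qed

text \<open>Between the frames at p and at its image the matrix becomes an element fixing
  \<open>\<i>\<close>, that is, a rotation, of Frobenius norm \<open>sqrt 2\<close>.\<close>

lemma norm_le_gmat:
  assumes "det A = 1" "Im p > 0"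
  shows "norm A \<le> norm (gmat (act A p)) * (71/50) * norm (gmat p)"
proof -
  define q where "q = act A p"
  have q: "Im q > 0" using assms by (simp add: q_def Im_act_pos)
  define B where "B = adj2 (gmat q) ** A ** gmat p"
  have dB: "det B = 1" using assms q by (simp add: B_def det_mul)
  have "act B \<i> = act (adj2 (gmat q)) (act A (act (gmat p) \<i>))"
    using assms q by (simp add: B_def act_mult det_mult2)
  also have "\<dots> = act (adj2 (gmat q)) (act (gmat q) \<i>)"
    using act_gmat_ii[OF assms(2)] act_gmat_ii[OF q] by (simp add: q_def[symmetric])
  also have "\<dots> = \<i>" using q by (intro act_adj2) auto
  finally have "(norm B)\<^sup>2 = 2" using norm_sq_eq_udist[OF dB] by (simp add: udist_def)
  hence "(norm B)\<^sup>2 \<le> (71/50)\<^sup>2" by (simp add: power_divide)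
  hence "norm B \<le> (71/50)" by (rule power2_le_imp_le) simp
  have "gmat q ** B ** adj2 (gmat p) = (gmat q ** adj2 (gmat q)) ** A ** (gmat p ** adj2 (gmat p))"
    by (simp add: B_def matrix_mul_assoc)
  hence "A = gmat q ** B ** adj2 (gmat p)" using assms q by (simp add: adj2_mult)
  hence "norm A \<le> norm (gmat q ** B) * norm (gmat p)" using norm_mat2_mult[of _ "adj2 (gmat p)"] by simp
  also have "\<dots> \<le> norm (gmat q) * norm B * norm (gmat p)"
    by (intro mult_right_mono norm_mat2_mult) simp
  also have "\<dots> \<le> norm (gmat q) * (71/50) * norm (gmat p)"
    by (intro mult_right_mono mult_left_mono \<open>norm B \<le> (71/50)\<close>) simp_all
  finally show ?thesis by (simp add: q_def)
qed

text \<open>The image under \<open>gmat z\<close> of a fixed Euclidean box about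
  \<open>\<i>\<close>. It replaces a hyperbolic ball: its hyperbolic size is independent of z, and
  its Lebesgue measure is immediate.\<close>

definition hbox :: "complex \<Rightarrow> complex set" where
  "hbox z = {w. Re z - Im z / 2 < Re w \<and> Re w < Re z + Im z / 2 \<and> Im z / 2 < Im w \<and> Im w < 3/2 * Im z}"

lemma hbox_eq_box: "hbox z = box (Complex (Re z - Im z/2) (Im z/2)) (Complex (Re z + Im z/2) (3/2 * Im z))"
  unfolding hbox_def by (auto simp: mem_box Basis_complex_def abs_less_iff)

lemma hbox_upper: "Im z > 0 \<Longrightarrow> hbox z \<subseteq> upper_half_plane"
  by (auto simp: hbox_def upper_half_plane_def)

lemma mem_hbox_self: "Im z > 0 \<Longrightarrow> z \<in> hbox z"
  by (simp add: hbox_def)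

lemma hbox_borel [measurable]: "hbox z \<in> sets borel"
  by (simp add: hbox_eq_box)

lemma norm_gmat_rel:
  assumes "Im z > 0" "w \<in> hbox z"
  shows "norm (gmat (act (adj2 (gmat z)) w)) \<le> 2"
    "Im (act (adj2 (gmat z)) w) > 0" "Im w > 0"
proof -
  show w: "Im w > 0" using assms by (auto simp: hbox_def)
  define p where "p = Complex ((Re w - Re z) / Im z) (Im w / Im z)"
  have p: "act (gmat z) p = w" using assms by (simp add: act_gmat p_def complex_eq_iff)
  have Ip: "Im p > 0" using assms w by (simp add: p_def)
  have eq: "act (adj2 (gmat z)) w = p" using act_adj2(1)[of "gmat z" p] assms Ip p by simp
  thus "Im (act (adj2 (gmat z)) w) > 0" using Ip by simp
  have b: "Im w < 3/2 * Im z" "Im w > Im z / 2" "\<bar>Re w - Re z\<bar> < Im z / 2"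
    using assms unfolding hbox_def mem_Collect_eq by linarith+
  have b1: "Im p < 3/2" "Im p > 1/2" using b assms(1) by (simp_all add: p_def field_simps)
  have "\<bar>Re p\<bar> < 1/2" using b assms(1) by (simp add: p_def abs_divide field_simps)
  hence "(Re p)\<^sup>2 \<le> (1/2)\<^sup>2" using abs_le_square_iff[of "Re p" "1/2"] by auto
  hence "(Re p)\<^sup>2 / Im p \<le> (1/2)\<^sup>2 / (1/2)" using b1 by (intro frac_le) auto
  hence c1: "(Re p)\<^sup>2 / Im p \<le> 1/2" by (simp add: power_divide)
  have "1 / Im p \<le> 1 / (1/2)" using b1 by (intro frac_le) auto
  hence c2: "1 / Im p \<le> 2" by simp
  \<comment> \<open>The three terms are at most 3/2, 1/2 and 2; their sum 4 is the square of the
    claimed bound.\<close>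
  have "Im p + (Re p)\<^sup>2 / Im p + 1 / Im p \<le> 4" using b1 c1 c2 by linarith
  hence "(norm (gmat p))\<^sup>2 \<le> 2\<^sup>2" using norm_gmat_sq[OF Ip] by simp
  thus "norm (gmat (act (adj2 (gmat z)) w)) \<le> 2" unfolding eq by (rule power2_le_imp_le) simp
qed

text \<open>Read in the frames at z and z', both points have frame matrices of norm at most 2, and
  \<open>2 * 71/50 * 2\<close> is below 6.\<close>

lemma norm_between_hbox:
  assumes "det A = 1" "Im z > 0" "Im z' > 0" "w \<in> hbox z" "act A w \<in> hbox z'"
  shows "norm (adj2 (gmat z') ** A ** gmat z) \<le> 6"
proof -
  define B where "B = adj2 (gmat z') ** A ** gmat z"
  define p where "p = act (adj2 (gmat z)) w"
  note 1 = norm_gmat_rel[OF assms(2,4)] and 2 = norm_gmat_rel[OF assms(3,5)]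
  have dB: "det B = 1" using assms by (simp add: B_def det_mul)
  have "act B p = act (adj2 (gmat z')) (act A (act (gmat z) (act (adj2 (gmat z)) w)))"
    using assms 1 2 by (simp add: B_def p_def act_mult det_mult2 Im_act_pos)
  also have "\<dots> = act (adj2 (gmat z')) (act A w)" using assms 1 by (simp add: act_adj2)
  finally have "norm (gmat (act B p)) \<le> 2" "norm (gmat p) \<le> 2" "Im p > 0" using 1 2 by (simp_all add: p_def)
  hence "norm (gmat (act B p)) * (71/50) * norm (gmat p) \<le> 2 * (71/50) * 2" by (intro mult_mono) auto
  with norm_le_gmat[OF dB \<open>Im p > 0\<close>] have "norm B \<le> 2 * (71/50) * 2" by (rule order.trans)
  thus ?thesis by (simp add: B_def)
qed

text \<open>The Euclidean area is \<open>(Im z)^2\<close>, and the height in the box stays below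
  \<open>3/2 * Im z\<close>, whence 4/9.\<close>

lemma hyperbolic_area_hbox:
  assumes "Im z > 0"
  shows "hyperbolic_area (hbox z) \<ge> ennreal (4/9)"
proof -
  have "emeasure lborel (hbox z) = ennreal ((Im z)\<^sup>2)"
    unfolding hbox_eq_box using assms
    by (subst emeasure_lborel_box) (auto simp: Basis_complex_def power2_eq_square)
  hence "ennreal (4/9) = ennreal (1 / (3/2 * Im z)\<^sup>2) * emeasure lborel (hbox z)"
    using assms by (simp add: ennreal_mult[symmetric] field_simps power2_eq_square)
  also have "\<dots> = (\<integral>\<^sup>+w. ennreal (1 / (3/2 * Im z)\<^sup>2) * indicator (hbox z) w \<partial>lborel)"
    by (subst nn_integral_cmult_indicator) auto
  also have "\<dots> \<le> hyperbolic_area (hbox z)"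
    unfolding hyperbolic_area_def
  proof (rule nn_integral_mono)
    fix w
    show "ennreal (1 / (3/2 * Im z)\<^sup>2) * indicator (hbox z) w \<le> ennreal (1 / (Im w)\<^sup>2) * indicator (hbox z) w"
    proof (cases "w \<in> hbox z")
      case True
      hence b: "Im w > 0" "Im w \<le> 3/2 * Im z" using assms by (auto simp: hbox_def abs_less_iff)
      hence "1 / (3/2 * Im z)\<^sup>2 \<le> 1 / (Im w)\<^sup>2"
        by (intro frac_le power_mono) auto
      thus ?thesis by (intro mult_right_mono ennreal_leI) auto
    qed simp
  qed
  finally show ?thesis .
qed

lemma udist_commute: "udist z w = udist w z"
  by (simp add: udist_def norm_minus_commute mult.commute)

text \<open>With \<open>t = |z - w|\<close> the estimate \<open>Im w \<le> Im z + t\<close> turns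
  the hypothesis into a quadratic inequality for t.\<close>

lemma udist_bound:
  assumes "Im z > 0" "Im w > 0" "udist z w \<le> R" "R \<ge> 0"
  shows "cmod (z - w) \<le> (R + 1) * Im z"
proof (rule ccontr)
  assume n: "\<not> ?thesis"
  define t where "t = cmod (z - w)"
  have 1: "t\<^sup>2 \<le> R * (Im z * Im w)" using assms by (simp add: udist_def t_def field_simps)
  have "Im w \<le> Im z + t" using abs_Im_le_cmod[of "z - w"] by (simp add: t_def)
  hence "R * (Im z * Im w) \<le> R * (Im z * (Im z + t))" using assms by (intro mult_left_mono) auto
  with 1 have 2: "t * t \<le> R * Im z * Im z + R * Im z * t" by (simp add: power2_eq_square algebra_simps)
  have t: "t > (R + 1) * Im z" using n by (simp add: t_def)
  have t': "t > R * Im z" "t > 0" using t assms by (auto simp: algebra_simps) (smt (verit) mult_nonneg_nonneg)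
  have "(R + 1) * Im z * t \<le> t * t" using t t' by (intro mult_right_mono) auto
  moreover have "R * Im z * Im z < Im z * t" using t' assms(1) by simp
  ultimately show False using 2 by (simp add: algebra_simps)
qed

lemma udist_ball_compact:
  assumes "Im z > 0" "R \<ge> 0"
  obtains K where "compact K" "K \<subseteq> upper_half_plane" "\<And>w. Im w > 0 \<Longrightarrow> udist z w \<le> R \<Longrightarrow> w \<in> K"
proof
  let ?K = "cball z ((R + 1) * Im z) \<inter> {w. Im w \<ge> Im z / (R + 2)}"
  show "compact ?K" by (intro compact_Int_closed compact_cball closed_halfspace_Im_ge)
  have "Im z / (R + 2) > 0" using assms by simp
  thus "?K \<subseteq> upper_half_plane" by (auto simp: upper_half_plane_def intro: less_le_trans)
  fix w assume w: "Im w > 0" "udist z w \<le> R"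
  have 1: "cmod (z - w) \<le> (R + 1) * Im z" using udist_bound assms w by auto
  have "cmod (z - w) \<le> (R + 1) * Im w" using udist_bound[of w z R] assms w udist_commute[of z w]
    by (simp add: norm_minus_commute)
  moreover have "Im z \<le> Im w + cmod (z - w)" using abs_Im_le_cmod[of "z - w"] by simp
  ultimately have "Im z \<le> (R + 2) * Im w" by (simp add: algebra_simps)
  hence "Im z / (R + 2) \<le> Im w" using assms by (simp add: field_simps)
  thus "w \<in> ?K" using 1 by (simp add: dist_norm)
qed

section \<open>Thick and thin parts\<close>

locale fuchsian_group = SL2R_subgroup +
  assumes fk: "fuchsian_first_kind \<Gamma>"
begin

lemma separated_from_one:
  obtains r where "r > 0" "\<And>\<gamma>. \<gamma> \<in> \<Gamma> \<Longrightarrow> norm (\<gamma> - mat 1) < r \<Longrightarrow> \<gamma> = mat 1"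
proof -
  have "mat 1 isolated_in \<Gamma>" using fk one_closed by (simp add: fuchsian_first_kind_def discrete_def)
  then obtain e where "e > 0" "\<forall>y\<in>\<Gamma>. dist (mat 1) y < e \<longrightarrow> y = mat 1"
    by (auto simp: isolated_in_dist_Ex_iff)
  thus ?thesis using that[of e] by (auto simp: dist_norm norm_minus_commute)
qed

text \<open>Left translation spreads the gap r at the identity over the group; on the norm ball of
  radius \<open>R'\<close> a gap \<open>r / R'\<close> remains, and a bounded uniformly discrete set
  is finite.\<close>

lemma finite_bounded: "finite {\<gamma>\<in>\<Gamma>. norm \<gamma> \<le> R}"
proof -
  obtain r where r: "r > 0" "\<And>\<gamma>. \<gamma> \<in> \<Gamma> \<Longrightarrow> norm (\<gamma> - mat 1) < r \<Longrightarrow> \<gamma> = mat 1"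
    by (rule separated_from_one) blast
  define R' where "R' = max R 1"
  have "uniform_discrete {\<gamma>\<in>\<Gamma>. norm \<gamma> \<le> R}"
  proof (rule uniformI1[of "r / R'"])
    show "r / R' > 0" using r by (simp add: R'_def)
    fix \<gamma> \<delta> assume g: "\<gamma> \<in> {\<gamma>\<in>\<Gamma>. norm \<gamma> \<le> R}" "\<delta> \<in> {\<gamma>\<in>\<Gamma>. norm \<gamma> \<le> R}" "dist \<gamma> \<delta> < r / R'"
    have d: "det \<gamma> = 1" using g det_1 by auto
    have "adj2 \<gamma> ** \<delta> - mat 1 = adj2 \<gamma> ** (\<delta> - \<gamma>)"
      using d by (simp add: mat2_diff_ldistrib adj2_mult)
    hence "norm (adj2 \<gamma> ** \<delta> - mat 1) \<le> norm \<gamma> * norm (\<delta> - \<gamma>)"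
      using norm_mat2_mult[of "adj2 \<gamma>" "\<delta> - \<gamma>"] by simp
    also have "\<dots> \<le> R' * dist \<gamma> \<delta>" using g by (intro mult_mono) (auto simp: R'_def dist_norm norm_minus_commute)
    also have "\<dots> < r" using g(3) by (simp add: R'_def field_simps)
    finally have "adj2 \<gamma> ** \<delta> = mat 1" using g by (intro r(2)) (auto intro: mult_closed adj2_closed)
    hence "\<gamma> ** (adj2 \<gamma> ** \<delta>) = \<gamma>" by simp
    thus "\<gamma> = \<delta>" using d by (simp add: matrix_mul_assoc adj2_mult)
  qed
  moreover have "bounded {\<gamma>\<in>\<Gamma>. norm \<gamma> \<le> R}" by (auto simp: bounded_iff)
  ultimately show ?thesis using uniform_discrete_finite_iff by blast
qed

lemma countable_group: "countable \<Gamma>"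
proof -
  have "\<exists>n. norm \<gamma> \<le> real n" for \<gamma> :: "real^2^2" by (rule real_arch_simple)
  hence "\<Gamma> = (\<Union>n::nat. {\<gamma>\<in>\<Gamma>. norm \<gamma> \<le> real n})" by blast
  moreover have "countable (\<Union>n::nat. {\<gamma>\<in>\<Gamma>. norm \<gamma> \<le> real n})"
    by (rule countable_UN) (simp_all add: countable_finite finite_bounded)
  ultimately show ?thesis by simp
qed

text \<open>Proper discontinuity: over a compact set the frames \<open>gmat z\<close> are bounded,
  so a bound in the frame is a bound on the matrix itself. The versions for \<open>disp\<close> and
  \<open>udist\<close> follow from it.\<close>

lemma finite_loc_bounded:
  assumes "compact K" "K \<subseteq> upper_half_plane"
  shows "finite {\<gamma>\<in>\<Gamma>. \<exists>z\<in>K. norm (loc z \<gamma>) \<le> R}"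
proof -
  have pos: "\<And>z. z \<in> K \<Longrightarrow> Im z > 0" using assms by (auto simp: upper_half_plane_def)
  have "continuous_on K (\<lambda>z. Im z + (Re z)\<^sup>2 / Im z + 1 / Im z)"
    using pos by (intro continuous_intros) force+
  hence "bounded ((\<lambda>z. Im z + (Re z)\<^sup>2 / Im z + 1 / Im z) ` K)"
    using assms(1) by (intro compact_imp_bounded compact_continuous_image)
  then obtain M where M: "\<And>z. z \<in> K \<Longrightarrow> Im z + (Re z)\<^sup>2 / Im z + 1 / Im z \<le> M"
    unfolding bounded_iff by (auto simp: abs_le_iff)
  have "{\<gamma>\<in>\<Gamma>. \<exists>z\<in>K. norm (loc z \<gamma>) \<le> R} \<subseteq> {\<gamma>\<in>\<Gamma>. norm \<gamma> \<le> \<bar>M\<bar> * \<bar>R\<bar>}"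
  proof clarify
    fix \<gamma> z assume *: "\<gamma> \<in> \<Gamma>" "z \<in> K" "norm (loc z \<gamma>) \<le> R"
    have "norm \<gamma> \<le> (norm (gmat z))\<^sup>2 * norm (loc z \<gamma>)" using pos[OF *(2)] by (rule norm_unloc)
    also have "\<dots> \<le> \<bar>M\<bar> * \<bar>R\<bar>"
      using M[OF *(2)] *(3) pos[OF *(2)] by (intro mult_mono) (auto simp: norm_gmat_sq)
    finally show "norm \<gamma> \<le> \<bar>M\<bar> * \<bar>R\<bar>" .
  qed
  thus ?thesis using finite_bounded finite_subset by blast
qed

lemma finite_disp_bounded:
  assumes "compact K" "K \<subseteq> upper_half_plane"
  shows "finite {\<gamma>\<in>\<Gamma>. \<exists>z\<in>K. disp \<gamma> z \<le> R}"
proof (rule finite_subset)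
  show "{\<gamma>\<in>\<Gamma>. \<exists>z\<in>K. disp \<gamma> z \<le> R} \<subseteq> {\<gamma>\<in>\<Gamma>. \<exists>z\<in>K. norm (loc z \<gamma>) \<le> sqrt \<bar>R\<bar> + (71/50)}"
  proof clarify
    fix \<gamma> z assume "\<gamma> \<in> \<Gamma>" "z \<in> K" "disp \<gamma> z \<le> R"
    hence "norm (loc z \<gamma>) \<le> sqrt \<bar>R\<bar> + (71/50)"
      using assms by (intro norm_loc_le) (auto simp: det_1 upper_half_plane_def)
    thus "\<exists>z\<in>K. norm (loc z \<gamma>) \<le> sqrt \<bar>R\<bar> + (71/50)" using \<open>z \<in> K\<close> by blast
  qed
qed (rule finite_loc_bounded[OF assms])

lemma finite_udist_bounded:
  assumes "compact K" "K \<subseteq> upper_half_plane"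
  shows "finite {\<gamma>\<in>\<Gamma>. \<exists>z\<in>K. udist z (act \<gamma> z) \<le> R}"
proof (rule finite_subset)
  show "{\<gamma>\<in>\<Gamma>. \<exists>z\<in>K. udist z (act \<gamma> z) \<le> R} \<subseteq> {\<gamma>\<in>\<Gamma>. \<exists>z\<in>K. norm (loc z \<gamma>) \<le> sqrt (\<bar>R\<bar> + 2)}"
  proof clarify
    fix \<gamma> z assume *: "\<gamma> \<in> \<Gamma>" "z \<in> K" "udist z (act \<gamma> z) \<le> R"
    hence "(norm (loc z \<gamma>))\<^sup>2 \<le> \<bar>R\<bar> + 2"
      using assms by (subst norm_loc_sq) (auto simp: det_1 upper_half_plane_def)
    hence "norm (loc z \<gamma>) \<le> sqrt (\<bar>R\<bar> + 2)" by (rule real_le_rsqrt)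
    thus "\<exists>z\<in>K. norm (loc z \<gamma>) \<le> sqrt (\<bar>R\<bar> + 2)" using *(2) by blast
  qed
qed (rule finite_loc_bounded[OF assms])

text \<open>Zassenhaus: an element closest to the identity commutes with every other small element,
  since their commutator would be smaller still.\<close>

lemma small_elements_commute:
  assumes z: "Im z > 0" and "\<gamma> \<in> \<Gamma>" "\<delta> \<in> \<Gamma>" "disp \<gamma> z < 1/100" "disp \<delta> z < 1/100"
  shows "\<gamma> ** \<delta> = \<delta> ** \<gamma>"
proof (cases "\<gamma> = mat 1 \<or> \<delta> = mat 1")
  case False
  define P where "P = {\<gamma>\<in>\<Gamma>. \<gamma> \<noteq> mat 1 \<and> disp \<gamma> z < 1/100}"
  have "P \<subseteq> {\<gamma>\<in>\<Gamma>. \<exists>z\<in>{z}. disp \<gamma> z \<le> 1/100}" by (auto simp: P_def)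
  moreover have "finite {\<gamma>\<in>\<Gamma>. \<exists>z\<in>{z}. disp \<gamma> z \<le> 1/100}"
    using z by (intro finite_disp_bounded) (auto simp: upper_half_plane_def)
  ultimately have fin: "finite P" by (rule finite_subset)
  have gd: "\<gamma> \<in> P" "\<delta> \<in> P" using False assms by (auto simp: P_def)
  hence ne: "P \<noteq> {}" by blast
  define A where "A = arg_min_on (\<lambda>B. disp B z) P"
  note am = arg_min_if_finite[OF fin ne, of "\<lambda>B. disp B z"]
  have A: "A \<in> P" "\<And>B. B \<in> P \<Longrightarrow> disp A z \<le> disp B z"
    using am(1) am(2) unfolding A_def by (blast, meson not_le)
  have comm: "A ** B = B ** A" if B: "B \<in> P" for B
  proof (rule ccontr)
    assume n: "A ** B \<noteq> B ** A"
    have d: "det A = 1" "det B = 1" using A B by (auto simp: P_def det_1)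
    define C where "C = A ** B ** adj2 A ** adj2 B"
    have C: "C \<in> \<Gamma>" "det C = 1" using A B by (auto simp: C_def P_def intro!: mult_closed adj2_closed det_1)
    have C1: "C \<noteq> mat 1" using commute_imp_commutator[OF d] n by (auto simp: C_def)
    let ?a = "loc z A" and ?b = "loc z B"
    have "(norm (?a - mat 1))\<^sup>2 \<le> (1/10)\<^sup>2" "(norm (?b - mat 1))\<^sup>2 \<le> (1/10)\<^sup>2"
      unfolding norm_loc_diff_one[OF d(1) z] norm_loc_diff_one[OF d(2) z]
      using A(1) B by (auto simp: P_def power_divide)
    hence na: "norm (?a - mat 1) \<le> 1/10" "norm (?b - mat 1) \<le> 1/10"
      by (auto elim!: power2_le_imp_le)
    hence na': "norm ?a \<le> (38/25)" "norm ?b \<le> (38/25)"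
      using norm_triangle_sub[of ?a "mat 1"] norm_triangle_sub[of ?b "mat 1"] norm_one_mat2_le by linarith+
    have pos: "norm (?a - mat 1) > 0"
      using norm_loc_diff_one[OF d(1) z] disp_eq_0[OF d(1) z] A(1) by (auto simp: P_def)
    have "loc z C = ?a ** ?b ** adj2 ?a ** adj2 ?b" using z by (simp add: C_def loc_mult loc_adj2)
    hence "norm (loc z C - mat 1) \<le> 2 * norm (?a - mat 1) * norm (?b - mat 1) * norm ?a * norm ?b"
      using norm_commutator_diff_one[of ?a ?b] d z by simp
    \<comment> \<open>\<open>38/25\<close> is \<open>1/10 + 71/50\<close>. The factor
      \<open>2 * (1/10) * (38/25)^2\<close> is below 1/2, so the threshold 1/100 makes the
      commutator strictly smaller than \<open>A\<close>.\<close>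
    also have "\<dots> \<le> 2 * norm (?a - mat 1) * (1/10) * (38/25) * (38/25)"
      using na na' by (intro mult_mono) auto
    also have "\<dots> < norm (?a - mat 1)" using pos by simp
    finally have "(norm (loc z C - mat 1))\<^sup>2 < (norm (?a - mat 1))\<^sup>2" by (intro power_strict_mono) auto
    hence less: "disp C z < disp A z" using norm_loc_diff_one z C d by simp
    moreover have "disp A z < 1/100" using A by (simp add: P_def)
    ultimately have "C \<in> P" using C C1 by (simp add: P_def)
    thus False using A(2)[of C] less by simp
  qed
  have "A \<noteq> - mat 1" using A(1) disp_minus_one[OF z] by (auto simp: P_def)
  moreover have "det A = 1" "A \<noteq> mat 1" using A(1) by (auto simp: P_def det_1)
  ultimately show ?thesis using comm[OF gd(1)] comm[OF gd(2)] commute_trans by blast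
qed auto

text \<open>The element \<open>- mat 1\<close> has displacement 8 everywhere, so its possible
  presence in \<Gamma> does not affect the set for small \<eta>.\<close>

definition thick :: "real \<Rightarrow> complex set" where
  "thick \<eta> = {z \<in> upper_half_plane. \<forall>\<gamma>\<in>\<Gamma>. \<gamma> \<noteq> mat 1 \<longrightarrow> disp \<gamma> z \<ge> \<eta>}"

text \<open>After division by one such element \<open>g0\<close> and localisation at z, the matrices
  have norm at most 6. Thickness makes any two of them differ by at least
  \<open>sqrt \<eta> / 6\<close>, so their number is bounded in terms of \<eta> alone, uniformly in
  z and w.\<close>

lemma thick_multiplicity:
  assumes "\<eta> > 0"
  obtains M where "\<And>z w. z \<in> thick \<eta> \<Longrightarrow> Im w > 0 \<Longrightarrow>
     finite {\<gamma>\<in>\<Gamma>. act \<gamma> w \<in> hbox z} \<and> card {\<gamma>\<in>\<Gamma>. act \<gamma> w \<in> hbox z} \<le> M"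
proof -
  have "sqrt \<eta> / 6 > 0" using assms by simp
  then obtain M where M: "\<And>S :: (real^2^2) set. S \<subseteq> cball 0 6 \<Longrightarrow>
     (\<And>x y. x \<in> S \<Longrightarrow> y \<in> S \<Longrightarrow> x \<noteq> y \<Longrightarrow> dist x y \<ge> sqrt \<eta> / 6) \<Longrightarrow> finite S \<and> card S \<le> M"
    by (rule card_separated_bound[of _ 6]) blast
  show ?thesis
  proof (rule that[of M])
    fix z w assume zt: "z \<in> thick \<eta>" and w: "Im w > 0"
    hence z: "Im z > 0" by (auto simp: thick_def upper_half_plane_def)
    let ?G = "{\<gamma>\<in>\<Gamma>. act \<gamma> w \<in> hbox z}"
    show "finite ?G \<and> card ?G \<le> M"
    proof (cases "?G = {}")
      case True
      show ?thesis unfolding True by simp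
    next
      case False
      then obtain g0 where g0: "g0 \<in> \<Gamma>" "act g0 w \<in> hbox z" by auto
      define f where "f = (\<lambda>\<gamma>. loc z (\<gamma> ** adj2 g0))"
      have inj: "inj_on f ?G"
      proof (rule inj_onI)
        fix x y assume "x \<in> ?G" "y \<in> ?G" "f x = f y"
        hence "gmat z ** f x ** adj2 (gmat z) = gmat z ** f y ** adj2 (gmat z)" by simp
        hence "x ** adj2 g0 = y ** adj2 g0" unfolding f_def by (simp only: unloc[OF z])
        hence "x ** (adj2 g0 ** g0) = y ** (adj2 g0 ** g0)" by (simp only: matrix_mul_assoc)
        thus "x = y" using det_1[OF g0(1)] by (simp add: adj2_mult)
      qed
      have fG: "f ` ?G \<subseteq> cball 0 6"
      proof clarify
        fix x assume x: "x \<in> \<Gamma>" "act x w \<in> hbox z"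
        have "act (x ** adj2 g0) (act g0 w) = act x w"
          using x g0 w by (simp add: act_mult det_1 Im_act_pos act_adj2)
        hence "norm (adj2 (gmat z) ** (x ** adj2 g0) ** gmat z) \<le> 6"
          using x g0 z by (intro norm_between_hbox[where w="act g0 w"]) (auto simp: det_1 det_mult2)
        thus "f x \<in> cball 0 6" by (simp add: f_def loc_def)
      qed
      have "finite (f ` ?G) \<and> card (f ` ?G) \<le> M"
      proof (rule M[OF fG])
        fix u v assume u: "u \<in> f ` ?G" and v: "v \<in> f ` ?G" and uv: "u \<noteq> v"
        then obtain x y where xy: "x \<in> \<Gamma>" "y \<in> \<Gamma>" "u = f x" "v = f y" by auto
        define a b where "a = x ** adj2 g0" and "b = y ** adj2 g0"
        have ab: "a \<in> \<Gamma>" "b \<in> \<Gamma>" "u = loc z a" "v = loc z b"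
          using xy g0 by (auto simp: a_def b_def f_def intro: mult_closed adj2_closed)
        have d: "det a = 1" "det b = 1" using ab det_1 by auto
        have "adj2 a ** b \<noteq> mat 1"
        proof
          assume "adj2 a ** b = mat 1"
          hence "a ** (adj2 a ** b) = a" by simp
          hence "a = b" using d by (simp add: matrix_mul_assoc adj2_mult)
          thus False using uv ab by simp
        qed
        hence "disp (adj2 a ** b) z \<ge> \<eta>" using zt ab by (auto simp: thick_def intro: mult_closed adj2_closed)
        hence "(norm (loc z (adj2 a ** b) - mat 1))\<^sup>2 \<ge> \<eta>"
          using d z by (subst norm_loc_diff_one) (auto simp: det_mult2)
        hence "sqrt \<eta> \<le> norm (loc z (adj2 a ** b) - mat 1)" by (simp add: real_le_lsqrt)
        also have "loc z (adj2 a ** b) - mat 1 = adj2 u ** (v - u)"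
        proof -
          have "loc z (adj2 a ** b) = adj2 u ** v" using z ab by (simp add: loc_mult loc_adj2)
          moreover have "adj2 u ** u = mat 1" using d z ab by (intro adj2_mult) simp
          ultimately show ?thesis by (simp add: mat2_diff_ldistrib)
        qed
        also have "norm \<dots> \<le> norm u * norm (v - u)" using norm_mat2_mult[of "adj2 u"] by simp
        also have "\<dots> \<le> 6 * norm (v - u)" using u fG by (intro mult_right_mono) auto
        finally show "dist u v \<ge> sqrt \<eta> / 6" by (simp add: dist_norm norm_minus_commute)
      qed
      thus ?thesis using inj by (simp add: card_image finite_image_iff)
    qed
  qed
qed

end

section \<open>Parabolic fixed points and discriminants of the fixed point form\<close>

definition translation :: "int \<Rightarrow> real^2^2" where
  "translation l = vector [vector [1, of_int l], vector [0, 1]]"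

lemma translation_nth [simp]:
  "translation l $1$1 = 1" "translation l $1$2 = of_int l" "translation l $2$1 = 0" "translation l $2$2 = 1"
  by (simp_all add: translation_def)

lemma det_translation [simp]: "det (translation l) = 1"
  by (simp add: det_2)

lemma act_translation [simp]: "act (translation l) z = z + of_int l"
  by (simp add: act_eq auto_factor_def)

lemma parabolic_fixed_point_exists:
  assumes "parabolic A"
  shows "\<exists>c. act_proj A c = c"
proof (cases "A$2$1 = 0")
  case False
  \<comment> \<open>The double root of \<open>fixform A\<close>, whose discriminant vanishes for a
    parabolic matrix.\<close>
  define x where "x = (A$1$1 - A$2$2) / (2 * A$2$1)"
  have tr: "A$1$1 + A$2$2 \<noteq> 0" "(A$1$1 + A$2$2)\<^sup>2 = 4" and d: "A$1$1 * A$2$2 - A$1$2 * A$2$1 = 1"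
    using assms by (auto simp: parabolic_def trace2 det_2 abs_square_eq_1 power2_eq_square) 
      (metis abs_mult_self_eq mult_2 numeral_Bit0 numeral_times_numeral semiring_norm(11))
  have e: "A$2$1 * x + A$2$2 = (A$1$1 + A$2$2) / 2" using False by (simp add: x_def field_simps)
  have n: "A$1$1 * x + A$1$2 = x * (A$2$1 * x + A$2$2)"
    using False tr(2) d by (simp add: x_def field_simps power2_eq_square) algebra
  have nz: "A$2$1 * x + A$2$2 \<noteq> 0" using e tr by simp
  hence "(A$1$1 * x + A$1$2) / (A$2$1 * x + A$2$2) = x"
    unfolding n by (rule nonzero_mult_div_cancel_right)
  thus ?thesis using nz by (intro exI[of _ "Fin x"]) simp
qed (auto intro!: exI[of _ Infty])

text \<open>The form has discriminant zero and is not identically zero: either it is a nonzero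
  constant, leaving only \<open>Infty\<close>, or it has one double root.\<close>

lemma parabolic_fixed_point_unique:
  assumes "parabolic A" "act_proj A c = c" "act_proj A c' = c'"
  shows "c = c'"
proof -
  have d: "A$1$1 * A$2$2 - A$1$2 * A$2$1 = 1" and ns: "A \<noteq> mat 1" "A \<noteq> - mat 1" "det A = 1"
    and "\<bar>trace A\<bar> = 2"
    using assms(1) by (auto simp: parabolic_def det_2)
  hence tr: "(A$1$1 + A$2$2)\<^sup>2 = 2\<^sup>2" by (metis power2_abs trace2)
  have root: "A$2$1 * x\<^sup>2 + (A$2$2 - A$1$1) * x = A$1$2" if "act_proj A (Fin x) = Fin x" for x
    using that by (simp add: field_simps power2_eq_square split: if_splits)
  show ?thesis
  proof (cases "A$2$1 = 0")
    case True
    hence "A$1$1 * A$2$2 = 1" using d by simp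
    hence eq: "A$1$1 = A$2$2" using tr by (simp add: power2_eq_square algebra_simps) algebra
    have "c = Infty" if "act_proj A c = c" for c
    proof (cases c)
      case (Fin x)
      hence "A$1$2 = 0" using root[of x] that True eq by simp
      thus ?thesis using scalar_cases[of A] True eq ns by simp
    qed
    from this[OF assms(2)] this[OF assms(3)] show ?thesis by simp
  next
    case False
    have "c = Fin ((A$1$1 - A$2$2) / (2 * A$2$1))" if "act_proj A c = c" for c
    proof (cases c)
      case (Fin x)
      have "(2 * A$2$1 * x + (A$2$2 - A$1$1))\<^sup>2
          = 4 * A$2$1 * (A$2$1 * x\<^sup>2 + (A$2$2 - A$1$1) * x) + (A$2$2 - A$1$1)\<^sup>2"
        by (simp add: power2_eq_square algebra_simps)
      also have "A$2$1 * x\<^sup>2 + (A$2$2 - A$1$1) * x = A$1$2" using that unfolding Fin by (rule root)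
      also have "4 * A$2$1 * A$1$2 + (A$2$2 - A$1$1)\<^sup>2 = (A$1$1 + A$2$2)\<^sup>2 - 4"
        using d by (simp add: power2_eq_square algebra_simps)
      finally have "(2 * A$2$1 * x + (A$2$2 - A$1$1))\<^sup>2 = (A$1$1 + A$2$2)\<^sup>2 - 4" .
      hence "2 * A$2$1 * x + (A$2$2 - A$1$1) = 0" using tr by simp
      thus ?thesis using Fin False by (simp add: field_simps)
    qed (use that False in simp)
    from this[OF assms(2)] this[OF assms(3)] show ?thesis by simp
  qed
qed

lemma disp_fixform:
  assumes "det A = 1" "Im z > 0"
  shows "disp A z = (cmod (fixform A z))\<^sup>2 / (Im z)\<^sup>2 + 4 - 2 * trace A"
  by (simp add: disp_def udist_act_fixform assms)

lemma continuous_on_disp: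
  assumes "det A = 1"
  shows "continuous_on upper_half_plane (disp A)"
proof -
  have "continuous_on upper_half_plane (\<lambda>z. (cmod (fixform A z))\<^sup>2 / (Im z)\<^sup>2 + 4 - 2 * trace A)"
    unfolding fixform_def by (intro continuous_intros) (auto simp: upper_half_plane_def)
  thus ?thesis by (rule continuous_on_eq) (simp add: disp_fixform assms upper_half_plane_def)
qed

lemma open_upper_half_plane: "open upper_half_plane"
  unfolding upper_half_plane_def by (rule open_halfspace_Im_gt)

lemma convex_upper_half_plane: "convex upper_half_plane"
  unfolding upper_half_plane_def by (rule convex_halfspace_Im_gt)

lemma open_disp_less:
  assumes "det A = 1"
  shows "open {z \<in> upper_half_plane. disp A z < e}" "open {z \<in> upper_half_plane. disp A z > e}"
proof -
  have "open (upper_half_plane \<inter> disp A -` {..<e})" "open (upper_half_plane \<inter> disp A -` {e<..})"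
    using continuous_open_preimage[OF continuous_on_disp[OF assms] open_upper_half_plane] by auto
  thus "open {z \<in> upper_half_plane. disp A z < e}" "open {z \<in> upper_half_plane. disp A z > e}"
    by (simp_all add: vimage_def Int_def)
qed

lemma trace_sq_det: "det A = 1 \<Longrightarrow> (trace (A::real^2^2))\<^sup>2 - 4 = (A$2$2 - A$1$1)\<^sup>2 + 4 * A$1$2 * A$2$1"
  by (simp add: trace2 det_2 power2_eq_square algebra_simps)

text \<open>\<open>trace^2 - 4\<close> is the discriminant of \<open>fixform\<close>, hence
  quadratic in the traceless part.\<close>

lemma proportional_trace:
  assumes "det A = 1" "det B = 1" "proportional \<beta> A B"
  shows "(trace B)\<^sup>2 - 4 = \<beta>\<^sup>2 * ((trace A)\<^sup>2 - 4)"
proof -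
  have e: "B$2$1 = \<beta> * A$2$1" "B$2$2 - B$1$1 = \<beta> * (A$2$2 - A$1$1)" "B$1$2 = \<beta> * A$1$2"
    using assms(3) by (auto simp: proportional_def)
  show ?thesis unfolding trace_sq_det[OF assms(1)] trace_sq_det[OF assms(2)] e
    by (simp add: power2_eq_square algebra_simps)
qed

lemma proportional_fixform:
  assumes "proportional \<beta> A B"
  shows "fixform B z = of_real \<beta> * fixform A z"
proof -
  have "fixform B z = of_real (\<beta> * A$2$1) * z\<^sup>2 + of_real (\<beta> * (A$2$2 - A$1$1)) * z - of_real (\<beta> * A$1$2)"
    using assms unfolding fixform_def proportional_def by simp
  thus ?thesis by (simp add: fixform_def algebra_simps)
qed

text \<open>For real \<open>p, q, r\<close> and \<open>z = x + \<i> y\<close>,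
  \<open>|p z^2 + q z + r|^2\<close> equals
  \<open>(q^2 - 4 p r) y^2 + (p |z|^2 + q x + r)^2\<close>. In the hyperbolic case the second square
  vanishes exactly on the axis joining the fixed points.\<close>

lemma fixform_disc_bound:
  assumes "det A = 1" "Im z > 0"
  shows "(cmod (fixform A z))\<^sup>2 / (Im z)\<^sup>2 \<ge> (trace A)\<^sup>2 - 4"
proof -
  define x y where "x = Re z" and "y = Im z"
  define p q r where "p = A$2$1" and "q = A$2$2 - A$1$1" and "r = - (A$1$2)"
  have z: "z = Complex x y" by (simp add: x_def y_def)
  have re: "Re (fixform A z) = p * (x\<^sup>2 - y\<^sup>2) + q * x + r" and im: "Im (fixform A z) = p * (2 * x * y) + q * y"
    by (simp_all add: fixform_def p_def q_def r_def x_def y_def power2_eq_square algebra_simps)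
  have "(cmod (fixform A z))\<^sup>2 = (q\<^sup>2 - 4 * p * r) * y\<^sup>2 + (p * (x\<^sup>2 + y\<^sup>2) + q * x + r)\<^sup>2"
    unfolding cmod_power2 re im by (simp add: power2_eq_square algebra_simps)
  moreover have "(trace A)\<^sup>2 - 4 = q\<^sup>2 - 4 * p * r"
    unfolding trace_sq_det[OF assms(1)] by (simp add: p_def q_def r_def)
  ultimately have "((trace A)\<^sup>2 - 4) * y\<^sup>2 \<le> (cmod (fixform A z))\<^sup>2" by simp
  thus ?thesis using assms(2) by (simp add: y_def field_simps)
qed

text \<open>Below trace 2 the term \<open>4 - 2 * trace A\<close> suffices; above it the
  discriminant bound leaves \<open>trace A * (trace A - 2)\<close>.\<close>

lemma disp_ge_trace:
  assumes "det A = 1" "Im z > 0" "trace A > 0"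
  shows "disp A z \<ge> 2 * \<bar>trace A - 2\<bar>"
proof (cases "trace A < 2")
  case True
  thus ?thesis using udist_nonneg[of z "act A z"] assms by (simp add: disp_def Im_act_pos)
next
  case False
  have "disp A z \<ge> (trace A)\<^sup>2 - 4 + 4 - 2 * trace A"
    unfolding disp_fixform[OF assms(1,2)] using fixform_disc_bound[OF assms(1,2)] by simp
  also have "(trace A)\<^sup>2 - 4 + 4 - 2 * trace A = trace A * (trace A - 2)"
    by (simp add: power2_eq_square algebra_simps)
  also have "trace A * (trace A - 2) \<ge> 2 * (trace A - 2)" using False by (intro mult_right_mono) auto
  finally show ?thesis using False by simp
qed

lemma finite_positive_lower_bound:
  fixes f :: "'a \<Rightarrow> real"
  assumes "finite S" "\<And>x. x \<in> S \<Longrightarrow> f x > 0"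
  shows "\<exists>m>0. \<forall>x\<in>S. f x \<ge> m"
proof (intro exI[of _ "Min (insert 1 (f ` S))"] conjI ballI)
  show "Min (insert 1 (f ` S)) > 0" using assms by (subst Min_gr_iff) auto
qed (use assms in auto)

section \<open>The thin part: elements commuting with a given one\<close>

context fuchsian_group
begin

text \<open>In coordinates, the elements commuting with a non-scalar \<open>\<gamma>\<close> have the quadratic form
  \<open>\<beta> \<cdot> fixform \<gamma>\<close>; discreteness bounds \<open>\<beta>\<close> away from zero.\<close>

lemma commuting_factor_bound:
  assumes g: "\<gamma> \<in> \<Gamma>" "\<gamma> \<noteq> mat 1" "\<gamma> \<noteq> - mat 1"
  obtains \<beta>0 where "\<beta>0 > 0"
    "\<And>B. B \<in> \<Gamma> \<Longrightarrow> B \<noteq> mat 1 \<Longrightarrow> trace B > 0 \<Longrightarrow> \<gamma> ** B = B ** \<gamma> \<Longrightarrow> \<exists>\<beta>. proportional \<beta> \<gamma> B \<and> \<bar>\<beta>\<bar> \<ge> \<beta>0"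
proof -
  \<comment> \<open>The l1-norm of the traceless part: it scales by \<open>|\<beta>|\<close> and
    vanishes only for scalar matrices.\<close>
  define nq where "nq = (\<lambda>B::real^2^2. \<bar>B$2$1\<bar> + \<bar>B$2$2 - B$1$1\<bar> + \<bar>B$1$2\<bar>)"
  have dg: "det \<gamma> = 1" using g det_1 by blast
  \<comment> \<open>Chosen so that \<open>|\<beta>| \<le> 1\<close> and \<open>trace B > 0\<close>
    imply \<open>disp B \<i> \<le> C\<close>; such a \<open>B\<close> then belongs to the finite set
    \<open>S\<close>.\<close>
  define C where "C = (cmod (fixform \<gamma> \<i>))\<^sup>2 + 4"
  define S where "S = {B\<in>\<Gamma>. disp B \<i> \<le> C \<and> B \<noteq> mat 1 \<and> trace B > 0}"
  have nq_pos: "nq B > 0" if "B \<in> \<Gamma>" "B \<noteq> mat 1" "trace B > 0" for B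
  proof (rule ccontr)
    assume "\<not> nq B > 0"
    hence "B$2$1 = 0" "B$2$2 = B$1$1" "B$1$2 = 0" unfolding nq_def by linarith+
    hence "B = - mat 1" using scalar_cases[of B] that det_1 by auto
    thus False using that(3) by (simp add: trace2)
  qed
  have "finite {B\<in>\<Gamma>. \<exists>z\<in>{\<i>}. disp B z \<le> C}"
    by (intro finite_disp_bounded) (auto simp: upper_half_plane_def)
  hence "finite S" by (rule finite_subset[rotated]) (auto simp: S_def)
  moreover have "\<And>B. B \<in> S \<Longrightarrow> nq B > 0" using nq_pos by (auto simp: S_def)
  ultimately obtain m where m: "m > 0" "\<And>B. B \<in> S \<Longrightarrow> nq B \<ge> m"
    using finite_positive_lower_bound[of S nq] by blast
  have nqg: "nq \<gamma> > 0"
  proof (rule ccontr)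
    assume "\<not> nq \<gamma> > 0"
    hence "\<gamma>$2$1 = 0" "\<gamma>$2$2 = \<gamma>$1$1" "\<gamma>$1$2 = 0" unfolding nq_def by linarith+
    thus False using scalar_cases[of \<gamma>] g dg by auto
  qed
  show ?thesis
  proof (rule that[of "min 1 (m / nq \<gamma>)"])
    show "min 1 (m / nq \<gamma>) > 0" using m nqg by simp
    fix B assume B: "B \<in> \<Gamma>" "B \<noteq> mat 1" "trace B > 0" "\<gamma> ** B = B ** \<gamma>"
    have dB: "det B = 1" using B det_1 by blast
    obtain \<beta> where \<beta>: "proportional \<beta> \<gamma> B" using commute_proportional[OF dg g(2,3) B(4)] .
    have "\<bar>\<beta>\<bar> \<ge> min 1 (m / nq \<gamma>)"
    proof (rule ccontr)
      assume n: "\<not> ?thesis"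
      hence b1: "\<bar>\<beta>\<bar> \<le> 1" "\<bar>\<beta>\<bar> < m / nq \<gamma>" by auto
      have "\<beta>\<^sup>2 \<le> 1" using b1(1) by (simp add: abs_square_le_1)
      hence "\<beta>\<^sup>2 * (cmod (fixform \<gamma> \<i>))\<^sup>2 \<le> 1 * (cmod (fixform \<gamma> \<i>))\<^sup>2" by (intro mult_right_mono) auto
      hence "disp B \<i> \<le> C" using B(3) dB
        by (simp add: disp_fixform proportional_fixform[OF \<beta>] norm_mult power_mult_distrib C_def)
      hence "nq B \<ge> m" using B by (intro m) (auto simp: S_def)
      moreover have e: "B$2$1 = \<beta> * \<gamma>$2$1" "B$2$2 - B$1$1 = \<beta> * (\<gamma>$2$2 - \<gamma>$1$1)" "B$1$2 = \<beta> * \<gamma>$1$2"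
        using \<beta> by (auto simp: proportional_def)
      have "nq B = \<bar>\<beta>\<bar> * nq \<gamma>" unfolding nq_def e by (simp add: abs_mult distrib_left)
      ultimately show False using b1(2) nqg by (simp add: field_simps)
    qed
    thus "\<exists>\<beta>. proportional \<beta> \<gamma> B \<and> \<bar>\<beta>\<bar> \<ge> min 1 (m / nq \<gamma>)" using \<beta> by blast
  qed
qed

text \<open>The point z is taken low above a real x that \<gamma> does not fix: there
  \<open>fixform \<gamma> z / Im z\<close> blows up as the height tends to 0, and the forms of
  commuting elements are multiples of it by factors bounded away from zero. The lemma serves to show
  that a union of thin sets is not the whole half plane.\<close>

lemma commuting_not_small_everywhere:
  assumes g: "\<gamma> \<in> \<Gamma>" "\<gamma> \<noteq> mat 1" "\<gamma> \<noteq> - mat 1"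
  obtains z where "Im z > 0" "\<And>B. B \<in> \<Gamma> \<Longrightarrow> B \<noteq> mat 1 \<Longrightarrow> \<gamma> ** B = B ** \<gamma> \<Longrightarrow> disp B z \<ge> 1"
proof -
  have dg: "det \<gamma> = 1" using g det_1 by blast
  obtain \<beta>0 where b0: "\<beta>0 > 0"
    "\<And>B. B \<in> \<Gamma> \<Longrightarrow> B \<noteq> mat 1 \<Longrightarrow> trace B > 0 \<Longrightarrow> \<gamma> ** B = B ** \<gamma> \<Longrightarrow> \<exists>\<beta>. proportional \<beta> \<gamma> B \<and> \<bar>\<beta>\<bar> \<ge> \<beta>0"
    using commuting_factor_bound[OF g] by blast
  define q where "q = (\<lambda>x::real. \<gamma>$2$1 * x\<^sup>2 + (\<gamma>$2$2 - \<gamma>$1$1) * x - \<gamma>$1$2)"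
  obtain x where x: "q x \<noteq> 0"
  proof (rule ccontr)
    assume "\<not> thesis"
    \<comment> \<open>A quadratic polynomial with three zeros vanishes identically, which would make
      \<gamma> scalar.\<close>
    hence "q 0 = 0" "q 1 = 0" "q (-1) = 0" using that by auto
    hence "\<gamma>$1$2 = 0" "\<gamma>$2$1 = 0" "\<gamma>$2$2 = \<gamma>$1$1" by (auto simp: q_def)
    thus False using scalar_cases[of \<gamma>] g dg by auto
  qed
  \<comment> \<open>The first summand absorbs \<open>4 - 2 * trace B\<close>, which is at least
    \<open>- \<beta>^2 * |(trace \<gamma>)^2 - 4|\<close>; the second leaves
    \<open>\<beta>^2 / \<beta>0^2 \<ge> 1\<close>.\<close>
  define K where "K = \<bar>(trace \<gamma>)\<^sup>2 - 4\<bar> + 1 / \<beta>0\<^sup>2"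
  define \<phi> where "\<phi> = (\<lambda>y::real. (q x - \<gamma>$2$1 * y\<^sup>2)\<^sup>2 - K * y\<^sup>2)"
  have "isCont \<phi> 0" unfolding \<phi>_def by (intro continuous_intros)
  hence "(\<phi> \<longlongrightarrow> \<phi> 0) (at 0)" by (simp add: isCont_def)
  moreover have "\<phi> 0 > 0" using x by (simp add: \<phi>_def)
  ultimately have "\<forall>\<^sub>F y in at 0. \<phi> y > 0" by (rule order_tendstoD)
  then obtain d where d: "d > 0" "\<And>y. y \<noteq> 0 \<Longrightarrow> dist y 0 < d \<Longrightarrow> \<phi> y > 0"
    unfolding eventually_at by auto
  define y where "y = d / 2"
  have y: "y > 0" "\<phi> y > 0" using d by (auto simp: y_def)
  define z where "z = Complex x y"
  have "Re (fixform \<gamma> z) = q x - \<gamma>$2$1 * y\<^sup>2"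
    by (simp add: fixform_def z_def q_def power2_eq_square algebra_simps)
  hence "(q x - \<gamma>$2$1 * y\<^sup>2)\<^sup>2 \<le> (cmod (fixform \<gamma> z))\<^sup>2"
    using abs_Re_le_cmod[of "fixform \<gamma> z"] by (simp add: power2_le_iff_abs_le)
  hence "K * y\<^sup>2 < (cmod (fixform \<gamma> z))\<^sup>2" using y(2) by (simp add: \<phi>_def)
  hence K: "K < (cmod (fixform \<gamma> z))\<^sup>2 / (Im z)\<^sup>2" using y by (simp add: z_def field_simps)
  show ?thesis
  proof (rule that[of z])
    show z: "Im z > 0" using y by (simp add: z_def)
    fix B assume B: "B \<in> \<Gamma>" "B \<noteq> mat 1" "\<gamma> ** B = B ** \<gamma>"
    have dB: "det B = 1" using B det_1 by blast
    show "disp B z \<ge> 1"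
    proof (cases "trace B > 0")
      case True
      then obtain \<beta> where \<beta>: "proportional \<beta> \<gamma> B" "\<bar>\<beta>\<bar> \<ge> \<beta>0" using b0 B by blast
      define t where "t = trace B"
      have "t\<^sup>2 - 4 = (t - 2) * (t + 2)" by (simp add: power2_eq_square algebra_simps)
      hence "\<bar>t\<^sup>2 - 4\<bar> = \<bar>t - 2\<bar> * (t + 2)" using True by (simp add: abs_mult t_def)
      moreover have "\<bar>t - 2\<bar> * 2 \<le> \<bar>t - 2\<bar> * (t + 2)" using True by (intro mult_left_mono) (auto simp: t_def)
      moreover have "\<bar>t\<^sup>2 - 4\<bar> = \<beta>\<^sup>2 * \<bar>(trace \<gamma>)\<^sup>2 - 4\<bar>"
        unfolding t_def proportional_trace[OF dg dB \<beta>(1)] by (simp add: abs_mult)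
      ultimately have "\<bar>t - 2\<bar> * 2 \<le> \<beta>\<^sup>2 * \<bar>(trace \<gamma>)\<^sup>2 - 4\<bar>" by metis
      moreover have "u * 2 \<le> P \<Longrightarrow> t - 2 \<le> u \<Longrightarrow> - P \<le> 4 - 2 * t" for u P :: real by linarith
      ultimately have 1: "4 - 2 * t \<ge> - (\<beta>\<^sup>2 * \<bar>(trace \<gamma>)\<^sup>2 - 4\<bar>)"
        using abs_ge_self[of "t - 2"] by blast
      have "disp B z = \<beta>\<^sup>2 * ((cmod (fixform \<gamma> z))\<^sup>2 / (Im z)\<^sup>2) + (4 - 2 * t)"
        using z dB by (simp add: disp_fixform proportional_fixform[OF \<beta>(1)] norm_mult power_mult_distrib t_def)
      also have "\<dots> \<ge> \<beta>\<^sup>2 * ((cmod (fixform \<gamma> z))\<^sup>2 / (Im z)\<^sup>2) - \<beta>\<^sup>2 * \<bar>(trace \<gamma>)\<^sup>2 - 4\<bar>"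
        using 1 by simp
      also have "\<beta>\<^sup>2 * ((cmod (fixform \<gamma> z))\<^sup>2 / (Im z)\<^sup>2) - \<beta>\<^sup>2 * \<bar>(trace \<gamma>)\<^sup>2 - 4\<bar>
          = \<beta>\<^sup>2 * ((cmod (fixform \<gamma> z))\<^sup>2 / (Im z)\<^sup>2 - \<bar>(trace \<gamma>)\<^sup>2 - 4\<bar>)" by (simp add: algebra_simps)
      also have "\<dots> \<ge> \<beta>\<^sup>2 * (1 / \<beta>0\<^sup>2)" using K by (intro mult_left_mono) (auto simp: K_def)
      also have "\<beta>\<^sup>2 \<ge> \<beta>0\<^sup>2" using \<beta>(2) b0(1) by (metis abs_le_square_iff abs_of_pos)
      hence "\<beta>\<^sup>2 * (1 / \<beta>0\<^sup>2) \<ge> 1" using b0(1) by (simp add: field_simps)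
      finally show ?thesis by simp
    qed (use disp_neg_trace[OF z dB] in auto)
  qed
qed

text \<open>The discriminant of a commuting element is \<open>\<beta>^2\<close> times the nonzero
  discriminant of \<gamma>, so its trace stays away from 2, and the displacement dominates
  \<open>2 * |trace B - 2|\<close> when the trace is positive.\<close>

lemma commuting_nonparabolic_lower_bound:
  assumes g: "\<gamma> \<in> \<Gamma>" "\<gamma> \<noteq> mat 1" "\<gamma> \<noteq> - mat 1" "\<bar>trace \<gamma>\<bar> \<noteq> 2"
  obtains \<eta> where "\<eta> > 0"
    "\<And>B z. B \<in> \<Gamma> \<Longrightarrow> B \<noteq> mat 1 \<Longrightarrow> \<gamma> ** B = B ** \<gamma> \<Longrightarrow> Im z > 0 \<Longrightarrow> disp B z \<ge> \<eta>"
proof -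
  have dg: "det \<gamma> = 1" using g det_1 by blast
  obtain \<beta>0 where b0: "\<beta>0 > 0"
    "\<And>B. B \<in> \<Gamma> \<Longrightarrow> B \<noteq> mat 1 \<Longrightarrow> trace B > 0 \<Longrightarrow> \<gamma> ** B = B ** \<gamma> \<Longrightarrow> \<exists>\<beta>. proportional \<beta> \<gamma> B \<and> \<bar>\<beta>\<bar> \<ge> \<beta>0"
    using commuting_factor_bound[OF g(1-3)] by blast
  define d where "d = \<beta>0\<^sup>2 * \<bar>(trace \<gamma>)\<^sup>2 - 4\<bar>"
  have "(trace \<gamma>)\<^sup>2 \<noteq> 2\<^sup>2" using g(4) unfolding power2_eq_iff by auto
  hence d: "d > 0" using b0 by (simp add: d_def)
  show ?thesis
  \<comment> \<open>From \<open>d \<le> |t - 2| * (t + 2)\<close>: for \<open>t < 4\<close> the last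
    factor is below 6, so \<open>2 * |t - 2| \<ge> d / 3\<close>. For \<open>t \<ge> 4\<close>, and
    for trace at most 0, the displacement is at least 4.\<close>
  proof (rule that[of "min 4 (d / 3)"])
    show "min 4 (d / 3) > 0" using d by simp
    fix B z assume B: "B \<in> \<Gamma>" "B \<noteq> mat 1" "\<gamma> ** B = B ** \<gamma>" and z: "Im z > 0"
    have dB: "det B = 1" using B det_1 by blast
    show "disp B z \<ge> min 4 (d / 3)"
    proof (cases "trace B > 0")
      case True
      then obtain \<beta> where \<beta>: "proportional \<beta> \<gamma> B" "\<bar>\<beta>\<bar> \<ge> \<beta>0" using b0 B by blast
      define t where "t = trace B"
      have 1: "disp B z \<ge> 2 * \<bar>t - 2\<bar>" using disp_ge_trace[OF dB z True] by (simp add: t_def)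
      have "\<beta>\<^sup>2 \<ge> \<beta>0\<^sup>2" using \<beta>(2) b0(1) by (metis abs_le_square_iff abs_of_pos)
      hence "d \<le> \<beta>\<^sup>2 * \<bar>(trace \<gamma>)\<^sup>2 - 4\<bar>" unfolding d_def by (intro mult_right_mono) auto
      also have "\<dots> = \<bar>t\<^sup>2 - 4\<bar>" 
        unfolding t_def proportional_trace[OF dg dB \<beta>(1)] by (simp add: abs_mult)
      also have "t\<^sup>2 - 4 = (t - 2) * (t + 2)" by (simp add: power2_eq_square algebra_simps)
      also have "\<bar>(t - 2) * (t + 2)\<bar> = \<bar>t - 2\<bar> * (t + 2)" using True by (simp add: abs_mult t_def)
      finally have 2: "d \<le> \<bar>t - 2\<bar> * (t + 2)" .
      show ?thesis
      proof (cases "t \<ge> 4")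
        case False
        hence "\<bar>t - 2\<bar> * (t + 2) \<le> \<bar>t - 2\<bar> * 6" by (intro mult_left_mono) auto
        thus ?thesis using 1 2 by simp
      qed (use 1 in auto)
    qed (use disp_neg_trace[OF z dB] in auto)
  qed
qed

text \<open>Links every thin point to the thick part. The set \<open>V\<close> where some element
  commuting with \<gamma> has displacement below 1/400 is open and not everything, so it has a
  boundary point w. Local finiteness yields a commuting \<open>B\<close> with displacement at most
  1/400 there. An element below 1/400 at w would commute with \<open>B\<close>, both being below
  1/100, hence with \<gamma>, and would place w in \<open>V\<close>; so w is thick.\<close>

lemma thin_component_boundary:
  assumes g: "\<gamma> \<in> \<Gamma>" "\<gamma> \<noteq> mat 1" and z: "Im z > 0" and small: "disp \<gamma> z < 1/400"
  obtains w B where "w \<in> thick (1/400)" "B \<in> \<Gamma>" "B \<noteq> mat 1" "\<gamma> ** B = B ** \<gamma>" "disp B w \<le> 1/400"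
proof -
  have gm: "\<gamma> \<noteq> - mat 1" using small disp_minus_one[OF z] by auto
  define Cm where "Cm = {B\<in>\<Gamma>. B \<noteq> mat 1 \<and> \<gamma> ** B = B ** \<gamma>}"
  define V where "V = (\<Union>B\<in>Cm. {z \<in> upper_half_plane. disp B z < 1/400})"
  have detC: "det B = 1" if "B \<in> Cm" for B using that det_1 by (auto simp: Cm_def)
  have oV: "open V" unfolding V_def using detC by (intro open_UN ballI open_disp_less)
  have "z \<in> V" using g z small by (auto simp: V_def Cm_def upper_half_plane_def)
  moreover obtain z0 where z0: "Im z0 > 0" "\<And>B. B \<in> \<Gamma> \<Longrightarrow> B \<noteq> mat 1 \<Longrightarrow> \<gamma> ** B = B ** \<gamma> \<Longrightarrow> disp B z0 \<ge> 1"
    using commuting_not_small_everywhere[OF g gm] by blast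
  have "z0 \<notin> V" using z0 by (fastforce simp: V_def Cm_def)
  moreover have "connected upper_half_plane" using convex_upper_half_plane by (rule convex_connected)
  moreover have "z \<in> upper_half_plane" "z0 \<in> upper_half_plane" using z z0 by (auto simp: upper_half_plane_def)
  ultimately have "upper_half_plane \<inter> frontier V \<noteq> {}" by (intro connected_Int_frontier) auto
  then obtain w where w: "w \<in> upper_half_plane" "w \<in> closure V" "w \<notin> V"
    using oV by (auto simp: frontier_def interior_open)
  have Iw: "Im w > 0" using w by (simp add: upper_half_plane_def)
  have "\<exists>B\<in>Cm. disp B w \<le> 1/400"
  proof (rule ccontr)
    assume n: "\<not> ?thesis"
    let ?K = "cball w (Im w / 2)"
    have K: "?K \<subseteq> upper_half_plane"
    proof
      fix v assume "v \<in> ?K"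
      hence "\<bar>Im w - Im v\<bar> \<le> Im w / 2" using abs_Im_le_cmod[of "w - v"] by (simp add: dist_norm)
      thus "v \<in> upper_half_plane" using Iw unfolding upper_half_plane_def mem_Collect_eq by linarith
    qed
    define Bs where "Bs = {B\<in>\<Gamma>. \<exists>z\<in>?K. disp B z \<le> 1/400} \<inter> Cm"
    have "finite Bs" unfolding Bs_def using finite_disp_bounded[OF compact_cball K] by blast
    define U where "U = ball w (Im w / 2) \<inter> (\<Inter>B\<in>Bs. {z \<in> upper_half_plane. disp B z > 1/400})"
    have "open U" unfolding U_def using \<open>finite Bs\<close> detC
      by (intro open_Int open_ball open_INT ballI open_disp_less) (auto simp: Bs_def)
    moreover have "w \<in> U" using n w Iw by (force simp: U_def Bs_def)
    ultimately have "U \<inter> V \<noteq> {}" using w(2) open_Int_closure_eq_empty[of U V] by blast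
    then obtain v B where v: "v \<in> U" "B \<in> Cm" "disp B v < 1/400" by (auto simp: V_def)
    have "v \<in> ?K" using v(1) by (auto simp: U_def)
    hence "B \<in> Bs" using v by (auto simp: Bs_def Cm_def intro!: bexI[of _ v])
    thus False using v by (auto simp: U_def)
  qed
  then obtain B where B: "B \<in> Cm" "disp B w \<le> 1/400" by blast
  have Bm: "B \<noteq> - mat 1" using B disp_minus_one[OF Iw] by auto
  have "w \<in> thick (1/400)"
    unfolding thick_def
  proof (intro CollectI conjI ballI impI w(1), rule ccontr)
    fix D assume D: "D \<in> \<Gamma>" "D \<noteq> mat 1" "\<not> disp D w \<ge> 1/400"
    have "B ** D = D ** B" using B D by (intro small_elements_commute[OF Iw]) (auto simp: Cm_def)
    moreover have "B ** \<gamma> = \<gamma> ** B" "B \<noteq> mat 1" using B(1) unfolding Cm_def by simp_all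
    ultimately have "\<gamma> ** D = D ** \<gamma>" using commute_trans[OF detC[OF B(1)] _ Bm] by blast
    hence "w \<in> V" using D w by (auto simp: V_def Cm_def)
    thus False using w by simp
  qed
  thus ?thesis using that B by (auto simp: Cm_def)
qed

end

lemma finite_uniform_threshold:
  fixes P :: "'a \<Rightarrow> real \<Rightarrow> bool"
  assumes "finite S" "\<And>x. x \<in> S \<Longrightarrow> \<exists>\<eta>>0. P x \<eta>" "\<And>x \<eta> \<eta>'. P x \<eta> \<Longrightarrow> \<eta>' \<le> \<eta> \<Longrightarrow> P x \<eta>'"
  shows "\<exists>\<eta>>0. \<forall>x\<in>S. P x \<eta>"
  using assms(1,2)
proof (induction S rule: finite_induct)
  case (insert y S)
  then obtain \<eta>1 \<eta>2 where "\<eta>1 > 0" "P y \<eta>1" "\<eta>2 > 0" "\<forall>x\<in>S. P x \<eta>2" by blast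
  hence "min \<eta>1 \<eta>2 > 0" "\<forall>x\<in>insert y S. P x (min \<eta>1 \<eta>2)" using assms(3) by (auto intro: assms(3))
  thus ?case by blast
qed (auto intro: exI[of _ 1])

section \<open>Packing disjoint boxes and cocompactness of the thick part\<close>

context fuchsian_group
begin

definition saturation :: "complex \<Rightarrow> complex set" where
  "saturation z = {w. Im w > 0 \<and> (\<exists>\<gamma>\<in>\<Gamma>. act \<gamma> w \<in> hbox z)}"

lemma saturation_borel [measurable]: "saturation z \<in> sets borel"
proof -
  have "saturation z = upper_half_plane \<inter> (\<Union>\<gamma>\<in>\<Gamma>. act \<gamma> -` hbox z)"
    by (auto simp: saturation_def upper_half_plane_def)
  moreover have "(\<Union>\<gamma>\<in>\<Gamma>. act \<gamma> -` hbox z) \<in> sets borel"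
    using measurable_sets_borel[OF act_measurable hbox_borel]
    by (intro sets.countable_UN'' countable_group)
  ultimately show ?thesis using upper_half_plane_borel by (metis sets.Int)
qed

text \<open>Unfolding: every point of the box is \<open>act \<gamma> v\<close> with
  \<open>v \<in> F\<close>, so the box is covered by the translates of the pieces
  \<open>S \<gamma>\<close> of \<open>F\<close>. Moving each piece back keeps its area, and a point
  of \<open>F\<close> lies in at most \<open>M\<close> of them.\<close>

lemma area_saturation:
  assumes z: "Im z > 0" and M: "\<And>w. Im w > 0 \<Longrightarrow>
     finite {\<gamma>\<in>\<Gamma>. act \<gamma> w \<in> hbox z} \<and> card {\<gamma>\<in>\<Gamma>. act \<gamma> w \<in> hbox z} \<le> M"
    and F: "F \<in> sets borel" "F \<subseteq> upper_half_plane" "upper_half_plane \<subseteq> (\<Union>\<gamma>\<in>\<Gamma>. act \<gamma> ` F)"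
  shows "hyperbolic_area (hbox z) \<le> of_nat M * hyperbolic_area (F \<inter> saturation z)"
proof -
  define h where "h = (\<lambda>w::complex. ennreal (1 / (Im w)\<^sup>2))"
  have [measurable]: "h \<in> borel_measurable borel" unfolding h_def by measurable
  have hA: "hyperbolic_area U = (\<integral>\<^sup>+w. h w * indicator U w \<partial>lborel)" for U
    by (simp add: hyperbolic_area_def h_def)
  note F(1)[measurable]
  define S where "S = (\<lambda>\<gamma>. F \<inter> act \<gamma> -` hbox z)"
  have S[measurable]: "S \<gamma> \<in> sets borel" for \<gamma>
    unfolding S_def using measurable_sets_borel[OF act_measurable hbox_borel] F(1) by (metis sets.Int)
  have SH: "S \<gamma> \<subseteq> upper_half_plane" for \<gamma> using F(2) by (auto simp: S_def)
  have aS[measurable]: "act \<gamma> ` S \<gamma> \<in> sets borel" if "\<gamma> \<in> \<Gamma>" for \<gamma>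
    using act_image_borel[OF _ SH S] that det_1 by blast
  let ?T = "cbox (Complex (Re z - Im z/2) (Im z/2)) (Complex (Re z + Im z/2) (3/2 * Im z))"
  have T: "hbox z \<subseteq> ?T" "compact ?T" "?T \<subseteq> upper_half_plane"
    using z box_subset_cbox unfolding hbox_eq_box
    by (auto simp: mem_box Basis_complex_def upper_half_plane_def)
  have area: "hyperbolic_area (act \<gamma> ` S \<gamma>) = hyperbolic_area (S \<gamma>)" if "\<gamma> \<in> \<Gamma>" for \<gamma>
  proof (rule hyperbolic_area_act[OF _ S SH _ T(2,3)])
    show "det \<gamma> = 1" using that det_1 by blast
    show "act \<gamma> ` S \<gamma> \<subseteq> ?T" using T(1) by (auto simp: S_def)
  qed
  have "hyperbolic_area (hbox z) = (\<integral>\<^sup>+w. h w * indicator (hbox z) w \<partial>lborel)"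
    by (simp add: hyperbolic_area_def h_def)
  also have "\<dots> \<le> (\<integral>\<^sup>+w. (\<integral>\<^sup>+\<gamma>. h w * indicator (act \<gamma> ` S \<gamma>) w \<partial>count_space \<Gamma>) \<partial>lborel)"
  proof (rule nn_integral_mono)
    fix w :: complex
    show "h w * indicator (hbox z) w \<le> (\<integral>\<^sup>+\<gamma>. h w * indicator (act \<gamma> ` S \<gamma>) w \<partial>count_space \<Gamma>)"
    proof (cases "w \<in> hbox z")
      case True
      hence "w \<in> upper_half_plane" using hbox_upper[OF z] by auto
      then obtain \<gamma> v where g: "\<gamma> \<in> \<Gamma>" "v \<in> F" "w = act \<gamma> v" using F(3) by blast
      hence "w \<in> act \<gamma> ` S \<gamma>" using True by (auto simp: S_def)
      hence "h w * indicator (hbox z) w = h w * indicator (act \<gamma> ` S \<gamma>) w" using True by simp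
      also have "\<dots> \<le> (\<integral>\<^sup>+\<gamma>. h w * indicator (act \<gamma> ` S \<gamma>) w \<partial>count_space \<Gamma>)"
        using g(1) by (rule nn_integral_ge_point)
      finally show ?thesis .
    qed simp
  qed
  also have "\<dots> = (\<integral>\<^sup>+\<gamma>. (\<integral>\<^sup>+w. h w * indicator (act \<gamma> ` S \<gamma>) w \<partial>lborel) \<partial>count_space \<Gamma>)"
    by (intro nn_integral_count_space_nn_integral countable_group) measurable
  also have "\<dots> = (\<integral>\<^sup>+\<gamma>. (\<integral>\<^sup>+w. h w * indicator (S \<gamma>) w \<partial>lborel) \<partial>count_space \<Gamma>)"
  proof (rule nn_integral_cong)
    fix \<gamma> assume "\<gamma> \<in> space (count_space \<Gamma>)"
    thus "(\<integral>\<^sup>+w. h w * indicator (act \<gamma> ` S \<gamma>) w \<partial>lborel) = (\<integral>\<^sup>+w. h w * indicator (S \<gamma>) w \<partial>lborel)"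
      using area[of \<gamma>] by (simp add: hyperbolic_area_def h_def)
  qed
  also have "\<dots> = (\<integral>\<^sup>+w. (\<integral>\<^sup>+\<gamma>. h w * indicator (S \<gamma>) w \<partial>count_space \<Gamma>) \<partial>lborel)"
    by (intro nn_integral_count_space_nn_integral[symmetric] countable_group) measurable
  also have "\<dots> \<le> (\<integral>\<^sup>+w. of_nat M * (h w * indicator (F \<inter> saturation z) w) \<partial>lborel)"
  proof (rule nn_integral_mono)
    fix w :: complex
    show "(\<integral>\<^sup>+\<gamma>. h w * indicator (S \<gamma>) w \<partial>count_space \<Gamma>) \<le> of_nat M * (h w * indicator (F \<inter> saturation z) w)"
    proof (cases "w \<in> F \<inter> saturation z")
      case True
      hence w: "w \<in> F" "Im w > 0" by (auto simp: saturation_def)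
      let ?G = "{\<gamma>\<in>\<Gamma>. act \<gamma> w \<in> hbox z}"
      have "(\<integral>\<^sup>+\<gamma>. h w * indicator (S \<gamma>) w \<partial>count_space \<Gamma>) = (\<integral>\<^sup>+\<gamma>. h w * indicator ?G \<gamma> \<partial>count_space \<Gamma>)"
        using w by (intro nn_integral_cong) (auto simp: S_def indicator_def)
      also have "\<dots> = h w * emeasure (count_space \<Gamma>) ?G"
        by (intro nn_integral_cmult_indicator) auto
      also have "emeasure (count_space \<Gamma>) ?G = of_nat (card ?G)"
        using M[OF w(2)] by (intro emeasure_count_space_finite) auto
      also have "h w * of_nat (card ?G) \<le> h w * of_nat M"
        using M[OF w(2)] by (intro mult_left_mono) auto
      finally show ?thesis using True by (simp add: mult.commute)
    next
      case False
      hence "indicator (S \<gamma>) w = (0::ennreal)" if "\<gamma> \<in> \<Gamma>" for \<gamma>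
        using that F(2) by (auto simp: S_def saturation_def upper_half_plane_def indicator_def)
      hence "(\<integral>\<^sup>+\<gamma>. h w * indicator (S \<gamma>) w \<partial>count_space \<Gamma>) = (\<integral>\<^sup>+\<gamma>. 0 \<partial>count_space \<Gamma>)"
        by (intro nn_integral_cong) auto
      thus ?thesis by simp
    qed
  qed
  also have "\<dots> = of_nat M * hyperbolic_area (F \<inter> saturation z)"
    unfolding hA by (intro nn_integral_cmult) measurable
  finally show ?thesis .
qed

text \<open>Disjoint saturations cut disjoint pieces out of \<open>F\<close>. Each has area at least
  \<open>4 / (9 M)\<close>, because its box has area at least 4/9, so the area of \<open>F\<close>
  bounds their number.\<close>

lemma thick_packing_bound:
  assumes "\<eta> > 0"
  obtains N where "\<And>Z. finite Z \<Longrightarrow> Z \<subseteq> thick \<eta> \<Longrightarrow> disjoint_family_on saturation Z \<Longrightarrow> card Z \<le> N"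
proof -
  obtain F where F: "F \<in> sets borel" "F \<subseteq> upper_half_plane" "upper_half_plane \<subseteq> (\<Union>\<gamma>\<in>\<Gamma>. act \<gamma> ` F)"
    "hyperbolic_area F < \<infinity>"
    using fk unfolding fuchsian_first_kind_def fundamental_domain_def by blast
  note F(1)[measurable]
  obtain M where M: "\<And>z w. z \<in> thick \<eta> \<Longrightarrow> Im w > 0 \<Longrightarrow>
     finite {\<gamma>\<in>\<Gamma>. act \<gamma> w \<in> hbox z} \<and> card {\<gamma>\<in>\<Gamma>. act \<gamma> w \<in> hbox z} \<le> M"
    using thick_multiplicity[OF assms] by blast
  define A where "A = enn2real (hyperbolic_area F)"
  have A: "hyperbolic_area F = ennreal A" "A \<ge> 0" using F(4) by (auto simp: A_def)
  define N where "N = nat \<lceil>9/4 * (real M * A)\<rceil>"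
  show ?thesis
  proof (rule that[of N])
    fix Z assume Z: "finite Z" "Z \<subseteq> thick \<eta>" "disjoint_family_on saturation Z"
    define h where "h = (\<lambda>w::complex. ennreal (1 / (Im w)\<^sup>2))"
    have [measurable]: "h \<in> borel_measurable borel" unfolding h_def by measurable
    have hA: "hyperbolic_area U = (\<integral>\<^sup>+w. h w * indicator U w \<partial>lborel)" for U
      by (simp add: hyperbolic_area_def h_def)
    have "of_nat (card Z) * ennreal (4/9) = (\<Sum>z\<in>Z. ennreal (4/9))" by simp
    also have "\<dots> \<le> (\<Sum>z\<in>Z. of_nat M * hyperbolic_area (F \<inter> saturation z))"
    proof (rule sum_mono)
      fix z assume "z \<in> Z"
      hence zt: "z \<in> thick \<eta>" "Im z > 0" using Z by (auto simp: thick_def upper_half_plane_def)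
      have "ennreal (4/9) \<le> hyperbolic_area (hbox z)" by (rule hyperbolic_area_hbox[OF zt(2)])
      also have "\<dots> \<le> of_nat M * hyperbolic_area (F \<inter> saturation z)"
        by (rule area_saturation[OF zt(2) M[OF zt(1)] F(1-3)])
      finally show "ennreal (4/9) \<le> of_nat M * hyperbolic_area (F \<inter> saturation z)" .
    qed
    also have "\<dots> = of_nat M * (\<Sum>z\<in>Z. hyperbolic_area (F \<inter> saturation z))" by (simp add: sum_distrib_left)
    also have "(\<Sum>z\<in>Z. hyperbolic_area (F \<inter> saturation z))
        = (\<integral>\<^sup>+w. (\<Sum>z\<in>Z. h w * indicator (F \<inter> saturation z) w) \<partial>lborel)"
      unfolding hA by (intro nn_integral_sum[symmetric]) measurable
    also have "\<dots> \<le> hyperbolic_area F"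
      unfolding hA
    proof (rule nn_integral_mono)
      fix w :: complex
      have "disjoint_family_on (\<lambda>z. F \<inter> saturation z) Z"
        using Z(3) unfolding disjoint_family_on_def by blast
      hence "(\<Sum>z\<in>Z. indicator (F \<inter> saturation z) w) = (indicator (\<Union>z\<in>Z. F \<inter> saturation z) w :: ennreal)"
        using indicator_UN_disjoint[OF Z(1)] by metis
      also have "\<dots> \<le> indicator F w" by (auto simp: indicator_def)
      finally have "h w * (\<Sum>z\<in>Z. indicator (F \<inter> saturation z) w) \<le> h w * indicator F w"
        by (rule mult_left_mono) simp
      thus "(\<Sum>z\<in>Z. h w * indicator (F \<inter> saturation z) w) \<le> h w * indicator F w"
        by (simp add: sum_distrib_left)
    qed
    finally have "of_nat (card Z) * ennreal (4/9) \<le> of_nat M * hyperbolic_area F"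
      by (simp add: mult_left_mono)
    moreover have "ennreal (real (card Z) * (4/9)) = of_nat (card Z) * ennreal (4/9)"
      by (subst ennreal_mult) (simp_all add: ennreal_of_nat_eq_real_of_nat)
    moreover have "ennreal (real M * A) = of_nat M * hyperbolic_area F"
      using A by (subst ennreal_mult) (simp_all add: ennreal_of_nat_eq_real_of_nat)
    ultimately have "ennreal (real (card Z) * (4/9)) \<le> ennreal (real M * A)" by simp
    hence "real (card Z) * (4/9) \<le> real M * A" using A(2) by (simp add: ennreal_le_iff)
    hence "real (card Z) \<le> 9/4 * (real M * A)" by simp
    thus "card Z \<le> N" unfolding N_def by linarith
  qed
qed

text \<open>The packing bound provides a disjoint family of maximal size. The saturation of any
  other thick point meets one of its members, so some translate of that point lies at bounded
  distance from one of finitely many centres.\<close>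

lemma thick_cocompact:
  assumes "\<eta> > 0"
  obtains K where "compact K" "K \<subseteq> upper_half_plane" "\<And>z. z \<in> thick \<eta> \<Longrightarrow> \<exists>\<gamma>\<in>\<Gamma>. act \<gamma> z \<in> K"
proof -
  define P where "P = (\<lambda>Z. finite Z \<and> Z \<subseteq> thick \<eta> \<and> disjoint_family_on saturation Z)"
  obtain N where N: "\<And>Z. P Z \<Longrightarrow> card Z \<le> N"
    using thick_packing_bound[OF assms] unfolding P_def by metis
  have "P {}" by (simp add: P_def disjoint_family_on_def)
  moreover have "\<forall>Z. P Z \<longrightarrow> card Z < Suc N" using N by (auto simp: less_Suc_eq_le)
  ultimately obtain Z where Z: "P Z" "\<And>Z'. P Z' \<Longrightarrow> card Z' \<le> card Z"
    using ex_has_greatest_nat[of P "{}" card "Suc N"] by blast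
  have pos: "Im z > 0" if "z \<in> thick \<eta>" for z using that by (auto simp: thick_def upper_half_plane_def)
  have "\<forall>z\<in>Z. \<exists>K. compact K \<and> K \<subseteq> upper_half_plane \<and> (\<forall>w. Im w > 0 \<longrightarrow> udist z w \<le> 34 \<longrightarrow> w \<in> K)"
  proof
    fix z assume "z \<in> Z"
    hence "Im z > 0" using Z(1) pos by (auto simp: P_def)
    thus "\<exists>K. compact K \<and> K \<subseteq> upper_half_plane \<and> (\<forall>w. Im w > 0 \<longrightarrow> udist z w \<le> 34 \<longrightarrow> w \<in> K)"
      using udist_ball_compact[of z 34] by (metis zero_le_numeral)
  qed
  then obtain k where k: "\<And>z. z \<in> Z \<Longrightarrow> compact (k z)" "\<And>z. z \<in> Z \<Longrightarrow> k z \<subseteq> upper_half_plane"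
    "\<And>z w. z \<in> Z \<Longrightarrow> Im w > 0 \<Longrightarrow> udist z w \<le> 34 \<Longrightarrow> w \<in> k z" by metis
  show ?thesis
  proof (rule that[of "\<Union>z\<in>Z. k z"])
    show "compact (\<Union>z\<in>Z. k z)" using Z(1) k(1) by (intro compact_UN) (auto simp: P_def)
    show "(\<Union>z\<in>Z. k z) \<subseteq> upper_half_plane" using k(2) by auto
    fix z' assume z': "z' \<in> thick \<eta>"
    have "\<exists>z\<in>Z. saturation z \<inter> saturation z' \<noteq> {}"
    proof (rule ccontr)
      assume n: "\<not> ?thesis"
      have "z' \<in> saturation z'"
        using mem_hbox_self[OF pos[OF z']] pos[OF z'] one_closed by (auto simp: saturation_def intro!: bexI[of _ "mat 1"])
      hence nin: "z' \<notin> Z" using n by auto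
      have "P (insert z' Z)" using Z(1) z' n unfolding P_def disjoint_family_on_def by (auto 0 4)
      hence "card (insert z' Z) \<le> card Z" by (rule Z(2))
      thus False using nin Z(1) by (simp add: P_def)
    qed
    then obtain z w where z: "z \<in> Z" and w: "w \<in> saturation z" "w \<in> saturation z'" by blast
    then obtain \<gamma> \<delta> where g: "\<gamma> \<in> \<Gamma>" "act \<gamma> w \<in> hbox z" "\<delta> \<in> \<Gamma>" "act \<delta> w \<in> hbox z'" "Im w > 0"
      by (auto simp: saturation_def)
    have Iz: "Im z > 0" "Im z' > 0" using z z' Z(1) pos by (auto simp: P_def)
    define a where "a = \<gamma> ** adj2 \<delta>"
    have a: "a \<in> \<Gamma>" "det a = 1" using g by (auto simp: a_def intro!: mult_closed adj2_closed det_1)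
    have "act a (act \<delta> w) = act \<gamma> w"
      using g by (simp add: a_def act_mult det_1 Im_act_pos act_adj2)
    hence n6: "norm (adj2 (gmat z) ** a ** gmat z') \<le> 6"
      using g Iz a by (intro norm_between_hbox[where w="act \<delta> w"]) auto
    define B where "B = adj2 (gmat z) ** a ** gmat z'"
    have dB: "det B = 1" using Iz a by (simp add: B_def det_mul)
    have "udist \<i> (act B \<i>) = (norm B)\<^sup>2 - 2" using norm_sq_eq_udist[OF dB] by simp
    also have "(norm B)\<^sup>2 \<le> 6\<^sup>2" using n6 unfolding B_def by (intro power_mono) auto
    \<comment> \<open>\<open>34 = 6^2 - 2\<close>, because the squared norm of \<open>B\<close> is
      \<open>udist \<i> (act B \<i>) + 2\<close>.\<close>
    finally have "udist \<i> (act B \<i>) \<le> 34" by simp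
    moreover have "act (gmat z) (act B \<i>) = act a z'"
      using Iz a by (simp add: B_def act_mult det_mult2 Im_act_pos act_adj2)
    ultimately have "udist z (act a z') \<le> 34"
      using udist_act[of "gmat z" \<i> "act B \<i>"] dB Iz by (simp add: Im_act_pos)
    hence "act a z' \<in> k z" using z a Iz by (intro k(3)) (auto simp: Im_act_pos)
    thus "\<exists>\<gamma>\<in>\<Gamma>. act \<gamma> z' \<in> (\<Union>z\<in>Z. k z)" using a z by blast
  qed
qed

end

section \<open>Scaling matrices and the covering by cusp regions\<close>

locale fuchsian_scaled = fuchsian_group +
  fixes \<sigma> :: "proj_real \<Rightarrow> real^2^2"
  assumes scaling: "is_cusp \<Gamma> c \<Longrightarrow> scaling_matrix \<Gamma> c (\<sigma> c)"
begin

lemma det_scaling: "is_cusp \<Gamma> c \<Longrightarrow> det (\<sigma> c) = 1"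
  using scaling[of c] by (simp add: scaling_matrix_def)

lemma scaling_Infty: "is_cusp \<Gamma> c \<Longrightarrow> act_proj (\<sigma> c) Infty = c"
  using scaling[of c] by (simp add: scaling_matrix_def)

lemma pm_scaling:
  assumes "is_cusp \<Gamma> c"
  shows "pm ((\<lambda>\<gamma>. adj2 (\<sigma> c) ** \<gamma> ** \<sigma> c) ` cusp_stabilizer \<Gamma> c) = pm (range translation)"
  using scaling[OF assms] unfolding scaling_matrix_def translation_def
  by (auto simp: matrix_inv_eq_adj2 det_scaling[OF assms])

text \<open>The scaling condition holds modulo signs: a stabilizer element may correspond to minus a
  translation while \<Gamma> lacks \<open>- mat 1\<close>. The sign is carried along and disappears
  under \<open>act\<close>.\<close>

lemma stabilizer_translation:
  assumes "is_cusp \<Gamma> c" "\<tau> \<in> cusp_stabilizer \<Gamma> c"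
  obtains l where "adj2 (\<sigma> c) ** \<tau> ** \<sigma> c = translation l \<or> adj2 (\<sigma> c) ** \<tau> ** \<sigma> c = - translation l"
proof -
  have "adj2 (\<sigma> c) ** \<tau> ** \<sigma> c \<in> pm (range translation)"
    unfolding pm_scaling[OF assms(1), symmetric] using assms(2) by (auto simp: pm_def)
  thus ?thesis using that by (auto simp: pm_def)
qed

lemma translation_stabilizer:
  assumes "is_cusp \<Gamma> c"
  obtains \<tau> where "\<tau> \<in> cusp_stabilizer \<Gamma> c"
    "adj2 (\<sigma> c) ** \<tau> ** \<sigma> c = translation l \<or> adj2 (\<sigma> c) ** \<tau> ** \<sigma> c = - translation l"
proof -
  have "translation l \<in> pm ((\<lambda>\<gamma>. adj2 (\<sigma> c) ** \<gamma> ** \<sigma> c) ` cusp_stabilizer \<Gamma> c)"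
    unfolding pm_scaling[OF assms] by (auto simp: pm_def)
  then obtain \<tau> where t: "\<tau> \<in> cusp_stabilizer \<Gamma> c"
    "translation l = adj2 (\<sigma> c) ** \<tau> ** \<sigma> c \<or> translation l = - (adj2 (\<sigma> c) ** \<tau> ** \<sigma> c)"
    by (auto simp: pm_def)
  show ?thesis
  proof (rule that[OF t(1)])
    show "adj2 (\<sigma> c) ** \<tau> ** \<sigma> c = translation l \<or> adj2 (\<sigma> c) ** \<tau> ** \<sigma> c = - translation l"
      using t(2) by (metis minus_minus)
  qed
qed

text \<open>The companion in the thick part of a thin point can be moved into the compact
  \<open>K1\<close>, where only finitely many elements \<open>A\<close> have small displacement. The
  small element at the thin point commutes with one of these. If that \<open>A\<close> is parabolic,
  the small element fixes the same cusp and is a nontrivial translation in its coordinate, and a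
  translation moves a point little only at great height.\<close>

lemma cusp_cover:
  obtains K C where "compact K" "K \<subseteq> upper_half_plane" "finite C" "\<And>c. c \<in> C \<Longrightarrow> is_cusp \<Gamma> c"
    "\<And>z. Im z > 0 \<Longrightarrow> \<exists>\<delta>\<in>\<Gamma>. act \<delta> z \<in> K \<or> (\<exists>c\<in>C. Im (act (adj2 (\<sigma> c)) (act \<delta> z)) \<ge> 1)"
proof -
  let ?e = "1/400 :: real"
  obtain K1 where K1: "compact K1" "K1 \<subseteq> upper_half_plane" "\<And>z. z \<in> thick ?e \<Longrightarrow> \<exists>\<gamma>\<in>\<Gamma>. act \<gamma> z \<in> K1"
    using thick_cocompact[of ?e] by (metis zero_less_divide_1_iff zero_less_numeral)
  define S where "S = {A\<in>\<Gamma>. A \<noteq> mat 1 \<and> (\<exists>w\<in>K1. disp A w \<le> ?e)}"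
  have "finite {A\<in>\<Gamma>. \<exists>w\<in>K1. disp A w \<le> ?e}" by (rule finite_disp_bounded[OF K1(1,2)])
  hence finS: "finite S" by (rule finite_subset[rotated]) (auto simp: S_def)
  have Sm: "A \<noteq> - mat 1" if "A \<in> S" for A
    using that disp_minus_one K1(2) by (force simp: S_def upper_half_plane_def)
  define Q where "Q = (\<lambda>A \<eta>. \<forall>B z. B \<in> \<Gamma> \<longrightarrow> B \<noteq> mat 1 \<longrightarrow> A ** B = B ** A \<longrightarrow> Im z > 0 \<longrightarrow> disp B z \<ge> \<eta>)"
  define S' where "S' = {A\<in>S. \<not> parabolic A}"
  have "\<exists>\<eta>>0. \<forall>A\<in>S'. Q A \<eta>"
  proof (rule finite_uniform_threshold)
    show "finite S'" using finS by (simp add: S'_def)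
    fix A assume A: "A \<in> S'"
    hence "\<bar>trace A\<bar> \<noteq> 2" using Sm[of A] det_1[of A] by (auto simp: S'_def S_def parabolic_def)
    moreover have "A \<in> \<Gamma>" "A \<noteq> mat 1" "A \<noteq> - mat 1" using A Sm by (auto simp: S'_def S_def)
    ultimately show "\<exists>\<eta>>0. Q A \<eta>"
      using commuting_nonparabolic_lower_bound[of A] unfolding Q_def by metis
  next
    fix A \<eta> \<eta>' assume "Q A \<eta>" "\<eta>' \<le> (\<eta>::real)"
    thus "Q A \<eta>'" unfolding Q_def by (meson order.trans)
  qed
  then obtain \<eta>1 where \<eta>1: "\<eta>1 > 0" "\<And>A. A \<in> S' \<Longrightarrow> Q A \<eta>1" by blast
  \<comment> \<open>Two thresholds: 1/400 produces the finite set \<open>S\<close>, while \<eta>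
    lies below every displacement of a nontrivial element commuting with a non-parabolic member of
    \<open>S\<close>. Outside \<open>thick \<eta>\<close> only parabolic members remain
    possible.\<close>
  define \<eta> where "\<eta> = min \<eta>1 ?e"
  have \<eta>: "\<eta> > 0" "\<eta> \<le> ?e" "\<eta> \<le> \<eta>1" using \<eta>1 by (auto simp: \<eta>_def)
  obtain K2 where K2: "compact K2" "K2 \<subseteq> upper_half_plane" "\<And>z. z \<in> thick \<eta> \<Longrightarrow> \<exists>\<gamma>\<in>\<Gamma>. act \<gamma> z \<in> K2"
    using thick_cocompact[OF \<eta>(1)] by metis
  define fp where "fp = (\<lambda>A. SOME c. act_proj A c = c)"
  have fp: "act_proj A (fp A) = fp A" if "parabolic A" for A
    unfolding fp_def using parabolic_fixed_point_exists[OF that] by (rule someI_ex)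
  define C where "C = fp ` {A\<in>S. parabolic A}"
  have Ccusp: "is_cusp \<Gamma> c" if "c \<in> C" for c
    using that fp unfolding C_def is_cusp_def S_def by auto
  show ?thesis
  proof (rule that[OF K2(1,2) _ Ccusp])
    show "finite C" using finS by (simp add: C_def)
    fix z :: complex assume z: "Im z > 0"
    show "\<exists>\<delta>\<in>\<Gamma>. act \<delta> z \<in> K2 \<or> (\<exists>c\<in>C. Im (act (adj2 (\<sigma> c)) (act \<delta> z)) \<ge> 1)"
    proof (cases "z \<in> thick \<eta>")
      case True
      thus ?thesis using K2(3) by blast
    next
      case False
      then obtain \<gamma> where g: "\<gamma> \<in> \<Gamma>" "\<gamma> \<noteq> mat 1" "disp \<gamma> z < \<eta>"
        using z by (auto simp: thick_def upper_half_plane_def not_le)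
      have "disp \<gamma> z < ?e" using g \<eta> by simp
      then obtain w B where wB: "w \<in> thick ?e" "B \<in> \<Gamma>" "B \<noteq> mat 1" "\<gamma> ** B = B ** \<gamma>" "disp B w \<le> ?e"
        using thin_component_boundary[OF g(1,2) z] by metis
      have Iw: "Im w > 0" using wB by (auto simp: thick_def upper_half_plane_def)
      obtain \<delta> where d: "\<delta> \<in> \<Gamma>" "act \<delta> w \<in> K1" using K1(3) wB(1) by blast
      define A g' where "A = \<delta> ** B ** adj2 \<delta>" and "g' = \<delta> ** \<gamma> ** adj2 \<delta>"
      have dets: "det \<delta> = 1" "det B = 1" "det \<gamma> = 1" using d wB g det_1 by auto
      have inj: "X = Y" if "\<delta> ** X ** adj2 \<delta> = \<delta> ** Y ** adj2 \<delta>" for X Y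
      proof -
        have "adj2 \<delta> ** (\<delta> ** X ** adj2 \<delta>) ** \<delta> = adj2 \<delta> ** (\<delta> ** Y ** adj2 \<delta>) ** \<delta>" using that by simp
        hence "(adj2 \<delta> ** \<delta>) ** X ** (adj2 \<delta> ** \<delta>) = (adj2 \<delta> ** \<delta>) ** Y ** (adj2 \<delta> ** \<delta>)"
          by (simp only: matrix_mul_assoc)
        thus ?thesis using dets by (simp add: adj2_mult)
      qed
      have one: "\<delta> ** mat 1 ** adj2 \<delta> = mat 1" using dets by (simp add: adj2_mult)
      have A1: "A \<noteq> mat 1" using inj[of B "mat 1"] wB(3) one unfolding A_def by metis
      have g1: "g' \<noteq> mat 1" using inj[of \<gamma> "mat 1"] g(2) one unfolding g'_def by metis
      have AG: "A \<in> \<Gamma>" "g' \<in> \<Gamma>" using d wB g by (auto simp: A_def g'_def intro: conj_closed)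
      have "disp A (act \<delta> w) \<le> ?e" using disp_conj[OF dets(2,1) Iw] wB by (simp add: A_def)
      hence AS: "A \<in> S" using A1 AG d by (auto simp: S_def)
      have mm: "\<delta> ** X ** adj2 \<delta> ** (\<delta> ** Y ** adj2 \<delta>) = \<delta> ** (X ** Y) ** adj2 \<delta>" for X Y
      proof -
        have "\<delta> ** X ** adj2 \<delta> ** (\<delta> ** Y ** adj2 \<delta>) = \<delta> ** X ** (adj2 \<delta> ** \<delta>) ** Y ** adj2 \<delta>"
          by (simp only: matrix_mul_assoc)
        thus ?thesis using dets by (simp add: adj2_mult matrix_mul_assoc)
      qed
      have comm: "A ** g' = g' ** A" unfolding A_def g'_def mm wB(4) ..
      have dz: "disp g' (act \<delta> z) < \<eta>" using disp_conj[OF dets(3,1) z] g by (simp add: g'_def)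
      have Idz: "Im (act \<delta> z) > 0" using z dets by (simp add: Im_act_pos)
      have par: "parabolic A"
      proof (rule ccontr)
        assume "\<not> parabolic A"
        hence "Q A \<eta>1" using AS \<eta>1 by (auto simp: S'_def)
        hence "disp g' (act \<delta> z) \<ge> \<eta>1" using AG g1 comm Idz unfolding Q_def by blast
        thus False using dz \<eta> by simp
      qed
      define c where "c = fp A"
      have cC: "c \<in> C" using par AS by (auto simp: C_def c_def)
      have cc: "is_cusp \<Gamma> c" using Ccusp cC by blast
      have dA: "det A = 1" "det g' = 1" using AG det_1 by auto
      \<comment> \<open>An element commuting with \<open>A\<close> permutes the fixed points of
        \<open>A\<close>, and a parabolic \<open>A\<close> has just one.\<close>
      have "act_proj A (act_proj g' c) = act_proj g' (act_proj A c)"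
        using comm act_proj_mult[OF dA] act_proj_mult[OF dA(2,1)] by metis
      hence "act_proj A (act_proj g' c) = act_proj g' c" using fp[OF par] by (simp add: c_def)
      hence "act_proj g' c = c"
        by (rule parabolic_fixed_point_unique[OF par _ fp[OF par, folded c_def]])
      hence st: "g' \<in> cusp_stabilizer \<Gamma> c" using AG by (simp add: cusp_stabilizer_def)
      have ds: "det (\<sigma> c) = 1" using det_scaling[OF cc] .
      define u where "u = act (adj2 (\<sigma> c)) (act \<delta> z)"
      have Iu: "Im u > 0" using Idz ds by (simp add: u_def Im_act_pos)
      obtain l where l: "adj2 (\<sigma> c) ** g' ** \<sigma> c = translation l \<or> adj2 (\<sigma> c) ** g' ** \<sigma> c = - translation l"
        using stabilizer_translation[OF cc st] .
      have "disp (adj2 (\<sigma> c) ** g' ** adj2 (adj2 (\<sigma> c))) u = disp g' (act \<delta> z)"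
        unfolding u_def using Idz ds dA by (intro disp_conj) auto
      hence du: "disp (adj2 (\<sigma> c) ** g' ** \<sigma> c) u < ?e" using dz \<eta> by simp
      have fx: "udist u (u + of_int l) = (of_int l)\<^sup>2 / (Im u)\<^sup>2"
        by (simp add: udist_def power2_eq_square)
      \<comment> \<open>The sign is settled by the trace: \<open>- translation l\<close> has trace
        -2 and cannot have small displacement.\<close>
      have "disp (- translation l) u \<ge> 4" by (rule disp_neg_trace[OF Iu]) (auto simp: trace2)
      with du l have eq: "adj2 (\<sigma> c) ** g' ** \<sigma> c = translation l" by auto
      have l0: "l \<noteq> 0"
      proof
        assume "l = 0"
        hence "adj2 (\<sigma> c) ** g' ** \<sigma> c = mat 1" using eq by (simp add: mat2_eq_iff)
        hence "\<sigma> c ** (adj2 (\<sigma> c) ** g' ** \<sigma> c) ** adj2 (\<sigma> c) = mat 1" using ds by (simp add: adj2_mult)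
        hence "(\<sigma> c ** adj2 (\<sigma> c)) ** g' ** (\<sigma> c ** adj2 (\<sigma> c)) = mat 1" by (simp only: matrix_mul_assoc)
        thus False using g1 ds by (simp add: adj2_mult)
      qed
      \<comment> \<open>Trace 2 leaves only \<open>udist\<close> in the displacement. With
        \<open>l \<noteq> 0\<close> the inequality makes \<open>Im u\<close> exceed 20, well above
        the claimed 1.\<close>
      have "(of_int l)\<^sup>2 / (Im u)\<^sup>2 < ?e" using du unfolding eq disp_def by (simp add: fx trace2)
      hence "(of_int l)\<^sup>2 * 400 < (Im u)\<^sup>2" using Iu by (simp add: field_simps)
      moreover have "(1::real) \<le> (of_int l)\<^sup>2" using l0 by (simp add: int_one_le_iff_zero_less flip: of_int_power) 
      ultimately have "1\<^sup>2 \<le> (Im u)\<^sup>2" by simp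
      hence "Im u \<ge> 1" using Iu by (intro power2_le_imp_le[of 1 "Im u"]) auto
      thus ?thesis using d cC unfolding u_def by blast
    qed
  qed
qed

end

section \<open>Cusp forms and their primitives\<close>

text \<open>Convergence at \<open>\<i> / 2\<close> bounds
  \<open>|q (m + 1)| * exp (- pi * (m + 1))\<close>. Passing to \<open>Im z \<ge> 1\<close>
  multiplies this by \<open>r ^ (m + 1)\<close> with
  \<open>r = exp (pi - 2 * pi * Im z) \<le> 1/2\<close>; the geometric series leaves one factor r,
  which is at most a constant times \<open>exp (- Im z)\<close>.\<close>

lemma q_series_decay:
  fixes q :: "nat \<Rightarrow> complex" and h :: "complex \<Rightarrow> complex"
  assumes "\<And>z. Im z > 0 \<Longrightarrow> (\<lambda>m. q (Suc m) * exp (2 * of_real pi * \<i> * of_nat (Suc m) * z)) sums h z"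
  obtains C where "\<And>z. Im z \<ge> 1 \<Longrightarrow> norm (h z) \<le> C * exp (- Im z)"
proof -
  define e where "e = (\<lambda>m z. exp (2 * of_real pi * \<i> * of_nat (Suc m) * z))"
  have ne: "norm (e m z) = exp (- (2 * pi * real (Suc m) * Im z))" for m z
    unfolding e_def by (simp add: algebra_simps)
  have "summable (\<lambda>m. q (Suc m) * e m (\<i> / 2))"
    using assms[of "\<i> / 2"] by (simp add: sums_summable e_def)
  hence "(\<lambda>m. q (Suc m) * e m (\<i> / 2)) \<longlonglongrightarrow> 0" by (rule summable_LIMSEQ_zero)
  hence "Bseq (\<lambda>m. q (Suc m) * e m (\<i> / 2))" using convergentI convergent_imp_Bseq by blast
  then obtain D where D: "D > 0" "\<And>m. norm (q (Suc m) * e m (\<i> / 2)) \<le> D" by (auto simp: Bseq_def)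
  have half: "exp (- 1) \<le> (1 / 2 :: real)"
  proof -
    have "(2::real) \<le> exp 1" using exp_ge_add_one_self[of 1] by simp
    thus ?thesis by (simp add: exp_minus field_simps)
  qed
  show ?thesis
  proof (rule that[of "D * exp pi * 2"])
    fix z :: complex assume z: "Im z \<ge> 1"
    define r where "r = exp (pi - 2 * pi * Im z)"
    have pi: "pi * Im z \<ge> pi" "pi \<ge> 3" using z pi_gt3 by auto
    have "r \<le> exp (pi - 1 * Im z)"
    proof -
      have "1 * Im z \<le> 2 * pi * Im z" using z pi by (intro mult_right_mono) auto
      thus ?thesis unfolding r_def by simp
    qed
    hence r1: "r \<le> exp pi * exp (- Im z)" by (simp add: exp_diff exp_minus field_simps)
    have "2 * pi * Im z = 2 * (pi * Im z)" by simp
    hence "pi - 2 * pi * Im z \<le> - 1" using pi by linarith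
    hence "r \<le> exp (- 1)" unfolding r_def by simp
    hence r2: "r \<le> 1/2" using half by linarith
    have r3: "r > 0" by (simp add: r_def)
    have bound: "norm (q (Suc m) * e m z) \<le> D * r * (1/2)^m" for m
    proof -
      have "norm (e m z) = norm (e m (\<i>/2)) * r ^ Suc m"
        unfolding ne r_def exp_of_nat_mult[symmetric] exp_add[symmetric]
        by (simp add: algebra_simps)
      hence "norm (q (Suc m) * e m z) = norm (q (Suc m) * e m (\<i>/2)) * r ^ Suc m"
        by (simp add: norm_mult)
      also have "\<dots> \<le> D * r ^ Suc m" using D r2 r3 by (intro mult_right_mono) auto
      also have "\<dots> = D * r * r ^ m" by simp
      also have "\<dots> \<le> D * r * (1/2)^m" using D r2 r3 by (intro mult_left_mono power_mono) auto
      finally show ?thesis .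
    qed
    have s: "summable (\<lambda>m. D * r * (1/2)^m)" by (intro summable_mult summable_geometric) simp
    have "h z = (\<Sum>m. q (Suc m) * e m z)" using assms[of z] z by (simp add: sums_iff e_def)
    also have "norm \<dots> \<le> (\<Sum>m. D * r * (1/2)^m)" by (rule norm_suminf_le) (use bound s in auto)
    also have "\<dots> = D * r * 2" using suminf_geometric[of "1/2::real"] by (subst suminf_mult) (auto simp: summable_geometric)
    also have "\<dots> \<le> D * (exp pi * exp (- Im z)) * 2" using D r1 by (intro mult_right_mono mult_left_mono) auto
    finally show "norm (h z) \<le> D * exp pi * 2 * exp (- Im z)" by (simp add: algebra_simps)
  qed
qed

lemma holomorphic_slash2:
  assumes "det A = 1" "f holomorphic_on upper_half_plane"
  shows "slash2 f A holomorphic_on upper_half_plane"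
proof -
  have "act A holomorphic_on upper_half_plane"
    unfolding holomorphic_on_open[OF open_upper_half_plane]
    using has_field_derivative_act[OF assms(1)] by (auto simp: upper_half_plane_def)
  hence "(f \<circ> act A) holomorphic_on upper_half_plane"
    using assms act_upper by (intro holomorphic_on_compose_gen[of "act A" _ f upper_half_plane]) auto
  hence "(\<lambda>z. f (act A z)) holomorphic_on upper_half_plane" by (simp add: o_def)
  hence "(\<lambda>z. f (act A z) / (auto_factor A z)\<^sup>2) holomorphic_on upper_half_plane"
    using auto_factor_nonzero[OF assms(1)] unfolding auto_factor_def
    by (intro holomorphic_intros) (auto simp: upper_half_plane_def)
  thus ?thesis by (simp add: slash2_eq[abs_def])
qed

text \<open>In weight 2 the factor \<open>|cz + d|^-2\<close> is exactly the change of height, so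
  \<open>y |f|\<close> is the invariant quantity.\<close>

lemma norm_slash2:
  assumes "det A = 1" "Im w > 0"
  shows "Im w * norm (slash2 f A w) = Im (act A w) * norm (f (act A w))"
  using auto_factor_nonzero[OF assms]
  by (simp add: slash2_eq Im_act[OF assms(1)] norm_divide norm_power)

context fuchsian_scaled
begin

lemma cusp_form_decay:
  assumes "cusp_form \<Gamma> \<sigma> f" "is_cusp \<Gamma> c"
  obtains C where "\<And>w. Im w \<ge> 1 \<Longrightarrow> norm (slash2 f (\<sigma> c) w) \<le> C * exp (- Im w)"
proof -
  from assms obtain q :: "nat \<Rightarrow> complex" where "\<forall>z\<in>upper_half_plane.
        (\<lambda>m. q (Suc m) * exp (2 * of_real pi * \<i> * of_nat (Suc m) * z)) sums slash2 f (\<sigma> c) z"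
    unfolding cusp_form_def by blast
  hence "\<And>z. Im z > 0 \<Longrightarrow> (\<lambda>m. q (Suc m) * exp (2 * of_real pi * \<i> * of_nat (Suc m) * z)) sums slash2 f (\<sigma> c) z"
    by (simp add: upper_half_plane_def)
  thus ?thesis using that by (rule q_series_decay)
qed

lemma cusp_form_invariant_norm:
  assumes "cusp_form \<Gamma> \<sigma> f" "\<gamma> \<in> \<Gamma>" "Im z > 0"
  shows "Im (act \<gamma> z) * norm (f (act \<gamma> z)) = Im z * norm (f z)"
proof -
  have "slash2 f \<gamma> z = f z" using assms by (simp add: cusp_form_def upper_half_plane_def)
  thus ?thesis using norm_slash2[of \<gamma> z f] assms det_1 by simp
qed

lemma cusp_form_bounded:
  assumes f: "cusp_form \<Gamma> \<sigma> f"
  obtains M where "M > 0" "\<And>z. Im z > 0 \<Longrightarrow> Im z * norm (f z) \<le> M"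
proof -
  obtain K C where KC: "compact K" "K \<subseteq> upper_half_plane" "finite C" "\<And>c. c \<in> C \<Longrightarrow> is_cusp \<Gamma> c"
    "\<And>z. Im z > 0 \<Longrightarrow> \<exists>\<delta>\<in>\<Gamma>. act \<delta> z \<in> K \<or> (\<exists>c\<in>C. Im (act (adj2 (\<sigma> c)) (act \<delta> z)) \<ge> 1)"
    using cusp_cover by metis
  have "continuous_on K f" using f KC(2) 
    by (meson continuous_on_subset cusp_form_def holomorphic_on_imp_continuous_on)
  hence "continuous_on K (\<lambda>z. Im z * norm (f z))" by (intro continuous_intros)
  hence "bounded ((\<lambda>z. Im z * norm (f z)) ` K)"
    using KC(1) by (intro compact_imp_bounded compact_continuous_image)
  then obtain M0 where M0: "\<And>z. z \<in> K \<Longrightarrow> Im z * norm (f z) \<le> M0"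
    unfolding bounded_iff by (fastforce simp: abs_le_iff)
  have "\<forall>c\<in>C. \<exists>M. \<forall>w. Im w \<ge> 1 \<longrightarrow> Im w * norm (slash2 f (\<sigma> c) w) \<le> M"
  proof
    fix c assume "c \<in> C"
    then obtain D where D: "\<And>w. Im w \<ge> 1 \<Longrightarrow> norm (slash2 f (\<sigma> c) w) \<le> D * exp (- Im w)"
      using cusp_form_decay[OF f] KC(4) by metis
    show "\<exists>M. \<forall>w. Im w \<ge> 1 \<longrightarrow> Im w * norm (slash2 f (\<sigma> c) w) \<le> M"
    proof (intro exI[of _ "\<bar>D\<bar>"] allI impI)
      fix w assume w: "Im w \<ge> 1"
      have "norm (slash2 f (\<sigma> c) w) \<le> \<bar>D\<bar> * exp (- Im w)"
        using D[OF w] by (rule order.trans) (simp add: mult_right_mono)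
      hence "Im w * norm (slash2 f (\<sigma> c) w) \<le> Im w * (\<bar>D\<bar> * exp (- Im w))"
        using w by (intro mult_left_mono) auto
      also have "\<dots> = \<bar>D\<bar> * (Im w * exp (- Im w))" by simp
      also have "Im w * exp (- Im w) \<le> 1"
      proof -
        have "Im w \<le> exp (Im w)" using exp_ge_add_one_self[of "Im w"] by linarith
        thus ?thesis by (simp add: exp_minus field_simps)
      qed
      hence "\<bar>D\<bar> * (Im w * exp (- Im w)) \<le> \<bar>D\<bar>" by (intro mult_left_le) auto
      finally show "Im w * norm (slash2 f (\<sigma> c) w) \<le> \<bar>D\<bar>" .
    qed
  qed
  then obtain m where m: "\<And>c w. c \<in> C \<Longrightarrow> Im w \<ge> 1 \<Longrightarrow> Im w * norm (slash2 f (\<sigma> c) w) \<le> m c" by metis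
  define M where "M = Max (insert 1 (insert M0 (m ` C)))"
  have M: "1 \<le> M" "M0 \<le> M" "\<And>c. c \<in> C \<Longrightarrow> m c \<le> M"
    unfolding M_def using KC(3) by (intro Max_ge; auto)+
  show ?thesis
  proof (rule that[of M])
    show "M > 0" using M by simp
    fix z :: complex assume z: "Im z > 0"
    obtain \<delta> where d: "\<delta> \<in> \<Gamma>" "act \<delta> z \<in> K \<or> (\<exists>c\<in>C. Im (act (adj2 (\<sigma> c)) (act \<delta> z)) \<ge> 1)"
      using KC(5)[OF z] by blast
    have Id: "Im (act \<delta> z) > 0" using z det_1[OF d(1)] by (simp add: Im_act_pos)
    have "Im (act \<delta> z) * norm (f (act \<delta> z)) \<le> M"
      using d(2)
    proof
      assume "act \<delta> z \<in> K" thus ?thesis using M0 M by fastforce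
    next
      assume "\<exists>c\<in>C. Im (act (adj2 (\<sigma> c)) (act \<delta> z)) \<ge> 1"
      then obtain c where c: "c \<in> C" "Im (act (adj2 (\<sigma> c)) (act \<delta> z)) \<ge> 1" by blast
      have ds: "det (\<sigma> c) = 1" using det_scaling KC(4) c by blast
      have "act (\<sigma> c) (act (adj2 (\<sigma> c)) (act \<delta> z)) = act \<delta> z" using ds Id by (rule act_adj2)
      moreover have "Im (act (adj2 (\<sigma> c)) (act \<delta> z)) > 0" using c by simp
      ultimately show ?thesis using m[OF c] M(3)[OF c(1)] norm_slash2[OF ds, of "act (adj2 (\<sigma> c)) (act \<delta> z)" f]
        by simp
    qed
    thus "Im z * norm (f z) \<le> M" using cusp_form_invariant_norm[OF f d(1) z] by simp
  qed
qed

text \<open>Two regimes: up to height 1 the global bound gives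
  \<open>1 / y \<le> y powr (-1 - \<eta>)\<close>, above it \<open>exp (- y) \<le> 2 / y^2\<close>,
  and \<open>\<eta> \<le> 1\<close> makes this enough. The exponent is integrable up to the cusp and
  loses only \<open>y powr (- \<eta>)\<close> near the real line.\<close>

lemma cusp_form_power_bound:
  assumes f: "cusp_form \<Gamma> \<sigma> f" and c: "is_cusp \<Gamma> c" and \<eta>: "0 < \<eta>" "\<eta> \<le> 1"
  obtains M where "M > 0" "\<And>w. Im w > 0 \<Longrightarrow> norm (slash2 f (\<sigma> c) w) \<le> M * Im w powr (-1 - \<eta>)"
proof -
  obtain M1 where M1: "M1 > 0" "\<And>z. Im z > 0 \<Longrightarrow> Im z * norm (f z) \<le> M1"
    using cusp_form_bounded[OF f] by metis
  obtain D where D: "\<And>w. Im w \<ge> 1 \<Longrightarrow> norm (slash2 f (\<sigma> c) w) \<le> D * exp (- Im w)"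
    using cusp_form_decay[OF f c] by metis
  have ds: "det (\<sigma> c) = 1" using det_scaling c by blast
  show ?thesis
  proof (rule that[of "M1 + 2 * \<bar>D\<bar>"])
    show "M1 + 2 * \<bar>D\<bar> > 0" using M1 by simp
    fix w :: complex assume w: "Im w > 0"
    show "norm (slash2 f (\<sigma> c) w) \<le> (M1 + 2 * \<bar>D\<bar>) * Im w powr (-1 - \<eta>)"
    proof (cases "Im w \<le> 1")
      case True
      have "Im w * norm (slash2 f (\<sigma> c) w) \<le> M1"
        using norm_slash2[OF ds w] M1(2) Im_act_pos[OF ds w] by simp
      hence "norm (slash2 f (\<sigma> c) w) \<le> M1 * Im w powr (-1)"
        using w by (simp add: powr_minus powr_one field_simps)
      also have "Im w powr (-1) \<le> Im w powr (-1 - \<eta>)" using w True \<eta> by (intro powr_mono') auto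
      hence "M1 * Im w powr (-1) \<le> (M1 + 2 * \<bar>D\<bar>) * Im w powr (-1 - \<eta>)"
        using M1 by (intro mult_mono) auto
      finally show ?thesis .
    next
      case False
      define y where "y = Im w"
      have y: "y \<ge> 1" using False by (simp add: y_def)
      have "1 + y + y\<^sup>2 / 2 \<le> exp y" using exp_lower_Taylor_quadratic[of y] y by simp
      hence "exp (- y) \<le> 2 / y\<^sup>2" using y by (simp add: exp_minus field_simps)
      also have "\<dots> = 2 * y powr (-2)" using y by (simp add: powr_minus field_simps)
      also have "y powr (-2) \<le> y powr (-1 - \<eta>)" using y \<eta> by (intro powr_mono) auto
      finally have e: "exp (- y) \<le> 2 * y powr (-1 - \<eta>)" by simp
      have "norm (slash2 f (\<sigma> c) w) \<le> D * exp (- y)" using D[of w] y by (simp add: y_def)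
      also have "\<dots> \<le> \<bar>D\<bar> * (2 * y powr (-1 - \<eta>))" using e by (intro mult_mono) auto
      also have "\<dots> \<le> (M1 + 2 * \<bar>D\<bar>) * y powr (-1 - \<eta>)" using M1 by (simp add: algebra_simps)
      finally show ?thesis by (simp add: y_def)
    qed
  qed
qed

text \<open>Convergence is required on whole vertical strips, not only along the geodesic into the cusp:
  moving a cusp by an element of \<open>\<Gamma>\<close> changes its scaling matrix by a translation.\<close>

definition regular :: "(endpoint \<Rightarrow> complex) \<Rightarrow> bool" where
  "regular G \<longleftrightarrow> (\<lambda>z. G (Interior z)) holomorphic_on upper_half_plane \<and>
     (\<forall>c. is_cusp \<Gamma> c \<longrightarrow> (\<forall>X. \<forall>e>0. \<exists>Y>0. \<forall>w. \<bar>Re w\<bar> \<le> X \<and> Im w \<ge> Y \<longrightarrow>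
        norm (G (Interior (act (\<sigma> c) w)) - G (Boundary c)) < e))"

text \<open>The class of integrands, a cusp form times a function converging at the cusps.
  Exponential decay gives both integrability along the rays into cusps and limits of primitives
  there.\<close>

definition decaying :: "(complex \<Rightarrow> complex) \<Rightarrow> bool" where
  "decaying g \<longleftrightarrow> g holomorphic_on upper_half_plane \<and>
     (\<forall>c. is_cusp \<Gamma> c \<longrightarrow> (\<forall>X. \<exists>C. \<exists>Y>0. \<forall>w. \<bar>Re w\<bar> \<le> X \<and> Im w \<ge> Y \<longrightarrow>
        norm (slash2 g (\<sigma> c) w) \<le> C * exp (- Im w)))"

definition primitive_of :: "(complex \<Rightarrow> complex) \<Rightarrow> (endpoint \<Rightarrow> complex) \<Rightarrow> bool" where
  "primitive_of g G \<longleftrightarrow> regular G \<and>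
     (\<forall>z. Im z > 0 \<longrightarrow> ((\<lambda>z. G (Interior z)) has_field_derivative g z) (at z))"

lemma decaying_mult:
  assumes f: "cusp_form \<Gamma> \<sigma> f" and G: "regular G"
  shows "decaying (\<lambda>z. f z * G (Interior z))"
  unfolding decaying_def
proof (intro conjI allI impI)
  show "(\<lambda>z. f z * G (Interior z)) holomorphic_on upper_half_plane"
    using f G unfolding cusp_form_def regular_def by (intro holomorphic_intros) auto
  fix c X assume c: "is_cusp \<Gamma> c"
  obtain D where D: "\<And>w. Im w \<ge> 1 \<Longrightarrow> norm (slash2 f (\<sigma> c) w) \<le> D * exp (- Im w)"
    using cusp_form_decay[OF f c] by metis
  obtain Y where Y: "Y > 0" "\<And>w. \<bar>Re w\<bar> \<le> X \<Longrightarrow> Im w \<ge> Y \<Longrightarrow> norm (G (Interior (act (\<sigma> c) w)) - G (Boundary c)) < 1"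
    using G c unfolding regular_def by (meson zero_less_one)
  define B where "B = norm (G (Boundary c)) + 1"
  show "\<exists>C. \<exists>Y>0. \<forall>w. \<bar>Re w\<bar> \<le> X \<and> Im w \<ge> Y \<longrightarrow>
        norm (slash2 (\<lambda>z. f z * G (Interior z)) (\<sigma> c) w) \<le> C * exp (- Im w)"
  proof (rule exI[of _ "D * B"], rule exI[of _ "max 1 Y"], intro conjI allI impI)
    fix w assume w: "\<bar>Re w\<bar> \<le> X \<and> max 1 Y \<le> Im w"
    have "norm (G (Interior (act (\<sigma> c) w))) \<le> B"
      using Y(2)[of w] w norm_triangle_sub[of "G (Interior (act (\<sigma> c) w))" "G (Boundary c)"] by (simp add: B_def)
    moreover have "norm (slash2 f (\<sigma> c) w) \<le> D * exp (- Im w)" using D w by simp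
    ultimately have "norm (slash2 f (\<sigma> c) w) * norm (G (Interior (act (\<sigma> c) w))) \<le> D * exp (- Im w) * B"
      by (intro mult_mono) (auto intro: order.trans[OF norm_ge_zero])
    moreover have "slash2 (\<lambda>z. f z * G (Interior z)) (\<sigma> c) w = slash2 f (\<sigma> c) w * G (Interior (act (\<sigma> c) w))"
      by (simp add: slash2_def)
    ultimately show "norm (slash2 (\<lambda>z. f z * G (Interior z)) (\<sigma> c) w) \<le> D * B * exp (- Im w)"
      by (simp add: norm_mult algebra_simps)
  qed simp
qed

text \<open>The mean value inequality with \<open>- C * exp (- t)\<close> as majorant. The bound
  does not involve \<open>y2\<close>, which is what the Cauchy property at the cusp
  requires.\<close>

lemma vertical_decay:
  fixes F :: "complex \<Rightarrow> complex"
  assumes "\<And>w. Re w = x \<Longrightarrow> Im w \<ge> y1 \<Longrightarrow> (F has_field_derivative h w) (at w)"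
    and "\<And>w. Re w = x \<Longrightarrow> Im w \<ge> y1 \<Longrightarrow> norm (h w) \<le> C * exp (- Im w)"
    and "y1 \<le> y2"
  shows "norm (F (Complex x y2) - F (Complex x y1)) \<le> C * exp (- y1)"
proof (cases "y1 < y2")
  case True
  have der: "((\<lambda>t. F (Complex x t)) has_vector_derivative h (Complex x t) * \<i>) (at t)" if "t \<ge> y1" for t
  proof -
    have "((\<lambda>t. Complex x t) has_vector_derivative \<i>) (at t)"
      unfolding Complex_eq by (auto intro!: derivative_eq_intros)
    thus ?thesis using field_vector_diff_chain_at[of "\<lambda>t. Complex x t" \<i> t F "h (Complex x t)"] assms(1)[of "Complex x t"] that
      by (simp add: o_def mult.commute)
  qed
  have "norm (F (Complex x y2) - F (Complex x y1)) \<le> (- C * exp (- y2)) - (- C * exp (- y1))"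
  proof (rule differentiable_bound_general[OF True])
    show "continuous_on {y1..y2} (\<lambda>t. F (Complex x t))"
      using der has_vector_derivative_continuous by (intro continuous_at_imp_continuous_on) force
    show "continuous_on {y1..y2} (\<lambda>t. - C * exp (- t))" by (intro continuous_intros)
    show "((\<lambda>t. F (Complex x t)) has_vector_derivative h (Complex x t) * \<i>) (at t)" if "y1 < t" for t
      using der that by simp
    show "((\<lambda>t. - C * exp (- t)) has_vector_derivative C * exp (- t)) (at t)" for t
      by (auto intro!: derivative_eq_intros simp: has_real_derivative_iff_has_vector_derivative[symmetric])
    show "norm (h (Complex x t) * \<i>) \<le> C * exp (- t)" if "y1 < t" for t
      using assms(2)[of "Complex x t"] that by (simp add: norm_mult)
  qed
  moreover have "C * exp (- y2) \<ge> 0"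
    using assms(2)[of "Complex x y2"] assms(3) by (auto intro: order.trans[OF norm_ge_zero])
  ultimately show ?thesis by simp
next
  case False
  hence "y1 = y2" using assms(3) by simp
  moreover have "C * exp (- y1) \<ge> 0"
    using assms(2)[of "Complex x y1"] by (auto intro: order.trans[OF norm_ge_zero])
  ultimately show ?thesis by simp
qed

lemma has_field_derivative_comp_act:
  assumes "det A = 1" "Im w > 0" "(P has_field_derivative g (act A w)) (at (act A w))"
  shows "((\<lambda>w. P (act A w)) has_field_derivative slash2 g A w) (at w)"
  using DERIV_chain2[OF assms(3) has_field_derivative_act[OF assms(1,2)]] by (simp add: slash2_eq)

text \<open>The convex half plane provides a primitive \<open>P\<close>. In each cusp coordinate
  \<open>P\<close> is Cauchy along the imaginary axis, and a sideways move at height y inside a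
  strip changes it by at most a constant times \<open>exp (- y)\<close>. So the limit holds on whole
  strips and can serve as the value at the cusp.\<close>

lemma primitive_exists:
  assumes g: "decaying g"
  obtains G where "primitive_of g G"
proof -
  have "g holomorphic_on upper_half_plane" using g by (simp add: decaying_def)
  then obtain P where P0: "\<And>z. z \<in> upper_half_plane \<Longrightarrow> (P has_field_derivative g z) (at z within upper_half_plane)"
    using holomorphic_convex_primitive'[OF convex_upper_half_plane open_upper_half_plane] by blast
  have P: "(P has_field_derivative g z) (at z)" if "Im z > 0" for z
  proof -
    have z: "z \<in> upper_half_plane" using that by (simp add: upper_half_plane_def)
    show ?thesis using P0[OF z] unfolding at_within_open[OF z open_upper_half_plane] .
  qed
  have lim: "\<exists>L. \<forall>X. \<forall>e>0. \<exists>Y>0. \<forall>w. \<bar>Re w\<bar> \<le> X \<and> Im w \<ge> Y \<longrightarrow> norm (P (act (\<sigma> c) w) - L) < e"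
    if c: "is_cusp \<Gamma> c" for c
  proof -
    have ds: "det (\<sigma> c) = 1" using det_scaling c by blast
    define F where "F = (\<lambda>w. P (act (\<sigma> c) w))"
    have F: "(F has_field_derivative slash2 g (\<sigma> c) w) (at w)" if "Im w > 0" for w
      unfolding F_def using ds that P Im_act_pos by (intro has_field_derivative_comp_act) auto
    obtain C0 Y0 where C0: "Y0 > 0" "\<And>w. \<bar>Re w\<bar> \<le> 0 \<Longrightarrow> Im w \<ge> Y0 \<Longrightarrow> norm (slash2 g (\<sigma> c) w) \<le> C0 * exp (- Im w)"
      using g c unfolding decaying_def by metis
    have v0: "norm (F (Complex 0 y2) - F (Complex 0 y1)) \<le> C0 * exp (- y1)" if "y1 \<ge> Y0" "y1 \<le> y2" for y1 y2
      using that C0 by (intro vertical_decay[where h="slash2 g (\<sigma> c)"] F) auto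
    have C0pos: "C0 \<ge> 0" using C0(2)[of "Complex 0 Y0"] by (auto intro: order.trans[OF norm_ge_zero] simp: zero_le_mult_iff)
      (smt (verit) exp_gt_zero norm_ge_zero zero_le_mult_iff)
    have tend: "((\<lambda>y. C * exp (- y)) \<longlongrightarrow> 0) at_top" for C :: real
      by (intro tendsto_mult_right_zero filterlim_compose[OF exp_at_bot] filterlim_uminus_at_bot_at_top)
    define s where "s = (\<lambda>n::nat. F (Complex 0 (real n)))"
    have "Cauchy s"
    proof (rule metric_CauchyI)
      fix e :: real assume e: "e > 0"
      have "\<forall>\<^sub>F y in at_top. C0 * exp (- y) < e / 2" using tend[of C0] e by (intro order_tendstoD) auto
      then obtain Y1 where Y1: "\<And>y. y \<ge> Y1 \<Longrightarrow> C0 * exp (- y) < e / 2" by (auto simp: eventually_at_top_linorder)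
      define N where "N = nat \<lceil>max Y0 Y1\<rceil>"
      have N: "real N \<ge> Y0" "real N \<ge> Y1" unfolding N_def by linarith+
      have "dist (s m) (s N) < e / 2" if "m \<ge> N" for m
        using v0[of "real N" "real m"] Y1[of "real N"] N that unfolding s_def dist_norm by simp
      hence "dist (s m) (s n) < e / 2 + e / 2" if "m \<ge> N" "n \<ge> N" for m n
        using that by (meson dist_triangle_half_l dist_triangle_half_r add_strict_mono dist_triangle2 le_less_trans)
      thus "\<exists>M. \<forall>m\<ge>M. \<forall>n\<ge>M. dist (s m) (s n) < e" by auto
    qed
    then obtain L where L: "s \<longlonglongrightarrow> L" using Cauchy_convergent convergent_def by blast
    have FL: "norm (F (Complex 0 y) - L) \<le> C0 * exp (- y)" if "y \<ge> Y0" for y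
    proof -
      have "(\<lambda>n. F (Complex 0 y) - s n) \<longlonglongrightarrow> F (Complex 0 y) - L" by (intro tendsto_intros L)
      moreover have "\<forall>\<^sub>F n in sequentially. norm (F (Complex 0 y) - s n) \<le> C0 * exp (- y)"
        using eventually_ge_at_top[of "nat \<lceil>y\<rceil>"]
      proof eventually_elim
        case (elim n)
        hence "real n \<ge> y" by linarith
        thus ?case using v0[OF that, of "real n"] by (simp add: s_def norm_minus_commute)
      qed
      ultimately show ?thesis by (intro Lim_norm_ubound[of sequentially]) auto
    qed
    have "\<exists>Y>0. \<forall>w. \<bar>Re w\<bar> \<le> X \<and> Im w \<ge> Y \<longrightarrow> norm (P (act (\<sigma> c) w) - L) < e" if e: "e > 0" for X e
    proof -
      obtain C Y1 where C: "Y1 > 0" "\<And>w. \<bar>Re w\<bar> \<le> X \<Longrightarrow> Im w \<ge> Y1 \<Longrightarrow> norm (slash2 g (\<sigma> c) w) \<le> C * exp (- Im w)"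
        using g c unfolding decaying_def by metis
      have "\<forall>\<^sub>F y in at_top. (\<bar>C\<bar> * \<bar>X\<bar> + C0) * exp (- y) < e" using tend e by (intro order_tendstoD) auto
      then obtain Y2 where Y2: "\<And>y. y \<ge> Y2 \<Longrightarrow> (\<bar>C\<bar> * \<bar>X\<bar> + C0) * exp (- y) < e" by (auto simp: eventually_at_top_linorder)
      show ?thesis
      proof (intro exI[of _ "max Y0 (max Y1 Y2)"] conjI allI impI)
        show "max Y0 (max Y1 Y2) > 0" using C0 by simp
        fix w assume w: "\<bar>Re w\<bar> \<le> X \<and> max Y0 (max Y1 Y2) \<le> Im w"
        define y where "y = Im w"
        have y: "y \<ge> Y0" "y \<ge> Y1" "y \<ge> Y2" "y > 0" using w C0(1) by (auto simp: y_def)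
        have cs: "\<bar>Re u\<bar> \<le> X \<and> Im u = y" if "u \<in> closed_segment w (Complex 0 y)" for u
        proof -
          obtain t where t: "0 \<le> t" "t \<le> 1" "u = (1 - t) *\<^sub>R w + t *\<^sub>R Complex 0 y"
            using \<open>u \<in> _\<close> by (auto simp: in_segment)
          have "\<bar>Re u\<bar> = (1 - t) * \<bar>Re w\<bar>" using t by (simp add: abs_mult)
          also have "\<dots> \<le> 1 * \<bar>Re w\<bar>" using t by (intro mult_right_mono) auto
          finally have "\<bar>Re u\<bar> \<le> X" using w by simp
          moreover have "Im u = y" unfolding t(3) by (simp add: y_def algebra_simps)
          ultimately show ?thesis by simp
        qed
        have "norm (F w - F (Complex 0 y)) \<le> C * exp (- y) * norm (w - Complex 0 y)"
        proof (rule field_differentiable_bound[of "closed_segment w (Complex 0 y)" F "slash2 g (\<sigma> c)"])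
          fix u assume "u \<in> closed_segment w (Complex 0 y)"
          note u = cs[OF this]
          show "(F has_field_derivative slash2 g (\<sigma> c) u) (at u within closed_segment w (Complex 0 y))"
            by (rule has_field_derivative_at_within[OF F]) (use u y(4) in linarith)
          show "norm (slash2 g (\<sigma> c) u) \<le> C * exp (- y)" using C(2)[of u] u y(2) by simp
        qed auto
        also have "norm (w - Complex 0 y) = \<bar>Re w\<bar>" by (simp add: y_def cmod_def)
        also have "C * exp (- y) * \<bar>Re w\<bar> \<le> \<bar>C\<bar> * exp (- y) * \<bar>X\<bar>"
          using w by (intro mult_mono) auto
        finally have "norm (F w - L) \<le> \<bar>C\<bar> * exp (- y) * \<bar>X\<bar> + C0 * exp (- y)"
          using FL[OF y(1)] norm_triangle_ineq[of "F w - F (Complex 0 y)" "F (Complex 0 y) - L"] by simp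
        also have "\<dots> = (\<bar>C\<bar> * \<bar>X\<bar> + C0) * exp (- y)" by (simp add: algebra_simps)
        also have "\<dots> < e" using Y2 y by simp
        finally show "norm (P (act (\<sigma> c) w) - L) < e" by (simp add: F_def)
      qed
    qed
    thus ?thesis by blast
  qed
  then obtain L where L: "\<And>c X e. is_cusp \<Gamma> c \<Longrightarrow> e > 0 \<Longrightarrow> \<exists>Y>0. \<forall>w. \<bar>Re w\<bar> \<le> X \<and> Im w \<ge> Y \<longrightarrow> norm (P (act (\<sigma> c) w) - L c) < e"
    by metis
  define G where "G = (\<lambda>e. case e of Interior z \<Rightarrow> P z | Boundary c \<Rightarrow> L c)"
  have [simp]: "G (Interior z) = P z" "G (Boundary c) = L c" for z c by (simp_all add: G_def)
  have "P holomorphic_on upper_half_plane"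
    unfolding holomorphic_on_open[OF open_upper_half_plane] using P by (auto simp: upper_half_plane_def)
  hence "primitive_of g G" using P L by (auto simp: primitive_of_def regular_def)
  thus ?thesis by (rule that)
qed

end

section \<open>Integrals up to cusps\<close>

declare iterated_integral_rev.simps(2) [simp del]

context fuchsian_scaled
begin

lemma cusp_ray_eq:
  assumes "is_cusp \<Gamma> c"
  shows "cusp_ray \<sigma> c z t = act (\<sigma> c) (act (adj2 (\<sigma> c)) z + \<i> * of_real t)"
  by (simp add: cusp_ray_def matrix_inv_eq_adj2[OF det_scaling[OF assms]])

text \<open>The fundamental theorem of calculus on the ray, whose limit at infinity is
  \<open>G (Boundary c)\<close>. On the initial stretch the integrand is bounded by compactness,
  beyond it by decay; together this gives absolute integrability.\<close>

lemma end_integral_cusp: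
  assumes g: "decaying g" and G: "primitive_of g G" and c: "is_cusp \<Gamma> c" and z: "Im z > 0"
  shows "end_integral \<sigma> z (Boundary c) g = G (Boundary c) - G (Interior z)"
proof -
  have ds: "det (\<sigma> c) = 1" using det_scaling c by blast
  define u where "u = act (adj2 (\<sigma> c)) z"
  have u: "Im u > 0" using ds z by (simp add: u_def Im_act_pos)
  have zu: "act (\<sigma> c) u = z" using ds z by (simp add: u_def act_adj2)
  define ray where "ray = cusp_ray \<sigma> c z"
  have ray: "ray t = act (\<sigma> c) (u + \<i> * of_real t)" for t by (simp add: ray_def cusp_ray_eq[OF c] u_def)
  have lin: "((\<lambda>t. u + \<i> * of_real t) has_vector_derivative \<i>) (at t)" for t
    by (auto intro!: derivative_eq_intros)
  have Iu: "Im (u + \<i> * of_real t) > 0" if "t > - Im u" for t using that by simp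
  have dray: "(ray has_vector_derivative \<i> * (1 / (auto_factor (\<sigma> c) (u + \<i> * of_real t))\<^sup>2)) (at t)"
    if "t > - Im u" for t
    using field_vector_diff_chain_at[OF lin has_field_derivative_act[OF ds Iu[OF that]]]
    unfolding ray[abs_def] o_def .
  define h where "h = (\<lambda>t. slash2 g (\<sigma> c) (u + \<i> * of_real t) * \<i>)"
  have integrand: "g (ray t) * vector_derivative ray (at t) = h t" if "t > - Im u" for t
    using dray[OF that] by (simp add: vector_derivative_at h_def slash2_eq ray)
  have dG: "((\<lambda>t. G (Interior (ray t))) has_vector_derivative h t) (at t)" if "t > - Im u" for t
  proof -
    have "((\<lambda>z. G (Interior z)) has_field_derivative g (ray t)) (at (ray t))"
      using G Im_act_pos[OF ds Iu[OF that]] unfolding primitive_of_def ray by blast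
    from field_vector_diff_chain_at[OF dray[OF that] this] show ?thesis
      by (simp add: o_def h_def slash2_eq ray mult_ac)
  qed
  have conth: "continuous_on {- Im u <..} h"
  proof -
    have "slash2 g (\<sigma> c) holomorphic_on upper_half_plane"
      using g ds by (intro holomorphic_slash2) (auto simp: decaying_def)
    hence cs: "continuous_on upper_half_plane (slash2 g (\<sigma> c))" by (rule holomorphic_on_imp_continuous_on)
    have "continuous_on {- Im u <..} (\<lambda>t. slash2 g (\<sigma> c) (u + \<i> * of_real t))"
      by (rule continuous_on_compose2[OF cs]) (auto intro!: continuous_intros simp: upper_half_plane_def)
    thus ?thesis unfolding h_def by (intro continuous_intros)
  qed
  obtain C Y where CY: "Y > 0" "\<And>w. \<bar>Re w\<bar> \<le> \<bar>Re u\<bar> \<Longrightarrow> Im w \<ge> Y \<Longrightarrow> norm (slash2 g (\<sigma> c) w) \<le> C * exp (- Im w)"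
    using g c unfolding decaying_def by metis
  have "compact (h ` {0..Y})"
    using u conth by (intro compact_continuous_image) (auto elim!: continuous_on_subset)
  then obtain B where B: "\<And>t. t \<in> {0..Y} \<Longrightarrow> norm (h t) \<le> B"
    using compact_imp_bounded bounded_iff by (metis imageI)
  have bound: "norm (h t) \<le> (\<bar>B\<bar> * exp Y + \<bar>C\<bar>) * exp (- t)" if "t \<ge> 0" for t
  proof (cases "t \<le> Y")
    case True
    have "norm (h t) \<le> \<bar>B\<bar> * 1" using B[of t] that True by auto
    also have "\<dots> \<le> \<bar>B\<bar> * (exp Y * exp (- t))" using True by (intro mult_left_mono) (auto simp: exp_minus field_simps)
    also have "\<dots> \<le> (\<bar>B\<bar> * exp Y + \<bar>C\<bar>) * exp (- t)" by (simp add: algebra_simps)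
    finally show ?thesis .
  next
    case False
    have "norm (h t) \<le> C * exp (- (Im u + t))"
      using CY(2)[of "u + \<i> * of_real t"] False u by (simp add: h_def norm_mult)
    also have "\<dots> \<le> \<bar>C\<bar> * exp (- t)" using u by (intro mult_mono) auto
    also have "\<dots> \<le> (\<bar>B\<bar> * exp Y + \<bar>C\<bar>) * exp (- t)" by (simp add: algebra_simps)
    finally show ?thesis .
  qed
  have expint: "set_integrable lborel {0..} (\<lambda>t::real. exp (- t))"
  proof -
    have "((\<lambda>t. exp (- t)) has_integral 1) {0::real..}"
      using has_integral_exp_minus_to_infinity[of 1 0] by simp
    hence "(\<lambda>t. exp (- t)) absolutely_integrable_on {0::real..}"
      by (intro nonnegative_absolutely_integrable_1) (auto simp: has_integral_integrable)
    thus ?thesis by (simp add: set_integrable_def integrable_completion)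
  qed
  have meas: "set_borel_measurable lborel {0..} h"
  proof -
    have "continuous_on {0..} h" using conth by (rule continuous_on_subset) (use u in auto)
    thus ?thesis by (simp add: set_borel_measurable_def borel_measurable_continuous_on_indicator)
  qed
  have int: "set_integrable lborel {0..} h"
  proof (rule set_integrable_bound)
    show "set_integrable lborel {0..} (\<lambda>t. (\<bar>B\<bar> * exp Y + \<bar>C\<bar>) * exp (- t))"
      using expint by (rule set_integrable_mult_right[rotated])
    show "AE x in lborel. x \<in> {0..} \<longrightarrow> norm (h x) \<le> norm ((\<bar>B\<bar> * exp Y + \<bar>C\<bar>) * exp (- x))"
      using bound by (intro AE_I2) (auto intro: order.trans)
  qed (rule meas)
  have lim: "((\<lambda>t. G (Interior (ray t))) \<longlongrightarrow> G (Boundary c)) at_top"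
  proof (rule tendstoI)
    fix e :: real assume "e > 0"
    then obtain Y where Y: "Y > 0" "\<And>w. \<bar>Re w\<bar> \<le> \<bar>Re u\<bar> \<Longrightarrow> Im w \<ge> Y \<Longrightarrow>
        norm (G (Interior (act (\<sigma> c) w)) - G (Boundary c)) < e"
      using G c unfolding primitive_of_def regular_def by meson
    show "\<forall>\<^sub>F t in at_top. dist (G (Interior (ray t))) (G (Boundary c)) < e"
      using eventually_ge_at_top[of Y]
    proof eventually_elim
      case (elim t)
      thus ?case using Y(2)[of "u + \<i> * of_real t"] u by (simp add: ray dist_norm)
    qed
  qed
  have "(LBINT x=ereal 0..\<infinity>. h x) = G (Boundary c) - G (Interior (ray 0))"
  proof (rule interval_integral_FTC_integrable)
    show "ereal 0 < \<infinity>" by simp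
    show "((\<lambda>t. G (Interior (ray t))) has_vector_derivative h x) (at x)" if "ereal 0 < ereal x" for x
      using dG that u by simp
    show "isCont h x" if "ereal 0 < ereal x" for x
      using conth that u by (simp add: continuous_on_eq_continuous_at)
    show "set_integrable lborel (einterval (ereal 0) \<infinity>) h"
      using int by (rule set_integrable_subset) (auto simp: einterval_def)
    have "isCont (\<lambda>t. G (Interior (ray t))) 0"
      using dG[of 0] u has_vector_derivative_continuous by auto
    hence "((\<lambda>t. G (Interior (ray t))) \<longlongrightarrow> G (Interior (ray 0))) (at_right 0)"
      by (simp add: isCont_def filterlim_at_split)
    thus "(((\<lambda>t. G (Interior (ray t))) \<circ> real_of_ereal) \<longlongrightarrow> G (Interior (ray 0))) (at_right (ereal 0))"
      by (simp add: ereal_tendsto_simps1)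
    show "(((\<lambda>t. G (Interior (ray t))) \<circ> real_of_ereal) \<longlongrightarrow> G (Boundary c)) (at_left \<infinity>)"
      using lim by (simp add: ereal_tendsto_simps1)
  qed
  also have "(LBINT x=ereal 0..\<infinity>. h x) = (LBINT x:{0<..}. h x)"
    by (simp add: interval_lebesgue_integral_def einterval_def greaterThan_def)
  also have "\<dots> = (LBINT x:{0..}. h x)"
    unfolding set_lebesgue_integral_def
  proof (rule integral_cong_AE)
    show "AE x in lborel. indicat_real {0<..} x *\<^sub>R h x = indicat_real {0..} x *\<^sub>R h x"
      using AE_lborel_singleton[of 0] by eventually_elim (auto simp: indicator_def)
    show "(\<lambda>x. indicat_real {0<..} x *\<^sub>R h x) \<in> borel_measurable lborel"
    proof -
      have "set_borel_measurable lborel {0<..} h" by (rule set_borel_measurable_subset[OF meas]) auto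
      thus ?thesis by (simp add: set_borel_measurable_def)
    qed
    show "(\<lambda>x. indicat_real {0..} x *\<^sub>R h x) \<in> borel_measurable lborel"
      using meas by (simp add: set_borel_measurable_def)
  qed
  also have "\<dots> = (LBINT t:{0..}. g (ray t) * vector_derivative ray (at t))"
    using integrand u by (intro set_lebesgue_integral_cong) auto
  finally show ?thesis by (simp add: ray_def[symmetric] ray zu)
qed

lemma end_integral_eq:
  assumes "decaying g" "primitive_of g G" "is_endpoint \<Gamma> e" "attached z e" "Im z > 0"
  shows "end_integral \<sigma> z e g = G e - G (Interior z)"
  using assms by (cases e) (auto simp: end_integral_cusp simp del: end_integral.simps(2))

text \<open>The three contributions telescope for every admissible path, so the path picked by
  \<open>SOME\<close> does not influence the value.\<close>

lemma endpoint_integral_eq: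
  assumes g: "decaying g" and G: "primitive_of g G" and a: "is_endpoint \<Gamma> a" and b: "is_endpoint \<Gamma> b"
  shows "endpoint_integral \<sigma> a b g = G b - G a"
proof -
  \<comment> \<open>At a cusp the middle part may start anywhere; \<open>\<i>\<close> is an
    arbitrary point used to exhibit an admissible path.\<close>
  define q where "q = (\<lambda>e. case e of Interior z \<Rightarrow> z | Boundary c \<Rightarrow> \<i>)"
  have q: "Im (q e) > 0" "attached (q e) e" if "is_endpoint \<Gamma> e" for e
    using that by (auto simp: q_def upper_half_plane_def split: endpoint.splits)
  have "middle_path a b (linepath (q a) (q b))"
    using q[OF a] q[OF b] closed_segment_subset[OF _ _ convex_upper_half_plane, of "q a" "q b"]
    by (auto simp: middle_path_def upper_half_plane_def)
  hence ex: "\<exists>p. middle_path a b p" by blast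
  define p where "p = (SOME p. middle_path a b p)"
  have p: "valid_path p" "path_image p \<subseteq> upper_half_plane" "attached (pathstart p) a" "attached (pathfinish p) b"
    using someI_ex[OF ex] unfolding p_def middle_path_def by blast+
  have ends: "Im (pathstart p) > 0" "Im (pathfinish p) > 0"
    using p(2) pathstart_in_path_image[of p] pathfinish_in_path_image[of p] by (auto simp: upper_half_plane_def)
  have "(g has_contour_integral (G (Interior (pathfinish p)) - G (Interior (pathstart p)))) p"
  proof (rule contour_integral_primitive[where S = upper_half_plane, OF _ p(1,2)])
    fix z assume "z \<in> upper_half_plane"
    hence "((\<lambda>z. G (Interior z)) has_field_derivative g z) (at z)"
      using G by (simp add: primitive_of_def upper_half_plane_def)
    thus "((\<lambda>z. G (Interior z)) has_field_derivative g z) (at z within upper_half_plane)"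
      by (rule has_field_derivative_at_within)
  qed
  hence "contour_integral p g = G (Interior (pathfinish p)) - G (Interior (pathstart p))"
    by (rule contour_integral_unique)
  thus ?thesis
    unfolding endpoint_integral_def Let_def p_def[symmetric]
    using end_integral_eq[OF g G a p(3) ends(1)] end_integral_eq[OF g G b p(4) ends(2)] by simp
qed

section \<open>Closure properties of regular functions and the laws of iterated integrals\<close>

lemma regularD:
  assumes "regular G" "is_cusp \<Gamma> c" "e > 0"
  shows "\<exists>Y>0. \<forall>w. \<bar>Re w\<bar> \<le> X \<and> Im w \<ge> Y \<longrightarrow> norm (G (Interior (act (\<sigma> c) w)) - G (Boundary c)) < e"
  using assms unfolding regular_def by blast

lemma regular_const: "regular (\<lambda>e. k)"
  unfolding regular_def by (auto intro: exI[of _ 1])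

lemma regular_add:
  assumes "regular G" "regular H"
  shows "regular (\<lambda>e. G e + H e)"
  unfolding regular_def
proof (intro conjI allI impI)
  show "(\<lambda>z. G (Interior z) + H (Interior z)) holomorphic_on upper_half_plane"
    using assms unfolding regular_def by (intro holomorphic_intros) auto
  fix c X and e :: real assume c: "is_cusp \<Gamma> c" and e: "e > 0"
  obtain Y1 where Y1: "Y1 > 0" "\<And>w. \<bar>Re w\<bar> \<le> X \<Longrightarrow> Im w \<ge> Y1 \<Longrightarrow> norm (G (Interior (act (\<sigma> c) w)) - G (Boundary c)) < e / 2"
    using assms(1) c e unfolding regular_def by (meson half_gt_zero)
  obtain Y2 where Y2: "Y2 > 0" "\<And>w. \<bar>Re w\<bar> \<le> X \<Longrightarrow> Im w \<ge> Y2 \<Longrightarrow> norm (H (Interior (act (\<sigma> c) w)) - H (Boundary c)) < e / 2"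
    using assms(2) c e unfolding regular_def by (meson half_gt_zero)
  show "\<exists>Y>0. \<forall>w. \<bar>Re w\<bar> \<le> X \<and> Im w \<ge> Y \<longrightarrow>
     norm (G (Interior (act (\<sigma> c) w)) + H (Interior (act (\<sigma> c) w)) - (G (Boundary c) + H (Boundary c))) < e"
  proof (intro exI[of _ "max Y1 Y2"] conjI allI impI)
    fix w assume w: "\<bar>Re w\<bar> \<le> X \<and> max Y1 Y2 \<le> Im w"
    have "norm ((G (Interior (act (\<sigma> c) w)) - G (Boundary c)) + (H (Interior (act (\<sigma> c) w)) - H (Boundary c))) < e/2 + e/2"
      using w by (intro norm_add_less Y1 Y2) auto
    thus "norm (G (Interior (act (\<sigma> c) w)) + H (Interior (act (\<sigma> c) w)) - (G (Boundary c) + H (Boundary c))) < e"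
      by (simp add: algebra_simps)
  qed (use Y1 in simp)
qed

lemma regular_cmult:
  assumes "regular G"
  shows "regular (\<lambda>e. k * G e)"
  unfolding regular_def
proof (intro conjI allI impI)
  show "(\<lambda>z. k * G (Interior z)) holomorphic_on upper_half_plane"
    using assms unfolding regular_def by (intro holomorphic_intros) auto
  fix c X and e :: real assume c: "is_cusp \<Gamma> c" and e: "e > 0"
  have "e / (norm k + 1) > 0" using e by (simp add: add_nonneg_pos)
  then obtain Y1 where Y1: "Y1 > 0" "\<And>w. \<bar>Re w\<bar> \<le> X \<Longrightarrow> Im w \<ge> Y1 \<Longrightarrow>
      norm (G (Interior (act (\<sigma> c) w)) - G (Boundary c)) < e / (norm k + 1)"
    using assms(1) c unfolding regular_def by meson
  show "\<exists>Y>0. \<forall>w. \<bar>Re w\<bar> \<le> X \<and> Im w \<ge> Y \<longrightarrow>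
     norm (k * G (Interior (act (\<sigma> c) w)) - k * G (Boundary c)) < e"
  proof (intro exI[of _ Y1] conjI allI impI)
    fix w assume w: "\<bar>Re w\<bar> \<le> X \<and> Y1 \<le> Im w"
    let ?d = "norm (G (Interior (act (\<sigma> c) w)) - G (Boundary c))"
    have "norm (k * G (Interior (act (\<sigma> c) w)) - k * G (Boundary c)) = norm k * ?d"
      by (simp add: right_diff_distrib[symmetric] norm_mult)
    also have "\<dots> \<le> (norm k + 1) * ?d" by (intro mult_right_mono) auto
    also have "\<dots> < e"
    proof -
      have "norm k + 1 > 0" by (simp add: add_nonneg_pos)
      moreover have "?d < e / (norm k + 1)" using Y1(2) w by blast
      ultimately show ?thesis by (simp only: pos_less_divide_eq mult.commute)
    qed
    finally show "norm (k * G (Interior (act (\<sigma> c) w)) - k * G (Boundary c)) < e" .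
  qed (use Y1 in simp)
qed

lemma regular_sum: "finite A \<Longrightarrow> (\<And>i. i \<in> A \<Longrightarrow> regular (G i)) \<Longrightarrow> regular (\<lambda>e. \<Sum>i\<in>A. G i e)"
  by (induction A rule: finite_induct) (auto intro: regular_const regular_add)

lemma regular_cong:
  assumes "regular G" "\<And>e. is_endpoint \<Gamma> e \<Longrightarrow> H e = G e"
  shows "regular H"
proof -
  have i: "H (Interior z) = G (Interior z)" if "z \<in> upper_half_plane" for z using assms(2)[of "Interior z"] that by simp
  have b: "H (Boundary c) = G (Boundary c)" if "is_cusp \<Gamma> c" for c using assms(2)[of "Boundary c"] that by simp
  show ?thesis
    unfolding regular_def
  proof (intro conjI allI impI)
    have "(\<lambda>z. G (Interior z)) holomorphic_on upper_half_plane" using assms(1) by (simp add: regular_def)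
    thus "(\<lambda>z. H (Interior z)) holomorphic_on upper_half_plane"
      by (rule holomorphic_transform) (simp add: i)
    fix c X and e :: real assume c: "is_cusp \<Gamma> c" and e: "e > 0"
    obtain Y where Y: "Y > 0" "\<And>w. \<bar>Re w\<bar> \<le> X \<Longrightarrow> Im w \<ge> Y \<Longrightarrow> norm (G (Interior (act (\<sigma> c) w)) - G (Boundary c)) < e"
      using assms(1) c e unfolding regular_def by meson
    show "\<exists>Y>0. \<forall>w. \<bar>Re w\<bar> \<le> X \<and> Im w \<ge> Y \<longrightarrow> norm (H (Interior (act (\<sigma> c) w)) - H (Boundary c)) < e"
    proof (intro exI[of _ Y] conjI allI impI)
      fix w assume w: "\<bar>Re w\<bar> \<le> X \<and> Y \<le> Im w"
      have "act (\<sigma> c) w \<in> upper_half_plane"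
        using w Y(1) by (intro act_upper det_scaling c) (auto simp: upper_half_plane_def)
      thus "norm (H (Interior (act (\<sigma> c) w)) - H (Boundary c)) < e" using Y(2) w by (simp add: i b[OF c])
    qed (rule Y(1))
  qed
qed

text \<open>In the coordinates at c and at its image, \<gamma> becomes a matrix \<open>U\<close>
  fixing \<open>Infty\<close>, that is, an affine map \<open>w \<mapsto> m * w + t\<close> with
  \<open>m > 0\<close>. It carries the high part of a strip into the high part of another
  strip.\<close>

lemma regular_act:
  assumes G: "regular G" and \<gamma>: "\<gamma> \<in> \<Gamma>"
  shows "regular (\<lambda>e. G (act_endpoint \<gamma> e))"
  unfolding regular_def
proof (intro conjI allI impI)
  have d: "det \<gamma> = 1" using \<gamma> det_1 by blast
  have "act \<gamma> holomorphic_on upper_half_plane"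
    unfolding holomorphic_on_open[OF open_upper_half_plane]
    using has_field_derivative_act[OF d] by (auto simp: upper_half_plane_def)
  hence "((\<lambda>z. G (Interior z)) \<circ> act \<gamma>) holomorphic_on upper_half_plane"
    using G act_upper[OF d]
    by (intro holomorphic_on_compose_gen[of "act \<gamma>" _ _ upper_half_plane]) (auto simp: regular_def)
  thus "(\<lambda>z. G (act_endpoint \<gamma> (Interior z))) holomorphic_on upper_half_plane" by (simp add: o_def)
  fix c X and e :: real assume c: "is_cusp \<Gamma> c" and e: "e > 0"
  define c' where "c' = act_proj \<gamma> c"
  have c': "is_cusp \<Gamma> c'" using is_cusp_act[OF c \<gamma>] by (simp add: c'_def)
  have ds: "det (\<sigma> c) = 1" "det (\<sigma> c') = 1" using det_scaling c c' by auto
  define U where "U = adj2 (\<sigma> c') ** \<gamma> ** \<sigma> c"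
  have dU: "det U = 1" using ds d by (simp add: U_def det_mul)
  have da: "det (adj2 (\<sigma> c')) = 1" using ds by simp
  have "act_proj U Infty = act_proj (adj2 (\<sigma> c')) (act_proj \<gamma> (act_proj (\<sigma> c) Infty))"
    by (simp only: U_def act_proj_mult[OF det_mult2[OF da d] ds(1)] act_proj_mult[OF da d])
  also have "\<dots> = act_proj (adj2 (\<sigma> c')) (act_proj (\<sigma> c') Infty)"
    by (simp only: scaling_Infty[OF c] scaling_Infty[OF c'] c'_def[symmetric])
  also have "\<dots> = act_proj (adj2 (\<sigma> c') ** \<sigma> c') Infty" by (rule act_proj_mult[OF da ds(2), symmetric])
  also have "\<dots> = Infty" by (simp only: adj2_mult[OF ds(2)] act_proj_one)
  finally have U21: "U$2$1 = 0" by (simp split: if_splits)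
  have U1: "U$1$1 * U$2$2 = 1" using dU U21 by (simp add: det_2)
  define m t where "m = (U$1$1)\<^sup>2" and "t = U$1$1 * U$1$2"
  have m: "m > 0" using U1 by (auto simp: m_def)
  have actU: "act U w = of_real m * w + of_real t" for w
  proof -
    have nz: "U$1$1 \<noteq> 0" using U1 by auto
    have u2: "U$2$2 = 1 / U$1$1" using U1 nz by (simp add: nonzero_eq_divide_eq mult.commute)
    show ?thesis unfolding act_eq auto_factor_def U21 m_def t_def u2 using nz
      by (simp add: power2_eq_square field_simps)
  qed
  have rel: "act \<gamma> (act (\<sigma> c) w) = act (\<sigma> c') (act U w)" if "Im w > 0" for w
    using that ds d by (simp add: U_def act_mult det_mult2 Im_act_pos act_adj2)
  obtain Y where Y: "Y > 0" "\<And>w. \<bar>Re w\<bar> \<le> m * X + \<bar>t\<bar> \<Longrightarrow> Im w \<ge> Y \<Longrightarrow> norm (G (Interior (act (\<sigma> c') w)) - G (Boundary c')) < e"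
    using G c' e unfolding regular_def by meson
  show "\<exists>Y>0. \<forall>w. \<bar>Re w\<bar> \<le> X \<and> Im w \<ge> Y \<longrightarrow>
     norm (G (act_endpoint \<gamma> (Interior (act (\<sigma> c) w))) - G (act_endpoint \<gamma> (Boundary c))) < e"
  proof (intro exI[of _ "Y / m"] conjI allI impI)
    show "Y / m > 0" using Y m by simp
    fix w assume w: "\<bar>Re w\<bar> \<le> X \<and> Y / m \<le> Im w"
    have Iw: "Im w > 0" using w \<open>Y / m > 0\<close> by linarith
    have "\<bar>Re (act U w)\<bar> \<le> m * \<bar>Re w\<bar> + \<bar>t\<bar>"
      using abs_triangle_ineq[of "m * Re w" t] m by (simp add: actU abs_mult)
    also have "\<dots> \<le> m * X + \<bar>t\<bar>" using w m by simp
    finally have "\<bar>Re (act U w)\<bar> \<le> m * X + \<bar>t\<bar>" .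
    moreover have "Im (act U w) \<ge> Y" using w m by (simp add: actU field_simps)
    ultimately show "norm (G (act_endpoint \<gamma> (Interior (act (\<sigma> c) w))) - G (act_endpoint \<gamma> (Boundary c))) < e"
      using Y(2) by (simp add: rel[OF Iw] c'_def[symmetric])
  qed
qed

text \<open>The difference is constant on the half plane, and its value at a cusp is a limit of
  interior values, hence the same constant. All identities between iterated integrals are reduced to
  this.\<close>

lemma primitive_unique:
  assumes "primitive_of g G" "primitive_of g H" "is_endpoint \<Gamma> a" "G a = H a" "is_endpoint \<Gamma> e"
  shows "G e = H e"
proof -
  define D where "D = (\<lambda>e. G e + (-1) * H e)"
  have D: "regular D" using assms unfolding D_def primitive_of_def by (intro regular_add regular_cmult) auto
  have "((\<lambda>z. D (Interior z)) has_field_derivative 0) (at z)" if "Im z > 0" for z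
    using DERIV_diff[of "\<lambda>z. G (Interior z)" "g z" z UNIV "\<lambda>z. H (Interior z)" "g z"] assms(1,2) that
    by (simp add: D_def primitive_of_def)
  hence "\<exists>k. \<forall>z\<in>upper_half_plane. D (Interior z) = k"
    by (intro has_field_derivative_zero_constant[OF convex_upper_half_plane])
       (auto intro: has_field_derivative_at_within simp: upper_half_plane_def)
  then obtain k where k: "\<And>z. z \<in> upper_half_plane \<Longrightarrow> D (Interior z) = k" by blast
  have "D e = k" if "is_endpoint \<Gamma> e" for e
  proof (cases e)
    case (Boundary c)
    hence c: "is_cusp \<Gamma> c" using that by simp
    have "norm (k - D (Boundary c)) < \<epsilon>" if pos: "\<epsilon> > 0" for \<epsilon>
    proof -
      obtain Y where Y: "Y > 0" "\<And>w. \<bar>Re w\<bar> \<le> 0 \<Longrightarrow> Im w \<ge> Y \<Longrightarrow> norm (D (Interior (act (\<sigma> c) w)) - D (Boundary c)) < \<epsilon>"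
        using regularD[OF D c pos, of 0] by blast
      have "act (\<sigma> c) (Complex 0 Y) \<in> upper_half_plane"
        using Y det_scaling[OF c] by (intro act_upper) (auto simp: upper_half_plane_def)
      thus ?thesis using Y(2)[of "Complex 0 Y"] k by simp
    qed
    hence "norm (k - D (Boundary c)) \<le> 0" by (meson less_irrefl not_le)
    thus ?thesis using Boundary by simp
  qed (use k that in simp)
  from this[OF assms(3)] this[OF assms(5)] assms(4) show ?thesis by (simp add: D_def)
qed

text \<open>Both facts go through the induction together: regularity of the inner integral makes the
  next integrand decaying, and this is what provides the next primitive.\<close>

lemma iterated_integral_rev_primitive:
  assumes "is_endpoint \<Gamma> a" "\<And>f. f \<in> set L \<Longrightarrow> cusp_form \<Gamma> \<sigma> f"
  shows "regular (iterated_integral_rev \<sigma> a L) \<and>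
    (\<forall>f gs. L = f # gs \<longrightarrow>
      primitive_of (\<lambda>z. f z * iterated_integral_rev \<sigma> a gs (Interior z)) (iterated_integral_rev \<sigma> a L) \<and>
      iterated_integral_rev \<sigma> a L a = 0)"
  using assms(2)
proof (induction L)
  case Nil
  have "regular (iterated_integral_rev \<sigma> a [])" by (rule regular_cong[OF regular_const[of 1]]) simp
  thus ?case by (auto simp del: iterated_integral_rev.simps)
next
  case (Cons f gs)
  let ?g = "\<lambda>z. f z * iterated_integral_rev \<sigma> a gs (Interior z)"
  have dec: "decaying ?g" using Cons by (intro decaying_mult) auto
  then obtain G where G: "primitive_of ?g G" by (rule primitive_exists)
  \<comment> \<open>The iterated integral is the primitive normalised to vanish at the base
    point.\<close>
  have eq: "iterated_integral_rev \<sigma> a (f # gs) e = G e + (- G a)" if "is_endpoint \<Gamma> e" for e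
    using endpoint_integral_eq[OF dec G assms(1) that] by (simp add: iterated_integral_rev.simps(2))
  have reg: "regular (iterated_integral_rev \<sigma> a (f # gs))"
    by (rule regular_cong[OF regular_add[OF _ regular_const] eq]) (use G in \<open>simp add: primitive_of_def\<close>)
  have "((\<lambda>z. iterated_integral_rev \<sigma> a (f # gs) (Interior z)) has_field_derivative ?g z) (at z)" if z: "Im z > 0" for z
  proof -
    have "((\<lambda>z. G (Interior z) + (- G a)) has_field_derivative ?g z + 0) (at z)"
      using G z by (intro DERIV_add) (auto simp: primitive_of_def)
    hence d: "((\<lambda>z. G (Interior z) + (- G a)) has_field_derivative ?g z) (at z)" by simp
    have zu: "z \<in> upper_half_plane" using z by (simp add: upper_half_plane_def)
    show ?thesis
    proof (rule has_field_derivative_transform_within_open[OF d open_upper_half_plane zu])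
      fix w assume "w \<in> upper_half_plane"
      thus "G (Interior w) + (- G a) = iterated_integral_rev \<sigma> a (f # gs) (Interior w)"
        using eq[of "Interior w"] by simp
    qed
  qed
  hence "primitive_of ?g (iterated_integral_rev \<sigma> a (f # gs))" using reg by (simp add: primitive_of_def)
  moreover have "iterated_integral_rev \<sigma> a (f # gs) a = 0" using eq[OF assms(1)] by simp
  ultimately show ?case using reg by blast
qed

lemma iterated_regular:
  assumes "is_endpoint \<Gamma> a" "\<And>f. f \<in> set L \<Longrightarrow> cusp_form \<Gamma> \<sigma> f"
  shows "regular (iterated_integral_rev \<sigma> a L)"
  using assms by (rule iterated_integral_rev_primitive[THEN conjunct1])

lemma iterated_primitive:
  assumes "is_endpoint \<Gamma> a" "\<And>h. h \<in> set (f # gs) \<Longrightarrow> cusp_form \<Gamma> \<sigma> h"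
  shows "primitive_of (\<lambda>z. f z * iterated_integral_rev \<sigma> a gs (Interior z)) (iterated_integral_rev \<sigma> a (f # gs))"
    "iterated_integral_rev \<sigma> a (f # gs) a = 0"
proof -
  have "\<forall>f' gs'. f # gs = f' # gs' \<longrightarrow>
      primitive_of (\<lambda>z. f' z * iterated_integral_rev \<sigma> a gs' (Interior z)) (iterated_integral_rev \<sigma> a (f # gs)) \<and>
      iterated_integral_rev \<sigma> a (f # gs) a = 0"
    using assms by (intro iterated_integral_rev_primitive[THEN conjunct2]) blast+
  from this[THEN spec, THEN spec, THEN mp, OF refl]
  show "primitive_of (\<lambda>z. f z * iterated_integral_rev \<sigma> a gs (Interior z)) (iterated_integral_rev \<sigma> a (f # gs))"
    "iterated_integral_rev \<sigma> a (f # gs) a = 0" by (rule conjunct1, rule conjunct2)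
qed

text \<open>Induction on the outermost form: as functions of e both sides are primitives of the same
  integrand, by the induction hypothesis under the integral, and they agree at \<open>e = b\<close>.
  The list is reversed, so \<open>take k\<close> contains the outer forms, integrated from
  b.\<close>

lemma iterated_integral_compose:
  assumes "is_endpoint \<Gamma> a" "is_endpoint \<Gamma> b" "\<And>h. h \<in> set L \<Longrightarrow> cusp_form \<Gamma> \<sigma> h" "is_endpoint \<Gamma> e"
  shows "iterated_integral_rev \<sigma> a L e =
    (\<Sum>k\<le>length L. iterated_integral_rev \<sigma> b (take k L) e * iterated_integral_rev \<sigma> a (drop k L) b)"
  using assms(3,4)
proof (induction L arbitrary: e)
  case (Cons f gs)
  let ?J = "iterated_integral_rev \<sigma>"
  define R where "R = (\<lambda>e. ?J a (f # gs) b + (\<Sum>k\<le>length gs. ?J a (drop k gs) b * ?J b (f # take k gs) e))"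
  have split: "(\<Sum>k\<le>length (f # gs). ?J b (take k (f # gs)) e * ?J a (drop k (f # gs)) b) = R e" for e
    unfolding R_def length_Cons by (subst sum.atMost_Suc_shift) (simp add: mult.commute)
  have prim: "primitive_of (\<lambda>z. f z * ?J b (take k gs) (Interior z)) (?J b (f # take k gs))" for k
    using Cons.prems assms by (intro iterated_primitive) (auto dest: in_set_takeD)
  have regR: "regular R" unfolding R_def
    using prim by (intro regular_add regular_const regular_sum regular_cmult) (auto simp: primitive_of_def)
  have derR: "((\<lambda>z. R (Interior z)) has_field_derivative f z * ?J a gs (Interior z)) (at z)" if z: "Im z > 0" for z
  proof -
    have "((\<lambda>z. R (Interior z)) has_field_derivative
       0 + (\<Sum>k\<le>length gs. ?J a (drop k gs) b * (f z * ?J b (take k gs) (Interior z)))) (at z)"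
      unfolding R_def using prim z
      by (intro DERIV_add DERIV_const DERIV_sum DERIV_cmult) (auto simp: primitive_of_def)
    moreover have "(\<Sum>k\<le>length gs. ?J a (drop k gs) b * (f z * ?J b (take k gs) (Interior z)))
        = f z * ?J a gs (Interior z)"
      using Cons.IH[of "Interior z"] Cons.prems z
      by (simp add: upper_half_plane_def sum_distrib_left mult_ac)
    ultimately show ?thesis by simp
  qed
  have "?J a (f # gs) e = R e"
  proof (rule primitive_unique[OF _ _ assms(2) _ Cons.prems(2)])
    show "primitive_of (\<lambda>z. f z * ?J a gs (Interior z)) (?J a (f # gs))"
      using Cons.prems assms by (intro iterated_primitive) auto
    show "primitive_of (\<lambda>z. f z * ?J a gs (Interior z)) R" using regR derR by (simp add: primitive_of_def)
    \<comment> \<open>At \<open>e = b\<close> every integral from b vanishes, leaving the constant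
      term, which is the summand with no outer form.\<close>
    have "?J b (f # take k gs) b = 0" for k
      using Cons.prems assms by (intro iterated_primitive) (auto dest: in_set_takeD)
    thus "?J a (f # gs) b = R b" by (simp add: R_def)
  qed
  thus ?case unfolding split .
qed simp

text \<open>Again uniqueness of primitives, with base point a, where both sides vanish; the weight 2
  law cancels the derivative of \<open>act \<gamma>\<close>.\<close>

lemma iterated_integral_act:
  assumes "is_endpoint \<Gamma> a" "\<gamma> \<in> \<Gamma>" "\<And>h. h \<in> set L \<Longrightarrow> cusp_form \<Gamma> \<sigma> h" "is_endpoint \<Gamma> e"
  shows "iterated_integral_rev \<sigma> (act_endpoint \<gamma> a) L (act_endpoint \<gamma> e) = iterated_integral_rev \<sigma> a L e"
  using assms(3,4)
proof (induction L arbitrary: e)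
  case (Cons f gs)
  let ?J = "iterated_integral_rev \<sigma>"
  have d: "det \<gamma> = 1" using assms(2) det_1 by blast
  have ga: "is_endpoint \<Gamma> (act_endpoint \<gamma> a)" using assms is_endpoint_act by blast
  have prim: "primitive_of (\<lambda>z. f z * ?J (act_endpoint \<gamma> a) gs (Interior z)) (?J (act_endpoint \<gamma> a) (f # gs))"
    using Cons.prems ga by (intro iterated_primitive) auto
  define R where "R = (\<lambda>e. ?J (act_endpoint \<gamma> a) (f # gs) (act_endpoint \<gamma> e))"
  have regR: "regular R" unfolding R_def using prim assms(2) by (intro regular_act) (auto simp: primitive_of_def)
  have derR: "((\<lambda>z. R (Interior z)) has_field_derivative f z * ?J a gs (Interior z)) (at z)" if z: "Im z > 0" for z
  proof -
    have "((\<lambda>z. ?J (act_endpoint \<gamma> a) (f # gs) (Interior z)) has_field_derivative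
         f (act \<gamma> z) * ?J (act_endpoint \<gamma> a) gs (Interior (act \<gamma> z))) (at (act \<gamma> z))"
      using prim z d Im_act_pos unfolding primitive_of_def by blast
    from DERIV_chain2[OF this has_field_derivative_act[OF d z]]
    have "((\<lambda>z. R (Interior z)) has_field_derivative
        f (act \<gamma> z) * ?J (act_endpoint \<gamma> a) gs (Interior (act \<gamma> z)) * (1 / (auto_factor \<gamma> z)\<^sup>2)) (at z)"
      by (simp add: R_def)
    moreover have "?J (act_endpoint \<gamma> a) gs (Interior (act \<gamma> z)) = ?J a gs (Interior z)"
      using Cons.IH[of "Interior z"] Cons.prems z by (simp add: upper_half_plane_def)
    moreover have "f (act \<gamma> z) / (auto_factor \<gamma> z)\<^sup>2 = f z"
      using Cons.prems(1)[of f] assms(2) z unfolding cusp_form_def slash2_eq by (simp add: upper_half_plane_def)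
    ultimately show ?thesis by (simp add: mult_ac) (metis times_divide_eq_right mult.commute)
  qed
  have "R e = ?J a (f # gs) e"
  proof (rule primitive_unique[OF _ _ assms(1) _ Cons.prems(2)])
    show "primitive_of (\<lambda>z. f z * ?J a gs (Interior z)) (?J a (f # gs))"
      using Cons.prems assms by (intro iterated_primitive) auto
    show "primitive_of (\<lambda>z. f z * ?J a gs (Interior z)) R" using regR derR by (simp add: primitive_of_def)
    have "?J (act_endpoint \<gamma> a) (f # gs) (act_endpoint \<gamma> a) = 0" "?J a (f # gs) a = 0"
      using Cons.prems assms ga by (auto intro!: iterated_primitive)
    thus "R a = ?J a (f # gs) a" by (simp add: R_def)
  qed
  thus ?case by (simp only: R_def)
qed simp

end

section \<open>Generating series\<close>

definition nc_one :: nc_series where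
  "nc_one w = (if w = [] then 1 else 0)"

lemma nc_mult_one_right: "nc_mult A nc_one = A"
proof
  fix w
  have "nc_mult A nc_one w = (\<Sum>k\<in>{length w}. A (take k w) * nc_one (drop k w))"
    unfolding nc_mult_def by (rule sum.mono_neutral_right) (auto simp: nc_one_def)
  thus "nc_mult A nc_one w = A w" by (simp add: nc_one_def)
qed

locale fuchsian_forms = fuchsian_scaled +
  fixes fs :: "(complex \<Rightarrow> complex) list"
  assumes forms: "f \<in> set fs \<Longrightarrow> cusp_form \<Gamma> \<sigma> f"
begin

abbreviation gen :: "endpoint \<Rightarrow> endpoint \<Rightarrow> nc_series" where
  "gen \<equiv> gen_series \<sigma> fs"

lemma gen_series_eq:
  "set w \<subseteq> {..<length fs} \<Longrightarrow> gen a b w = iterated_integral_rev \<sigma> a (rev (map (\<lambda>i. fs ! i) w)) b"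
  by (simp add: gen_series_def iterated_integral_def)

lemma forms_word: "set w \<subseteq> {..<length fs} \<Longrightarrow> h \<in> set (rev (map (\<lambda>i. fs ! i) w)) \<Longrightarrow> cusp_form \<Gamma> \<sigma> h"
  using forms by auto

lemma gen_series_compose:
  assumes "is_endpoint \<Gamma> a" "is_endpoint \<Gamma> b" "is_endpoint \<Gamma> c"
  shows "gen a c = nc_mult (gen a b) (gen b c)"
proof
  fix w
  show "gen a c w = nc_mult (gen a b) (gen b c) w"
  proof (cases "set w \<subseteq> {..<length fs}")
    case True
    define L where "L = rev (map (\<lambda>i. fs ! i) w)"
    define n where "n = length w"
    have n: "length L = n" by (simp add: L_def n_def)
    have "gen a c w = (\<Sum>k\<le>n. iterated_integral_rev \<sigma> b (take k L) c * iterated_integral_rev \<sigma> a (drop k L) b)"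
      unfolding gen_series_eq[OF True] L_def[symmetric] n[symmetric]
      using assms forms_word[OF True] unfolding L_def by (intro iterated_integral_compose)
    \<comment> \<open>Words are reversed before integration, so a prefix of the word is a suffix of
      \<open>L\<close>; the summation index is reflected accordingly.\<close>
    also have "\<dots> = (\<Sum>k\<le>n. iterated_integral_rev \<sigma> b (take (n - k) L) c * iterated_integral_rev \<sigma> a (drop (n - k) L) b)"
      by (rule sum.reindex_bij_witness[of _ "\<lambda>k. n - k" "\<lambda>k. n - k"]) auto
    also have "\<dots> = nc_mult (gen a b) (gen b c) w"
      unfolding nc_mult_def n_def[symmetric]
    proof (rule sum.cong[OF refl])
      fix k assume "k \<in> {..n}"
      have s: "set (take k w) \<subseteq> {..<length fs}" "set (drop k w) \<subseteq> {..<length fs}"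
        using True set_take_subset set_drop_subset by fast+
      have "rev (map ((!) fs) (take k w)) = drop (n - k) L" "rev (map ((!) fs) (drop k w)) = take (n - k) L"
        by (simp_all add: L_def n_def take_map[symmetric] drop_map[symmetric] rev_take rev_drop)
      thus "iterated_integral_rev \<sigma> b (take (n - k) L) c * iterated_integral_rev \<sigma> a (drop (n - k) L) b =
          gen a b (take k w) * gen b c (drop k w)"
        by (simp add: gen_series_eq s mult.commute)
    qed
    finally show ?thesis .
  next
    case False
    \<comment> \<open>A letter out of range lands in one of the two parts, whose coefficient is 0 by
      default.\<close>
    have "gen a b (take k w) * gen b c (drop k w) = 0" for k
    proof -
      have "set w = set (take k w) \<union> set (drop k w)" by (metis append_take_drop_id set_append)
      hence "\<not> set (take k w) \<subseteq> {..<length fs} \<or> \<not> set (drop k w) \<subseteq> {..<length fs}" using False by auto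
      thus ?thesis by (auto simp: gen_series_def)
    qed
    hence "nc_mult (gen a b) (gen b c) w = 0" unfolding nc_mult_def by (intro sum.neutral) blast
    moreover have "gen a c w = 0" using False by (simp add: gen_series_def)
    ultimately show ?thesis by simp
  qed
qed

lemma gen_series_act:
  assumes "is_endpoint \<Gamma> a" "is_endpoint \<Gamma> b" "\<gamma> \<in> \<Gamma>"
  shows "gen (act_endpoint \<gamma> a) (act_endpoint \<gamma> b) = gen a b"
proof
  fix w
  show "gen (act_endpoint \<gamma> a) (act_endpoint \<gamma> b) w = gen a b w"
  proof (cases "set w \<subseteq> {..<length fs}")
    case True
    thus ?thesis unfolding gen_series_eq[OF True]
      using assms forms_word[OF True] by (intro iterated_integral_act) auto
  qed (simp add: gen_series_def)
qed

lemma gen_series_self: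
  assumes "is_endpoint \<Gamma> a"
  shows "gen a a = nc_one"
proof
  fix w
  show "gen a a w = nc_one w"
  proof (cases "set w \<subseteq> {..<length fs} \<and> w \<noteq> []")
    case True
    then obtain f gs where fg: "rev (map (\<lambda>i. fs ! i) w) = f # gs" by (metis list.map_disc_iff neq_Nil_conv rev_is_Nil_conv)
    have "gen a a w = iterated_integral_rev \<sigma> a (f # gs) a" using gen_series_eq[of w] True fg by simp
    also have "\<dots> = 0" using assms forms_word[of w] True fg by (intro iterated_primitive(2)) auto
    finally show ?thesis using True by (simp add: nc_one_def)
  qed (auto simp: gen_series_def nc_one_def iterated_integral_def)
qed

lemma gen_series_stabilizer:
  assumes "is_endpoint \<Gamma> a" "is_cusp \<Gamma> b" "\<tau> \<in> cusp_stabilizer \<Gamma> b"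
  shows "gen (act_endpoint \<tau> a) a = nc_one"
proof -
  have t: "\<tau> \<in> \<Gamma>" "act_endpoint \<tau> (Boundary b) = Boundary b" using cusp_stabilizerD[OF assms(3)] by auto
  have e: "is_endpoint \<Gamma> (act_endpoint \<tau> a)" "is_endpoint \<Gamma> (Boundary b)"
    using is_endpoint_act[OF assms(1) t(1)] assms(2) by auto
  have "gen (act_endpoint \<tau> a) a = nc_mult (gen (act_endpoint \<tau> a) (act_endpoint \<tau> (Boundary b))) (gen (Boundary b) a)"
    unfolding t(2) using e assms(1) by (intro gen_series_compose)
  also have "\<dots> = nc_mult (gen a (Boundary b)) (gen (Boundary b) a)"
    unfolding gen_series_act[OF assms(1) e(2) t(1)] ..
  also have "\<dots> = gen a a" using e assms(1) by (intro gen_series_compose[symmetric])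
  finally show ?thesis using gen_series_self[OF assms(1)] by simp
qed

text \<open>The path from \<gamma>a to a is split at \<gamma>\<delta>a, and its first piece is moved
  back by \<gamma>. The left factor is then independent of \<gamma> and can be taken out of the
  Eisenstein series.\<close>

lemma gen_series_shift:
  assumes "is_endpoint \<Gamma> a" "\<gamma> \<in> \<Gamma>" "\<delta> \<in> \<Gamma>"
  shows "gen (act_endpoint \<gamma> a) a = nc_mult (gen a (act_endpoint \<delta> a)) (gen (act_endpoint (\<gamma> ** \<delta>) a) a)"
proof -
  have e: "is_endpoint \<Gamma> (act_endpoint \<gamma> a)" "is_endpoint \<Gamma> (act_endpoint \<delta> a)"
    using is_endpoint_act assms by auto
  have m: "act_endpoint (\<gamma> ** \<delta>) a = act_endpoint \<gamma> (act_endpoint \<delta> a)"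
    using assms det_1 by (intro act_endpoint_mult) auto
  have "is_endpoint \<Gamma> (act_endpoint (\<gamma> ** \<delta>) a)" unfolding m using e assms by (intro is_endpoint_act)
  hence "gen (act_endpoint \<gamma> a) a = nc_mult (gen (act_endpoint \<gamma> a) (act_endpoint (\<gamma> ** \<delta>) a)) (gen (act_endpoint (\<gamma> ** \<delta>) a) a)"
    using e assms by (intro gen_series_compose)
  also have "gen (act_endpoint \<gamma> a) (act_endpoint (\<gamma> ** \<delta>) a) = gen a (act_endpoint \<delta> a)"
    unfolding m using assms e by (intro gen_series_act)
  finally show ?thesis .
qed

text \<open>The path is split at \<tau>a: the first piece is moved back by \<tau>, and the second is
  trivial because \<tau> fixes the cusp b.\<close>

lemma gen_series_left_mult:
  assumes "is_endpoint \<Gamma> a" "is_cusp \<Gamma> b" "\<gamma> \<in> \<Gamma>" "\<tau> \<in> cusp_stabilizer \<Gamma> b"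
  shows "gen (act_endpoint (\<tau> ** \<gamma>) a) a = gen (act_endpoint \<gamma> a) a"
proof -
  have t: "\<tau> \<in> \<Gamma>" using cusp_stabilizerD[OF assms(4)] by simp
  have e: "is_endpoint \<Gamma> (act_endpoint \<gamma> a)" "is_endpoint \<Gamma> (act_endpoint \<tau> a)"
    using is_endpoint_act assms t by auto
  have m: "act_endpoint (\<tau> ** \<gamma>) a = act_endpoint \<tau> (act_endpoint \<gamma> a)"
    using assms t det_1 by (intro act_endpoint_mult) auto
  have "is_endpoint \<Gamma> (act_endpoint (\<tau> ** \<gamma>) a)" unfolding m using e(1) t by (rule is_endpoint_act)
  hence "gen (act_endpoint (\<tau> ** \<gamma>) a) a = nc_mult (gen (act_endpoint (\<tau> ** \<gamma>) a) (act_endpoint \<tau> a)) (gen (act_endpoint \<tau> a) a)"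
    using e assms by (intro gen_series_compose)
  also have "gen (act_endpoint (\<tau> ** \<gamma>) a) (act_endpoint \<tau> a) = gen (act_endpoint \<gamma> a) a"
    unfolding m using assms e t by (intro gen_series_act)
  finally show ?thesis unfolding gen_series_stabilizer[OF assms(1,2,4)] nc_mult_one_right .
qed

text \<open>Induction along the vertical line above u. The inner integral is bounded by a power of
  \<open>B\<close>, uniformly in t, and integrating \<open>M * y powr (-1 - \<eta>)\<close> upwards
  from \<open>Im u\<close> adds one more factor
  \<open>B = M / \<eta> * Im u powr (- \<eta>)\<close>.\<close>

lemma iterated_vertical_bound:
  assumes b: "is_cusp \<Gamma> b" and u: "Im u > 0" and M: "M > 0" and \<eta>: "\<eta> > 0"
    and L: "\<And>f. f \<in> set L \<Longrightarrow> cusp_form \<Gamma> \<sigma> f"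
      "\<And>f w. f \<in> set L \<Longrightarrow> Im w > 0 \<Longrightarrow> norm (slash2 f (\<sigma> b) w) \<le> M * Im w powr (-1 - \<eta>)"
    and t: "t \<ge> 0"
  shows "norm (iterated_integral_rev \<sigma> (Interior (act (\<sigma> b) u)) L (Interior (act (\<sigma> b) (u + \<i> * of_real t))))
     \<le> (M / \<eta> * Im u powr (- \<eta>)) ^ length L"
  using L t
proof (induction L arbitrary: t)
  case (Cons f gs)
  have ds: "det (\<sigma> b) = 1" using det_scaling b by blast
  define a where "a = Interior (act (\<sigma> b) u)"
  have a: "is_endpoint \<Gamma> a" using u ds by (simp add: a_def upper_half_plane_def Im_act_pos)
  define B where "B = M / \<eta> * Im u powr (- \<eta>)"
  have B: "B > 0" using M \<eta> u by (simp add: B_def)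
  define n where "n = length gs"
  let ?J = "iterated_integral_rev \<sigma> a"
  have IH: "norm (?J gs (Interior (act (\<sigma> b) (u + \<i> * of_real x)))) \<le> B ^ n" if "x \<ge> 0" for x
    using Cons.IH[of x] Cons.prems that by (simp add: a_def B_def n_def)
  have prim: "primitive_of (\<lambda>z. f z * ?J gs (Interior z)) (?J (f # gs))" and zero: "?J (f # gs) a = 0"
    using iterated_primitive[OF a, of f gs] Cons.prems(1) by auto
  define F where "F = (\<lambda>x. ?J (f # gs) (Interior (act (\<sigma> b) (u + \<i> * of_real x))))"
  have F0: "F 0 = 0" using zero by (simp add: F_def a_def)
  define F' where "F' = (\<lambda>x. \<i> * (slash2 f (\<sigma> b) (u + \<i> * of_real x) * ?J gs (Interior (act (\<sigma> b) (u + \<i> * of_real x)))))"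
  have dF: "(F has_vector_derivative F' x) (at x)" if "x \<ge> 0" for x
  proof -
    let ?w = "u + \<i> * of_real x"
    have w: "Im ?w > 0" using u that by simp
    have "((\<lambda>z. ?J (f # gs) (Interior z)) has_field_derivative f (act (\<sigma> b) ?w) * ?J gs (Interior (act (\<sigma> b) ?w))) (at (act (\<sigma> b) ?w))"
      using prim Im_act_pos[OF ds w] unfolding primitive_of_def by blast
    from DERIV_chain2[OF this has_field_derivative_act[OF ds w]]
    have "((\<lambda>w. ?J (f # gs) (Interior (act (\<sigma> b) w))) has_field_derivative
         slash2 f (\<sigma> b) ?w * ?J gs (Interior (act (\<sigma> b) ?w))) (at ?w)"
      by (simp add: slash2_eq mult_ac)
    moreover have "((\<lambda>x. u + \<i> * of_real x) has_vector_derivative \<i>) (at x)"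
      by (auto intro!: derivative_eq_intros)
    ultimately show ?thesis
      using field_vector_diff_chain_at[of "\<lambda>x. u + \<i> * of_real x" \<i> x "\<lambda>w. ?J (f # gs) (Interior (act (\<sigma> b) w))"]
      by (simp add: o_def F_def F'_def)
  qed
  \<comment> \<open>The antiderivative of the majorant. It is negative and increases towards 0, so
    its increment is at most \<open>- \<phi> 0 = B ^ Suc n\<close>.\<close>
  define \<phi> where "\<phi> = (\<lambda>x. - (B ^ n * M / \<eta>) * (Im u + x) powr (- \<eta>))"
  have d\<phi>: "(\<phi> has_vector_derivative B ^ n * (M * (Im u + x) powr (-1 - \<eta>))) (at x)" if "x \<ge> 0" for x
  proof -
    have "((\<lambda>x. (Im u + x) powr (- \<eta>)) has_real_derivative (- \<eta>) * (Im u + x) powr (- \<eta> - 1)) (at x)"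
      using u that by (auto intro!: derivative_eq_intros)
    from DERIV_cmult[OF this, of "- (B ^ n * M / \<eta>)"]
    have "(\<phi> has_real_derivative - (B ^ n * M / \<eta>) * ((- \<eta>) * (Im u + x) powr (- \<eta> - 1))) (at x)"
      unfolding \<phi>_def .
    also have "- \<eta> - 1 = -1 - \<eta>" by simp
    also have "- (B ^ n * M / \<eta>) * ((- \<eta>) * (Im u + x) powr (-1 - \<eta>)) = B ^ n * (M * (Im u + x) powr (-1 - \<eta>))"
      using \<eta> by (simp add: field_simps)
    finally have "(\<phi> has_real_derivative B ^ n * (M * (Im u + x) powr (-1 - \<eta>))) (at x)" .
    thus ?thesis by (simp add: has_real_derivative_iff_has_vector_derivative)
  qed
  have "norm (F t) \<le> B ^ Suc n"
  proof (cases "t = 0")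
    case False
    hence t: "0 < t" using Cons.prems by simp
    have "norm (F t - F 0) \<le> \<phi> t - \<phi> 0"
    proof (rule differentiable_bound_general[OF t])
      show "continuous_on {0..t} F"
        using dF has_vector_derivative_continuous by (intro continuous_at_imp_continuous_on) force
      show "continuous_on {0..t} \<phi>"
        using d\<phi> has_vector_derivative_continuous by (intro continuous_at_imp_continuous_on) force
      show "(F has_vector_derivative F' x) (at x)" if "0 < x" for x using dF that by simp
      show "(\<phi> has_vector_derivative B ^ n * (M * (Im u + x) powr (-1 - \<eta>))) (at x)" if "0 < x" for x
        using d\<phi> that by simp
      show "norm (F' x) \<le> B ^ n * (M * (Im u + x) powr (-1 - \<eta>))" if x: "0 < x" for x
      proof -
        have "norm (slash2 f (\<sigma> b) (u + \<i> * of_real x)) \<le> M * (Im u + x) powr (-1 - \<eta>)"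
          using Cons.prems(2)[of f "u + \<i> * of_real x"] u x by simp
        hence "norm (slash2 f (\<sigma> b) (u + \<i> * of_real x)) * norm (?J gs (Interior (act (\<sigma> b) (u + \<i> * of_real x))))
            \<le> (M * (Im u + x) powr (-1 - \<eta>)) * B ^ n"
          using IH[of x] x M by (intro mult_mono) auto
        thus ?thesis by (simp add: F'_def norm_mult mult.commute)
      qed
    qed
    also have "\<phi> t - \<phi> 0 \<le> - \<phi> 0" using B M \<eta> by (simp add: \<phi>_def)
    also have "- \<phi> 0 = B ^ Suc n" by (simp add: \<phi>_def B_def)
    finally show ?thesis using F0 by simp
  qed (use F0 B in simp)
  thus ?case by (simp add: F_def a_def B_def n_def)
qed simp

text \<open>The vertical bound is uniform in t, so regularity allows t to tend to infinity, up to an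
  arbitrary error e.\<close>

lemma iterated_cusp_bound:
  assumes b: "is_cusp \<Gamma> b" and u: "Im u > 0" and M: "M > 0" and \<eta>: "\<eta> > 0"
    and L: "\<And>f. f \<in> set L \<Longrightarrow> cusp_form \<Gamma> \<sigma> f"
      "\<And>f w. f \<in> set L \<Longrightarrow> Im w > 0 \<Longrightarrow> norm (slash2 f (\<sigma> b) w) \<le> M * Im w powr (-1 - \<eta>)"
  shows "norm (iterated_integral_rev \<sigma> (Interior (act (\<sigma> b) u)) L (Boundary b))
     \<le> (M / \<eta> * Im u powr (- \<eta>)) ^ length L"
proof (rule field_le_epsilon)
  fix e :: real assume e: "e > 0"
  have ds: "det (\<sigma> b) = 1" using det_scaling b by blast
  define J where "J = iterated_integral_rev \<sigma> (Interior (act (\<sigma> b) u)) L"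
  have "regular J" unfolding J_def using u ds L(1)
    by (intro iterated_regular) (auto simp: upper_half_plane_def Im_act_pos)
  then obtain Y where Y: "\<And>w. \<bar>Re w\<bar> \<le> \<bar>Re u\<bar> \<Longrightarrow> Im w \<ge> Y \<Longrightarrow> norm (J (Interior (act (\<sigma> b) w)) - J (Boundary b)) < e"
    using regularD[OF _ b e, of J "\<bar>Re u\<bar>"] by blast
  define t where "t = \<bar>Y\<bar>"
  have 1: "norm (J (Interior (act (\<sigma> b) (u + \<i> * of_real t))) - J (Boundary b)) < e"
    using u by (intro Y) (auto simp: t_def)
  have 2: "norm (J (Interior (act (\<sigma> b) (u + \<i> * of_real t)))) \<le> (M / \<eta> * Im u powr (- \<eta>)) ^ length L"
    unfolding J_def by (rule iterated_vertical_bound[OF b u M \<eta> L]) (auto simp: t_def)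
  have "norm (J (Boundary b)) \<le> norm (J (Interior (act (\<sigma> b) (u + \<i> * of_real t)))) +
      norm (J (Interior (act (\<sigma> b) (u + \<i> * of_real t))) - J (Boundary b))"
    by (metis norm_minus_commute norm_triangle_sub)
  thus "norm (iterated_integral_rev \<sigma> (Interior (act (\<sigma> b) u)) L (Boundary b))
     \<le> (M / \<eta> * Im u powr (- \<eta>)) ^ length L + e" using 1 2 by (simp add: J_def)
qed

lemma uniform_power_bound:
  assumes b: "is_cusp \<Gamma> b" and \<eta>: "0 < \<eta>" "\<eta> \<le> 1"
  obtains M where "M > 0"
    "\<And>f w. f \<in> set fs \<Longrightarrow> Im w > 0 \<Longrightarrow> norm (slash2 f (\<sigma> b) w) \<le> M * Im w powr (-1 - \<eta>)"
proof -
  have "\<forall>f\<in>set fs. \<exists>M. \<forall>w. Im w > 0 \<longrightarrow> norm (slash2 f (\<sigma> b) w) \<le> M * Im w powr (-1 - \<eta>)"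
    using cusp_form_power_bound[OF forms b \<eta>] by metis
  then obtain m where m: "\<And>f w. f \<in> set fs \<Longrightarrow> Im w > 0 \<Longrightarrow> norm (slash2 f (\<sigma> b) w) \<le> m f * Im w powr (-1 - \<eta>)"
    by metis
  define M where "M = 1 + (\<Sum>f\<in>set fs. \<bar>m f\<bar>)"
  show ?thesis
  proof (rule that[of M])
    show "M > 0" unfolding M_def by (intro add_pos_nonneg sum_nonneg) auto
    fix f w assume f: "f \<in> set fs" and w: "Im w > 0"
    have "m f \<le> \<bar>m f\<bar>" by simp
    also have "\<dots> \<le> M" unfolding M_def using member_le_sum[OF f, of "\<lambda>f. \<bar>m f\<bar>"] by simp
    finally have "m f * Im w powr (-1 - \<eta>) \<le> M * Im w powr (-1 - \<eta>)" by (intro mult_right_mono) auto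
    thus "norm (slash2 f (\<sigma> b) w) \<le> M * Im w powr (-1 - \<eta>)" using m[OF f w] by linarith
  qed
qed

text \<open>The summand 1 accommodates the empty word, whose coefficient is 1 at every
  height.\<close>

lemma gen_series_cusp_bound:
  assumes b: "is_cusp \<Gamma> b" and \<epsilon>: "0 < \<epsilon>" "\<epsilon> \<le> 1"
  shows "\<exists>C\<ge>0. \<forall>z. Im z > 0 \<longrightarrow> norm (gen (Interior z) (Boundary b) w) \<le> C * (1 + Im (act (adj2 (\<sigma> b)) z) powr (- \<epsilon>))"
proof (cases "set w \<subseteq> {..<length fs} \<and> w \<noteq> []")
  case True
  have ds: "det (\<sigma> b) = 1" using det_scaling b by blast
  define n where "n = length w"
  have n: "n > 0" using True by (simp add: n_def)
  \<comment> \<open>Each of the n integrations loses \<open>Im u powr (- \<eta>)\<close>, so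
    together they lose \<open>Im u powr (- \<epsilon>)\<close>.\<close>
  define \<eta> where "\<eta> = \<epsilon> / real n"
  have \<eta>: "0 < \<eta>" "\<eta> \<le> 1" using \<epsilon> n by (auto simp: \<eta>_def divide_le_eq)
  obtain M where M: "M > 0"
    "\<And>f w. f \<in> set fs \<Longrightarrow> Im w > 0 \<Longrightarrow> norm (slash2 f (\<sigma> b) w) \<le> M * Im w powr (-1 - \<eta>)"
    using uniform_power_bound[OF b \<eta>] by metis
  show ?thesis
  proof (intro exI[of _ "(M / \<eta>) ^ n"] conjI allI impI)
    show "(M / \<eta>) ^ n \<ge> 0" using M \<eta> by simp
    fix z :: complex assume z: "Im z > 0"
    define u where "u = act (adj2 (\<sigma> b)) z"
    have u: "Im u > 0" "act (\<sigma> b) u = z" using z ds by (simp_all add: u_def Im_act_pos act_adj2)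
    have set: "set (rev (map (\<lambda>i. fs ! i) w)) \<subseteq> set fs" using True by auto
    have "norm (gen (Interior z) (Boundary b) w)
        = norm (iterated_integral_rev \<sigma> (Interior (act (\<sigma> b) u)) (rev (map (\<lambda>i. fs ! i) w)) (Boundary b))"
      using True u by (simp add: gen_series_eq)
    also have "\<dots> \<le> (M / \<eta> * Im u powr (- \<eta>)) ^ length (rev (map (\<lambda>i. fs ! i) w))"
      using set forms by (intro iterated_cusp_bound[OF b u(1) M(1) \<eta>(1)] M(2)) auto
    also have "\<dots> = (M / \<eta>) ^ n * (Im u powr (- \<eta>)) ^ n" by (simp only: n_def length_rev length_map power_mult_distrib)
    also have "(Im u powr (- \<eta>)) ^ n = Im u powr (- \<epsilon>)"
      using u n by (simp add: powr_power \<eta>_def)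
    also have "(M / \<eta>) ^ n * Im u powr (- \<epsilon>) \<le> (M / \<eta>) ^ n * (1 + Im u powr (- \<epsilon>))"
      using M \<eta> by (intro mult_left_mono) auto
    finally show "norm (gen (Interior z) (Boundary b) w) \<le> (M / \<eta>) ^ n * (1 + Im (act (adj2 (\<sigma> b)) z) powr (- \<epsilon>))"
      by (simp add: u_def)
  qed
next
  case False
  hence "norm (gen e e' w) \<le> 1" for e e' by (auto simp: gen_series_def iterated_integral_def)
  hence "norm (gen (Interior z) (Boundary b) w) \<le> 1 * (1 + Im (act (adj2 (\<sigma> b)) z) powr (- \<epsilon>))" for z
    by (rule order.trans) simp
  thus ?thesis by (intro exI[of _ 1]) auto
qed

text \<open>The path from \<gamma>a to a is split at \<gamma>z and at the cusp b. The first piece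
  may be replaced by the path from a to z, and the last runs from b to a, so both are independent of
  \<gamma>. Only the piece from \<gamma>z to b varies, and the height of \<gamma>z controls
  it.\<close>

lemma gen_series_orbit_bound:
  assumes a: "is_endpoint \<Gamma> a" and b: "is_cusp \<Gamma> b" and \<epsilon>: "0 < \<epsilon>" "\<epsilon> \<le> 1" and z: "Im z > 0"
  shows "\<exists>C\<ge>0. \<forall>\<gamma>\<in>\<Gamma>. norm (gen (act_endpoint \<gamma> a) a w) \<le> C * (1 + Im (act (adj2 (\<sigma> b)) (act \<gamma> z)) powr (- \<epsilon>))"
proof -
  have "\<forall>v. \<exists>C. C \<ge> 0 \<and> (\<forall>z. Im z > 0 \<longrightarrow> norm (gen (Interior z) (Boundary b) v) \<le> C * (1 + Im (act (adj2 (\<sigma> b)) z) powr (- \<epsilon>)))"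
    using gen_series_cusp_bound[OF b \<epsilon>] by blast
  from choice[OF this] obtain C where C: "\<And>v. C v \<ge> 0" "\<And>v z. Im z > 0 \<Longrightarrow> norm (gen (Interior z) (Boundary b) v) \<le> C v * (1 + Im (act (adj2 (\<sigma> b)) z) powr (- \<epsilon>))"
    by blast
  define A where "A = (\<Sum>k\<le>length w. norm (gen a (Interior z) (take k w)) *
     (\<Sum>j\<le>length (drop k w). C (take j (drop k w)) * norm (gen (Boundary b) a (drop j (drop k w)))))"
  show ?thesis
  proof (intro exI[of _ A] conjI ballI)
    show "A \<ge> 0" unfolding A_def using C(1) by (intro sum_nonneg mult_nonneg_nonneg) auto
    fix \<gamma> assume \<gamma>: "\<gamma> \<in> \<Gamma>"
    have gz: "Im (act \<gamma> z) > 0" using z det_1[OF \<gamma>] by (simp add: Im_act_pos)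
    define H where "H = 1 + Im (act (adj2 (\<sigma> b)) (act \<gamma> z)) powr (- \<epsilon>)"
    have e: "is_endpoint \<Gamma> (Interior z)" "is_endpoint \<Gamma> (Interior (act \<gamma> z))" "is_endpoint \<Gamma> (Boundary b)"
      "is_endpoint \<Gamma> (act_endpoint \<gamma> a)"
      using z gz b is_endpoint_act[OF a \<gamma>] by (auto simp: upper_half_plane_def)
    have "gen (act_endpoint \<gamma> a) a = nc_mult (gen (act_endpoint \<gamma> a) (act_endpoint \<gamma> (Interior z))) (gen (Interior (act \<gamma> z)) a)"
      using e a by (simp add: gen_series_compose[of "act_endpoint \<gamma> a" "Interior (act \<gamma> z)" a])
    also have "gen (act_endpoint \<gamma> a) (act_endpoint \<gamma> (Interior z)) = gen a (Interior z)"
      using a e \<gamma> by (intro gen_series_act)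
    also have "gen (Interior (act \<gamma> z)) a = nc_mult (gen (Interior (act \<gamma> z)) (Boundary b)) (gen (Boundary b) a)"
      using e a by (intro gen_series_compose)
    finally have eq: "gen (act_endpoint \<gamma> a) a w = (\<Sum>k\<le>length w. gen a (Interior z) (take k w) *
       (\<Sum>j\<le>length (drop k w). gen (Interior (act \<gamma> z)) (Boundary b) (take j (drop k w)) * gen (Boundary b) a (drop j (drop k w))))"
      by (simp only: nc_mult_def)
    have "norm (gen (act_endpoint \<gamma> a) a w) \<le> (\<Sum>k\<le>length w. norm (gen a (Interior z) (take k w)) *
       (\<Sum>j\<le>length (drop k w). (C (take j (drop k w)) * H) * norm (gen (Boundary b) a (drop j (drop k w)))))"
      unfolding eq
    proof (rule sum_norm_le)
      fix k
      have "norm (\<Sum>j\<le>length (drop k w). gen (Interior (act \<gamma> z)) (Boundary b) (take j (drop k w)) * gen (Boundary b) a (drop j (drop k w)))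
         \<le> (\<Sum>j\<le>length (drop k w). (C (take j (drop k w)) * H) * norm (gen (Boundary b) a (drop j (drop k w))))"
      proof (rule sum_norm_le)
        fix j
        show "norm (gen (Interior (act \<gamma> z)) (Boundary b) (take j (drop k w)) * gen (Boundary b) a (drop j (drop k w)))
          \<le> (C (take j (drop k w)) * H) * norm (gen (Boundary b) a (drop j (drop k w)))"
          unfolding norm_mult H_def using C(2)[OF gz] by (intro mult_right_mono) auto
      qed
      thus "norm (gen a (Interior z) (take k w) *
         (\<Sum>j\<le>length (drop k w). gen (Interior (act \<gamma> z)) (Boundary b) (take j (drop k w)) * gen (Boundary b) a (drop j (drop k w))))
         \<le> norm (gen a (Interior z) (take k w)) *
         (\<Sum>j\<le>length (drop k w). (C (take j (drop k w)) * H) * norm (gen (Boundary b) a (drop j (drop k w))))"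
        unfolding norm_mult by (intro mult_left_mono) auto
    qed
    also have "\<dots> = A * H"
      unfolding A_def by (simp add: sum_distrib_right sum_distrib_left mult_ac)
    finally show "norm (gen (act_endpoint \<gamma> a) a w) \<le> A * (1 + Im (act (adj2 (\<sigma> b)) (act \<gamma> z)) powr (- \<epsilon>))"
      by (simp add: H_def)
  qed
qed

end

section \<open>The real Eisenstein series\<close>

text \<open>At level k there are at most \<open>2 ^ Suc k + 1\<close> cells of at most
  \<open>N\<close> elements, with terms at most \<open>C * q ^ k\<close>. The partial sums are
  dominated by a geometric series of ratio \<open>2 * q\<close>.\<close>

lemma summable_on_levels:
  fixes f :: "'a \<Rightarrow> real" and lv cell :: "'a \<Rightarrow> nat"
  assumes f: "\<And>x. x \<in> A \<Longrightarrow> 0 \<le> f x" "\<And>x. x \<in> A \<Longrightarrow> f x \<le> C * q ^ lv x"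
    and cell: "\<And>x. x \<in> A \<Longrightarrow> cell x \<le> 2 ^ Suc (lv x)"
    and fiber: "\<And>F k j. F \<subseteq> A \<Longrightarrow> finite F \<Longrightarrow> card {x\<in>F. lv x = k \<and> cell x = j} \<le> N"
    and q: "0 \<le> q" "2 * q < 1" and C: "C \<ge> 0"
  shows "f summable_on A"
proof (rule nonneg_bdd_above_summable_on[OF f(1)])
  show "bdd_above (sum f ` {F. F \<subseteq> A \<and> finite F})"
  proof (rule bdd_aboveI2)
    fix F assume "F \<in> {F. F \<subseteq> A \<and> finite F}"
    hence F: "F \<subseteq> A" "finite F" by auto
    define n where "n = Max (insert 0 (lv ` F))"
    have n: "lv x \<le> n" if "x \<in> F" for x unfolding n_def using that F by (intro Max_ge) auto
    define T where "T = Sigma {..n} (\<lambda>k. {..2 ^ Suc k :: nat})"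
    have "sum f F = (\<Sum>y\<in>T. \<Sum>x\<in>{x\<in>F. (lv x, cell x) = y}. f x)"
      using F n cell by (intro sum.group[symmetric]) (auto simp: T_def)
    also have "\<dots> \<le> (\<Sum>(k, j)\<in>T. real N * (C * q ^ k))"
    proof (rule sum_mono, clarify)
      fix k j assume "(k, j) \<in> T"
      have "(\<Sum>x\<in>{x\<in>F. (lv x, cell x) = (k, j)}. f x) \<le> (\<Sum>x\<in>{x\<in>F. lv x = k \<and> cell x = j}. C * q ^ k)"
        unfolding prod.inject
      proof (rule sum_mono)
        fix x assume "x \<in> {x\<in>F. lv x = k \<and> cell x = j}"
        thus "f x \<le> C * q ^ k" using f(2)[of x] F(1) by blast
      qed
      also have "\<dots> = real (card {x\<in>F. lv x = k \<and> cell x = j}) * (C * q ^ k)" by simp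
      also have "\<dots> \<le> real N * (C * q ^ k)"
        using fiber[OF F] q C by (intro mult_right_mono) auto
      finally show "(\<Sum>x\<in>{x\<in>F. (lv x, cell x) = (k, j)}. f x) \<le> real N * (C * q ^ k)" .
    qed
    also have "\<dots> = (\<Sum>k\<le>n. \<Sum>j\<le>2 ^ Suc k :: nat. real N * (C * q ^ k))"
      unfolding T_def by (subst sum.Sigma) auto
    also have "\<dots> = (\<Sum>k\<le>n. real N * C * ((2 ^ Suc k + 1) * q ^ k))" by (simp add: algebra_simps)
    also have "\<dots> \<le> (\<Sum>k\<le>n. real N * C * (3 * (2 * q) ^ k))"
    proof (rule sum_mono, rule mult_left_mono)
      fix k
      have "(2 ^ Suc k + 1) * q ^ k \<le> (3 * 2 ^ k) * q ^ k"
        using q by (intro mult_right_mono) auto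
      thus "(2 ^ Suc k + 1) * q ^ k \<le> 3 * (2 * q) ^ k" by (simp add: power_mult_distrib mult_ac)
    qed (use C in auto)
    also have "\<dots> = real N * C * 3 * (\<Sum>k\<le>n. (2 * q) ^ k)" by (simp add: sum_distrib_left mult_ac)
    also have "(\<Sum>k\<le>n. (2 * q) ^ k) \<le> (\<Sum>k. (2 * q) ^ k)"
      using q by (intro sum_le_suminf summable_geometric) auto
    hence "real N * C * 3 * (\<Sum>k\<le>n. (2 * q) ^ k) \<le> real N * C * 3 * (\<Sum>k. (2 * q) ^ k)"
      using C by (intro mult_left_mono) auto
    finally show "sum f F \<le> real N * C * 3 * (\<Sum>k. (2 * q) ^ k)" .
  qed
qed

lemma dyadic_level:
  fixes y :: real
  assumes "y \<ge> 1"
  shows "\<exists>n. 2 ^ n \<le> y \<and> y < 2 ^ Suc n"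
proof -
  obtain m where m: "y < 2 ^ m" using real_arch_pow[of 2 y] by auto
  define k where "k = (LEAST m. y < 2 ^ m)"
  have k: "y < 2 ^ k" unfolding k_def using m by (rule LeastI)
  have "k \<noteq> 0" using k assms by (intro notI) simp
  then obtain n where n: "k = Suc n" using not0_implies_Suc by blast
  have "\<not> y < 2 ^ n" using not_less_Least[of n "\<lambda>m. y < 2 ^ m"] n by (simp add: k_def)
  thus ?thesis using k n by (intro exI[of _ n]) simp
qed

context fuchsian_scaled
begin

definition height :: "proj_real \<Rightarrow> complex \<Rightarrow> real^2^2 \<Rightarrow> real" where
  "height b z \<gamma> = Im (act (adj2 (\<sigma> b)) (act \<gamma> z))"

lemma height_pos:
  assumes "is_cusp \<Gamma> b" "\<gamma> \<in> \<Gamma>" "Im z > 0"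
  shows "height b z \<gamma> > 0"
  using assms det_scaling[of b] det_1 by (simp add: height_def Im_act_pos)

lemma stabilizer_act:
  assumes b: "is_cusp \<Gamma> b" and \<tau>: "\<tau> \<in> \<Gamma>"
    "adj2 (\<sigma> b) ** \<tau> ** \<sigma> b = translation l \<or> adj2 (\<sigma> b) ** \<tau> ** \<sigma> b = - translation l"
    and z: "Im z > 0"
  shows "act (adj2 (\<sigma> b)) (act \<tau> z) = act (adj2 (\<sigma> b)) z + of_int l"
proof -
  have d: "det (\<sigma> b) = 1" "det \<tau> = 1" using det_scaling b \<tau> det_1 by auto
  have "act (adj2 (\<sigma> b) ** \<tau> ** \<sigma> b) (act (adj2 (\<sigma> b)) z) = act (adj2 (\<sigma> b)) (act \<tau> z)"
    using d z by (simp add: act_mult det_mult2 Im_act_pos act_adj2)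
  moreover have "act (adj2 (\<sigma> b) ** \<tau> ** \<sigma> b) u = u + of_int l" for u using \<tau>(2) by auto
  ultimately show ?thesis by simp
qed

lemma height_left_mult:
  assumes "is_cusp \<Gamma> b" "\<tau> \<in> cusp_stabilizer \<Gamma> b" "\<gamma> \<in> \<Gamma>" "Im z > 0"
  shows "height b z (\<tau> ** \<gamma>) = height b z \<gamma>"
proof -
  obtain l where l: "adj2 (\<sigma> b) ** \<tau> ** \<sigma> b = translation l \<or> adj2 (\<sigma> b) ** \<tau> ** \<sigma> b = - translation l"
    using stabilizer_translation[OF assms(1,2)] .
  have t: "\<tau> \<in> \<Gamma>" using assms by (simp add: cusp_stabilizer_def)
  have "act (\<tau> ** \<gamma>) z = act \<tau> (act \<gamma> z)" using assms t det_1 by (intro act_mult) auto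
  thus ?thesis using stabilizer_act[OF assms(1) t l, of "act \<gamma> z"] assms(3,4) det_1
    by (simp add: height_def Im_act_pos)
qed

text \<open>If \<gamma>z is high at the cusp, the unit translation moves it little. Conjugated back
  by \<gamma> it is an element of \<Gamma> moving z by the positive amount
  \<open>1 / (Im p)^2\<close>. Only finitely many elements move z by at most 1, so the positive
  amounts are bounded below.\<close>

lemma height_bounded:
  assumes b: "is_cusp \<Gamma> b" and z: "Im z > 0"
  shows "\<exists>Y\<ge>1. \<forall>\<gamma>\<in>\<Gamma>. height b z \<gamma> \<le> Y"
proof -
  obtain \<tau> where t: "\<tau> \<in> cusp_stabilizer \<Gamma> b"
    "adj2 (\<sigma> b) ** \<tau> ** \<sigma> b = translation 1 \<or> adj2 (\<sigma> b) ** \<tau> ** \<sigma> b = - translation 1"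
    using translation_stabilizer[OF b] by metis
  have tG: "\<tau> \<in> \<Gamma>" using t by (simp add: cusp_stabilizer_def)
  have db: "det (\<sigma> b) = 1" using det_scaling b by blast
  define S where "S = {\<alpha>\<in>\<Gamma>. udist z (act \<alpha> z) \<le> 1 \<and> udist z (act \<alpha> z) > 0}"
  have "finite {\<alpha>\<in>\<Gamma>. \<exists>z\<in>{z}. udist z (act \<alpha> z) \<le> 1}"
    using z by (intro finite_udist_bounded) (auto simp: upper_half_plane_def)
  hence "finite S" by (rule finite_subset[rotated]) (auto simp: S_def)
  moreover have "\<And>\<alpha>. \<alpha> \<in> S \<Longrightarrow> udist z (act \<alpha> z) > 0" by (simp add: S_def)
  ultimately have "\<exists>m>0. \<forall>\<alpha>\<in>S. udist z (act \<alpha> z) \<ge> m" by (rule finite_positive_lower_bound)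
  then obtain m where m: "m > 0" "\<And>\<alpha>. \<alpha> \<in> S \<Longrightarrow> udist z (act \<alpha> z) \<ge> m" by blast
  show ?thesis
  proof (intro exI[of _ "max 1 (1 / sqrt m)"] conjI ballI)
    fix \<gamma> assume g: "\<gamma> \<in> \<Gamma>"
    define p where "p = act (adj2 (\<sigma> b)) (act \<gamma> z)"
    have dg: "det \<gamma> = 1" "det \<tau> = 1" using g tG det_1 by auto
    have Ip: "Im p > 0" using height_pos[OF b g z] by (simp add: p_def height_def)
    define \<alpha> where "\<alpha> = adj2 \<gamma> ** \<tau> ** \<gamma>"
    have aG: "\<alpha> \<in> \<Gamma>" using g tG by (simp add: \<alpha>_def mult_closed adj2_closed)
    have ga: "act \<gamma> (act \<alpha> z) = act \<tau> (act \<gamma> z)"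
      using dg z by (simp add: \<alpha>_def act_mult det_mult2 Im_act_pos act_adj2)
    have "udist z (act \<alpha> z) = udist (act \<gamma> z) (act \<gamma> (act \<alpha> z))"
      using dg z aG det_1 by (intro udist_act[symmetric]) (auto simp: Im_act_pos)
    also have "\<dots> = udist (act (adj2 (\<sigma> b)) (act \<gamma> z)) (act (adj2 (\<sigma> b)) (act \<tau> (act \<gamma> z)))"
      unfolding ga using dg z db by (intro udist_act[symmetric]) (auto simp: Im_act_pos)
    also have "\<dots> = udist p (p + 1)"
      using stabilizer_act[OF b tG t(2), of "act \<gamma> z"] dg z by (simp add: p_def Im_act_pos)
    also have "\<dots> = 1 / (Im p)\<^sup>2" by (simp add: udist_def power2_eq_square)
    finally have u: "udist z (act \<alpha> z) = 1 / (Im p)\<^sup>2" .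
    show "height b z \<gamma> \<le> max 1 (1 / sqrt m)"
    proof (cases "Im p \<le> 1")
      case False
      hence "1 / (Im p)\<^sup>2 \<le> 1" by (simp add: divide_le_eq one_le_power)
      hence "\<alpha> \<in> S" using aG u Ip by (auto simp: S_def)
      hence "m \<le> 1 / (Im p)\<^sup>2" using m(2) u by metis
      hence "(Im p)\<^sup>2 \<le> 1 / m" using m(1) Ip by (simp add: field_simps)
      hence "Im p \<le> sqrt (1 / m)" by (rule real_le_rsqrt)
      thus ?thesis by (simp add: p_def height_def real_sqrt_divide)
    qed (simp add: p_def height_def)
  qed simp
qed

lemma coset_representative:
  assumes "K \<in> cusp_cosets \<Gamma> b" "\<gamma> \<in> K"
  shows "\<gamma> \<in> \<Gamma>" "K = (\<lambda>\<tau>. \<tau> ** \<gamma>) ` cusp_stabilizer \<Gamma> b"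
proof -
  obtain \<gamma>0 where g0: "\<gamma>0 \<in> \<Gamma>" "K = (\<lambda>\<tau>. \<tau> ** \<gamma>0) ` cusp_stabilizer \<Gamma> b"
    using assms(1) unfolding cusp_cosets_eq by blast
  obtain \<tau>0 where t0: "\<tau>0 \<in> cusp_stabilizer \<Gamma> b" "\<gamma> = \<tau>0 ** \<gamma>0" using assms(2) g0 by blast
  have d: "det \<tau>0 = 1" using t0 by (auto simp: cusp_stabilizer_def det_1)
  show "\<gamma> \<in> \<Gamma>" using t0 g0 by (auto simp: cusp_stabilizer_def intro: mult_closed)
  show "K = (\<lambda>\<tau>. \<tau> ** \<gamma>) ` cusp_stabilizer \<Gamma> b"
  proof (intro equalityI subsetI)
    fix x assume "x \<in> K"
    then obtain \<tau> where t: "\<tau> \<in> cusp_stabilizer \<Gamma> b" "x = \<tau> ** \<gamma>0" using g0 by blast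
    have "(\<tau> ** adj2 \<tau>0) ** (\<tau>0 ** \<gamma>0) = \<tau> ** (adj2 \<tau>0 ** \<tau>0) ** \<gamma>0" by (simp only: matrix_mul_assoc)
    hence "x = (\<tau> ** adj2 \<tau>0) ** \<gamma>" using t t0 d by (simp add: adj2_mult)
    moreover have "\<tau> ** adj2 \<tau>0 \<in> cusp_stabilizer \<Gamma> b" using t t0 by (intro cusp_stabilizer_mult cusp_stabilizer_adj2)
    ultimately show "x \<in> (\<lambda>\<tau>. \<tau> ** \<gamma>) ` cusp_stabilizer \<Gamma> b" by blast
  next
    fix x assume "x \<in> (\<lambda>\<tau>. \<tau> ** \<gamma>) ` cusp_stabilizer \<Gamma> b"
    then obtain \<tau> where t: "\<tau> \<in> cusp_stabilizer \<Gamma> b" "x = \<tau> ** \<gamma>" by blast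
    hence "x = (\<tau> ** \<tau>0) ** \<gamma>0" using t0 by (simp add: matrix_mul_assoc)
    moreover have "\<tau> ** \<tau>0 \<in> cusp_stabilizer \<Gamma> b" using t t0 by (intro cusp_stabilizer_mult)
    ultimately show "x \<in> K" unfolding g0(2) by blast
  qed
qed

lemma coset_nonempty:
  assumes "K \<in> cusp_cosets \<Gamma> b"
  shows "(SOME \<gamma>. \<gamma> \<in> K) \<in> K"
proof -
  obtain \<gamma>0 where g0: "\<gamma>0 \<in> \<Gamma>" "K = (\<lambda>\<tau>. \<tau> ** \<gamma>0) ` cusp_stabilizer \<Gamma> b"
    using assms unfolding cusp_cosets_eq by blast
  have "mat 1 ** \<gamma>0 \<in> K" unfolding g0(2) using one_in_cusp_stabilizer by (rule imageI)
  thus ?thesis by (rule someI)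
qed

lemma height_coset:
  assumes "is_cusp \<Gamma> b" "K \<in> cusp_cosets \<Gamma> b" "\<gamma> \<in> K" "\<delta> \<in> K" "Im z > 0"
  shows "height b z \<gamma> = height b z \<delta>"
proof -
  note 1 = coset_representative[OF assms(2,3)]
  obtain \<tau> where "\<tau> \<in> cusp_stabilizer \<Gamma> b" "\<delta> = \<tau> ** \<gamma>" using assms(4) unfolding 1(2) by blast
  thus ?thesis using height_left_mult[OF assms(1) _ 1(1) assms(5)] by simp
qed

lemma reduced_representative:
  assumes b: "is_cusp \<Gamma> b" and K: "K \<in> cusp_cosets \<Gamma> b" and z: "Im z > 0"
  shows "\<exists>\<gamma>\<in>K. 0 \<le> Re (act (adj2 (\<sigma> b)) (act \<gamma> z)) \<and> Re (act (adj2 (\<sigma> b)) (act \<gamma> z)) < 1"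
proof -
  define \<gamma> where "\<gamma> = (SOME \<gamma>. \<gamma> \<in> K)"
  have gK: "\<gamma> \<in> K" unfolding \<gamma>_def by (rule coset_nonempty[OF K])
  note g = coset_representative[OF K gK]
  define x where "x = Re (act (adj2 (\<sigma> b)) (act \<gamma> z))"
  obtain \<tau> where t: "\<tau> \<in> cusp_stabilizer \<Gamma> b"
    "adj2 (\<sigma> b) ** \<tau> ** \<sigma> b = translation (- \<lfloor>x\<rfloor>) \<or> adj2 (\<sigma> b) ** \<tau> ** \<sigma> b = - translation (- \<lfloor>x\<rfloor>)"
    using translation_stabilizer[OF b] by metis
  have tG: "\<tau> \<in> \<Gamma>" using t by (simp add: cusp_stabilizer_def)
  have "act (\<tau> ** \<gamma>) z = act \<tau> (act \<gamma> z)" using g tG det_1 z by (intro act_mult) auto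
  hence "Re (act (adj2 (\<sigma> b)) (act (\<tau> ** \<gamma>) z)) = x - of_int \<lfloor>x\<rfloor>"
    using stabilizer_act[OF b tG t(2), of "act \<gamma> z"] z g det_1 by (simp add: Im_act_pos x_def)
  moreover have "\<tau> ** \<gamma> \<in> K" unfolding g(2) using t by blast
  ultimately show ?thesis using floor_correct[of x] by (intro bexI[of _ "\<tau> ** \<gamma>"]) (auto, linarith+)
qed

text \<open>Orbit points are sorted into boxes: heights between \<open>h\<close> and
  \<open>2 * h\<close> with \<open>h = Y / 2 ^ Suc lv\<close>, real parts in intervals of length h
  within the unit interval. Two points of one box are within \<open>udist\<close> 2, so the number
  of points per box is bounded by the number of elements moving z by at most 2. The number of boxes
  doubles from level to level while the terms shrink by \<open>2 powr (- s)\<close>, which is where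
  \<open>s > 1\<close> enters.\<close>

lemma height_powr_summable:
  assumes b: "is_cusp \<Gamma> b" and z: "Im z > 0" and s: "s > 1"
  shows "(\<lambda>K. height b z (SOME \<gamma>. \<gamma> \<in> K) powr s) summable_on cusp_cosets \<Gamma> b"
proof -
  obtain Y where Y: "Y \<ge> 1" "\<And>\<gamma>. \<gamma> \<in> \<Gamma> \<Longrightarrow> height b z \<gamma> \<le> Y" using height_bounded[OF b z] by blast
  have db: "det (\<sigma> b) = 1" using det_scaling b by blast
  let ?A = "cusp_cosets \<Gamma> b"
  have "\<forall>K\<in>?A. \<exists>\<gamma>. \<gamma> \<in> K \<and> 0 \<le> Re (act (adj2 (\<sigma> b)) (act \<gamma> z)) \<and> Re (act (adj2 (\<sigma> b)) (act \<gamma> z)) < 1"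
    using reduced_representative[OF b _ z] by blast
  from bchoice[OF this] obtain g where g: "\<And>K. K \<in> ?A \<Longrightarrow> g K \<in> K"
    "\<And>K. K \<in> ?A \<Longrightarrow> 0 \<le> Re (act (adj2 (\<sigma> b)) (act (g K) z))"
    "\<And>K. K \<in> ?A \<Longrightarrow> Re (act (adj2 (\<sigma> b)) (act (g K) z)) < 1" by blast
  have gG: "g K \<in> \<Gamma>" if "K \<in> ?A" for K using coset_representative(1)[OF that g(1)[OF that]] .
  define p where "p = (\<lambda>K. act (adj2 (\<sigma> b)) (act (g K) z))"
  have Ip: "Im (p K) > 0" "Im (p K) \<le> Y" if "K \<in> ?A" for K
    using height_pos[OF b gG[OF that] z] Y(2)[OF gG[OF that]] by (auto simp: height_def p_def)
  have hp: "height b z (SOME \<gamma>. \<gamma> \<in> K) = Im (p K)" if "K \<in> ?A" for K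
    using height_coset[OF b that coset_nonempty[OF that] g(1)[OF that] z] by (simp add: height_def p_def)
  have "\<forall>K\<in>?A. \<exists>n. 2 ^ n \<le> Y / Im (p K) \<and> Y / Im (p K) < 2 ^ Suc n"
    using Ip by (intro ballI dyadic_level) simp
  from bchoice[OF this] obtain lv where lv: "\<And>K. K \<in> ?A \<Longrightarrow> 2 ^ lv K \<le> Y / Im (p K)"
    "\<And>K. K \<in> ?A \<Longrightarrow> Y / Im (p K) < 2 ^ Suc (lv K)" by blast
  define h where "h = (\<lambda>K. Y / 2 ^ Suc (lv K))"
  have h: "h K > 0" for K using Y by (simp add: h_def)
  have hI: "h K \<le> Im (p K)" "Im (p K) \<le> 2 * h K" if "K \<in> ?A" for K
    using lv[OF that] Ip(1)[OF that] by (auto simp: h_def field_simps)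
  define cell where "cell = (\<lambda>K. nat \<lfloor>Re (p K) / h K\<rfloor>)"
  have rp: "0 \<le> Re (p K)" "Re (p K) < 1" if "K \<in> ?A" for K using g(2,3)[OF that] by (auto simp: p_def)
  define \<Phi> where "\<Phi> = {\<alpha>\<in>\<Gamma>. \<exists>z\<in>{z}. udist z (act \<alpha> z) \<le> 2}"
  have fin\<Phi>: "finite \<Phi>" unfolding \<Phi>_def
    using z by (intro finite_udist_bounded) (auto simp: upper_half_plane_def)
  show ?thesis
  proof (rule summable_on_levels[where lv = lv and cell = cell and q = "2 powr (- s)" and C = "Y powr s" and N = "card \<Phi>"])
    fix K assume K: "K \<in> ?A"
    show "0 \<le> height b z (SOME \<gamma>. \<gamma> \<in> K) powr s" by simp
    have "Im (p K) \<le> Y / 2 ^ lv K" using hI(2)[OF K] by (simp add: h_def)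
    hence "Im (p K) powr s \<le> (Y / 2 ^ lv K) powr s" using Ip(1)[OF K] s by (intro powr_mono2) auto
    also have "\<dots> = Y powr s * (2 powr (- s)) ^ lv K"
    proof -
      have "(Y / 2 ^ lv K) powr s = Y powr s / (2 ^ lv K) powr s" using Y by (simp add: powr_divide)
      also have "((2::real) ^ lv K) powr s = 2 powr (real (lv K) * s)"
        by (simp add: powr_realpow[symmetric] powr_powr)
      also have "Y powr s / 2 powr (real (lv K) * s) = Y powr s * 2 powr (- s * real (lv K))"
      proof -
        have e: "- s * real (lv K) = - (real (lv K) * s)" by (simp only: mult_minus_left mult.commute)
        show ?thesis unfolding e powr_minus divide_inverse ..
      qed
      also have "2 powr (- s * real (lv K)) = (2 powr (- s)) ^ lv K"
        by (subst powr_powr[symmetric], subst powr_realpow) simp_all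
      finally show ?thesis .
    qed
    finally show "height b z (SOME \<gamma>. \<gamma> \<in> K) powr s \<le> Y powr s * (2 powr (- s)) ^ lv K" by (simp add: hp[OF K])
    have "Re (p K) / h K \<le> 1 / h K" using rp[OF K] h[of K] by (intro divide_right_mono) auto
    \<comment> \<open>\<open>1 / h K\<close> is \<open>2 ^ Suc (lv K) / Y\<close>; this is where
      \<open>Y \<ge> 1\<close> enters.\<close>
    also have "1 / h K \<le> 2 ^ Suc (lv K)" using Y by (simp add: h_def field_simps)
    finally have "\<lfloor>Re (p K) / h K\<rfloor> \<le> 2 ^ Suc (lv K)" by (simp add: floor_le_iff)
    thus "cell K \<le> 2 ^ Suc (lv K)" unfolding cell_def by (simp add: nat_le_iff)
  next
    fix F k j assume F: "F \<subseteq> ?A" "finite F"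
    let ?S = "{K\<in>F. lv K = k \<and> cell K = j}"
    show "card ?S \<le> card \<Phi>"
    proof (cases "?S = {}")
      case False
      then obtain K0 where K0: "K0 \<in> ?S" by blast
      hence K0A: "K0 \<in> ?A" using F by auto
      have d0: "det (g K0) = 1" using gG[OF K0A] det_1 by blast
      \<comment> \<open>By invariance \<open>act (\<psi> K) z\<close> is as far from z as the orbit
        points of \<open>K\<close> and \<open>K0\<close> are from each other.\<close>
      define \<psi> where "\<psi> = (\<lambda>K. adj2 (g K0) ** g K)"
      have "inj_on \<psi> ?S"
      proof (rule inj_onI)
        fix K K' assume KK: "K \<in> ?S" "K' \<in> ?S" "\<psi> K = \<psi> K'"
        hence "g K0 ** (adj2 (g K0) ** g K) = g K0 ** (adj2 (g K0) ** g K')" by (simp add: \<psi>_def)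
        hence eq: "g K = g K'" using d0 by (simp add: matrix_mul_assoc adj2_mult)
        have A: "K \<in> ?A" "K' \<in> ?A" using KK F by auto
        show "K = K'" using coset_representative(2)[OF A(1) g(1)[OF A(1)]] coset_representative(2)[OF A(2) g(1)[OF A(2)]] eq by simp
      qed
      moreover have "\<psi> ` ?S \<subseteq> \<Phi>"
      proof (rule image_subsetI)
        fix K assume K: "K \<in> ?S"
        hence KA: "K \<in> ?A" using F by auto
        have dK: "det (g K) = 1" using gG[OF KA] det_1 by blast
        have eqs: "h K = h K0" "cell K = cell K0" using K K0 by (auto simp: h_def)
        have "udist z (act (\<psi> K) z) = udist (act (g K0) z) (act (g K0) (act (\<psi> K) z))"
          using d0 dK z by (intro udist_act[symmetric]) (auto simp: \<psi>_def Im_act_pos det_mult2)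
        also have "act (g K0) (act (\<psi> K) z) = act (g K) z"
          using d0 dK z by (simp add: \<psi>_def act_mult Im_act_pos act_adj2)
        also have "udist (act (g K0) z) (act (g K) z) = udist (p K0) (p K)"
          unfolding p_def using d0 dK z db by (intro udist_act[symmetric]) (auto simp: Im_act_pos)
        also have "\<dots> \<le> 2"
        proof -
          let ?h = "h K0"
          have "nat \<lfloor>Re (p K) / ?h\<rfloor> = nat \<lfloor>Re (p K0) / ?h\<rfloor>" using eqs by (simp add: cell_def)
          moreover have "Re (p K) / ?h \<ge> 0" "Re (p K0) / ?h \<ge> 0" using rp[OF KA] rp[OF K0A] h[of K0] by auto
          ultimately have "\<lfloor>Re (p K) / ?h\<rfloor> = \<lfloor>Re (p K0) / ?h\<rfloor>" by (simp add: eq_nat_nat_iff)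
          hence "\<bar>Re (p K) / ?h - Re (p K0) / ?h\<bar> \<le> 1" by linarith
          hence 1: "\<bar>Re (p K0 - p K)\<bar> \<le> ?h"
            using h[of K0] by (simp add: diff_divide_distrib[symmetric] abs_divide abs_minus_commute divide_le_eq)
          have 2: "\<bar>Im (p K0 - p K)\<bar> \<le> ?h" using hI[OF KA] hI[OF K0A] eqs by (simp add: abs_le_iff)
          \<comment> \<open>Both coordinates differ by at most h and both heights are at least h, so
            the quotient is at most 2.\<close>
          have "(cmod (p K0 - p K))\<^sup>2 \<le> ?h\<^sup>2 + ?h\<^sup>2"
            unfolding cmod_power2 using 1 2 h[of K0] by (intro add_mono power2_le_iff_abs_le[THEN iffD2]) auto
          also have "\<dots> = 2 * (?h * ?h)" by (simp add: power2_eq_square)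
          also have "\<dots> \<le> 2 * (Im (p K0) * Im (p K))"
            using hI(1)[OF KA] hI(1)[OF K0A] eqs h[of K0] by (intro mult_left_mono mult_mono) auto
          finally show ?thesis using Ip(1)[OF KA] Ip(1)[OF K0A] by (simp add: udist_def divide_le_eq)
        qed
        finally have "udist z (act (\<psi> K) z) \<le> 2" .
        moreover have "\<psi> K \<in> \<Gamma>" unfolding \<psi>_def using gG[OF KA] gG[OF K0A] by (intro mult_closed adj2_closed)
        ultimately show "\<psi> K \<in> \<Phi>" by (simp add: \<Phi>_def)
      qed
      ultimately show ?thesis using fin\<Phi> by (intro card_inj_on_le)
    next
      case True
      show ?thesis unfolding True by simp
    qed
  next
    have "2 * 2 powr (- s) = 2 powr (1 - s)" by (simp add: powr_diff powr_minus divide_inverse)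
    also have "\<dots> < 2 powr 0" using s by (intro powr_less_mono) auto
    finally show "2 * 2 powr (- s) < (1::real)" by simp
  qed auto
qed

end

section \<open>Termwise differentiation\<close>

text \<open>Carries existence and value together: \<open>partial_x\<close> and
  \<open>partial_y\<close> are total, so their values alone would not witness
  differentiability.\<close>

definition has_partials :: "complex set \<Rightarrow> (complex \<Rightarrow> complex) \<Rightarrow> (complex \<Rightarrow> complex) \<Rightarrow> (complex \<Rightarrow> complex) \<Rightarrow> bool" where
  "has_partials S u ux uy \<longleftrightarrow> (\<forall>z\<in>S.
     ((\<lambda>t::real. u (z + of_real t)) has_vector_derivative ux z) (at 0) \<and>
     ((\<lambda>t::real. u (z + \<i> * of_real t)) has_vector_derivative uy z) (at 0))"

lemma partials_eq:
  assumes "has_partials S u ux uy" "z \<in> S"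
  shows "partial_x u z = ux z" "partial_y u z = uy z"
  using assms by (auto simp: has_partials_def partial_x_def partial_y_def vector_derivative_at)

lemma C1_onI:
  assumes "has_partials S u ux uy" "continuous_on S ux" "continuous_on S uy"
  shows "C1_on S u"
  unfolding C1_on_def
proof (intro conjI ballI)
  fix z assume "z \<in> S"
  thus "(\<lambda>t::real. u (z + of_real t)) differentiable (at 0)" "(\<lambda>t::real. u (z + \<i> * of_real t)) differentiable (at 0)"
    using assms(1) unfolding has_partials_def by (blast intro: differentiableI_vector)+
next
  show "continuous_on S (partial_x u)" "continuous_on S (partial_y u)"
    using assms(2,3) partials_eq[OF assms(1)] by (auto cong: continuous_on_cong)
qed

lemma has_partials_cong:
  assumes "has_partials S u ux uy" "open S" "\<And>z. z \<in> S \<Longrightarrow> v z = u z"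
    "\<And>z. z \<in> S \<Longrightarrow> vx z = ux z" "\<And>z. z \<in> S \<Longrightarrow> vy z = uy z"
  shows "has_partials S v vx vy"
  unfolding has_partials_def
proof (intro ballI conjI)
  fix z assume z: "z \<in> S"
  have o: "open ((\<lambda>t::real. z + k * of_real t) -` S)" for k
    by (intro open_vimage assms(2) continuous_intros)
  show "((\<lambda>t::real. v (z + of_real t)) has_vector_derivative vx z) (at 0)"
  proof (rule has_vector_derivative_transform_within_open)
    show "((\<lambda>t::real. u (z + of_real t)) has_vector_derivative vx z) (at 0)"
      using assms(1,4) z by (simp add: has_partials_def)
    show "open ((\<lambda>t::real. z + 1 * of_real t) -` S)" by (rule o)
  qed (use assms(3) z in auto)
  show "((\<lambda>t::real. v (z + \<i> * of_real t)) has_vector_derivative vy z) (at 0)"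
  proof (rule has_vector_derivative_transform_within_open)
    show "((\<lambda>t::real. u (z + \<i> * of_real t)) has_vector_derivative vy z) (at 0)"
      using assms(1,5) z by (simp add: has_partials_def)
    show "open ((\<lambda>t::real. z + \<i> * of_real t) -` S)" by (rule o)
  qed (use assms(3) z in auto)
qed

lemma C2_onI:
  assumes "open S" "has_partials S u ux uy" "has_partials S ux uxx uxy" "has_partials S uy uyx uyy"
    and cont: "continuous_on S ux" "continuous_on S uy" "continuous_on S uxx" "continuous_on S uxy"
      "continuous_on S uyx" "continuous_on S uyy"
  shows "C2_on S u" "\<And>z. z \<in> S \<Longrightarrow> partial_x (partial_x u) z = uxx z"
    "\<And>z. z \<in> S \<Longrightarrow> partial_y (partial_y u) z = uyy z"
proof -
  have x: "has_partials S (partial_x u) uxx uxy"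
    by (rule has_partials_cong[OF assms(3,1)]) (use partials_eq[OF assms(2)] in auto)
  have y: "has_partials S (partial_y u) uyx uyy"
    by (rule has_partials_cong[OF assms(4,1)]) (use partials_eq[OF assms(2)] in auto)
  show "C2_on S u" unfolding C2_on_def
    using C1_onI[OF assms(2) cont(1,2)] C1_onI[OF x cont(3,4)] C1_onI[OF y cont(5,6)] by blast
  show "partial_x (partial_x u) z = uxx z" "partial_y (partial_y u) z = uyy z" if "z \<in> S" for z
    using partials_eq[OF x that] partials_eq[OF y that] by auto
qed

text \<open>The mean value inequality bounds all difference quotients by \<open>m K\<close>. Their
  series therefore converges uniformly by the Weierstrass test, and the limit at 0 may be taken term
  by term.\<close>

lemma has_vector_derivative_infsum:
  fixes f f' :: "'a \<Rightarrow> real \<Rightarrow> complex"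
  assumes r: "r > 0"
    and f: "\<And>K t. K \<in> A \<Longrightarrow> \<bar>t\<bar> < r \<Longrightarrow> (f K has_vector_derivative f' K t) (at t)"
    and m: "\<And>K t. K \<in> A \<Longrightarrow> \<bar>t\<bar> < r \<Longrightarrow> norm (f' K t) \<le> m K" "m summable_on A"
    and f0: "(\<lambda>K. f K 0) summable_on A"
  shows "((\<lambda>t. \<Sum>\<^sub>\<infinity>K\<in>A. f K t) has_vector_derivative (\<Sum>\<^sub>\<infinity>K\<in>A. f' K 0)) (at 0)"
proof -
  define q where "q = (\<lambda>K t. (f K t - f K 0) / of_real t)"
  \<comment> \<open>Punctured at 0, where the quotient \<open>q\<close> only has the default value
    of division by zero.\<close>
  define S where "S = {-r<..<r} - {0::real}"
  have inc: "norm (f K t - f K 0) \<le> m K * \<bar>t\<bar>" if K: "K \<in> A" and t: "\<bar>t\<bar> < r" for K t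
  proof -
    have "norm (f K t - f K 0) \<le> m K * norm (t - 0)"
    proof (rule differentiable_bound[where S = "{-r<..<r}"])
      fix x assume x: "x \<in> {-r<..<r}"
      hence x': "\<bar>x\<bar> < r" by auto
      show "(f K has_derivative (\<lambda>h. h *\<^sub>R f' K x)) (at x within {-r<..<r})"
        using f[OF K x'] unfolding has_vector_derivative_def by (rule has_derivative_at_withinI)
      show "onorm (\<lambda>h. h *\<^sub>R f' K x) \<le> m K"
        using m(1)[OF K x'] by (intro onorm_le) (simp add: mult.commute mult_left_mono)
    qed (use t r in auto)
    thus ?thesis by simp
  qed
  have qb: "norm (q K t) \<le> m K" if "K \<in> A" "t \<in> S" for K t
    using inc[of K t] that by (auto simp: q_def S_def norm_divide divide_le_eq)
  have unif: "uniform_limit S (\<lambda>X t. \<Sum>K\<in>X. q K t) (\<lambda>t. \<Sum>\<^sub>\<infinity>K\<in>A. q K t) (finite_subsets_at_top A)"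
    using qb m(2) by (rule Weierstrass_m_test_general)
  have f'sum: "(\<lambda>K. f' K 0) summable_on A"
    by (rule abs_summable_summable[OF Infinite_Sum.abs_summable_on_comparison_test'[OF m(2)]])
       (rule m(1), assumption, simp add: r)
  have lim: "((\<lambda>t. \<Sum>\<^sub>\<infinity>K\<in>A. q K t) \<longlongrightarrow> (\<Sum>\<^sub>\<infinity>K\<in>A. f' K 0)) (at 0 within S)"
  proof (rule swap_uniform_limit[OF _ _ unif])
    have "((\<lambda>t. \<Sum>K\<in>X. q K t) \<longlongrightarrow> (\<Sum>K\<in>X. f' K 0)) (at 0 within S)" if X: "X \<subseteq> A" for X
    proof (rule tendsto_sum)
      fix K assume "K \<in> X"
      hence "(f K has_vector_derivative f' K 0) (at 0)" using f X r by auto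
      hence "((\<lambda>y. norm ((f K y - f K 0) - y *\<^sub>R f' K 0) / norm y) \<longlongrightarrow> 0) (at 0)"
        unfolding has_vector_derivative_def has_derivative_iff_norm by simp
      hence "((\<lambda>y. norm ((f K y - f K 0) - y *\<^sub>R f' K 0) / norm y) \<longlongrightarrow> 0) (at 0 within S)"
        by (rule tendsto_within_subset) simp
      hence "((\<lambda>y. norm (q K y - f' K 0)) \<longlongrightarrow> 0) (at 0 within S)"
      proof (rule Lim_transform_eventually)
        show "\<forall>\<^sub>F y in at 0 within S. norm ((f K y - f K 0) - y *\<^sub>R f' K 0) / norm y = norm (q K y - f' K 0)"
          unfolding eventually_at_filter
        proof (intro always_eventually allI impI)
          fix y :: real assume y: "y \<noteq> 0"
          have "q K y - f' K 0 = ((f K y - f K 0) - y *\<^sub>R f' K 0) / of_real y"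
            using y by (simp add: q_def field_simps scaleR_conv_of_real)
          thus "norm ((f K y - f K 0) - y *\<^sub>R f' K 0) / norm y = norm (q K y - f' K 0)"
            by (simp add: norm_divide)
        qed
      qed
      thus "((\<lambda>t. q K t) \<longlongrightarrow> f' K 0) (at 0 within S)"
        by (subst Lim_null) (rule tendsto_norm_zero_cancel)
    qed
    thus "\<forall>\<^sub>F X in finite_subsets_at_top A. ((\<lambda>t. \<Sum>K\<in>X. q K t) \<longlongrightarrow> (\<Sum>K\<in>X. f' K 0)) (at 0 within S)"
      by (rule eventually_finite_subsets_at_top_weakI)
    show "((\<lambda>X. \<Sum>K\<in>X. f' K 0) \<longlongrightarrow> (\<Sum>\<^sub>\<infinity>K\<in>A. f' K 0)) (finite_subsets_at_top A)"
      using f'sum by (rule infsum_tendsto)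
  qed simp
  define U where "U = (\<lambda>t. \<Sum>\<^sub>\<infinity>K\<in>A. f K t)"
  have UQ: "(\<Sum>\<^sub>\<infinity>K\<in>A. q K t) = (U t - U 0) / of_real t" if t: "t \<in> S" for t
  proof -
    have t0: "t \<noteq> 0" using t by (simp add: S_def)
    have qs: "(\<lambda>K. q K t) summable_on A"
      by (rule abs_summable_summable[OF Infinite_Sum.abs_summable_on_comparison_test'[OF m(2)]]) (rule qb[OF _ t])
    have "U t = (\<Sum>\<^sub>\<infinity>K\<in>A. f K 0 + of_real t * q K t)"
      unfolding U_def using t0 by (intro infsum_cong) (simp add: q_def)
    also have "\<dots> = U 0 + of_real t * (\<Sum>\<^sub>\<infinity>K\<in>A. q K t)"
      unfolding U_def using f0 qs by (subst infsum_add) (auto intro: summable_on_cmult_right simp: infsum_cmult_right')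
    finally show ?thesis using t0 by (simp add: field_simps)
  qed
  have at: "at 0 within S = at (0::real)"
    unfolding S_def using r by (subst at_within_nhd[of 0 "{-r<..<r}" _ UNIV]) auto
  have "((\<lambda>t. (U t - U 0) / of_real t) \<longlongrightarrow> (\<Sum>\<^sub>\<infinity>K\<in>A. f' K 0)) (at 0)"
    using lim unfolding at[symmetric]
    by (rule Lim_transform_eventually) (auto simp: eventually_at_filter UQ)
  hence "((\<lambda>t. norm ((U t - U 0) / of_real t - (\<Sum>\<^sub>\<infinity>K\<in>A. f' K 0))) \<longlongrightarrow> 0) (at 0)"
    by (subst (asm) Lim_null) (rule tendsto_norm_zero)
  hence "((\<lambda>y. norm ((U y - U 0) - (y - 0) *\<^sub>R (\<Sum>\<^sub>\<infinity>K\<in>A. f' K 0)) / norm (y - 0)) \<longlongrightarrow> 0) (at 0)"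
  proof (rule Lim_transform_eventually)
    show "\<forall>\<^sub>F t in at 0. norm ((U t - U 0) / of_real t - (\<Sum>\<^sub>\<infinity>K\<in>A. f' K 0)) =
        norm ((U t - U 0) - (t - 0) *\<^sub>R (\<Sum>\<^sub>\<infinity>K\<in>A. f' K 0)) / norm (t - 0)"
      unfolding eventually_at_filter
    proof (intro always_eventually allI impI)
      fix y :: real assume y: "y \<noteq> 0"
      have "(U y - U 0) / of_real y - (\<Sum>\<^sub>\<infinity>K\<in>A. f' K 0) = ((U y - U 0) - (y - 0) *\<^sub>R (\<Sum>\<^sub>\<infinity>K\<in>A. f' K 0)) / of_real y"
        using y by (simp add: field_simps scaleR_conv_of_real)
      thus "norm ((U y - U 0) / of_real y - (\<Sum>\<^sub>\<infinity>K\<in>A. f' K 0)) =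
        norm ((U y - U 0) - (y - 0) *\<^sub>R (\<Sum>\<^sub>\<infinity>K\<in>A. f' K 0)) / norm (y - 0)"
        by (simp add: norm_divide)
    qed
  qed
  hence "(U has_vector_derivative (\<Sum>\<^sub>\<infinity>K\<in>A. f' K 0)) (at 0)"
    unfolding has_vector_derivative_def has_derivative_iff_norm by (simp add: bounded_linear_scaleR_left)
  thus ?thesis by (simp add: U_def)
qed

lemma has_vector_derivative_shift:
  fixes g :: "real \<Rightarrow> 'b::real_normed_vector"
  assumes "((\<lambda>s. g (t + s)) has_vector_derivative D) (at 0)"
  shows "(g has_vector_derivative D) (at t)"
proof -
  have "((\<lambda>x. x - t) has_vector_derivative 1) (at t)" by (auto intro!: derivative_eq_intros)
  from vector_diff_chain_at[OF this, of "\<lambda>s. g (t + s)" D] assms show ?thesis by (simp add: o_def)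
qed

text \<open>A local majorant of the terms and of their partials is used twice: to differentiate
  termwise along both axes, and to make the summed partials continuous as locally uniform
  limits.\<close>

lemma partials_infsum:
  fixes u ux uy :: "'a \<Rightarrow> complex \<Rightarrow> complex"
  assumes S: "open S"
    and u: "\<And>K. K \<in> A \<Longrightarrow> has_partials S (u K) (ux K) (uy K)"
    and cont: "\<And>K. K \<in> A \<Longrightarrow> continuous_on S (ux K)" "\<And>K. K \<in> A \<Longrightarrow> continuous_on S (uy K)"
    and loc: "\<And>z. z \<in> S \<Longrightarrow> \<exists>r>0. \<exists>m. ball z r \<subseteq> S \<and> m summable_on A \<and>
      (\<forall>K\<in>A. \<forall>w\<in>ball z r. norm (u K w) \<le> m K \<and> norm (ux K w) \<le> m K \<and> norm (uy K w) \<le> m K)"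
  shows "has_partials S (\<lambda>z. \<Sum>\<^sub>\<infinity>K\<in>A. u K z) (\<lambda>z. \<Sum>\<^sub>\<infinity>K\<in>A. ux K z) (\<lambda>z. \<Sum>\<^sub>\<infinity>K\<in>A. uy K z)"
    "continuous_on S (\<lambda>z. \<Sum>\<^sub>\<infinity>K\<in>A. ux K z)" "continuous_on S (\<lambda>z. \<Sum>\<^sub>\<infinity>K\<in>A. uy K z)"
proof -
  show "has_partials S (\<lambda>z. \<Sum>\<^sub>\<infinity>K\<in>A. u K z) (\<lambda>z. \<Sum>\<^sub>\<infinity>K\<in>A. ux K z) (\<lambda>z. \<Sum>\<^sub>\<infinity>K\<in>A. uy K z)"
    unfolding has_partials_def
  proof (intro ballI conjI)
    fix z assume z: "z \<in> S"
    obtain r m where rm: "r > 0" "ball z r \<subseteq> S" "m summable_on A"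
      "\<And>K w. K \<in> A \<Longrightarrow> w \<in> ball z r \<Longrightarrow> norm (u K w) \<le> m K \<and> norm (ux K w) \<le> m K \<and> norm (uy K w) \<le> m K"
      using loc[OF z] by metis
    have zb: "z \<in> ball z r" using rm(1) by simp
    have s0: "(\<lambda>K. u K z) summable_on A"
      by (rule abs_summable_summable[OF Infinite_Sum.abs_summable_on_comparison_test'[OF rm(3)]])
         (rule rm(4)[OF _ zb, THEN conjunct1])
    have inb: "z + of_real t \<in> ball z r" "z + \<i> * of_real t \<in> ball z r" if "\<bar>t\<bar> < r" for t
      using that by (auto simp: dist_norm norm_mult)
    have x: "((\<lambda>t. u K (z + of_real t)) has_vector_derivative ux K (z + of_real t)) (at t)" if "K \<in> A" "\<bar>t\<bar> < r" for K t
    proof (rule has_vector_derivative_shift)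
      have "z + of_real t \<in> S" using inb(1)[OF that(2)] rm(2) by blast
      hence "((\<lambda>s::real. u K (z + of_real t + of_real s)) has_vector_derivative ux K (z + of_real t)) (at 0)"
        using u[OF that(1)] unfolding has_partials_def by blast
      thus "((\<lambda>s. u K (z + of_real (t + s))) has_vector_derivative ux K (z + of_real t)) (at 0)"
        by (simp only: of_real_add add.assoc)
    qed
    have y: "((\<lambda>t. u K (z + \<i> * of_real t)) has_vector_derivative uy K (z + \<i> * of_real t)) (at t)" if "K \<in> A" "\<bar>t\<bar> < r" for K t
    proof (rule has_vector_derivative_shift)
      have "z + \<i> * of_real t \<in> S" using inb(2)[OF that(2)] rm(2) by blast
      hence "((\<lambda>s::real. u K (z + \<i> * of_real t + \<i> * of_real s)) has_vector_derivative uy K (z + \<i> * of_real t)) (at 0)"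
        using u[OF that(1)] unfolding has_partials_def by blast
      thus "((\<lambda>s. u K (z + \<i> * of_real (t + s))) has_vector_derivative uy K (z + \<i> * of_real t)) (at 0)"
        by (simp only: of_real_add add.assoc distrib_left)
    qed
    have hbox: "norm (ux K (z + of_real t)) \<le> m K" "norm (uy K (z + \<i> * of_real t)) \<le> m K"
      if "K \<in> A" "\<bar>t\<bar> < r" for K t
      using rm(4)[OF that(1) inb(1)[OF that(2)]] rm(4)[OF that(1) inb(2)[OF that(2)]] by blast+
    show "((\<lambda>t::real. \<Sum>\<^sub>\<infinity>K\<in>A. u K (z + of_real t)) has_vector_derivative (\<Sum>\<^sub>\<infinity>K\<in>A. ux K z)) (at 0)"
      using has_vector_derivative_infsum[OF rm(1) x hbox(1) rm(3)] s0 by simp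
    show "((\<lambda>t::real. \<Sum>\<^sub>\<infinity>K\<in>A. u K (z + \<i> * of_real t)) has_vector_derivative (\<Sum>\<^sub>\<infinity>K\<in>A. uy K z)) (at 0)"
      using has_vector_derivative_infsum[OF rm(1) y hbox(2) rm(3)] s0 by simp
  qed
  have cont_sum: "continuous_on S (\<lambda>z. \<Sum>\<^sub>\<infinity>K\<in>A. v K z)"
    if vc: "\<And>K. K \<in> A \<Longrightarrow> continuous_on S (v K)"
      and vb: "\<And>z. z \<in> S \<Longrightarrow> \<exists>r>0. \<exists>m. ball z r \<subseteq> S \<and> m summable_on A \<and> (\<forall>K\<in>A. \<forall>w\<in>ball z r. norm (v K w) \<le> m K)"
    for v :: "'a \<Rightarrow> complex \<Rightarrow> complex"
    unfolding continuous_on_eq_continuous_at[OF S]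
  proof
    fix z assume "z \<in> S"
    then obtain r m where rm: "r > 0" "ball z r \<subseteq> S" "m summable_on A"
      "\<And>K w. K \<in> A \<Longrightarrow> w \<in> ball z r \<Longrightarrow> norm (v K w) \<le> m K"
      using vb by metis
    have "uniform_limit (ball z r) (\<lambda>X w. \<Sum>K\<in>X. v K w) (\<lambda>w. \<Sum>\<^sub>\<infinity>K\<in>A. v K w) (finite_subsets_at_top A)"
      using rm(4,3) by (rule Weierstrass_m_test_general)
    moreover have "\<forall>\<^sub>F X in finite_subsets_at_top A. continuous_on (ball z r) (\<lambda>w. \<Sum>K\<in>X. v K w)"
    proof (rule eventually_finite_subsets_at_top_weakI)
      fix X assume "X \<subseteq> A"
      thus "continuous_on (ball z r) (\<lambda>w. \<Sum>K\<in>X. v K w)"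
        using vc rm(2) by (intro continuous_on_sum) (auto intro: continuous_on_subset)
    qed
    ultimately have "continuous_on (ball z r) (\<lambda>w. \<Sum>\<^sub>\<infinity>K\<in>A. v K w)"
      by (intro uniform_limit_theorem) auto
    thus "isCont (\<lambda>w. \<Sum>\<^sub>\<infinity>K\<in>A. v K w) z"
      using rm(1) by (auto simp: continuous_on_eq_continuous_at)
  qed
  show "continuous_on S (\<lambda>z. \<Sum>\<^sub>\<infinity>K\<in>A. ux K z)"
    using cont(1)
  proof (rule cont_sum)
    fix z assume "z \<in> S"
    from loc[OF this] show "\<exists>r>0. \<exists>m. ball z r \<subseteq> S \<and> m summable_on A \<and> (\<forall>K\<in>A. \<forall>w\<in>ball z r. norm (ux K w) \<le> m K)" by blast
  qed
  show "continuous_on S (\<lambda>z. \<Sum>\<^sub>\<infinity>K\<in>A. uy K z)"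
    using cont(2)
  proof (rule cont_sum)
    fix z assume "z \<in> S"
    from loc[OF this] show "\<exists>r>0. \<exists>m. ball z r \<subseteq> S \<and> m summable_on A \<and> (\<forall>K\<in>A. \<forall>w\<in>ball z r. norm (uy K w) \<le> m K)" by blast
  qed
qed

lemma has_partials_mult:
  assumes "has_partials S p px py" "has_partials S f fx fy"
  shows "has_partials S (\<lambda>z. p z * f z) (\<lambda>z. px z * f z + p z * fx z) (\<lambda>z. py z * f z + p z * fy z)"
  unfolding has_partials_def
proof (intro ballI conjI)
  fix z assume z: "z \<in> S"
  show "((\<lambda>t::real. p (z + of_real t) * f (z + of_real t)) has_vector_derivative px z * f z + p z * fx z) (at 0)"
    using has_vector_derivative_mult[of "\<lambda>t. p (z + of_real t)" "px z" 0 UNIV "\<lambda>t. f (z + of_real t)" "fx z"] assms z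
    by (simp add: has_partials_def add.commute)
  show "((\<lambda>t::real. p (z + \<i> * of_real t) * f (z + \<i> * of_real t)) has_vector_derivative py z * f z + p z * fy z) (at 0)"
    using has_vector_derivative_mult[of "\<lambda>t. p (z + \<i> * of_real t)" "py z" 0 UNIV "\<lambda>t. f (z + \<i> * of_real t)" "fy z"] assms z
    by (simp add: has_partials_def add.commute)
qed

lemma has_partials_cmult:
  assumes "has_partials S f fx fy"
  shows "has_partials S (\<lambda>z. k * f z) (\<lambda>z. k * fx z) (\<lambda>z. k * fy z)"
  using assms unfolding has_partials_def
  by (auto intro!: derivative_eq_intros)

text \<open>For \<open>Y = Im (act A z)\<close> the logarithmic derivatives of \<open>Y\<close> are \<open>Y\<^sub>x/Y = -2 Re \<mu>\<close> and
  \<open>Y\<^sub>y/Y = 1/y + 2 Im \<mu>\<close> with \<open>\<mu> = c/(cz+d)\<close>, and \<open>\<mu>' = -\<mu>\<^sup>2\<close>.\<close>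

definition mu :: "real^2^2 \<Rightarrow> complex \<Rightarrow> complex" where
  "mu A z = of_real (A$2$1) / auto_factor A z"

definition logdx :: "real^2^2 \<Rightarrow> complex \<Rightarrow> complex" where
  "logdx A z = of_real (- 2 * Re (mu A z))"

definition logdy :: "real^2^2 \<Rightarrow> complex \<Rightarrow> complex" where
  "logdy A z = of_real (1 / Im z + 2 * Im (mu A z))"

definition height_power :: "real^2^2 \<Rightarrow> complex \<Rightarrow> complex \<Rightarrow> complex" where
  "height_power A s z = of_real (Im (act A z)) powr s"

lemma has_field_derivative_mu:
  assumes "det A = 1" "Im z > 0"
  shows "(mu A has_field_derivative - (mu A z)\<^sup>2) (at z)"
proof -
  have nz: "of_real (A$2$1) * z + of_real (A$2$2) \<noteq> (0::complex)"
    using auto_factor_nonzero[OF assms] by (simp add: auto_factor_def)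
  show ?thesis unfolding mu_def[abs_def] auto_factor_def
    by (rule derivative_eq_intros refl nz)+ (use nz in \<open>simp add: power2_eq_square field_simps\<close>)
qed

lemma directional_derivative:
  assumes "(f has_field_derivative D) (at z)"
  shows "((\<lambda>t::real. f (z + k * of_real t)) has_vector_derivative k * D) (at 0)"
proof -
  have "((\<lambda>t::real. z + k * of_real t) has_vector_derivative k) (at 0)"
    by (auto intro!: derivative_eq_intros)
  thus ?thesis using field_vector_diff_chain_at[of "\<lambda>t::real. z + k * of_real t" k 0 f D] assms by (simp add: o_def)
qed

lemma directional_Re_Im:
  assumes "(f has_field_derivative D) (at z)"
  shows "((\<lambda>t::real. Re (f (z + k * of_real t))) has_real_derivative Re (k * D)) (at 0)"
    "((\<lambda>t::real. Im (f (z + k * of_real t))) has_real_derivative Im (k * D)) (at 0)"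
  using bounded_linear.has_vector_derivative[OF bounded_linear_Re directional_derivative[OF assms, of k]]
    bounded_linear.has_vector_derivative[OF bounded_linear_Im directional_derivative[OF assms, of k]]
  by (simp_all add: has_real_derivative_iff_has_vector_derivative)

lemma has_partials_logdx:
  assumes "det A = 1"
  shows "has_partials upper_half_plane (logdx A) (\<lambda>z. of_real (2 * Re ((mu A z)\<^sup>2))) (\<lambda>z. of_real (- 2 * Im ((mu A z)\<^sup>2)))"
  unfolding has_partials_def logdx_def
proof (intro ballI conjI)
  fix z assume "z \<in> upper_half_plane"
  hence z: "Im z > 0" by (simp add: upper_half_plane_def)
  note d = directional_Re_Im(1)[OF has_field_derivative_mu[OF assms z]]
  have "((\<lambda>t::real. - 2 * Re (mu A (z + of_real t))) has_real_derivative 2 * Re ((mu A z)\<^sup>2)) (at 0)"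
    using DERIV_cmult[OF d[of 1], of "- 2"] by simp
  thus "((\<lambda>t::real. complex_of_real (- 2 * Re (mu A (z + of_real t)))) has_vector_derivative of_real (2 * Re ((mu A z)\<^sup>2))) (at 0)"
    by (rule has_vector_derivative_of_real)
  have "((\<lambda>t::real. - 2 * Re (mu A (z + \<i> * of_real t))) has_real_derivative - 2 * Im ((mu A z)\<^sup>2)) (at 0)"
    using DERIV_cmult[OF d[of \<i>], of "- 2"] by simp
  thus "((\<lambda>t::real. complex_of_real (- 2 * Re (mu A (z + \<i> * of_real t)))) has_vector_derivative of_real (- 2 * Im ((mu A z)\<^sup>2))) (at 0)"
    by (rule has_vector_derivative_of_real)
qed

lemma has_partials_logdy:
  assumes "det A = 1"
  shows "has_partials upper_half_plane (logdy A) (\<lambda>z. of_real (- 2 * Im ((mu A z)\<^sup>2)))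
     (\<lambda>z. of_real (- 1 / (Im z)\<^sup>2 - 2 * Re ((mu A z)\<^sup>2)))"
  unfolding has_partials_def logdy_def
proof (intro ballI conjI)
  fix z assume "z \<in> upper_half_plane"
  hence z: "Im z > 0" by (simp add: upper_half_plane_def)
  note d = directional_Re_Im(2)[OF has_field_derivative_mu[OF assms z]]
  have "((\<lambda>t::real. 1 / Im z + 2 * Im (mu A (z + of_real t))) has_real_derivative 0 + 2 * Im (1 * - (mu A z)\<^sup>2)) (at 0)"
    using DERIV_add[OF DERIV_const DERIV_cmult[OF d[of 1], of 2]] by simp
  hence "((\<lambda>t::real. 1 / Im (z + of_real t) + 2 * Im (mu A (z + of_real t))) has_real_derivative - 2 * Im ((mu A z)\<^sup>2)) (at 0)"
    by simp
  thus "((\<lambda>t::real. complex_of_real (1 / Im (z + of_real t) + 2 * Im (mu A (z + of_real t)))) has_vector_derivative of_real (- 2 * Im ((mu A z)\<^sup>2))) (at 0)"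
    by (rule has_vector_derivative_of_real)
  have "((\<lambda>t::real. 1 / (Im z + t)) has_real_derivative - 1 / (Im z)\<^sup>2) (at 0)"
    using z by (auto intro!: derivative_eq_intros simp: power2_eq_square field_simps)
  from DERIV_add[OF this DERIV_cmult[OF d[of \<i>], of 2]]
  have "((\<lambda>t::real. 1 / Im (z + \<i> * of_real t) + 2 * Im (mu A (z + \<i> * of_real t))) has_real_derivative
      - 1 / (Im z)\<^sup>2 - 2 * Re ((mu A z)\<^sup>2)) (at 0)"
    by simp
  thus "((\<lambda>t::real. complex_of_real (1 / Im (z + \<i> * of_real t) + 2 * Im (mu A (z + \<i> * of_real t)))) has_vector_derivative
      of_real (- 1 / (Im z)\<^sup>2 - 2 * Re ((mu A z)\<^sup>2))) (at 0)"
    by (rule has_vector_derivative_of_real)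
qed

lemma mu_bound:
  assumes "det A = 1" "Im z > 0"
  shows "norm (mu A z) \<le> 1 / Im z"
proof -
  have "\<bar>A$2$1\<bar> * Im z = \<bar>Im (auto_factor A z)\<bar>" using assms(2) by (simp add: auto_factor_def abs_mult)
  also have "\<dots> \<le> norm (auto_factor A z)" by (rule abs_Im_le_cmod)
  finally show ?thesis using auto_factor_nonzero[OF assms] assms(2) by (simp add: mu_def norm_divide field_simps)
qed

text \<open>The first two express the partials of \<open>Y = Im (act A z)\<close> through Y itself.
  The third states \<open>|grad log Y|^2 = 1 / y^2\<close>, the invariance of the hyperbolic
  gradient length, and is the source of the term \<open>s^2\<close> in the eigenvalue.\<close>

lemma log_derivative_identities:
  assumes "det A = 1" "Im z > 0"
  shows "Im (1 / (auto_factor A z)\<^sup>2) = (- 2 * Re (mu A z)) * Im (act A z)"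
    "Re (1 / (auto_factor A z)\<^sup>2) = (1 / Im z + 2 * Im (mu A z)) * Im (act A z)"
    "(Re (mu A z))\<^sup>2 * 4 + (1 / Im z + 2 * Im (mu A z))\<^sup>2 = 1 / (Im z)\<^sup>2"
proof -
  define y where "y = Im z"
  define c where "c = A$2$1"
  define a where "a = Re (auto_factor A z)"
  have b: "Im (auto_factor A z) = c * y" by (simp add: auto_factor_def c_def y_def)
  have j: "auto_factor A z = Complex a (c * y)" using b by (simp add: a_def complex_eq_iff)
  define N where "N = a\<^sup>2 + (c * y)\<^sup>2"
  have "auto_factor A z \<noteq> 0" using auto_factor_nonzero[OF assms] .
  hence N: "N > 0" using j by (auto simp: N_def complex_eq_iff sum_power2_gt_zero_iff)
  have y: "y > 0" using assms by (simp add: y_def)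
  have mu: "Re (mu A z) = c * a / N" "Im (mu A z) = - (c * (c * y)) / N"
    unfolding mu_def j by (simp_all add: Re_divide Im_divide N_def c_def)
  have ia: "Im (act A z) = y / N"
    unfolding Im_act[OF assms(1)] cmod_power2 b by (simp add: N_def y_def a_def)
  have sq: "(auto_factor A z)\<^sup>2 = Complex (a\<^sup>2 - (c * y)\<^sup>2) (2 * a * (c * y))"
    unfolding j by (simp add: complex_eq_iff power2_eq_square)
  have n2: "(a\<^sup>2 - (c * y)\<^sup>2)\<^sup>2 + (2 * a * (c * y))\<^sup>2 = N\<^sup>2"
    by (simp add: N_def power2_eq_square algebra_simps)
  have "Im (1 / (auto_factor A z)\<^sup>2) = - (2 * a * (c * y)) / N\<^sup>2"
    unfolding sq Im_divide complex.sel n2 by simp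
  also have "\<dots> = (- 2 * (c * a / N)) * (y / N)" using N by (simp add: power2_eq_square)
  finally show "Im (1 / (auto_factor A z)\<^sup>2) = (- 2 * Re (mu A z)) * Im (act A z)" by (simp add: mu ia)
  have "Re (1 / (auto_factor A z)\<^sup>2) = (a\<^sup>2 - (c * y)\<^sup>2) / N\<^sup>2"
    unfolding sq Re_divide complex.sel n2 by simp
  also have "a\<^sup>2 - (c * y)\<^sup>2 = N - 2 * (c * y)\<^sup>2" by (simp add: N_def)
  also have "(N - 2 * (c * y)\<^sup>2) / N\<^sup>2 = (1 / y + 2 * (- (c * (c * y)) / N)) * (y / N)"
    using N y by (simp add: power2_eq_square field_simps)
  finally show "Re (1 / (auto_factor A z)\<^sup>2) = (1 / Im z + 2 * Im (mu A z)) * Im (act A z)" by (simp add: mu ia y_def)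
  have "(c * a / N)\<^sup>2 * 4 + (1 / y + 2 * (- (c * (c * y)) / N))\<^sup>2
      = 1 / y\<^sup>2 + 4 * c\<^sup>2 * (a\<^sup>2 + (c * y)\<^sup>2 - N) / N\<^sup>2"
    using N y by (simp add: power2_eq_square field_simps)
  also have "\<dots> = 1 / y\<^sup>2" by (simp add: N_def)
  finally show "(Re (mu A z))\<^sup>2 * 4 + (1 / Im z + 2 * Im (mu A z))\<^sup>2 = 1 / (Im z)\<^sup>2" by (simp add: mu y_def)
qed

lemma has_vector_derivative_powr:
  fixes h :: "real \<Rightarrow> real" and s :: complex
  assumes "(h has_real_derivative l * h x) (at x)" "h x > 0"
  shows "((\<lambda>t. of_real (h t) powr s) has_vector_derivative s * of_real l * of_real (h x) powr s) (at x)"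
proof -
  have "((\<lambda>t. complex_of_real (h t)) has_vector_derivative of_real (l * h x)) (at x)"
    using assms(1) by (rule has_vector_derivative_of_real)
  moreover have "((\<lambda>w. w powr s) has_field_derivative s * of_real (h x) powr (s - 1)) (at (complex_of_real (h x)))"
    using assms(2) by (intro has_field_derivative_powr) (simp add: complex_nonpos_Reals_iff)
  ultimately have "((\<lambda>t. of_real (h t) powr s) has_vector_derivative of_real (l * h x) * (s * of_real (h x) powr (s - 1))) (at x)"
    using field_vector_diff_chain_at[of "\<lambda>t. complex_of_real (h t)" _ x "\<lambda>w. w powr s"] by (simp add: o_def)
  moreover have "of_real (h x) powr (s - 1) = of_real (h x) powr s / of_real (h x)"
    using assms(2) by (simp add: powr_diff)
  ultimately show ?thesis using assms(2) by (simp add: mult_ac)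
qed

lemma has_partials_height_power:
  assumes "det A = 1"
  shows "has_partials upper_half_plane (height_power A s) (\<lambda>z. s * logdx A z * height_power A s z)
     (\<lambda>z. s * logdy A z * height_power A s z)"
  unfolding has_partials_def
proof (intro ballI conjI)
  fix z assume "z \<in> upper_half_plane"
  hence z: "Im z > 0" by (simp add: upper_half_plane_def)
  note d = directional_Re_Im(2)[OF has_field_derivative_act[OF assms z]]
  note id = log_derivative_identities[OF assms z]
  have "((\<lambda>t::real. Im (act A (z + of_real t))) has_real_derivative (- 2 * Re (mu A z)) * Im (act A (z + of_real 0))) (at 0)"
    using d[of 1] id(1) by simp
  from has_vector_derivative_powr[OF this, of s]
  show "((\<lambda>t::real. height_power A s (z + of_real t)) has_vector_derivative s * logdx A z * height_power A s z) (at 0)"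
    using Im_act_pos[OF assms z] by (simp add: height_power_def logdx_def)
  have "((\<lambda>t::real. Im (act A (z + \<i> * of_real t))) has_real_derivative (1 / Im z + 2 * Im (mu A z)) * Im (act A (z + \<i> * of_real 0))) (at 0)"
    using d[of \<i>] unfolding Im_i_times id(2) by simp
  from has_vector_derivative_powr[OF this, of s]
  show "((\<lambda>t::real. height_power A s (z + \<i> * of_real t)) has_vector_derivative s * logdy A z * height_power A s z) (at 0)"
    using Im_act_pos[OF assms z] by (simp add: height_power_def logdy_def)
qed

lemma infsum_sum_swap:
  fixes f :: "'i \<Rightarrow> 'a \<Rightarrow> complex"
  assumes "finite I" "\<And>i. i \<in> I \<Longrightarrow> f i summable_on A"
  shows "(\<lambda>x. \<Sum>i\<in>I. f i x) summable_on A \<and> (\<Sum>\<^sub>\<infinity>x\<in>A. \<Sum>i\<in>I. f i x) = (\<Sum>i\<in>I. \<Sum>\<^sub>\<infinity>x\<in>A. f i x)"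
  using assms
proof (induction I rule: finite_induct)
  case (insert j I)
  hence "f j summable_on A" "(\<lambda>x. \<Sum>i\<in>I. f i x) summable_on A"
    "(\<Sum>\<^sub>\<infinity>x\<in>A. \<Sum>i\<in>I. f i x) = (\<Sum>i\<in>I. \<Sum>\<^sub>\<infinity>x\<in>A. f i x)" by blast+
  thus ?case using insert.hyps by (simp add: summable_on_add infsum_add)
qed simp

lemma height_power_eq_exp:
  assumes "det A = 1" "Im z > 0"
  shows "height_power A s z = exp (s * of_real (ln (Im (act A z))))"
  using Im_act_pos[OF assms] by (simp add: height_power_def powr_def Ln_of_real)

lemma continuous_on_act:
  assumes "det A = 1"
  shows "continuous_on upper_half_plane (act A)"
  using has_field_derivative_act[OF assms]
  by (intro continuous_at_imp_continuous_on) (auto intro: DERIV_isCont simp: upper_half_plane_def)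

lemma continuous_on_height_power:
  assumes "det A = 1"
  shows "continuous_on upper_half_plane (height_power A s)"
proof -
  have "Im (act A z) \<noteq> 0" if "z \<in> upper_half_plane" for z
    using Im_act_pos[OF assms, of z] that by (simp add: upper_half_plane_def)
  hence "continuous_on upper_half_plane (\<lambda>z. exp (s * of_real (ln (Im (act A z)))))"
    by (intro continuous_intros continuous_on_act assms) auto
  thus ?thesis by (rule continuous_on_eq) (simp add: height_power_eq_exp assms upper_half_plane_def)
qed

lemma continuous_on_mu:
  assumes "det A = 1"
  shows "continuous_on upper_half_plane (mu A)"
  using has_field_derivative_mu[OF assms]
  by (intro continuous_at_imp_continuous_on) (auto intro: DERIV_isCont simp: upper_half_plane_def)

section \<open>Second derivatives of height powers and their majorants\<close>

definition hp_x :: "complex \<Rightarrow> real^2^2 \<Rightarrow> complex \<Rightarrow> complex" where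
  "hp_x s A z = s * (logdx A z * height_power A s z)"

definition hp_y :: "complex \<Rightarrow> real^2^2 \<Rightarrow> complex \<Rightarrow> complex" where
  "hp_y s A z = s * (logdy A z * height_power A s z)"

text \<open>The product rule for \<open>s * l * Y^s\<close>: here \<open>d\<close> is the derivative
  of the logarithmic derivative \<open>l\<close>, and \<open>s * l' * Y^s\<close> is the derivative
  of \<open>Y^s\<close> in the same direction.\<close>

definition hp_second :: "complex \<Rightarrow> real^2^2 \<Rightarrow> (complex \<Rightarrow> real) \<Rightarrow> (complex \<Rightarrow> complex) \<Rightarrow> (complex \<Rightarrow> complex) \<Rightarrow> complex \<Rightarrow> complex" where
  "hp_second s A d l l' z = s * (of_real (d z) * height_power A s z + l z * (s * (l' z * height_power A s z)))"

text \<open>These are the second partials of \<open>log Y\<close>; the mixed one serves for both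
  orders of differentiation.\<close>

definition d_xx :: "real^2^2 \<Rightarrow> complex \<Rightarrow> real" where "d_xx A z = 2 * Re ((mu A z)\<^sup>2)"
definition d_xy :: "real^2^2 \<Rightarrow> complex \<Rightarrow> real" where "d_xy A z = - 2 * Im ((mu A z)\<^sup>2)"
definition d_yy :: "real^2^2 \<Rightarrow> complex \<Rightarrow> real" where "d_yy A z = - 1 / (Im z)\<^sup>2 - 2 * Re ((mu A z)\<^sup>2)"

lemma has_partials_first:
  assumes "det A = 1"
  shows "has_partials upper_half_plane (height_power A s) (hp_x s A) (hp_y s A)"
  using has_partials_height_power[OF assms, of s] by (simp add: hp_x_def[abs_def] hp_y_def[abs_def] mult.assoc)

lemma has_partials_second:
  assumes "det A = 1"
  shows "has_partials upper_half_plane (hp_x s A) (hp_second s A (d_xx A) (logdx A) (logdx A)) (hp_second s A (d_xy A) (logdx A) (logdy A))"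
    "has_partials upper_half_plane (hp_y s A) (hp_second s A (d_xy A) (logdy A) (logdx A)) (hp_second s A (d_yy A) (logdy A) (logdy A))"
  using has_partials_cmult[OF has_partials_mult[OF has_partials_logdx[OF assms] has_partials_first[OF assms, of s]], of s]
    has_partials_cmult[OF has_partials_mult[OF has_partials_logdy[OF assms] has_partials_first[OF assms, of s]], of s]
  unfolding hp_x_def hp_y_def hp_second_def d_xx_def d_xy_def d_yy_def hp_x_def[abs_def] hp_y_def[abs_def] hp_second_def[abs_def]
  by blast+

lemma continuous_on_coefficients:
  assumes "det A = 1"
  shows "continuous_on upper_half_plane (logdx A)" "continuous_on upper_half_plane (logdy A)"
    "continuous_on upper_half_plane (d_xx A)" "continuous_on upper_half_plane (d_xy A)" "continuous_on upper_half_plane (d_yy A)"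
  unfolding logdx_def[abs_def] logdy_def[abs_def] d_xx_def[abs_def] d_xy_def[abs_def] d_yy_def[abs_def]
  by (intro continuous_intros continuous_on_mu assms; auto simp: upper_half_plane_def)+

lemma continuous_on_hp:
  assumes "det A = 1"
  shows "continuous_on upper_half_plane (hp_x s A)" "continuous_on upper_half_plane (hp_y s A)"
    "continuous_on upper_half_plane d \<Longrightarrow> continuous_on upper_half_plane l \<Longrightarrow> continuous_on upper_half_plane l' \<Longrightarrow>
      continuous_on upper_half_plane (hp_second s A d l l')"
  unfolding hp_x_def[abs_def] hp_y_def[abs_def] hp_second_def[abs_def]
  by (intro continuous_intros continuous_on_coefficients continuous_on_height_power assms; assumption)+

text \<open>Everything follows from \<open>|\<mu>| \<le> 1 / Im z\<close>. The 3 comes from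
  \<open>1 / Im z + 2 * |\<mu>|\<close>, and the same \<open>3 / y0\<close> and its square are used
  for all coefficients.\<close>

lemma coefficient_bounds:
  assumes "det A = 1" "Im z \<ge> y0" "y0 > 0"
  shows "norm (logdx A z) \<le> 3 / y0" "norm (logdy A z) \<le> 3 / y0"
    "\<bar>d_xx A z\<bar> \<le> (3 / y0)\<^sup>2" "\<bar>d_xy A z\<bar> \<le> (3 / y0)\<^sup>2" "\<bar>d_yy A z\<bar> \<le> (3 / y0)\<^sup>2"
proof -
  have z: "Im z > 0" using assms by simp
  have "1 / Im z \<le> 1 / y0" using assms by (intro divide_left_mono) auto
  hence m: "norm (mu A z) \<le> 1 / y0" and y: "1 / Im z \<le> 1 / y0" using mu_bound[OF assms(1) z] by auto
  have r: "\<bar>Re (mu A z)\<bar> \<le> 1 / y0" "\<bar>Im (mu A z)\<bar> \<le> 1 / y0"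
    using m abs_Re_le_cmod[of "mu A z"] abs_Im_le_cmod[of "mu A z"] by linarith+
  have q: "3 / y0 = 3 * (1 / y0)" by simp
  have p: "1 / y0 > 0" "1 / Im z > 0" using assms z by auto
  have "\<bar>- 2 * Re (mu A z)\<bar> \<le> 3 * (1 / y0)" "\<bar>1 / Im z + 2 * Im (mu A z)\<bar> \<le> 3 * (1 / y0)"
    using r y p by linarith+
  thus "norm (logdx A z) \<le> 3 / y0" "norm (logdy A z) \<le> 3 / y0"
    unfolding logdx_def logdy_def norm_of_real q by blast+
  have "norm ((mu A z)\<^sup>2) \<le> (1 / y0)\<^sup>2" unfolding norm_power using m by (intro power_mono) auto
  hence m2: "\<bar>Re ((mu A z)\<^sup>2)\<bar> \<le> (1 / y0)\<^sup>2" "\<bar>Im ((mu A z)\<^sup>2)\<bar> \<le> (1 / y0)\<^sup>2"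
    using abs_Re_le_cmod[of "(mu A z)\<^sup>2"] abs_Im_le_cmod[of "(mu A z)\<^sup>2"] by linarith+
  have "(1 / Im z)\<^sup>2 \<le> (1 / y0)\<^sup>2" using y p by (intro power_mono) auto
  hence y2: "1 / (Im z)\<^sup>2 \<le> (1 / y0)\<^sup>2" by (simp add: power_divide)
  have q2: "(3 / y0)\<^sup>2 = 9 * (1 / y0)\<^sup>2" by (simp add: power_divide)
  have p2: "(1 / y0)\<^sup>2 \<ge> 0" "1 / (Im z)\<^sup>2 \<ge> 0" by simp_all
  show "\<bar>d_xx A z\<bar> \<le> (3 / y0)\<^sup>2" "\<bar>d_xy A z\<bar> \<le> (3 / y0)\<^sup>2" "\<bar>d_yy A z\<bar> \<le> (3 / y0)\<^sup>2"
    unfolding d_xx_def d_xy_def d_yy_def q2 minus_divide_left[symmetric] using m2 y2 p2 by linarith+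
qed

text \<open>\<open>T\<close> exceeds every product of coefficients occurring up to order two, so a
  single multiple of \<open>norm h\<close> majorises the term and all its partials.\<close>

lemma second_order_bound:
  fixes s h l l' :: complex and d Q :: real
  assumes "norm l \<le> Q" "norm l' \<le> Q" "\<bar>d\<bar> \<le> Q\<^sup>2"
  defines "T \<equiv> (1 + norm s)\<^sup>2 * (1 + Q)\<^sup>2"
  shows "norm h \<le> T * norm h" "norm (s * (l * h)) \<le> T * norm h"
    "norm (s * (of_real d * h + l * (s * (l' * h)))) \<le> T * norm h"
proof -
  have Q: "Q \<ge> 0" using assms(1) norm_ge_zero order.trans by blast
  define n where "n = norm s"
  have n: "n \<ge> 0" by (simp add: n_def)
  have T: "T = 1 + 2 * n + n\<^sup>2 + 2 * Q + 4 * n * Q + 2 * n\<^sup>2 * Q + Q\<^sup>2 + 2 * n * Q\<^sup>2 + n\<^sup>2 * Q\<^sup>2"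
    by (simp add: T_def n_def power2_eq_square algebra_simps)
  have nn: "0 \<le> n\<^sup>2" "0 \<le> n * Q" "0 \<le> n\<^sup>2 * Q" "0 \<le> Q\<^sup>2" "0 \<le> n * Q\<^sup>2" "0 \<le> n\<^sup>2 * Q\<^sup>2" using n Q by auto
  have T1: "1 \<le> T" "n * Q \<le> T" "n * (Q\<^sup>2 + Q * (n * Q)) \<le> T"
    unfolding T using nn n Q by (simp_all add: algebra_simps power2_eq_square)
  show "norm h \<le> T * norm h" using T1(1) by (simp add: mult_right_mono[of 1 T "norm h", simplified])
  have "norm (s * (l * h)) = n * norm l * norm h" by (simp add: norm_mult n_def)
  also have "\<dots> \<le> n * Q * norm h" using assms n by (intro mult_right_mono mult_left_mono) auto
  also have "\<dots> \<le> T * norm h" using T1 by (intro mult_right_mono) auto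
  finally show "norm (s * (l * h)) \<le> T * norm h" .
  have "norm (s * (of_real d * h + l * (s * (l' * h)))) \<le> n * (\<bar>d\<bar> * norm h + norm l * (n * (norm l' * norm h)))"
    unfolding norm_mult[of s] n_def[symmetric]
    by (intro mult_left_mono order.trans[OF norm_triangle_ineq] n) (simp add: norm_mult n_def)
  also have "\<dots> \<le> n * (Q\<^sup>2 * norm h + Q * (n * (Q * norm h)))"
    using assms n Q by (intro mult_left_mono add_mono mult_mono mult_nonneg_nonneg) auto
  also have "\<dots> = n * (Q\<^sup>2 + Q * (n * Q)) * norm h" by (simp add: algebra_simps)
  also have "\<dots> \<le> T * norm h" using T1 by (intro mult_right_mono) auto
  finally show "norm (s * (of_real d * h + l * (s * (l' * h)))) \<le> T * norm h" .
qed

lemma norm_height_power: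
  assumes "det A = 1" "Im z > 0"
  shows "norm (height_power A s z) = Im (act A z) powr Re s"
  using Im_act_pos[OF assms] by (simp add: height_power_def norm_powr_real_powr)

text \<open>A Harnack-type comparison with a constant independent of \<open>A\<close>:
  \<open>Im w \<le> 3/2 * Im z0\<close> and \<open>|c z0 + d| \<le> 2 * |c w + d|\<close> give
  \<open>6 = 3/2 * 2^2\<close>. It turns convergence at the centre into a majorant on the
  ball.\<close>

lemma height_comparison:
  assumes A: "det A = 1" and z0: "Im z0 > 0" and w: "w \<in> ball z0 (Im z0 / 2)"
  shows "Im w \<ge> Im z0 / 2" "Im (act A w) \<le> 6 * Im (act A z0)"
proof -
  have d: "cmod (z0 - w) \<le> Im z0 / 2" using w by (simp add: dist_norm)
  hence i: "\<bar>Im z0 - Im w\<bar> \<le> Im z0 / 2" using abs_Im_le_cmod[of "z0 - w"] by simp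
  thus Iw: "Im w \<ge> Im z0 / 2" by linarith
  have Iw': "Im w > 0" "Im w \<le> 3/2 * Im z0" using i z0 by linarith+
  let ?j = "cmod (auto_factor A w)"
  have jp: "?j > 0" "cmod (auto_factor A z0) > 0" using auto_factor_nonzero[OF A] Iw' z0 by auto
  have "\<bar>A$2$1\<bar> * Im w = \<bar>Im (auto_factor A w)\<bar>" using Iw' by (simp add: auto_factor_def abs_mult)
  hence cj: "\<bar>A$2$1\<bar> * Im w \<le> ?j" using abs_Im_le_cmod[of "auto_factor A w"] by simp
  have "auto_factor A z0 = auto_factor A w + of_real (A$2$1) * (z0 - w)" by (simp add: auto_factor_def algebra_simps)
  hence "cmod (auto_factor A z0) \<le> ?j + \<bar>A$2$1\<bar> * cmod (z0 - w)"
    by (metis norm_mult norm_of_real norm_triangle_ineq)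
  also have "\<bar>A$2$1\<bar> * cmod (z0 - w) \<le> \<bar>A$2$1\<bar> * Im w" using d Iw by (intro mult_left_mono) auto
  finally have "cmod (auto_factor A z0) \<le> 2 * ?j" using cj by simp
  hence "(cmod (auto_factor A z0))\<^sup>2 \<le> (2 * ?j)\<^sup>2" using jp by (intro power_mono) auto
  hence sq: "(cmod (auto_factor A z0))\<^sup>2 / 4 \<le> ?j\<^sup>2" by (simp add: power_mult_distrib)
  have "Im (act A w) = Im w / ?j\<^sup>2" by (rule Im_act[OF A])
  also have "\<dots> \<le> (3/2 * Im z0) / ((cmod (auto_factor A z0))\<^sup>2 / 4)"
    using sq jp Iw' z0 by (intro frac_le) auto
  also have "\<dots> = 6 * Im (act A z0)" by (simp add: Im_act[OF A])
  finally show "Im (act A w) \<le> 6 * Im (act A z0)" .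
qed

section \<open>The twisted Eisenstein series\<close>

context fuchsian_forms
begin

context
  fixes a :: endpoint and b :: proj_real
  assumes a: "is_endpoint \<Gamma> a" and b: "is_cusp \<Gamma> b"
begin

abbreviation rep :: "(real^2^2) set \<Rightarrow> real^2^2" where
  "rep K \<equiv> (SOME \<gamma>. \<gamma> \<in> K)"

lemma eisenstein_term_eq:
  "eisenstein_term \<sigma> fs a b z s \<gamma> w = gen (act_endpoint \<gamma> a) a w * of_real (height b z \<gamma>) powr s"
  by (simp add: eisenstein_term_def height_def matrix_inv_eq_adj2[OF det_scaling[OF b]])

lemma eisenstein_term_left_mult:
  assumes "z \<in> upper_half_plane" "\<gamma> \<in> \<Gamma>" "\<tau> \<in> cusp_stabilizer \<Gamma> b"
  shows "eisenstein_term \<sigma> fs a b z s (\<tau> ** \<gamma>) = eisenstein_term \<sigma> fs a b z s \<gamma>"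
proof
  fix w
  show "eisenstein_term \<sigma> fs a b z s (\<tau> ** \<gamma>) w = eisenstein_term \<sigma> fs a b z s \<gamma> w"
    using gen_series_left_mult[OF a b assms(2,3)] height_left_mult[OF b assms(3,2)] assms(1)
    by (simp add: eisenstein_term_eq upper_half_plane_def)
qed

lemma eisenstein_coset_term_rep:
  assumes "K \<in> cusp_cosets \<Gamma> b" "\<gamma> \<in> K" "z \<in> upper_half_plane"
  shows "eisenstein_coset_term \<sigma> fs a b z s K = eisenstein_term \<sigma> fs a b z s \<gamma>"
proof -
  note g = coset_representative[OF assms(1,2)]
  obtain \<tau> where "\<tau> \<in> cusp_stabilizer \<Gamma> b" "rep K = \<tau> ** \<gamma>"
    using coset_nonempty[OF assms(1)] unfolding g(2) by blast
  thus ?thesis using eisenstein_term_left_mult[OF assms(3) g(1)] by (simp add: eisenstein_coset_term_def)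
qed

lemma rep_in:
  assumes "K \<in> cusp_cosets \<Gamma> b"
  shows "rep K \<in> \<Gamma>" "det (rep K) = 1" "det (adj2 (\<sigma> b) ** rep K) = 1"
proof -
  show 1: "rep K \<in> \<Gamma>" by (rule coset_representative(1)[OF assms coset_nonempty[OF assms]])
  thus 2: "det (rep K) = 1" by (rule det_1)
  show "det (adj2 (\<sigma> b) ** rep K) = 1" using 2 det_scaling[OF b] by (simp add: det_mult2)
qed

definition coef :: "nat list \<Rightarrow> (real^2^2) set \<Rightarrow> complex" where
  "coef w K = gen (act_endpoint (rep K) a) a w"

definition cmat :: "(real^2^2) set \<Rightarrow> real^2^2" where
  "cmat K = adj2 (\<sigma> b) ** rep K"

lemma coset_term_eq:
  assumes "K \<in> cusp_cosets \<Gamma> b" "Im z > 0"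
  shows "eisenstein_coset_term \<sigma> fs a b z s K w = coef w K * height_power (cmat K) s z"
proof -
  have "act (cmat K) z = act (adj2 (\<sigma> b)) (act (rep K) z)"
    unfolding cmat_def using assms rep_in[OF assms(1)] det_scaling[OF b] by (intro act_mult) auto
  thus ?thesis unfolding eisenstein_coset_term_def eisenstein_term_eq coef_def height_power_def height_def by simp
qed

lemma det_cmat: "K \<in> cusp_cosets \<Gamma> b \<Longrightarrow> det (cmat K) = 1"
  using rep_in(3) by (simp add: cmat_def)

lemma coset_terms_summable:
  assumes s: "Re s > 1" and z: "Im z > 0"
  shows "(\<lambda>K. norm (eisenstein_coset_term \<sigma> fs a b z s K w)) summable_on cusp_cosets \<Gamma> b"
proof -
  let ?A = "cusp_cosets \<Gamma> b"
  \<comment> \<open>At most half of the margin \<open>Re s - 1\<close> is spent, so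
    \<open>Re s\<close> and \<open>Re s - \<epsilon>\<close> are both exponents of
    convergence.\<close>
  define \<epsilon> where "\<epsilon> = min 1 ((Re s - 1) / 2)"
  have \<epsilon>: "0 < \<epsilon>" "\<epsilon> \<le> 1" "Re s - \<epsilon> > 1"
    unfolding \<epsilon>_def min_def using s by (auto simp: field_simps)
  obtain C where C: "C \<ge> 0" "\<And>\<gamma>. \<gamma> \<in> \<Gamma> \<Longrightarrow> norm (gen (act_endpoint \<gamma> a) a w) \<le> C * (1 + height b z \<gamma> powr (- \<epsilon>))"
    using gen_series_orbit_bound[OF a b \<epsilon>(1,2) z, of w] unfolding height_def by blast
  have S: "(\<lambda>K. C * (height b z (rep K) powr Re s + height b z (rep K) powr (Re s - \<epsilon>))) summable_on ?A"
    by (intro summable_on_cmult_right summable_on_add height_powr_summable[OF b z] s \<epsilon>(3))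
  show ?thesis
  proof (rule Infinite_Sum.abs_summable_on_comparison_test'[OF S])
    fix K assume K: "K \<in> ?A"
    define H where "H = height b z (rep K)"
    have H: "H > 0" unfolding H_def using rep_in(1)[OF K] z by (intro height_pos[OF b])
    have "norm (eisenstein_coset_term \<sigma> fs a b z s K w) = norm (gen (act_endpoint (rep K) a) a w) * H powr Re s"
      unfolding eisenstein_coset_term_def eisenstein_term_eq norm_mult H_def[symmetric]
      using H by (simp add: norm_powr_real_powr)
    also have "\<dots> \<le> C * (1 + H powr (- \<epsilon>)) * H powr Re s"
      unfolding H_def by (intro mult_right_mono C(2) rep_in(1)[OF K]) simp
    also have "\<dots> = C * (H powr Re s + H powr (- \<epsilon>) * H powr Re s)" by (simp add: algebra_simps)
    also have "H powr (- \<epsilon>) * H powr Re s = H powr (Re s - \<epsilon>)" by (simp add: powr_add[symmetric])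
    finally show "norm (eisenstein_coset_term \<sigma> fs a b z s K w)
       \<le> C * (height b z (rep K) powr Re s + height b z (rep K) powr (Re s - \<epsilon>))" by (simp add: H_def)
  qed
qed

lemma eisenstein_regularity:
  assumes s: "Re s > 1"
  shows "C2_on upper_half_plane (\<lambda>z. nc_eisenstein \<Gamma> \<sigma> fs a b z s w)"
    "z \<in> upper_half_plane \<Longrightarrow> hyp_laplacian (\<lambda>z. nc_eisenstein \<Gamma> \<sigma> fs a b z s w) z =
       s * (s - 1) * nc_eisenstein \<Gamma> \<sigma> fs a b z s w"
proof -
  let ?A = "cusp_cosets \<Gamma> b"
  let ?H = upper_half_plane
  define u where "u = (\<lambda>K z. coef w K * height_power (cmat K) s z)"
  define ux where "ux = (\<lambda>K z. coef w K * hp_x s (cmat K) z)"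
  define uy where "uy = (\<lambda>K z. coef w K * hp_y s (cmat K) z)"
  define uxx where "uxx = (\<lambda>K z. coef w K * hp_second s (cmat K) (d_xx (cmat K)) (logdx (cmat K)) (logdx (cmat K)) z)"
  define uxy where "uxy = (\<lambda>K z. coef w K * hp_second s (cmat K) (d_xy (cmat K)) (logdx (cmat K)) (logdy (cmat K)) z)"
  define uyx where "uyx = (\<lambda>K z. coef w K * hp_second s (cmat K) (d_xy (cmat K)) (logdy (cmat K)) (logdx (cmat K)) z)"
  define uyy where "uyy = (\<lambda>K z. coef w K * hp_second s (cmat K) (d_yy (cmat K)) (logdy (cmat K)) (logdy (cmat K)) z)"
  note defs = u_def ux_def uy_def uxx_def uxy_def uyx_def uyy_def
  have part: "has_partials ?H (u K) (ux K) (uy K)" "has_partials ?H (ux K) (uxx K) (uxy K)"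
    "has_partials ?H (uy K) (uyx K) (uyy K)" if "K \<in> ?A" for K
    unfolding defs
    by (intro has_partials_cmult has_partials_first has_partials_second det_cmat that)+
  have cont: "continuous_on ?H (ux K)" "continuous_on ?H (uy K)" "continuous_on ?H (uxx K)" "continuous_on ?H (uxy K)"
    "continuous_on ?H (uyx K)" "continuous_on ?H (uyy K)" if "K \<in> ?A" for K
    unfolding defs
    by (intro continuous_on_mult continuous_on_const continuous_on_hp continuous_on_coefficients det_cmat that)+
  have loc: "\<exists>r>0. \<exists>m. ball z0 r \<subseteq> ?H \<and> m summable_on ?A \<and> (\<forall>K\<in>?A. \<forall>v\<in>ball z0 r.
      norm (u K v) \<le> m K \<and> norm (ux K v) \<le> m K \<and> norm (uy K v) \<le> m K \<and>
      norm (uxx K v) \<le> m K \<and> norm (uxy K v) \<le> m K \<and> norm (uyx K v) \<le> m K \<and> norm (uyy K v) \<le> m K)"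
    if z0: "z0 \<in> ?H" for z0
  proof -
    have I0: "Im z0 > 0" using z0 by (simp add: upper_half_plane_def)
    define y0 where "y0 = Im z0 / 2"
    have y0: "y0 > 0" using I0 by (simp add: y0_def)
    define Q where "Q = 3 / y0"
    define T where "T = (1 + norm s)\<^sup>2 * (1 + Q)\<^sup>2"
    have T: "T \<ge> 0" by (simp add: T_def)
    \<comment> \<open>The absolutely convergent series at the centre \<open>z0\<close>, enlarged by
      \<open>T\<close> for the derivatives and by \<open>6 powr Re s\<close> for the change of
      height across the ball.\<close>
    define m where "m = (\<lambda>K. T * 6 powr Re s * norm (eisenstein_coset_term \<sigma> fs a b z0 s K w))"
    have sm: "m summable_on ?A" unfolding m_def
      by (intro summable_on_cmult_right coset_terms_summable[OF s I0])
    have bsub: "ball z0 y0 \<subseteq> ?H"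
    proof
      fix v assume "v \<in> ball z0 y0"
      hence "Im v \<ge> y0" using height_comparison(1)[of "mat 1" z0 v] I0 by (simp add: y0_def)
      thus "v \<in> ?H" using y0 by (simp add: upper_half_plane_def)
    qed
    have bd: "norm (u K v) \<le> m K \<and> norm (ux K v) \<le> m K \<and> norm (uy K v) \<le> m K \<and>
      norm (uxx K v) \<le> m K \<and> norm (uxy K v) \<le> m K \<and> norm (uyx K v) \<le> m K \<and> norm (uyy K v) \<le> m K"
      if K: "K \<in> ?A" and v: "v \<in> ball z0 y0" for K v
    proof -
      define A where "A = cmat K"
      have dA: "det A = 1" using det_cmat[OF K] by (simp add: A_def)
      have v': "v \<in> ball z0 (Im z0 / 2)" using v by (simp add: y0_def)
      note hc = height_comparison[OF dA I0 v']
      have Iv: "Im v \<ge> y0" "Im v > 0" using hc(1) y0 by (auto simp: y0_def)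
      define h where "h = height_power A s v"
      have "norm h = Im (act A v) powr Re s" unfolding h_def by (rule norm_height_power[OF dA Iv(2)])
      also have "\<dots> \<le> (6 * Im (act A z0)) powr Re s"
        using hc(2) s Im_act_pos[OF dA Iv(2)] by (intro powr_mono2) auto
      also have "\<dots> = 6 powr Re s * norm (height_power A s z0)"
        using Im_act_pos[OF dA I0] by (simp add: powr_mult norm_height_power[OF dA I0])
      finally have h: "norm h \<le> 6 powr Re s * norm (height_power A s z0)" .
      have key: "norm (coef w K * t) \<le> m K" if "norm t \<le> T * norm h" for t
      proof -
        have "norm t \<le> T * (6 powr Re s * norm (height_power A s z0))"
          using that mult_left_mono[OF h T] by linarith
        hence "norm (coef w K) * norm t \<le> norm (coef w K) * (T * (6 powr Re s * norm (height_power A s z0)))"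
          by (intro mult_left_mono) auto
        thus ?thesis by (simp add: m_def coset_term_eq[OF K I0] norm_mult A_def mult_ac)
      qed
      note cb = coefficient_bounds[OF dA Iv(1) y0, folded Q_def]
      note so = second_order_bound[where s = s and h = h, folded T_def]
      have "norm h \<le> T * norm h" by (rule so(1)[OF cb(1) cb(1) cb(3), folded T_def])
      moreover have "norm (s * (logdx A v * h)) \<le> T * norm h" by (rule so(2)[OF cb(1) cb(1) cb(3), folded T_def])
      moreover have "norm (s * (logdy A v * h)) \<le> T * norm h" by (rule so(2)[OF cb(2) cb(1) cb(3), folded T_def])
      moreover note so(3)[OF cb(1) cb(1) cb(3), folded T_def] so(3)[OF cb(1) cb(2) cb(4), folded T_def]
        so(3)[OF cb(2) cb(1) cb(4), folded T_def] so(3)[OF cb(2) cb(2) cb(5), folded T_def]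
      ultimately show ?thesis
        unfolding defs hp_x_def hp_y_def hp_second_def A_def[symmetric] h_def[symmetric]
        using key by blast
    qed
    show ?thesis using y0 bsub sm bd by blast
  qed
  define U where "U = (\<lambda>z. \<Sum>\<^sub>\<infinity>K\<in>?A. u K z)"
  define Ux where "Ux = (\<lambda>z. \<Sum>\<^sub>\<infinity>K\<in>?A. ux K z)"
  define Uy where "Uy = (\<lambda>z. \<Sum>\<^sub>\<infinity>K\<in>?A. uy K z)"
  define Uxx where "Uxx = (\<lambda>z. \<Sum>\<^sub>\<infinity>K\<in>?A. uxx K z)"
  define Uxy where "Uxy = (\<lambda>z. \<Sum>\<^sub>\<infinity>K\<in>?A. uxy K z)"
  define Uyx where "Uyx = (\<lambda>z. \<Sum>\<^sub>\<infinity>K\<in>?A. uyx K z)"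
  define Uyy where "Uyy = (\<lambda>z. \<Sum>\<^sub>\<infinity>K\<in>?A. uyy K z)"
  have loc1: "\<exists>r>0. \<exists>m. ball z0 r \<subseteq> ?H \<and> m summable_on ?A \<and> (\<forall>K\<in>?A. \<forall>v\<in>ball z0 r.
      norm (u K v) \<le> m K \<and> norm (ux K v) \<le> m K \<and> norm (uy K v) \<le> m K)" if z0: "z0 \<in> ?H" for z0
    proof -
    obtain r m where rm: "r > 0" "ball z0 r \<subseteq> ?H" "m summable_on ?A"
      "\<And>K v. K \<in> ?A \<Longrightarrow> v \<in> ball z0 r \<Longrightarrow>
        norm (u K v) \<le> m K \<and> norm (ux K v) \<le> m K \<and> norm (uy K v) \<le> m K \<and> norm (uxx K v) \<le> m K \<and>
        norm (uxy K v) \<le> m K \<and> norm (uyx K v) \<le> m K \<and> norm (uyy K v) \<le> m K"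
      using loc[OF z0] by (elim exE conjE) blast
    show ?thesis by (rule exI[of _ r], rule conjI, rule rm(1), rule exI[of _ m], intro conjI rm(2,3) ballI) (use rm(4) in blast)+
  qed
  have loc2: "\<exists>r>0. \<exists>m. ball z0 r \<subseteq> ?H \<and> m summable_on ?A \<and> (\<forall>K\<in>?A. \<forall>v\<in>ball z0 r.
      norm (ux K v) \<le> m K \<and> norm (uxx K v) \<le> m K \<and> norm (uxy K v) \<le> m K)" if z0: "z0 \<in> ?H" for z0
    proof -
    obtain r m where rm: "r > 0" "ball z0 r \<subseteq> ?H" "m summable_on ?A"
      "\<And>K v. K \<in> ?A \<Longrightarrow> v \<in> ball z0 r \<Longrightarrow>
        norm (u K v) \<le> m K \<and> norm (ux K v) \<le> m K \<and> norm (uy K v) \<le> m K \<and> norm (uxx K v) \<le> m K \<and>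
        norm (uxy K v) \<le> m K \<and> norm (uyx K v) \<le> m K \<and> norm (uyy K v) \<le> m K"
      using loc[OF z0] by (elim exE conjE) blast
    show ?thesis by (rule exI[of _ r], rule conjI, rule rm(1), rule exI[of _ m], intro conjI rm(2,3) ballI) (use rm(4) in blast)+
  qed
  have loc3: "\<exists>r>0. \<exists>m. ball z0 r \<subseteq> ?H \<and> m summable_on ?A \<and> (\<forall>K\<in>?A. \<forall>v\<in>ball z0 r.
      norm (uy K v) \<le> m K \<and> norm (uyx K v) \<le> m K \<and> norm (uyy K v) \<le> m K)" if z0: "z0 \<in> ?H" for z0
    proof -
    obtain r m where rm: "r > 0" "ball z0 r \<subseteq> ?H" "m summable_on ?A"
      "\<And>K v. K \<in> ?A \<Longrightarrow> v \<in> ball z0 r \<Longrightarrow>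
        norm (u K v) \<le> m K \<and> norm (ux K v) \<le> m K \<and> norm (uy K v) \<le> m K \<and> norm (uxx K v) \<le> m K \<and>
        norm (uxy K v) \<le> m K \<and> norm (uyx K v) \<le> m K \<and> norm (uyy K v) \<le> m K"
      using loc[OF z0] by (elim exE conjE) blast
    show ?thesis by (rule exI[of _ r], rule conjI, rule rm(1), rule exI[of _ m], intro conjI rm(2,3) ballI) (use rm(4) in blast)+
  qed
  note p1 = partials_infsum[OF open_upper_half_plane part(1) cont(1,2) loc1, folded U_def Ux_def Uy_def]
  note p2 = partials_infsum[OF open_upper_half_plane part(2) cont(3,4) loc2, folded Ux_def Uxx_def Uxy_def]
  note p3 = partials_infsum[OF open_upper_half_plane part(3) cont(5,6) loc3, folded Uy_def Uyx_def Uyy_def]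
  define E where "E = (\<lambda>z. nc_eisenstein \<Gamma> \<sigma> fs a b z s w)"
  have E: "E z = U z" if "z \<in> ?H" for z
    unfolding E_def nc_eisenstein_def U_def u_def
    using that by (intro infsum_cong coset_term_eq) (auto simp: upper_half_plane_def)
  have pE: "has_partials ?H E Ux Uy" by (rule has_partials_cong[OF p1(1) open_upper_half_plane E]) auto
  note C2 = C2_onI[OF open_upper_half_plane pE p2(1) p3(1) p1(2,3) p2(2,3) p3(2,3)]
  show "C2_on ?H (\<lambda>z. nc_eisenstein \<Gamma> \<sigma> fs a b z s w)" using C2(1) by (simp add: E_def)
  assume z: "z \<in> ?H"
  hence Iz: "Im z > 0" by (simp add: upper_half_plane_def)
  obtain r m where rm: "r > 0" "m summable_on ?A" "\<forall>K\<in>?A. \<forall>v\<in>ball z r.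
      norm (u K v) \<le> m K \<and> norm (ux K v) \<le> m K \<and> norm (uy K v) \<le> m K \<and>
      norm (uxx K v) \<le> m K \<and> norm (uxy K v) \<le> m K \<and> norm (uyx K v) \<le> m K \<and> norm (uyy K v) \<le> m K"
    using loc[OF z] by (elim exE conjE) blast
  have zb: "z \<in> ball z r" using rm(1) by simp
  have sxx: "(\<lambda>K. uxx K z) summable_on ?A" "(\<lambda>K. uyy K z) summable_on ?A"
    by (rule abs_summable_summable[OF Infinite_Sum.abs_summable_on_comparison_test'[OF rm(2)]], use rm(3) zb in blast)+
  have "uxx K z + uyy K z = s * (s - 1) / of_real ((Im z)\<^sup>2) * u K z" if K: "K \<in> ?A" for K
  proof -
    define A where "A = cmat K"
    have dA: "det A = 1" using det_cmat[OF K] by (simp add: A_def)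
    define h where "h = height_power A s z"
    define iy where "iy = complex_of_real (1 / (Im z)\<^sup>2)"
    have "d_xx A z + d_yy A z = - (1 / (Im z)\<^sup>2)" by (simp add: d_xx_def d_yy_def)
    hence e1: "complex_of_real (d_xx A z) + of_real (d_yy A z) = - iy"
      unfolding iy_def by (metis of_real_add of_real_minus)
    have "(logdx A z)\<^sup>2 + (logdy A z)\<^sup>2 = of_real ((Re (mu A z))\<^sup>2 * 4 + (1 / Im z + 2 * Im (mu A z))\<^sup>2)"
      unfolding logdx_def logdy_def by (simp add: power_mult_distrib)
    hence e2: "(logdx A z)\<^sup>2 + (logdy A z)\<^sup>2 = iy"
      unfolding iy_def log_derivative_identities(3)[OF dA Iz] .
    \<comment> \<open>The second partials of \<open>log Y\<close> add up to
      \<open>- 1 / y^2\<close>, the squared gradient to \<open>1 / y^2\<close>; hence the eigenvalue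
      \<open>s * (- 1 + s)\<close> after multiplication by \<open>y^2\<close>.\<close>
    have "uxx K z + uyy K z = coef w K * (s * h * ((of_real (d_xx A z) + of_real (d_yy A z)) + s * ((logdx A z)\<^sup>2 + (logdy A z)\<^sup>2)))"
      unfolding uxx_def uyy_def hp_second_def A_def[symmetric] h_def[symmetric]
      by (simp add: power2_eq_square algebra_simps)
    also have "\<dots> = coef w K * (s * h * (- iy + s * iy))" unfolding e1 e2 ..
    also have "\<dots> = s * (s - 1) * iy * (coef w K * h)" by (simp add: algebra_simps)
    finally show ?thesis by (simp add: u_def A_def h_def iy_def)
  qed
  hence "(\<Sum>\<^sub>\<infinity>K\<in>?A. uxx K z + uyy K z) = (\<Sum>\<^sub>\<infinity>K\<in>?A. s * (s - 1) / of_real ((Im z)\<^sup>2) * u K z)"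
    by (rule infsum_cong)
  also have "\<dots> = s * (s - 1) / of_real ((Im z)\<^sup>2) * U z" unfolding U_def by (rule infsum_cmult_right')
  finally have "Uxx z + Uyy z = s * (s - 1) / of_real ((Im z)\<^sup>2) * U z"
    unfolding Uxx_def Uyy_def infsum_add[OF sxx] .
  moreover have pxx: "partial_x (partial_x E) z = Uxx z" by (rule C2(2)) (rule z | assumption)+
  moreover have pyy: "partial_y (partial_y E) z = Uyy z" by (rule C2(3)) (rule z | assumption)+
  ultimately have "hyp_laplacian E z = s * (s - 1) * U z"
    unfolding hyp_laplacian_def pxx pyy using Iz by simp
  thus "hyp_laplacian (\<lambda>z. nc_eisenstein \<Gamma> \<sigma> fs a b z s w) z = s * (s - 1) * nc_eisenstein \<Gamma> \<sigma> fs a b z s w"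
    using E[OF z] by (simp add: E_def)
qed

lemma bij_right_translate:
  assumes d: "\<delta> \<in> \<Gamma>"
  shows "bij_betw (\<lambda>K. (\<lambda>x. x ** \<delta>) ` K) (cusp_cosets \<Gamma> b) (cusp_cosets \<Gamma> b)"
proof -
  have img: "(\<lambda>x. x ** \<delta>) ` K \<in> cusp_cosets \<Gamma> b" if K: "K \<in> cusp_cosets \<Gamma> b" and d: "\<delta> \<in> \<Gamma>" for K \<delta>
  proof -
    obtain \<gamma> where g: "\<gamma> \<in> \<Gamma>" "K = (\<lambda>\<tau>. \<tau> ** \<gamma>) ` cusp_stabilizer \<Gamma> b" using K unfolding cusp_cosets_eq by blast
    have "(\<lambda>x. x ** \<delta>) ` K = (\<lambda>\<tau>. \<tau> ** (\<gamma> ** \<delta>)) ` cusp_stabilizer \<Gamma> b"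
      unfolding g(2) image_image by (simp add: matrix_mul_assoc)
    thus ?thesis unfolding cusp_cosets_eq using mult_closed[OF g(1) d] by blast
  qed
  have dd: "det \<delta> = 1" using d by (rule det_1)
  show ?thesis
  proof (rule bij_betw_byWitness[where f' = "\<lambda>K. (\<lambda>x. x ** adj2 \<delta>) ` K"])
    show "\<forall>K\<in>cusp_cosets \<Gamma> b. (\<lambda>x. x ** adj2 \<delta>) ` (\<lambda>x. x ** \<delta>) ` K = K"
      unfolding image_image by (simp add: matrix_mul_assoc[symmetric] adj2_mult[OF dd])
    show "\<forall>K\<in>cusp_cosets \<Gamma> b. (\<lambda>x. x ** \<delta>) ` (\<lambda>x. x ** adj2 \<delta>) ` K = K"
      unfolding image_image by (simp add: matrix_mul_assoc[symmetric] adj2_mult[OF dd])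
  qed (use img d adj2_closed in blast)+
qed

text \<open>Replacing z by \<delta>z permutes the cosets by right translation, and every term
  acquires the same left factor. For a fixed word the product of series is a finite sum, which may
  be exchanged with the summation over cosets.\<close>

lemma eisenstein_transformation:
  assumes s: "Re s > 1" and d: "\<delta> \<in> \<Gamma>" and z: "z \<in> upper_half_plane"
  shows "nc_eisenstein \<Gamma> \<sigma> fs a b (act \<delta> z) s =
     nc_mult (gen a (act_endpoint \<delta> a)) (nc_eisenstein \<Gamma> \<sigma> fs a b z s)"
proof
  fix w
  let ?A = "cusp_cosets \<Gamma> b"
  have Iz: "Im z > 0" using z by (simp add: upper_half_plane_def)
  define t where "t = (\<lambda>v K. eisenstein_coset_term \<sigma> fs a b z s K v)"
  define T where "T = (\<lambda>K :: (real^2^2) set. (\<lambda>x. x ** \<delta>) ` K)"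
  have bij: "bij_betw T ?A ?A" unfolding T_def by (rule bij_right_translate[OF d])
  have ts: "t v summable_on ?A" for v
    unfolding t_def using coset_terms_summable[OF s Iz] by (rule abs_summable_summable)
  have tTs: "(\<lambda>K. t v (T K)) summable_on ?A" for v
    using summable_on_reindex_bij_betw[OF bij, of "t v"] ts by simp
  have term_eq: "eisenstein_coset_term \<sigma> fs a b (act \<delta> z) s K w =
      (\<Sum>k\<le>length w. gen a (act_endpoint \<delta> a) (take k w) * t (drop k w) (T K))" if K: "K \<in> ?A" for K
  proof -
    note g = rep_in[OF K]
    have TK: "T K \<in> ?A" using bij K by (auto simp: bij_betw_def)
    \<comment> \<open>This element need not be the representative chosen for \<open>T K\<close>;
      independence of the representative bridges the gap.\<close>
    have "rep K ** \<delta> \<in> T K" unfolding T_def using coset_nonempty[OF K] by (rule imageI)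
    hence tT: "t v (T K) = gen (act_endpoint (rep K ** \<delta>) a) a v * of_real (height b z (rep K ** \<delta>)) powr s" for v
      unfolding t_def using eisenstein_coset_term_rep[OF TK _ z] by (simp add: eisenstein_term_eq)
    have "act (rep K) (act \<delta> z) = act (rep K ** \<delta>) z" using g d det_1 Iz by (intro act_mult[symmetric]) auto
    hence "eisenstein_coset_term \<sigma> fs a b (act \<delta> z) s K w
        = gen (act_endpoint (rep K) a) a w * of_real (height b z (rep K ** \<delta>)) powr s"
      unfolding eisenstein_coset_term_def eisenstein_term_eq height_def by simp
    also have "\<dots> = nc_mult (gen a (act_endpoint \<delta> a)) (gen (act_endpoint (rep K ** \<delta>) a) a) w
         * of_real (height b z (rep K ** \<delta>)) powr s"
      unfolding gen_series_shift[OF a g(1) d] ..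
    finally show ?thesis unfolding nc_mult_def tT by (simp add: sum_distrib_right mult.assoc)
  qed
  have "nc_eisenstein \<Gamma> \<sigma> fs a b (act \<delta> z) s w =
      (\<Sum>\<^sub>\<infinity>K\<in>?A. \<Sum>k\<le>length w. gen a (act_endpoint \<delta> a) (take k w) * t (drop k w) (T K))"
    unfolding nc_eisenstein_def using term_eq by (rule infsum_cong)
  also have "\<dots> = (\<Sum>k\<le>length w. \<Sum>\<^sub>\<infinity>K\<in>?A. gen a (act_endpoint \<delta> a) (take k w) * t (drop k w) (T K))"
    by (rule infsum_sum_swap[THEN conjunct2]) (auto intro: summable_on_cmult_right tTs)
  also have "\<dots> = (\<Sum>k\<le>length w. gen a (act_endpoint \<delta> a) (take k w) * (\<Sum>\<^sub>\<infinity>K\<in>?A. t (drop k w) (T K)))"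
    by (simp only: infsum_cmult_right')
  also have "\<dots> = (\<Sum>k\<le>length w. gen a (act_endpoint \<delta> a) (take k w) * (\<Sum>\<^sub>\<infinity>K\<in>?A. t (drop k w) K))"
    unfolding infsum_reindex_bij_betw[OF bij] ..
  finally show "nc_eisenstein \<Gamma> \<sigma> fs a b (act \<delta> z) s w =
     nc_mult (gen a (act_endpoint \<delta> a)) (nc_eisenstein \<Gamma> \<sigma> fs a b z s) w"
    by (simp add: nc_mult_def nc_eisenstein_def t_def)
qed

end

end

theorem theorem1p1:
  fixes \<Gamma> :: "(real^2^2) set"
    and \<sigma> :: "proj_real \<Rightarrow> real^2^2"
    and a :: endpoint
    and b :: proj_real
    and fs :: "(complex \<Rightarrow> complex) list"
  assumes "fuchsian_first_kind \<Gamma>"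
    and "\<And>c. is_cusp \<Gamma> c \<Longrightarrow> scaling_matrix \<Gamma> c (\<sigma> c)"
    and "is_cusp \<Gamma> b"
    and "is_endpoint \<Gamma> a"
    and "\<And>f. f \<in> set fs \<Longrightarrow> cusp_form \<Gamma> \<sigma> f"
  shows "(\<forall>s. \<forall>z\<in>upper_half_plane. \<forall>\<gamma>\<in>\<Gamma>. \<forall>\<tau>\<in>cusp_stabilizer \<Gamma> b.
            eisenstein_term \<sigma> fs a b z s (\<tau> ** \<gamma>) = eisenstein_term \<sigma> fs a b z s \<gamma>) \<and>
         (\<forall>s. Re s > 1 \<longrightarrow>
            (\<forall>z\<in>upper_half_plane. \<forall>w.
               (\<lambda>K. norm (eisenstein_coset_term \<sigma> fs a b z s K w)) summable_on cusp_cosets \<Gamma> b) \<and>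
            (\<forall>w. C2_on upper_half_plane (\<lambda>z. nc_eisenstein \<Gamma> \<sigma> fs a b z s w) \<and>
               (\<forall>z\<in>upper_half_plane.
                  hyp_laplacian (\<lambda>z. nc_eisenstein \<Gamma> \<sigma> fs a b z s w) z =
                  s * (s - 1) * nc_eisenstein \<Gamma> \<sigma> fs a b z s w)) \<and>
            (\<forall>\<delta>\<in>\<Gamma>. \<forall>z\<in>upper_half_plane.
               nc_eisenstein \<Gamma> \<sigma> fs a b (act \<delta> z) s =
               nc_mult (gen_series \<sigma> fs a (act_endpoint \<delta> a)) (nc_eisenstein \<Gamma> \<sigma> fs a b z s)))"
proof -
  have sub: "subgroup \<Gamma> SL2R" using assms(1) by (simp add: fuchsian_first_kind_def)
  interpret fuchsian_forms \<Gamma> \<sigma> fs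
    by (intro fuchsian_forms.intro fuchsian_scaled.intro fuchsian_group.intro SL2R_subgroup.intro
        fuchsian_group_axioms.intro fuchsian_scaled_axioms.intro fuchsian_forms_axioms.intro sub)
       (use assms in blast)+
  have up: "Im z > 0" if "z \<in> upper_half_plane" for z using that by (simp add: upper_half_plane_def)
  show ?thesis
    using eisenstein_term_left_mult[OF assms(4,3)] coset_terms_summable[OF assms(4,3)]
      eisenstein_regularity[OF assms(4,3)] eisenstein_transformation[OF assms(4,3)] up
    by blast
qed

end
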